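(* Let $\varepsilon>0$, $\beta>0$, $\tau\ge0$, $\lambda>0$. Let $u^0\in H^4(I)$ satisfy $u^0(\pm1)=\partial_xu^0(\pm1)=0$ and $u^0(x)>-1$ for $x\in I$, and let $(u,\psi)$ be the corresponding solution of the parabolic free boundary problem $(P_\lambda)$ on its maximal interval of existence $[0,T_m)$ (see context). Then $$\mathcal{E}(u(t))+\int_0^t\|\partial_tu(s)\|_{L_2(I)}^2\,\mathrm{d}s=\mathcal{E}(u^0),\qquad t\in[0,T_m).$$
   Context: $I:=(-1,1)$. For $v:[-1,1]\to(-1,\infty)$ with $v(\pm1)=0$ put $\Omega(v):=\{(x,z):x\in I,\ -1<z<v(x)\}$ and let $\psi_v$ denote the solution of $$\varepsilon^2\partial_x^2\psi_v+\partial_z^2\psi_v=0\text{ in }\Omega(v),\qquad \psi_v(x,z)=\frac{1+z}{1+v(x)}\text{ for }(x,z)\in\partial\Omega(v).$$ The problem $(P_\lambda)$ is: $\partial_tu+\beta\partial_x^4u-\tau\partial_x^2u=-\lambda\big(\varepsilon^2|\partial_x\psi(t,x,u(t,x))|^2+|\partial_z\psi(t,x,u(t,x))|^2\big)$ for $t>0$, $x\in I$; $u(t,\pm1)=\partial_xu(t,\pm1)=0$ for $t>0$; $u(0,\cdot)=u^0$; where $\psi(t)=\psi_{u(t)}$. For $u^0$ as in the claim it has a unique solution $(u,\psi)$ on a maximal interval of existence $[0,T_m)$ with $u\in C^1([0,T_m),L_2(I))\cap C([0,T_m),H^4(I))$, $u>-1$ on $[0,T_m)\times I$, and $\psi(t)\in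 H^2(\Omega(u(t)))$ for each $t\in[0,T_m)$. The energy is $\mathcal{E}(v):=\mathcal{E}_b(v)+\mathcal{E}_s(v)-\lambda\mathcal{E}_e(v)$ with $$\mathcal{E}_b(v):=\frac{\beta}{2}\|\partial_x^2v\|_{L_2(I)}^2,\quad \mathcal{E}_s(v):=\frac{\tau}{2}\|\partial_xv\|_{L_2(I)}^2,\quad \mathcal{E}_e(v):=\int_{\Omega(v)}\big[\varepsilon^2|\partial_x\psi_v|^2+|\partial_z\psi_v|^2\big]\,\mathrm{d}(x,z).$$ *)

theory Defs
  imports "HOL-Analysis.Analysis"
begin

section \<open>Smooth functions, weak derivatives and Sobolev spaces\<close>

coinductive smooth :: "('a::euclidean_space \<Rightarrow> real) \<Rightarrow> bool" where
  "(\<forall>x. f differentiable (at x)) \<Longrightarrow>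
   (\<forall>v. smooth (\<lambda>x. frechet_derivative f (at x) v)) \<Longrightarrow> smooth f"

definition test_function :: "'a::euclidean_space set \<Rightarrow> ('a \<Rightarrow> real) \<Rightarrow> bool" where
  "test_function S \<phi> \<longleftrightarrow>
     smooth \<phi> \<and> compact (closure {x. \<phi> x \<noteq> 0}) \<and> closure {x. \<phi> x \<noteq> 0} \<subseteq> S"

definition locally_integrable :: "'a::euclidean_space set \<Rightarrow> ('a \<Rightarrow> real) \<Rightarrow> bool" where
  "locally_integrable S f \<longleftrightarrow> (\<forall>K. compact K \<and> K \<subseteq> S \<longrightarrow> set_integrable lebesgue K f)"

definition has_weak_deriv ::
    "'a::euclidean_space set \<Rightarrow> 'a \<Rightarrow> ('a \<Rightarrow> real) \<Rightarrow> ('a \<Rightarrow> real) \<Rightarrow> bool" where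
  "has_weak_deriv S e f g \<longleftrightarrow>
     locally_integrable S f \<and> locally_integrable S g \<and>
     (\<forall>\<phi>. test_function S \<phi> \<longrightarrow>
        (LINT x:S|lebesgue. f x * frechet_derivative \<phi> (at x) e)
          = - (LINT x:S|lebesgue. g x * \<phi> x))"

text \<open>Weak derivatives are unique only almost everywhere; \<open>weak_deriv\<close> picks a representative,
  and is meaningful only if some weak derivative exists.\<close>

definition weak_deriv :: "'a::euclidean_space set \<Rightarrow> 'a \<Rightarrow> ('a \<Rightarrow> real) \<Rightarrow> 'a \<Rightarrow> real" where
  "weak_deriv S e f = (SOME g. has_weak_deriv S e f g)"

definition L2_on :: "'a::euclidean_space set \<Rightarrow> ('a \<Rightarrow> real) \<Rightarrow> bool" where
  "L2_on S f \<longleftrightarrow>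
     set_borel_measurable lebesgue S f \<and> set_integrable lebesgue S (\<lambda>x. (f x)\<^sup>2)"

definition L2_norm_on :: "'a::euclidean_space set \<Rightarrow> ('a \<Rightarrow> real) \<Rightarrow> real" where
  "L2_norm_on S f = sqrt (LINT x:S|lebesgue. (f x)\<^sup>2)"

text \<open>\<open>sobolev k S\<close> is the space \<open>H\<^sup>k(S)\<close>.\<close>

primrec sobolev :: "nat \<Rightarrow> 'a::euclidean_space set \<Rightarrow> ('a \<Rightarrow> real) \<Rightarrow> bool" where
  "sobolev 0 S f \<longleftrightarrow> L2_on S f"
| "sobolev (Suc k) S f \<longleftrightarrow>
     L2_on S f \<and> (\<forall>e\<in>Basis. \<exists>g. has_weak_deriv S e f g \<and> sobolev k S g)"

text \<open>The squared norm of \<open>H\<^sup>k(S)\<close>. For \<open>k \<le> 1\<close> and in dimension one this is the usual sum over all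
  derivatives of order at most \<open>k\<close>; otherwise mixed derivatives are counted once for each order
  of differentiation, which gives an equivalent norm.\<close>

primrec sobolev_sqnorm :: "nat \<Rightarrow> 'a::euclidean_space set \<Rightarrow> ('a \<Rightarrow> real) \<Rightarrow> real" where
  "sobolev_sqnorm 0 S f = (L2_norm_on S f)\<^sup>2"
| "sobolev_sqnorm (Suc k) S f =
     (L2_norm_on S f)\<^sup>2 + (\<Sum>e\<in>Basis. sobolev_sqnorm k S (weak_deriv S e f))"

definition sobolev_norm :: "nat \<Rightarrow> 'a::euclidean_space set \<Rightarrow> ('a \<Rightarrow> real) \<Rightarrow> real" where
  "sobolev_norm k S f = sqrt (sobolev_sqnorm k S f)"


section \<open>The domain and the electrostatic potential\<close>

abbreviation I :: "real set" where
  "I \<equiv> {-1<..<1}"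

definition Omega :: "(real \<Rightarrow> real) \<Rightarrow> (real \<times> real) set" where
  "Omega v = {(x, z). x \<in> I \<and> -1 < z \<and> z < v x}"

definition dx :: "(real \<Rightarrow> real) \<Rightarrow> (real \<times> real \<Rightarrow> real) \<Rightarrow> real \<times> real \<Rightarrow> real" where
  "dx v w = weak_deriv (Omega v) (1, 0) w"

definition dz :: "(real \<Rightarrow> real) \<Rightarrow> (real \<times> real \<Rightarrow> real) \<Rightarrow> real \<times> real \<Rightarrow> real" where
  "dz v w = weak_deriv (Omega v) (0, 1) w"

text \<open>Solutions in \<open>H\<^sup>2(\<Omega>(v))\<close>. As \<open>H\<^sup>2(\<Omega>(v))\<close> embeds into the continuous functions on the closed
  domain, \<open>\<psi>\<close> is taken to be the continuous representative, so that the boundary condition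
  can be imposed pointwise.\<close>

definition is_potential :: "real \<Rightarrow> (real \<Rightarrow> real) \<Rightarrow> (real \<times> real \<Rightarrow> real) \<Rightarrow> bool" where
  "is_potential \<epsilon> v \<psi> \<longleftrightarrow>
     sobolev 2 (Omega v) \<psi> \<and>
     continuous_on (closure (Omega v)) \<psi> \<and>
     (AE p in lebesgue. p \<in> Omega v \<longrightarrow>
        \<epsilon>\<^sup>2 * dx v (dx v \<psi>) p + dz v (dz v \<psi>) p = 0) \<and>
     (\<forall>(x, z) \<in> frontier (Omega v). \<psi> (x, z) = (1 + z) / (1 + v x))"

definition potential :: "real \<Rightarrow> (real \<Rightarrow> real) \<Rightarrow> real \<times> real \<Rightarrow> real" where
  "potential \<epsilon> v = (SOME \<psi>. is_potential \<epsilon> v \<psi>)"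

text \<open>The function \<open>g\<close> is the trace \<open>x \<mapsto> w(x, v(x))\<close> of \<open>w \<in> H\<^sup>1(\<Omega>(v))\<close> on the graph of \<open>v\<close>, i.e. the
  \<open>L\<^sub>2\<close> limit of the restrictions to the graph of smooth functions converging to \<open>w\<close> in \<open>H\<^sup>1\<close>.\<close>

definition has_graph_trace ::
    "(real \<Rightarrow> real) \<Rightarrow> (real \<times> real \<Rightarrow> real) \<Rightarrow> (real \<Rightarrow> real) \<Rightarrow> bool" where
  "has_graph_trace v w g \<longleftrightarrow>
     sobolev 1 (Omega v) w \<and> L2_on I g \<and>
     (\<exists>\<phi> :: nat \<Rightarrow> real \<times> real \<Rightarrow> real.
        (\<forall>n. smooth (\<phi> n)) \<and>
        (\<lambda>n. sobolev_norm 1 (Omega v) (\<lambda>p. \<phi> n p - w p)) \<longlonglongrightarrow> 0 \<and>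
        (\<lambda>n. L2_norm_on I (\<lambda>x. \<phi> n (x, v x) - g x)) \<longlonglongrightarrow> 0)"


section \<open>The energy\<close>

abbreviation dx1 :: "(real \<Rightarrow> real) \<Rightarrow> real \<Rightarrow> real" where
  "dx1 \<equiv> weak_deriv I 1"

definition energy_bending :: "real \<Rightarrow> (real \<Rightarrow> real) \<Rightarrow> real" where
  "energy_bending \<beta> v = \<beta> / 2 * (L2_norm_on I ((dx1 ^^ 2) v))\<^sup>2"

definition energy_stretching :: "real \<Rightarrow> (real \<Rightarrow> real) \<Rightarrow> real" where
  "energy_stretching \<tau> v = \<tau> / 2 * (L2_norm_on I (dx1 v))\<^sup>2"

definition energy_electrostatic :: "real \<Rightarrow> (real \<Rightarrow> real) \<Rightarrow> real" where
  "energy_electrostatic \<epsilon> v =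
     (LINT p:Omega v|lebesgue.
        \<epsilon>\<^sup>2 * (dx v (potential \<epsilon> v) p)\<^sup>2 + (dz v (potential \<epsilon> v) p)\<^sup>2)"

definition energy :: "real \<Rightarrow> real \<Rightarrow> real \<Rightarrow> real \<Rightarrow> (real \<Rightarrow> real) \<Rightarrow> real" where
  "energy \<epsilon> \<beta> \<tau> lam v =
     energy_bending \<beta> v + energy_stretching \<tau> v - lam * energy_electrostatic \<epsilon> v"


section \<open>The evolution problem\<close>

definition time_interval :: "ereal \<Rightarrow> real set" where
  "time_interval T = {t. 0 \<le> t \<and> ereal t < T}"

definition has_L2_time_deriv ::
    "real set \<Rightarrow> (real \<Rightarrow> real \<Rightarrow> real) \<Rightarrow> real \<Rightarrow> (real \<Rightarrow> real) \<Rightarrow> bool" where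
  "has_L2_time_deriv J u t g \<longleftrightarrow>
     L2_on I g \<and>
     ((\<lambda>s. L2_norm_on I (\<lambda>x. (u s x - u t x) / (s - t) - g x)) \<longlongrightarrow> 0) (at t within J)"

definition time_deriv ::
    "real set \<Rightarrow> (real \<Rightarrow> real \<Rightarrow> real) \<Rightarrow> real \<Rightarrow> real \<Rightarrow> real" where
  "time_deriv J u t = (SOME g. has_L2_time_deriv J u t g)"

definition C1_L2 :: "real set \<Rightarrow> (real \<Rightarrow> real \<Rightarrow> real) \<Rightarrow> bool" where
  "C1_L2 J u \<longleftrightarrow>
     (\<forall>t\<in>J. L2_on I (u t) \<and> (\<exists>g. has_L2_time_deriv J u t g) \<and>
        ((\<lambda>s. L2_norm_on I (\<lambda>x. time_deriv J u s x - time_deriv J u t x)) \<longlongrightarrow> 0)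
          (at t within J))"

text \<open>Elements of \<open>H\<^sup>4(I)\<close> are represented by their continuous representative on \<open>[-1, 1]\<close>
  (which is three times continuously differentiable there), so that pointwise conditions make sense.\<close>

definition H4 :: "(real \<Rightarrow> real) \<Rightarrow> bool" where
  "H4 v \<longleftrightarrow> sobolev 4 I v \<and> continuous_on {-1..1} v"

definition C_H4 :: "real set \<Rightarrow> (real \<Rightarrow> real \<Rightarrow> real) \<Rightarrow> bool" where
  "C_H4 J u \<longleftrightarrow>
     (\<forall>t\<in>J. H4 (u t) \<and>
        ((\<lambda>s. sobolev_norm 4 I (\<lambda>x. u s x - u t x)) \<longlongrightarrow> 0) (at t within J))"

definition clamped :: "(real \<Rightarrow> real) \<Rightarrow> bool" where
  "clamped v \<longleftrightarrow>
     (\<forall>x\<in>{-1, 1}. v x = 0 \<and> (v has_real_derivative 0) (at x within {-1..1}))"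

definition solution ::
    "real \<Rightarrow> real \<Rightarrow> real \<Rightarrow> real \<Rightarrow> (real \<Rightarrow> real) \<Rightarrow> ereal \<Rightarrow>
     (real \<Rightarrow> real \<Rightarrow> real) \<Rightarrow> (real \<Rightarrow> real \<times> real \<Rightarrow> real) \<Rightarrow> bool" where
  "solution \<epsilon> \<beta> \<tau> lam u0 T u \<psi> \<longleftrightarrow>
     0 < T \<and>
     C1_L2 (time_interval T) u \<and>
     C_H4 (time_interval T) u \<and>
     (\<forall>t\<in>time_interval T. \<forall>x\<in>I. u t x > -1) \<and>
     (\<forall>t\<in>time_interval T. is_potential \<epsilon> (u t) (\<psi> t)) \<and>
     (\<forall>x\<in>{-1..1}. u 0 x = u0 x) \<and>
     (\<forall>t\<in>time_interval T. t > 0 \<longrightarrow>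
        clamped (u t) \<and>
        (\<exists>gx gz.
           has_graph_trace (u t) (dx (u t) (\<psi> t)) gx \<and>
           has_graph_trace (u t) (dz (u t) (\<psi> t)) gz \<and>
           (AE x in lebesgue. x \<in> I \<longrightarrow>
              time_deriv (time_interval T) u t x
                + \<beta> * (dx1 ^^ 4) (u t) x - \<tau> * (dx1 ^^ 2) (u t) x
                = - lam * (\<epsilon>\<^sup>2 * (gx x)\<^sup>2 + (gz x)\<^sup>2))))"

definition maximal_solution ::
    "real \<Rightarrow> real \<Rightarrow> real \<Rightarrow> real \<Rightarrow> (real \<Rightarrow> real) \<Rightarrow> ereal \<Rightarrow>
     (real \<Rightarrow> real \<Rightarrow> real) \<Rightarrow> (real \<Rightarrow> real \<times> real \<Rightarrow> real) \<Rightarrow> bool" where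
  "maximal_solution \<epsilon> \<beta> \<tau> lam u0 T u \<psi> \<longleftrightarrow>
     solution \<epsilon> \<beta> \<tau> lam u0 T u \<psi> \<and>
     \<not> (\<exists>T' u' \<psi>'. T < T' \<and> solution \<epsilon> \<beta> \<tau> lam u0 T' u' \<psi>' \<and>
          (\<forall>t\<in>time_interval T. \<forall>x\<in>{-1..1}. u' t x = u t x))"

end

theory Submission
  imports Defs "HOL-Analysis.Analysis"
begin

text \<open>The energy identity is \<open>d/dt \<E> (u t) = - \<parallel>\<partial>\<^sub>t u\<parallel>\<^sup>2\<close> for \<open>t > 0\<close>, together with continuity of \<open>\<E> (u t)\<close> up to \<open>t = 0\<close>,
  integrated in time. Bending and stretching contribute to the derivative by partial integration in \<open>x\<close>
  (the ends are clamped). The substance is the electrostatic energy, whose derivative has to be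
  \<open>- \<integral> \<partial>\<^sub>t u (\<epsilon>\<^sup>2 \<psi>\<^sub>x\<^sup>2 + \<psi>\<^sub>z\<^sup>2) (x, u x) dx\<close>; the equation then turns the sum into
  \<open>- \<parallel>\<partial>\<^sub>t u\<parallel>\<^sup>2\<close>.
  
  That derivative is obtained from the variational principle, without any regularity of \<open>\<psi>\<close> in time.
  For two profiles \<open>v\<close> and \<open>w\<close> the vertical rescaling \<open>1 + z \<mapsto> (1 + z) (1 + w) / (1 + v)\<close> maps one
  domain to the other and preserves the boundary values. The rescaled potential of \<open>v\<close>
  competes with the potential of \<open>w\<close>, which bounds the Dirichlet energy of \<open>w\<close> from above; completing
  a square gives the matching lower bound (\<open>dirichlet_comparison\<close>). Both bounds are
  \<open>D v + first order + quadratic remainder\<close>, with coefficients that involve only the potential of \<open>v\<close>.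
  
  The first order term is a stress tensor integrated against the rescaling field. The stress tensor
  of a harmonic potential is divergence free, so this is an integral over the graph, and since
  \<open>\<psi> = 1\<close> there it is the expected one (\<open>first_order_boundary\<close>). The remainder
  is \<open>O (\<parallel>w - v\<parallel>\<^sup>2 + \<parallel>w' - v'\<parallel>\<^sup>2)\<close> in \<open>L\<^sub>2 (I)\<close>, because an \<open>H\<^sup>1\<close> function
  is square integrable in \<open>z\<close> uniformly in \<open>x\<close> (\<open>weight_estimate\<close>). As \<open>u\<close> is differentiable in time
  with values in \<open>L\<^sub>2\<close> and continuous with values in \<open>H\<^sup>2\<close>, the interpolation
  \<open>\<parallel>d'\<parallel>\<^sup>2 \<le> \<parallel>d\<parallel> \<parallel>d''\<parallel>\<close> for \<open>d = u s - u t\<close> makes the remainder \<open>o (s - t)\<close>. The density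
  \<open>\<epsilon>\<^sup>2 \<psi>\<^sub>x\<^sup>2 + \<psi>\<^sub>z\<^sup>2\<close> on the graph is in \<open>L\<^sub>2 (I)\<close> by the equation itself.
  
  Two technical points carry the rest. Weak potentials are smooth inside the domain by Weyl's lemma
  (\<open>very_weak_solution_smooth\<close>), so pointwise calculus applies there. Test functions that
  vanish on the boundary of the non-smooth domain are approximated by truncating their values near
  \<open>0\<close> (\<open>divergence_free_orthogonal\<close>), which avoids all boundary regularity.\<close>

section \<open>Smooth functions\<close>

text \<open>The coinductive predicate \<open>smooth\<close> is the intersection of these finite levels, on which
  closure properties are proved by induction.\<close>

primrec Ck :: "nat \<Rightarrow> ('a::euclidean_space \<Rightarrow> real) \<Rightarrow> bool" where
  "Ck 0 f \<longleftrightarrow> True"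
| "Ck (Suc k) f \<longleftrightarrow>
     (\<forall>x. f differentiable (at x)) \<and> (\<forall>v. Ck k (\<lambda>x. frechet_derivative f (at x) v))"

lemma smooth_iff_Ck: "smooth f \<longleftrightarrow> (\<forall>k. Ck k f)"
proof
  have "smooth f \<Longrightarrow> Ck k f" for k
    by (induction k arbitrary: f) (auto elim: smooth.cases)
  then show "smooth f \<Longrightarrow> \<forall>k. Ck k f" by blast
next
  assume "\<forall>k. Ck k f"
  then show "smooth f"
  proof (coinduction arbitrary: f)
    case smooth
    have "Ck (Suc k) f" for k using smooth by blast
    then show ?case by auto
  qed
qed

lemma Ck_Suc_imp: "Ck (Suc k) f \<Longrightarrow> Ck k f"
  by (induction k arbitrary: f) auto

lemma Ck_SucI:
  assumes "\<And>x. (f has_derivative (\<lambda>v. f' v x)) (at x)" "\<And>v. Ck k (f' v)"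
  shows "Ck (Suc k) f"
proof -
  have "frechet_derivative f (at x) = (\<lambda>v. f' v x)" for x
    using frechet_derivative_at[OF assms(1)] by simp
  then show ?thesis using assms by (auto simp: differentiable_def intro!: exI)
qed

lemma Ck_SucD:
  assumes "Ck (Suc k) f"
  shows "(f has_derivative frechet_derivative f (at x)) (at x)"
    "Ck k (\<lambda>x. frechet_derivative f (at x) v)"
  using assms by (auto simp: frechet_derivative_works)

lemma Ck_const: "Ck k (\<lambda>x. c)"
proof (induction k arbitrary: c)
  case (Suc k)
  show ?case by (rule Ck_SucI[where f' = "\<lambda>v x. 0"]) (auto intro: Suc)
qed simp

lemma Ck_bounded_linear:
  assumes "bounded_linear f"
  shows "Ck k f"
proof (cases k)
  case (Suc n)
  have "Ck (Suc n) f"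
    by (rule Ck_SucI[where f' = "\<lambda>v x. f v"])
      (use assms in \<open>simp_all add: bounded_linear_imp_has_derivative Ck_const\<close>)
  then show ?thesis using Suc by simp
qed simp

lemma Ck_add: "Ck k f \<Longrightarrow> Ck k g \<Longrightarrow> Ck k (\<lambda>x. f x + g x)"
proof (induction k arbitrary: f g)
  case (Suc k)
  show ?case
  proof (rule Ck_SucI)
    show "((\<lambda>x. f x + g x) has_derivative
        (\<lambda>v. frechet_derivative f (at x) v + frechet_derivative g (at x) v)) (at x)" for x
      by (intro has_derivative_add Ck_SucD(1)[OF Suc.prems(1)] Ck_SucD(1)[OF Suc.prems(2)])
    show "Ck k (\<lambda>x. frechet_derivative f (at x) v + frechet_derivative g (at x) v)" for v
      by (intro Suc.IH Ck_SucD(2)[OF Suc.prems(1)] Ck_SucD(2)[OF Suc.prems(2)])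
  qed
qed simp

lemma Ck_mult: "Ck k f \<Longrightarrow> Ck k g \<Longrightarrow> Ck k (\<lambda>x. f x * g x)"
proof (induction k arbitrary: f g)
  case (Suc k)
  show ?case
  proof (rule Ck_SucI)
    show "((\<lambda>x. f x * g x) has_derivative
        (\<lambda>v. f x * frechet_derivative g (at x) v + frechet_derivative f (at x) v * g x)) (at x)" for x
      by (intro has_derivative_mult Ck_SucD(1)[OF Suc.prems(1)] Ck_SucD(1)[OF Suc.prems(2)])
    show "Ck k (\<lambda>x. f x * frechet_derivative g (at x) v + frechet_derivative f (at x) v * g x)" for v
      by (intro Ck_add Suc.IH Ck_SucD(2)[OF Suc.prems(1)] Ck_SucD(2)[OF Suc.prems(2)]
          Ck_Suc_imp[OF Suc.prems(1)] Ck_Suc_imp[OF Suc.prems(2)])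
  qed
qed simp

lemma Ck_comp:
  fixes h :: "real \<Rightarrow> real"
  shows "Ck k h \<Longrightarrow> Ck k f \<Longrightarrow> Ck k (\<lambda>x. h (f x))"
proof (induction k arbitrary: h f)
  case (Suc k)
  have "((\<lambda>x. h (f x)) has_derivative
      (\<lambda>v. frechet_derivative h (at (f x)) 1 * frechet_derivative f (at x) v)) (at x)" for x
  proof -
    have "frechet_derivative h (at (f x)) = (\<lambda>y. frechet_derivative h (at (f x)) 1 * y)"
      using linear_frechet_derivative[of h "at (f x)"] Suc.prems
      by (auto simp: fun_eq_iff mult.commute[of _ "_::real"] dest: linear_cmul[of _ _ 1])
    then have "(h has_derivative (\<lambda>y. frechet_derivative h (at (f x)) 1 * y)) (at (f x))"
      using Ck_SucD(1)[OF Suc.prems(1)] by metis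
    then show ?thesis
      using has_derivative_compose[OF Ck_SucD(1)[OF Suc.prems(2)]] by blast
  qed
  moreover have "Ck k (\<lambda>x. frechet_derivative h (at (f x)) 1 * frechet_derivative f (at x) v)" for v
    using Suc.IH[OF Ck_SucD(2)[OF Suc.prems(1), of 1] Ck_Suc_imp[OF Suc.prems(2)]]
    by (intro Ck_mult Ck_SucD(2)[OF Suc.prems(2)])
  ultimately show ?case
    by (rule Ck_SucI[where f' = "\<lambda>v x. frechet_derivative h (at (f x)) 1 * frechet_derivative f (at x) v"])
qed simp

lemma smoothI:
  assumes "\<And>x. (f has_derivative (\<lambda>v. f' v x)) (at x)" "\<And>v. smooth (f' v)"
  shows "smooth f"
proof -
  have "Ck k f" for k
    using assms Ck_SucI[of f f'] by (cases k) (auto simp: smooth_iff_Ck simp del: Ck.simps(2))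
  then show ?thesis by (simp add: smooth_iff_Ck)
qed

lemma smooth_real_I:
  fixes f :: "real \<Rightarrow> real"
  assumes "\<And>x. (f has_real_derivative f' x) (at x)" "smooth f'"
  shows "smooth f"
  by (rule smoothI[where f' = "\<lambda>v x. f' x * v"])
    (use assms in \<open>auto simp: has_field_derivative_def smooth_iff_Ck intro!: Ck_mult Ck_const\<close>)

lemma smooth_has_derivative:
  "smooth f \<Longrightarrow> (f has_derivative frechet_derivative f (at x)) (at x)"
  using smooth_iff_Ck[of f] Ck_SucD(1)[of 0] by blast

lemma smooth_frechet_derivative: "smooth f \<Longrightarrow> smooth (\<lambda>x. frechet_derivative f (at x) v)"
  using smooth_iff_Ck Ck_SucD(2) by blast

lemma smooth_continuous: "smooth f \<Longrightarrow> continuous_on S f"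
  by (meson continuous_at_imp_continuous_on has_derivative_continuous smooth_has_derivative)

lemma smooth_const: "smooth (\<lambda>x. c)"
  and smooth_bounded_linear: "bounded_linear f \<Longrightarrow> smooth f"
  and smooth_add: "smooth f \<Longrightarrow> smooth g \<Longrightarrow> smooth (\<lambda>x. f x + g x)"
  and smooth_mult: "smooth f \<Longrightarrow> smooth g \<Longrightarrow> smooth (\<lambda>x. f x * g x)"
  and smooth_comp: "smooth h \<Longrightarrow> smooth f \<Longrightarrow> smooth (\<lambda>x. h (f x))" for h :: "real \<Rightarrow> real"
  by (simp_all add: smooth_iff_Ck Ck_const Ck_bounded_linear Ck_add Ck_mult Ck_comp)

lemma smooth_diff: "smooth f \<Longrightarrow> smooth g \<Longrightarrow> smooth (\<lambda>x. f x - g x)"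
  using smooth_add[OF _ smooth_mult[OF smooth_const[of "-1"]], of f g] by simp

lemma smooth_power: "smooth f \<Longrightarrow> smooth (\<lambda>x. f x ^ n)"
  by (induction n) (auto intro: smooth_const smooth_mult)

lemma smooth_prod: "(\<And>i. i \<in> A \<Longrightarrow> smooth (f i)) \<Longrightarrow> smooth (\<lambda>x. \<Prod>i\<in>A. f i x)"
  by (induction A rule: infinite_finite_induct) (auto intro: smooth_const smooth_mult)

lemmas smooth_intros = smooth_const smooth_bounded_linear smooth_add smooth_diff smooth_mult
  smooth_power bounded_linear_fst bounded_linear_snd bounded_linear_ident bounded_linear_inner_left

text \<open>The functions \<open>x\<^sup>-\<^sup>n exp (- 1 / x)\<close> are closed under differentiation up to
  linear combinations, which makes them smooth across the origin.\<close>

definition expinv :: "nat \<Rightarrow> real \<Rightarrow> real" where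
  "expinv n x = (if x \<le> 0 then 0 else (1 / x) ^ n * exp (- 1 / x))"

lemma expinv_div_tendsto: "((\<lambda>x. expinv n x / x) \<longlongrightarrow> 0) (at 0)"
proof -
  have lim: "((\<lambda>y::real. y ^ Suc n / exp y) \<longlongrightarrow> 0) at_top" by (rule tendsto_power_div_exp_0)
  have "((\<lambda>x. expinv n x / x) \<longlongrightarrow> 0) (at_right 0)"
  proof (rule Lim_transform_eventually[OF filterlim_compose[OF lim filterlim_inverse_at_top_right]])
    show "\<forall>\<^sub>F x in at_right 0. inverse x ^ Suc n / exp (inverse x) = expinv n x / x"
      unfolding eventually_at_filter
      by (auto simp: expinv_def exp_minus field_simps intro!: always_eventually)
  qed
  moreover have "((\<lambda>x. expinv n x / x) \<longlongrightarrow> 0) (at_left 0)"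
    by (rule Lim_transform_eventually[OF tendsto_const])
      (auto simp: expinv_def eventually_at_filter intro!: always_eventually)
  ultimately show ?thesis using filterlim_split_at by blast
qed

lemma expinv_has_derivative:
  "(expinv n has_real_derivative (expinv (n + 2) x - real n * expinv (n + 1) x)) (at x)"
proof (cases x "0::real" rule: linorder_cases)
  case less
  have "((\<lambda>x. 0) has_real_derivative 0) (at x)" by simp
  then have "(expinv n has_real_derivative 0) (at x)"
    by (rule has_field_derivative_transform_within_open[where S = "{..<0}"])
      (use less in \<open>auto simp: expinv_def\<close>)
  then show ?thesis using less by (simp add: expinv_def)
next
  case equal
  have "(expinv n has_real_derivative 0) (at 0)"
    using expinv_div_tendsto[of n] by (simp add: has_field_derivative_iff expinv_def)
  then show ?thesis using equal by (simp add: expinv_def)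
next
  case greater
  have e1: "real n * (1 / x) ^ (n - 1) * (1 / x ^ 2) = real n * (1 / x) ^ (n + 1)"
    by (cases n) (auto simp: field_simps power2_eq_square)
  have e2: "(1 / x) ^ n * (exp (- 1 / x) * (1 / x ^ 2)) = (1 / x) ^ (n + 2) * exp (- 1 / x)"
    by (simp add: power_add power_divide power2_eq_square)
  have "((\<lambda>x. (1 / x) ^ n * exp (- 1 / x)) has_real_derivative
      ((1 / x) ^ n * (exp (- 1 / x) * (1 / x ^ 2)) - (real n * (1 / x) ^ (n - 1) * (1 / x ^ 2)) * exp (- 1 / x))) (at x)"
    using greater by (auto intro!: derivative_eq_intros simp: power2_eq_square)
  then have "((\<lambda>x. (1 / x) ^ n * exp (- 1 / x)) has_real_derivative
      (expinv (n + 2) x - real n * expinv (n + 1) x)) (at x)"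
    unfolding e1 e2 using greater by (simp add: expinv_def mult.assoc)
  then show ?thesis
    by (rule has_field_derivative_transform_within_open[where S = "{0<..}"])
      (use greater in \<open>auto simp: expinv_def\<close>)
qed

lemma smooth_expinv: "smooth (expinv n)"
proof -
  have "Ck k (expinv n)" for k
  proof (induction k arbitrary: n)
    case (Suc k)
    have "Ck k (\<lambda>x. (expinv (n + 2) x + (- real n) * expinv (n + 1) x) * v)" for v
      by (intro Ck_mult Ck_add Ck_const Suc)
    moreover have "(expinv n has_derivative
        (\<lambda>v. (expinv (n + 2) x + (- real n) * expinv (n + 1) x) * v)) (at x)" for x
      using expinv_has_derivative[of n x] by (simp add: has_field_derivative_def)
    ultimately show ?case
      using Ck_SucI[of "expinv n" "\<lambda>v x. (expinv (n + 2) x + (- real n) * expinv (n + 1) x) * v" k] by blast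
  qed simp
  then show ?thesis by (simp add: smooth_iff_Ck)
qed

text \<open>A smooth step from 0 to 1 as the normalised primitive of a bump on \<open>(0, 1)\<close>.\<close>

lemma smooth_step_exists:
  "\<exists>\<kappa>::real \<Rightarrow> real. smooth \<kappa> \<and> (\<forall>x\<le>0. \<kappa> x = 0) \<and> (\<forall>x>0. \<kappa> x > 0) \<and> (\<forall>x\<ge>1. \<kappa> x = 1) \<and>
     (\<forall>x. 0 \<le> \<kappa> x \<and> \<kappa> x \<le> 1)"
proof -
  define b where "b x = expinv 0 x * expinv 0 (1 - x)" for x
  have sm: "smooth b" unfolding b_def
    using smooth_mult[OF smooth_expinv smooth_comp[OF smooth_expinv smooth_diff[OF smooth_const
      smooth_bounded_linear[OF bounded_linear_ident]]]] by simp
  have bpos: "b x > 0" if "0 < x" "x < 1" for x using that by (simp add: b_def expinv_def)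
  have b0: "b x = 0" if "x \<le> 0 \<or> x \<ge> 1" for x using that by (auto simp: b_def expinv_def)
  have bnn: "b x \<ge> 0" for x by (simp add: b_def expinv_def)
  have cont: "continuous_on S b" for S by (rule smooth_continuous[OF sm])
  define k where "k x = integral {-1..x} b" for x
  have int: "b integrable_on {x..y}" for x y by (rule integrable_continuous_real[OF cont])
  have integral_eq_zero_on: "integral {x..y} b = 0" if "\<And>z. z \<in> {x..y} \<Longrightarrow> b z = 0" for x y
    using integral_cong[of "{x..y}" b "\<lambda>_. 0"] that by simp
  have k0: "k x = 0" if "x \<le> 0" for x
    unfolding k_def using that by (intro integral_eq_zero_on) (auto simp: b0)
  have der: "(k has_real_derivative b x) (at x)" for x
  proof (cases "x < 0")
    case True
    have "((\<lambda>x. 0) has_real_derivative 0) (at x)" by simp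
    then have "(k has_real_derivative 0) (at x)"
      by (rule has_field_derivative_transform_within_open[where S = "{..<0}"]) (use True k0 in auto)
    then show ?thesis using True b0 by simp
  next
    case False
    have "(k has_real_derivative b x) (at x within {-1..x+1})"
      unfolding k_def by (rule integral_has_real_derivative[OF cont]) (use False in auto)
    moreover have "at x within {-1..x+1} = at x"
      using False by (intro at_within_interior) (auto simp: interior_atLeastAtMost_real)
    ultimately show ?thesis by simp
  qed
  have mono: "k x \<le> k y" if "x \<le> y" for x y
    by (rule DERIV_nonneg_imp_nondecreasing[OF that]) (use der bnn in blast)
  have pos: "k x > 0" if "x > 0" for x
  proof -
    define y where "y = min x 1 / 2"
    have "k 0 < k (2 * y)"
      by (rule DERIV_pos_imp_increasing_open[of 0 "2 * y"])
        (use that in \<open>auto simp: y_def intro!: exI[of _ "b _"] der bpos intro: DERIV_continuous_on[OF has_field_derivative_at_within[OF der]]\<close>)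
    then show ?thesis using mono[of "2 * y" x] k0[of 0] by (auto simp: y_def)
  qed
  have k1: "k x = k 1" if "x \<ge> 1" for x
  proof -
    have "k x = k 1 + integral {1..x} b"
      unfolding k_def using that by (intro Henstock_Kurzweil_Integration.integral_combine[symmetric] int) auto
    moreover have "integral {1..x} b = 0" by (intro integral_eq_zero_on) (auto simp: b0)
    ultimately show ?thesis by simp
  qed
  have c0: "smooth (\<lambda>x. k x * (1 / k 1))"
    by (intro smooth_mult smooth_const smooth_real_I[OF der sm])
  have k1pos: "k 1 > 0" by (rule pos) simp
  have c1: "k x * (1 / k 1) = 0" if "x \<le> 0" for x using k0[OF that] by simp
  have c2: "k x * (1 / k 1) > 0" if "x > 0" for x using pos[OF that] k1pos by simp
  have c3: "k x * (1 / k 1) = 1" if "x \<ge> 1" for x using k1[OF that] k1pos by simp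
  have c4: "0 \<le> k x * (1 / k 1)" for x using c1[of x] c2[of x] by (cases "x \<le> 0") auto
  have c5: "k x * (1 / k 1) \<le> 1" for x using mono[of x 1] c3[of x] k1pos by (cases "x \<le> 1") auto
  show ?thesis
    by (rule exI[of _ "\<lambda>x. k x * (1 / k 1)"]) (intro conjI allI impI c0 c1 c2 c3 c4 c5)
qed

definition step :: "real \<Rightarrow> real" where
  "step = (SOME \<kappa>. smooth \<kappa> \<and> (\<forall>x\<le>0. \<kappa> x = 0) \<and> (\<forall>x>0. \<kappa> x > 0) \<and> (\<forall>x\<ge>1. \<kappa> x = 1) \<and>
     (\<forall>x. 0 \<le> \<kappa> x \<and> \<kappa> x \<le> 1))"

lemma smooth_step: "smooth step"
  and step_0: "x \<le> 0 \<Longrightarrow> step x = 0"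
  and step_pos: "x > 0 \<Longrightarrow> step x > 0"
  and step_1: "x \<ge> 1 \<Longrightarrow> step x = 1"
  and step_bounds: "0 \<le> step x" "step x \<le> 1"
  using someI_ex[OF smooth_step_exists] unfolding step_def[symmetric] by auto


section \<open>Test functions and weak derivatives\<close>

text \<open>Tends to the indicator of the open box as \<open>n \<rightarrow> \<infinity>\<close>, which lets
  test functions detect integrals over boxes.\<close>

definition box_bump :: "real \<Rightarrow> 'a::euclidean_space \<Rightarrow> 'a \<Rightarrow> 'a \<Rightarrow> real" where
  "box_bump n a b x = (\<Prod>i\<in>Basis. step (n * (x \<bullet> i - a \<bullet> i)) * step (n * (b \<bullet> i - x \<bullet> i)))"

lemma smooth_box_bump: "smooth (box_bump n a b)"
  unfolding box_bump_def
  by (intro smooth_prod smooth_mult smooth_comp[OF smooth_step] smooth_diff smooth_const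
      smooth_bounded_linear bounded_linear_inner_left)

lemma box_bump_bounds: "0 \<le> box_bump n a b x" "box_bump n a b x \<le> 1"
  unfolding box_bump_def by (auto intro!: prod_nonneg prod_le_1 mult_le_one step_bounds mult_nonneg_nonneg)

lemma box_bump_outside: "n \<ge> 0 \<Longrightarrow> x \<notin> box a b \<Longrightarrow> box_bump n a b x = 0"
  unfolding box_bump_def mem_box
  by (auto simp: prod_zero_iff not_less mult_nonneg_nonpos intro!: bexI step_0)

lemma box_bump_tendsto: "(\<lambda>n. box_bump (real n) a b x) \<longlonglongrightarrow> indicator (box a b) x"
proof (cases "x \<in> box a b")
  case True
  have step_lim: "(\<lambda>n. step (real n * d)) \<longlonglongrightarrow> 1" if "d > 0" for d
  proof (rule Lim_transform_eventually[OF tendsto_const])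
    obtain N :: nat where N: "1 / d < real N" using reals_Archimedean2 by blast
    show "\<forall>\<^sub>F n in sequentially. 1 = step (real n * d)"
    proof (rule eventually_sequentiallyI[of N])
      fix n assume "N \<le> n"
      then have "real N * d \<le> real n * d" using that by (intro mult_right_mono) auto
      moreover have "1 < real N * d" using N that by (simp add: field_simps)
      ultimately have "1 \<le> real n * d" by linarith
      then show "1 = step (real n * d)" by (simp add: step_1)
    qed
  qed
  have "(\<lambda>n. box_bump (real n) a b x) \<longlonglongrightarrow> (\<Prod>i\<in>(Basis::'a set). 1 * 1)"
    unfolding box_bump_def by (intro tendsto_prod tendsto_mult step_lim) (use True in \<open>auto simp: mem_box\<close>)
  then show ?thesis using True by simp
qed (simp add: box_bump_outside)

lemma test_function_box_bump:
  assumes "n \<ge> 0" "cbox a b \<subseteq> S"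
  shows "test_function S (box_bump n a b)"
proof -
  have "closure {x. box_bump n a b x \<noteq> 0} \<subseteq> cbox a b"
    using box_bump_outside[OF assms(1)] box_subset_cbox by (intro closure_minimal) blast+
  moreover from this have "compact (closure {x. box_bump n a b x \<noteq> 0})"
    using compact_cbox compact_Int_closed closed_closure by (metis inf.absorb_iff2)
  ultimately show ?thesis
    unfolding test_function_def using smooth_box_bump assms by blast
qed

lemma smooth_borel_measurable: "smooth f \<Longrightarrow> f \<in> borel_measurable borel"
  by (intro borel_measurable_continuous_onI smooth_continuous)

lemma continuous_compact_support_bounded:
  fixes \<phi> :: "'a::euclidean_space \<Rightarrow> real"
  assumes "continuous_on UNIV \<phi>" "compact (closure {x. \<phi> x \<noteq> 0})"
  obtains C where "C \<ge> 0" "\<And>x. \<bar>\<phi> x\<bar> \<le> C"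
proof -
  have "bounded (\<phi> ` closure {x. \<phi> x \<noteq> 0})"
    using assms compact_continuous_image continuous_on_subset compact_imp_bounded by blast
  then obtain C where C: "\<And>x. x \<in> closure {x. \<phi> x \<noteq> 0} \<Longrightarrow> \<bar>\<phi> x\<bar> \<le> C"
    unfolding bounded_iff by auto
  then show ?thesis using closure_subset[of "{x. \<phi> x \<noteq> 0}"] by (intro that[of "max C 0"]) (fastforce simp: le_max_iff_disj)+
qed

lemma locally_integrable_times:
  assumes f: "locally_integrable S f" and c: "continuous_on UNIV \<phi>"
    and K: "compact (closure {x. \<phi> x \<noteq> 0})" "closure {x. \<phi> x \<noteq> 0} \<subseteq> S"
  shows "set_integrable lebesgue S (\<lambda>x. f x * \<phi> x)"
proof -
  let ?K = "closure {x. \<phi> x \<noteq> 0}"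
  obtain C where C: "C \<ge> 0" "\<And>x. \<bar>\<phi> x\<bar> \<le> C" using continuous_compact_support_bounded[OF c K(1)] by blast
  have fK: "integrable lebesgue (\<lambda>x. indicat_real ?K x * f x)"
    using f K unfolding locally_integrable_def set_integrable_def by auto
  have [measurable]: "\<phi> \<in> borel_measurable lebesgue"
    by (rule measurable_completion) (simp add: borel_measurable_continuous_onI[OF c])
  have "integrable lebesgue (\<lambda>x. (indicat_real ?K x * f x) * \<phi> x)"
  proof (rule Bochner_Integration.integrable_bound[of _ "\<lambda>x. C * (indicat_real ?K x * f x)"])
    show "integrable lebesgue (\<lambda>x. C * (indicat_real ?K x * f x))" using fK by simp
    have [measurable]: "(\<lambda>x. indicat_real ?K x * f x) \<in> borel_measurable lebesgue" using fK by blast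
    show "(\<lambda>x. (indicat_real ?K x * f x) * \<phi> x) \<in> borel_measurable lebesgue" by measurable
    show "AE x in lebesgue. norm ((indicat_real ?K x * f x) * \<phi> x) \<le> norm (C * (indicat_real ?K x * f x))"
      by (intro AE_I2) (use C in \<open>simp add: abs_mult mult.commute[of C] mult_left_mono\<close>)
  qed
  moreover have "(indicat_real ?K x * f x) * \<phi> x = indicat_real S x *\<^sub>R (f x * \<phi> x)" for x
    using K(2) closure_subset[of "{x. \<phi> x \<noteq> 0}"] by (auto simp: indicator_def)
  ultimately show ?thesis unfolding set_integrable_def by simp
qed

lemma test_function_integrable:
  "locally_integrable S f \<Longrightarrow> test_function S \<phi> \<Longrightarrow> set_integrable lebesgue S (\<lambda>x. f x * \<phi> x)"
  unfolding test_function_def by (intro locally_integrable_times smooth_continuous) auto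

lemma frechet_derivative_eq_0_outside_support:
  assumes "x \<notin> closure {x. \<phi> x \<noteq> 0}"
  shows "frechet_derivative \<phi> (at x) = (\<lambda>v. 0)"
proof -
  have "((\<lambda>x. 0) has_derivative (\<lambda>v. 0)) (at x)" by simp
  then have "(\<phi> has_derivative (\<lambda>v. 0)) (at x)"
    by (rule has_derivative_transform_within_open[OF _ open_Compl[OF closed_closure[of "{x. \<phi> x \<noteq> 0}"]]])
      (use assms closure_subset[of "{x. \<phi> x \<noteq> 0}"] in auto)
  then show ?thesis using frechet_derivative_at by metis
qed

lemma test_function_frechet:
  assumes "test_function S \<phi>"
  shows "test_function S (\<lambda>x. frechet_derivative \<phi> (at x) v)"
proof -
  have "closure {x. frechet_derivative \<phi> (at x) v \<noteq> 0} \<subseteq> closure {x. \<phi> x \<noteq> 0}"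
    using frechet_derivative_eq_0_outside_support[of _ \<phi>] by (intro closure_minimal) fastforce+
  moreover from this have "compact (closure {x. frechet_derivative \<phi> (at x) v \<noteq> 0})"
    using assms compact_Int_closed closed_closure unfolding test_function_def by (metis inf.absorb_iff2)
  ultimately show ?thesis using assms smooth_frechet_derivative unfolding test_function_def by blast
qed

text \<open>A function all of whose integrals over boxes vanish is null almost everywhere, since boxes
  form an intersection-stable generator of the Borel sets.\<close>

lemma AE_zero_of_box_integrals:
  fixes f :: "'a::euclidean_space \<Rightarrow> real"
  assumes f: "integrable lebesgue f"
    and box: "\<And>a b. (LINT x:box a b|lebesgue. f x) = 0"
  shows "AE x in lebesgue. f x = 0"
proof -
  obtain g where g[measurable]: "g \<in> borel_measurable lborel" and fg: "AE x in lborel. f x = g x"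
    using completion_ex_borel_measurable_real[of f lborel] f by auto
  have fg': "AE x in lebesgue. f x = g x" using fg by (rule AE_completion)
  have gi: "integrable lborel g"
    using f g fg' integrable_cong_AE[of f lebesgue g] integrable_completion[of g lborel]
    by (metis borel_measurable_integrable measurable_completion)
  have eq: "(LINT x:A|lborel. g x) = (LINT x:A|lebesgue. f x)" if "A \<in> sets borel" for A
  proof -
    have "(LINT x:A|lebesgue. f x) = (LINT x:A|lebesgue. g x)"
      unfolding set_lebesgue_integral_def
    proof (rule integral_cong_AE)
      show "(\<lambda>x. indicat_real A x *\<^sub>R f x) \<in> borel_measurable lebesgue"
        using f that by (intro borel_measurable_scaleR borel_measurable_indicator) auto
      show "(\<lambda>x. indicat_real A x *\<^sub>R g x) \<in> borel_measurable lebesgue"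
        using measurable_completion[OF g] that by (intro borel_measurable_scaleR borel_measurable_indicator) auto
    qed (use fg' in auto)
    then show ?thesis unfolding set_lebesgue_integral_def using that by (simp add: integral_completion)
  qed
  have gset: "set_integrable lborel A g" if "A \<in> sets borel" for A
    using gi that unfolding set_integrable_def by (intro integrable_mult_indicator) auto
  have total: "(LINT x:UNIV|lborel. g x) = 0"
  proof -
    have "(\<lambda>n. LINT x:box (- real n *\<^sub>R One) (real n *\<^sub>R One)|lborel. g x) \<longlonglongrightarrow> (LINT x:UNIV|lborel. g x)"
      unfolding set_lebesgue_integral_def
    proof (rule integral_dominated_convergence[where w = "\<lambda>x. norm (g x)"])
      show "AE x in lborel. (\<lambda>n. indicat_real (box (- real n *\<^sub>R One) (real n *\<^sub>R One)) x *\<^sub>R g x)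
          \<longlonglongrightarrow> indicat_real UNIV x *\<^sub>R g x"
      proof (rule AE_I2)
        fix x :: 'a
        obtain N :: nat where N: "norm x < real N" using reals_Archimedean2 by blast
        show "(\<lambda>n. indicat_real (box (- real n *\<^sub>R One) (real n *\<^sub>R One)) x *\<^sub>R g x) \<longlonglongrightarrow> indicat_real UNIV x *\<^sub>R g x"
        proof (rule Lim_transform_eventually[OF tendsto_const], rule eventually_sequentiallyI[of N])
          fix n assume "N \<le> n"
          then have "x \<in> box (- real n *\<^sub>R One) (real n *\<^sub>R One)"
            using N Basis_le_norm[of _ x] by (fastforce simp: mem_box abs_le_iff)
          then show "indicat_real UNIV x *\<^sub>R g x = indicat_real (box (- real n *\<^sub>R One) (real n *\<^sub>R One)) x *\<^sub>R g x"
            by simp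
        qed
      qed
    qed (use gi in \<open>auto simp: indicator_def\<close>)
    moreover have "(LINT x:box (- real n *\<^sub>R One) (real n *\<^sub>R One)|lborel. g x) = 0" for n
      using eq box by simp
    ultimately show ?thesis by (simp add: LIMSEQ_const_iff)
  qed
  have "(LINT x:A|lborel. g x) = 0" if "A \<in> sets borel" for A
  proof -
    let ?G = "range (\<lambda>(a, b). box a b :: 'a set)"
    have "Int_stable ?G"
      unfolding Int_stable_def by (auto simp: box_Int_box)
    moreover have "?G \<subseteq> Pow UNIV" by simp
    moreover have "A \<in> sigma_sets UNIV ?G" using that unfolding borel_eq_box by (simp add: sets_measure_of)
    ultimately show ?thesis
    proof (induction rule: sigma_sets_induct_disjoint)
      case (basic A)
      then show ?case using eq box by auto
    next
      case empty
      show ?case by (simp add: set_lebesgue_integral_def)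
    next
      case (compl A)
      have A: "A \<in> sets borel" using compl(1) unfolding borel_eq_box by (simp add: sets_measure_of)
      have "(LINT x:UNIV|lborel. g x) = (LINT x:A|lborel. g x) + (LINT x:UNIV - A|lborel. g x)"
        using set_integral_Un[of A "UNIV - A" lborel g] gset A by auto
      then show ?case using total compl by simp
    next
      case (union A)
      have A: "A i \<in> sets borel" for i using union(2) unfolding borel_eq_box by (auto simp: sets_measure_of)
      have "(LINT x:(\<Union>i. A i)|lborel. g x) = (\<Sum>i. (LINT x:A i|lborel. g x))"
        by (rule lebesgue_integral_countable_add)
          (use union(1) A gset in \<open>auto simp: disjoint_family_on_def intro!: gset\<close>)
      then show ?case using union by simp
    qed
  qed
  then have "AE x in lborel. g x = 0" using gi by (intro sigma_finite_measure.density_zero[OF sigma_finite_lborel]) auto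
  then have "AE x in lebesgue. g x = 0" by (rule AE_completion)
  then show ?thesis using fg' by auto
qed

text \<open>Testing with bumps that tend to the indicator of a box shows that \<open>f\<close> has zero integral
  over every box in \<open>S\<close>; countably many boxes cover \<open>S\<close>.\<close>

lemma fundamental_lemma:
  fixes f :: "'a::euclidean_space \<Rightarrow> real"
  assumes S: "open S" and f: "locally_integrable S f"
    and zero: "\<And>\<phi>. test_function S \<phi> \<Longrightarrow> (LINT x:S|lebesgue. f x * \<phi> x) = 0"
  shows "AE x in lebesgue. x \<in> S \<longrightarrow> f x = 0"
proof -
  have box0: "(LINT x:box a b|lebesgue. f x) = 0" if ab: "cbox a b \<subseteq> S" for a b
  proof -
    have fK: "integrable lebesgue (\<lambda>x. indicat_real (cbox a b) x * f x)"
      using f ab compact_cbox unfolding locally_integrable_def set_integrable_def by auto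
    have "(\<lambda>n. LINT x|lebesgue. indicat_real S x *\<^sub>R (f x * box_bump (real n) a b x))
        \<longlonglongrightarrow> (LINT x|lebesgue. indicat_real (box a b) x *\<^sub>R f x)"
    proof (rule integral_dominated_convergence[where w = "\<lambda>x. norm (indicat_real (cbox a b) x * f x)"])
      show "integrable lebesgue (\<lambda>x. norm (indicat_real (cbox a b) x * f x))" using fK by (rule integrable_norm)
      have "(\<lambda>x. indicat_real (box a b) x * (indicat_real (cbox a b) x * f x)) \<in> borel_measurable lebesgue"
        by (intro borel_measurable_times borel_measurable_indicator borel_measurable_integrable[OF fK]) simp
      moreover have "indicat_real (box a b) x * (indicat_real (cbox a b) x * f x) = indicat_real (box a b) x *\<^sub>R f x" for x
        using box_subset_cbox[of a b] by (auto simp: indicator_def)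
      ultimately show "(\<lambda>x. indicat_real (box a b) x *\<^sub>R f x) \<in> borel_measurable lebesgue" by simp
      show "(\<lambda>x. indicat_real S x *\<^sub>R (f x * box_bump (real n) a b x)) \<in> borel_measurable lebesgue" for n
        using test_function_integrable[OF f test_function_box_bump[OF _ ab, of "real n"]]
        unfolding set_integrable_def by auto
      show "AE x in lebesgue. norm (indicat_real S x *\<^sub>R (f x * box_bump (real n) a b x))
          \<le> norm (indicat_real (cbox a b) x * f x)" for n
      proof (rule AE_I2)
        fix x
        show "norm (indicat_real S x *\<^sub>R (f x * box_bump (real n) a b x)) \<le> norm (indicat_real (cbox a b) x * f x)"
        proof (cases "x \<in> cbox a b")
          case True
          then have "x \<in> S" using ab by blast
          then show ?thesis using True box_bump_bounds[of "real n" a b x]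
            by (auto simp: abs_mult intro: mult_left_le)
        next
          case False
          then have "box_bump (real n) a b x = 0" using box_bump_outside box_subset_cbox by (metis of_nat_0_le_iff subsetD)
          then show ?thesis by simp
        qed
      qed
      show "AE x in lebesgue. (\<lambda>n. indicat_real S x *\<^sub>R (f x * box_bump (real n) a b x)) \<longlonglongrightarrow> indicat_real (box a b) x *\<^sub>R f x"
      proof (rule AE_I2)
        fix x
        have "(\<lambda>n. indicat_real S x *\<^sub>R (f x * box_bump (real n) a b x)) \<longlonglongrightarrow> indicat_real S x *\<^sub>R (f x * indicat_real (box a b) x)"
          by (intro tendsto_intros box_bump_tendsto)
        also have "indicat_real S x *\<^sub>R (f x * indicat_real (box a b) x) = indicat_real (box a b) x *\<^sub>R f x"
          using ab box_subset_cbox[of a b] by (auto simp: indicator_def)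
        finally show "(\<lambda>n. indicat_real S x *\<^sub>R (f x * box_bump (real n) a b x)) \<longlonglongrightarrow> indicat_real (box a b) x *\<^sub>R f x" .
      qed
    qed
    moreover have "(LINT x|lebesgue. indicat_real S x *\<^sub>R (f x * box_bump (real n) a b x)) = 0" for n
      using zero[OF test_function_box_bump[OF _ ab, of "real n"]] unfolding set_lebesgue_integral_def by simp
    ultimately show ?thesis unfolding set_lebesgue_integral_def by (simp add: LIMSEQ_const_iff)
  qed
  have local0: "AE x in lebesgue. x \<in> box a b \<longrightarrow> f x = 0" if ab: "cbox a b \<subseteq> S" for a b
  proof -
    have fK: "integrable lebesgue (\<lambda>x. indicat_real (box a b) x * (indicat_real (cbox a b) x * f x))"
    proof -
      have "integrable lebesgue (\<lambda>x. indicat_real (cbox a b) x * f x)"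
        using f ab compact_cbox unfolding locally_integrable_def set_integrable_def by auto
      from integrable_mult_indicator[OF _ this, of "box a b"] show ?thesis by simp
    qed
    have "(LINT x:box c d|lebesgue. indicat_real (box a b) x * (indicat_real (cbox a b) x * f x)) = 0" for c d
    proof -
      obtain p q where pq: "box a b \<inter> box c d = box p q" by (rule that[OF box_Int_box])
      have sub: "box p q \<subseteq> box a b" using pq by blast
      have "cbox p q \<subseteq> cbox a b \<or> box p q = {}"
        using closure_mono[OF sub] closure_box[of p q] closure_minimal[OF box_subset_cbox[of a b] closed_cbox] by blast
      moreover have "(LINT x:box c d|lebesgue. indicat_real (box a b) x * (indicat_real (cbox a b) x * f x))
          = (LINT x:box p q|lebesgue. f x)"
        unfolding set_lebesgue_integral_def pq[symmetric] using box_subset_cbox[of a b]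
        by (intro Bochner_Integration.integral_cong) (auto simp: indicator_def)
      ultimately show ?thesis using box0[of p q] ab by (auto simp: set_lebesgue_integral_def)
    qed
    from AE_zero_of_box_integrals[OF fK this]
    show ?thesis by eventually_elim (use box_subset_cbox[of a b] in \<open>auto simp: indicator_def split: if_splits\<close>)
  qed
  obtain D where D: "countable D" "D \<subseteq> Pow S" "\<And>X. X \<in> D \<Longrightarrow> \<exists>a b. X = cbox a b" "\<Union>D = S"
    using open_countable_Union_open_cbox[OF S] by metis
  have "AE x in lebesgue. x \<in> X \<longrightarrow> f x = 0" if XD: "X \<in> D" for X
  proof -
    obtain a b where X: "X = cbox a b" using D(3)[OF XD] by blast
    have "AE x in lebesgue. x \<notin> cbox a b - box a b"
      using negligible_frontier_interval[of a b] unfolding negligible_iff_null_sets by (rule AE_not_in)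
    moreover have "AE x in lebesgue. x \<in> box a b \<longrightarrow> f x = 0" using local0 X XD D(2) by blast
    ultimately show ?thesis unfolding X by eventually_elim auto
  qed
  then have "AE x in lebesgue. \<forall>X\<in>D. x \<in> X \<longrightarrow> f x = 0" by (subst AE_ball_countable[OF D(1)]) blast
  then show ?thesis using D(4) by auto
qed


lemma borel_measurable_lebesgue_cong_AE:
  fixes f g :: "'a::euclidean_space \<Rightarrow> real"
  assumes f: "f \<in> borel_measurable lebesgue" and eq: "AE x in lebesgue. f x = g x"
  shows "g \<in> borel_measurable lebesgue"
proof (rule measurableI)
  fix B :: "real set" assume "B \<in> sets borel"
  then have A: "f -` B \<inter> space lebesgue \<in> sets lebesgue" using f by (rule measurable_sets[rotated])
  have ae: "AE x in lebesgue. x \<in> f -` B \<inter> space lebesgue \<longleftrightarrow> x \<in> g -` B \<inter> space lebesgue"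
    using eq by eventually_elim auto
  show "g -` B \<inter> space lebesgue \<in> sets lebesgue"
    by (rule completion.in_sets_AE[OF ae A]) blast
qed simp

lemma set_integrable_lebesgue_cong_AE:
  fixes f g :: "'a::euclidean_space \<Rightarrow> real"
  assumes "set_integrable lebesgue S f" and eq: "AE x in lebesgue. x \<in> S \<longrightarrow> f x = g x"
  shows "set_integrable lebesgue S g"
proof -
  have e: "AE x in lebesgue. indicat_real S x *\<^sub>R f x = indicat_real S x *\<^sub>R g x"
    using eq by eventually_elim (auto simp: indicator_def)
  have m: "(\<lambda>x. indicat_real S x *\<^sub>R f x) \<in> borel_measurable lebesgue"
    using assms(1) unfolding set_integrable_def by blast
  show ?thesis
    using assms(1) integrable_cong_AE[OF m borel_measurable_lebesgue_cong_AE[OF m e] e]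
    unfolding set_integrable_def by blast
qed

lemma set_integral_lebesgue_cong_AE:
  fixes f g :: "'a::euclidean_space \<Rightarrow> real"
  assumes f: "set_borel_measurable lebesgue S f" and eq: "AE x in lebesgue. x \<in> S \<longrightarrow> f x = g x"
  shows "(LINT x:S|lebesgue. f x) = (LINT x:S|lebesgue. g x)"
proof -
  have e: "AE x in lebesgue. indicat_real S x *\<^sub>R f x = indicat_real S x *\<^sub>R g x"
    using eq by eventually_elim (auto simp: indicator_def)
  show ?thesis
    unfolding set_lebesgue_integral_def
    using f borel_measurable_lebesgue_cong_AE[OF _ e] e
    by (intro integral_cong_AE) (auto simp: set_borel_measurable_def)
qed

lemma locally_integrable_cong_AE:
  assumes "locally_integrable S f" "AE x in lebesgue. x \<in> S \<longrightarrow> f x = g x"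
  shows "locally_integrable S g"
proof -
  have "set_integrable lebesgue K g" if "compact K \<and> K \<subseteq> S" for K
  proof (rule set_integrable_lebesgue_cong_AE)
    show "set_integrable lebesgue K f" using assms(1) that unfolding locally_integrable_def by blast
    show "AE x in lebesgue. x \<in> K \<longrightarrow> f x = g x" using assms(2) by eventually_elim (use that in auto)
  qed
  then show ?thesis unfolding locally_integrable_def by blast
qed

lemma locally_integrable_lincomb:
  "locally_integrable S f \<Longrightarrow> locally_integrable S g \<Longrightarrow> locally_integrable S (\<lambda>x. a * f x + b * g x)"
  unfolding locally_integrable_def by (auto intro!: set_integral_add)

lemma has_weak_deriv_lincomb:
  assumes "has_weak_deriv S e f f'" "has_weak_deriv S e g g'"
  shows "has_weak_deriv S e (\<lambda>x. a * f x + b * g x) (\<lambda>x. a * f' x + b * g' x)"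
proof -
  have "(LINT x:S|lebesgue. (a * f x + b * g x) * frechet_derivative \<phi> (at x) e)
      = - (LINT x:S|lebesgue. (a * f' x + b * g' x) * \<phi> x)" if "test_function S \<phi>" for \<phi>
  proof -
    have *: "(LINT x:S|lebesgue. (a * h x + b * k x) * p x)
      = a * (LINT x:S|lebesgue. h x * p x) + b * (LINT x:S|lebesgue. k x * p x)"
      if "locally_integrable S h" "locally_integrable S k" "test_function S p" for h k p
    proof -
      have "(LINT x:S|lebesgue. (a * h x + b * k x) * p x)
        = (LINT x:S|lebesgue. a * (h x * p x) + b * (k x * p x))"
        by (simp add: algebra_simps)
      also have "\<dots> = a * (LINT x:S|lebesgue. h x * p x) + b * (LINT x:S|lebesgue. k x * p x)"
        using test_function_integrable[OF that(1,3)] test_function_integrable[OF that(2,3)]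
        by (subst set_integral_add) auto
      finally show ?thesis .
    qed
    show ?thesis
      using assms that test_function_frechet[OF that] unfolding has_weak_deriv_def
      by (simp add: *)
  qed
  then show ?thesis
    using assms unfolding has_weak_deriv_def by (auto intro: locally_integrable_lincomb)
qed

lemma has_weak_deriv_diff:
  "has_weak_deriv S e f f' \<Longrightarrow> has_weak_deriv S e g g' \<Longrightarrow>
    has_weak_deriv S e (\<lambda>x. f x - g x) (\<lambda>x. f' x - g' x)"
  using has_weak_deriv_lincomb[of S e f f' g g' 1 "-1"] by simp

lemma has_weak_deriv_cong_AE:
  assumes "has_weak_deriv S e f f'"
    and f: "AE x in lebesgue. x \<in> S \<longrightarrow> f x = g x" and f': "AE x in lebesgue. x \<in> S \<longrightarrow> f' x = g' x"
  shows "has_weak_deriv S e g g'"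
proof -
  have li: "locally_integrable S f" "locally_integrable S f'" using assms(1) unfolding has_weak_deriv_def by auto
  have eq: "(LINT x:S|lebesgue. h x * p x) = (LINT x:S|lebesgue. k x * p x)"
    if "locally_integrable S h" "test_function S p" "AE x in lebesgue. x \<in> S \<longrightarrow> h x = k x" for h k p
    using test_function_integrable[OF that(1,2)] that(3) unfolding set_integrable_def
    by (intro set_integral_lebesgue_cong_AE) (auto simp: set_borel_measurable_def)
  have "(LINT x:S|lebesgue. g x * frechet_derivative \<phi> (at x) e) = - (LINT x:S|lebesgue. g' x * \<phi> x)"
    if \<phi>: "test_function S \<phi>" for \<phi>
    using assms(1) \<phi> eq[OF li(1) test_function_frechet[OF \<phi>] f, of e] eq[OF li(2) \<phi> f']
    unfolding has_weak_deriv_def by simp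
  then show ?thesis
    using locally_integrable_cong_AE[OF li(1) f] locally_integrable_cong_AE[OF li(2) f']
    unfolding has_weak_deriv_def by blast
qed

text \<open>Lets every weak derivative chosen by \<open>weak_deriv\<close> be replaced by a concrete one.\<close>

lemma has_weak_deriv_unique:
  assumes S: "open S" and g: "has_weak_deriv S e f g" "has_weak_deriv S e f h"
  shows "AE x in lebesgue. x \<in> S \<longrightarrow> g x = h x"
proof -
  have li: "locally_integrable S g" "locally_integrable S h" using g unfolding has_weak_deriv_def by auto
  have d: "has_weak_deriv S e (\<lambda>x. f x - f x) (\<lambda>x. g x - h x)" using has_weak_deriv_diff[OF g] .
  have "AE x in lebesgue. x \<in> S \<longrightarrow> g x - h x = 0"
    by (rule fundamental_lemma[OF S])
      (use d in \<open>auto simp: has_weak_deriv_def set_lebesgue_integral_def\<close>)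
  then show ?thesis by simp
qed

lemma has_weak_deriv_weak_deriv: "has_weak_deriv S e f g \<Longrightarrow> has_weak_deriv S e f (weak_deriv S e f)"
  unfolding weak_deriv_def by (rule someI[of "has_weak_deriv S e f"])

lemma weak_deriv_AE_eq:
  "open S \<Longrightarrow> has_weak_deriv S e f g \<Longrightarrow> AE x in lebesgue. x \<in> S \<longrightarrow> weak_deriv S e f x = g x"
  using has_weak_deriv_unique has_weak_deriv_weak_deriv by blast

lemma L2_on_cong_AE:
  assumes "L2_on S f" "AE x in lebesgue. x \<in> S \<longrightarrow> f x = g x"
  shows "L2_on S g"
proof -
  have e: "AE x in lebesgue. indicat_real S x *\<^sub>R f x = indicat_real S x *\<^sub>R g x"
    using assms(2) by eventually_elim (auto simp: indicator_def)
  have e2: "AE x in lebesgue. x \<in> S \<longrightarrow> (f x)\<^sup>2 = (g x)\<^sup>2" using assms(2) by eventually_elim auto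
  have f: "(\<lambda>x. indicat_real S x *\<^sub>R f x) \<in> borel_measurable lebesgue" "set_integrable lebesgue S (\<lambda>x. (f x)\<^sup>2)"
    using assms(1) unfolding L2_on_def set_borel_measurable_def by auto
  show ?thesis
    using borel_measurable_lebesgue_cong_AE[OF f(1) e] set_integrable_lebesgue_cong_AE[OF f(2) e2]
    unfolding L2_on_def set_borel_measurable_def by simp
qed

lemma L2_norm_on_cong_AE:
  assumes "L2_on S f" "AE x in lebesgue. x \<in> S \<longrightarrow> f x = g x"
  shows "L2_norm_on S f = L2_norm_on S g"
proof -
  have e: "AE x in lebesgue. x \<in> S \<longrightarrow> (f x)\<^sup>2 = (g x)\<^sup>2" using assms(2) by eventually_elim auto
  have "integrable lebesgue (\<lambda>x. indicat_real S x *\<^sub>R (f x)\<^sup>2)"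
    using assms(1) unfolding L2_on_def set_integrable_def by simp
  then have "set_borel_measurable lebesgue S (\<lambda>x. (f x)\<^sup>2)"
    unfolding set_borel_measurable_def by (rule borel_measurable_integrable)
  then show ?thesis unfolding L2_norm_on_def using set_integral_lebesgue_cong_AE[OF _ e] by simp
qed

lemma sobolev_L2: "sobolev k S f \<Longrightarrow> L2_on S f"
  by (cases k) auto

lemma sobolev_cong_AE:
  assumes "sobolev k S f" "AE x in lebesgue. x \<in> S \<longrightarrow> f x = g x"
  shows "sobolev k S g"
proof (cases k)
  case 0
  then show ?thesis using L2_on_cong_AE[OF _ assms(2)] assms(1) by simp
next
  case (Suc n)
  have "has_weak_deriv S e g h" if "has_weak_deriv S e f h" for e h
    using has_weak_deriv_cong_AE[OF that assms(2)] by simp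
  then show ?thesis using L2_on_cong_AE[OF _ assms(2)] assms(1) Suc by (auto, metis)
qed

lemma sobolev_weak_deriv:
  assumes "open S" "sobolev (Suc k) S f" "e \<in> Basis"
  shows "has_weak_deriv S e f (weak_deriv S e f)" "sobolev k S (weak_deriv S e f)"
proof -
  obtain g where g: "has_weak_deriv S e f g" "sobolev k S g" using assms by auto
  show "has_weak_deriv S e f (weak_deriv S e f)" using has_weak_deriv_weak_deriv[OF g(1)] .
  have "AE x in lebesgue. x \<in> S \<longrightarrow> g x = weak_deriv S e f x"
    using weak_deriv_AE_eq[OF assms(1) g(1)] by eventually_elim auto
  then show "sobolev k S (weak_deriv S e f)" using sobolev_cong_AE[OF g(2)] by blast
qed

section \<open>Square integrable functions\<close>

text \<open>Square integrability and the norm are stated for general measures, so that the same lemmas serve on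
  the interval and on the two-dimensional domains.\<close>

definition sqint :: "'a measure \<Rightarrow> ('a \<Rightarrow> real) \<Rightarrow> bool" where
  "sqint M f \<longleftrightarrow> f \<in> borel_measurable M \<and> integrable M (\<lambda>x. (f x)\<^sup>2)"

definition nrm :: "'a measure \<Rightarrow> ('a \<Rightarrow> real) \<Rightarrow> real" where
  "nrm M f = sqrt (LINT x|M. (f x)\<^sup>2)"

lemma sqint_measurable: "sqint M f \<Longrightarrow> f \<in> borel_measurable M"
  by (simp add: sqint_def)

lemma abs_mult_le_sum_squares: "\<bar>a * b\<bar> \<le> a\<^sup>2 + (b::real)\<^sup>2"
proof -
  have "2 * \<bar>a\<bar> * \<bar>b\<bar> \<le> a\<^sup>2 + b\<^sup>2" using sum_squares_bound[of "\<bar>a\<bar>" "\<bar>b\<bar>"] by simp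
  moreover have "0 \<le> \<bar>a\<bar> * \<bar>b\<bar>" by simp
  ultimately show ?thesis unfolding abs_mult by linarith
qed

lemma sqint_mult_integrable:
  assumes "sqint M f" "sqint M g"
  shows "integrable M (\<lambda>x. f x * g x)"
proof (rule Bochner_Integration.integrable_bound)
  show "integrable M (\<lambda>x. (f x)\<^sup>2 + (g x)\<^sup>2)" using assms by (simp add: sqint_def)
  show "(\<lambda>x. f x * g x) \<in> borel_measurable M"
    using assms by (intro borel_measurable_times sqint_measurable)
  show "AE x in M. norm (f x * g x) \<le> norm ((f x)\<^sup>2 + (g x)\<^sup>2)"
    using abs_mult_le_sum_squares by (intro AE_I2) (simp add: abs_of_nonneg)
qed

lemma sqint_bounded_mult:
  assumes f: "sqint M f" and k: "k \<in> borel_measurable M" "\<And>x. x \<in> space M \<Longrightarrow> \<bar>k x\<bar> \<le> C"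
  shows "sqint M (\<lambda>x. k x * f x)"
proof -
  have m: "(\<lambda>x. k x * f x) \<in> borel_measurable M" using k(1) sqint_measurable[OF f] by measurable
  have "integrable M (\<lambda>x. (k x * f x)\<^sup>2)"
  proof (rule Bochner_Integration.integrable_bound)
    show "integrable M (\<lambda>x. C\<^sup>2 * (f x)\<^sup>2)" using f by (simp add: sqint_def)
    show "(\<lambda>x. (k x * f x)\<^sup>2) \<in> borel_measurable M" using m by measurable
    show "AE x in M. norm ((k x * f x)\<^sup>2) \<le> norm (C\<^sup>2 * (f x)\<^sup>2)"
    proof (rule AE_I2)
      fix x assume "x \<in> space M"
      then have "(k x)\<^sup>2 \<le> C\<^sup>2" using k(2)[of x] by (metis abs_ge_zero power2_abs power_mono)
      then show "norm ((k x * f x)\<^sup>2) \<le> norm (C\<^sup>2 * (f x)\<^sup>2)"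
        by (simp add: power_mult_distrib mult_right_mono)
    qed
  qed
  then show ?thesis using m by (simp add: sqint_def)
qed

lemma sqint_cmult: "sqint M f \<Longrightarrow> sqint M (\<lambda>x. c * f x)"
  by (rule sqint_bounded_mult[where C = "\<bar>c\<bar>"]) auto

lemma sqint_add:
  assumes f: "sqint M f" and g: "sqint M g"
  shows "sqint M (\<lambda>x. f x + g x)"
proof -
  have "integrable M (\<lambda>x. (f x)\<^sup>2 + (g x)\<^sup>2 + 2 * (f x * g x))"
    using f g sqint_mult_integrable[OF f g] by (simp add: sqint_def)
  then show ?thesis
    using sqint_measurable[OF f] sqint_measurable[OF g] by (simp add: sqint_def power2_sum mult.assoc)
qed

lemma sqint_diff: "sqint M f \<Longrightarrow> sqint M g \<Longrightarrow> sqint M (\<lambda>x. f x - g x)"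
  using sqint_add[of M f "\<lambda>x. (-1) * g x"] sqint_cmult[of M g "-1"] by simp

lemma nrm_nonneg: "0 \<le> nrm M f"
  by (simp add: nrm_def)

lemma nrm_square: "(nrm M f)\<^sup>2 = (LINT x|M. (f x)\<^sup>2)"
  by (simp add: nrm_def)

lemma nrm_cmult: "nrm M (\<lambda>x. c * f x) = \<bar>c\<bar> * nrm M f"
  by (simp add: nrm_def power_mult_distrib real_sqrt_mult)

lemma Cauchy_Schwarz_integral:
  assumes f: "sqint M f" and g: "sqint M g"
  shows "\<bar>LINT x|M. f x * g x\<bar> \<le> nrm M f * nrm M g"
proof -
  let ?A = "LINT x|M. (f x)\<^sup>2" and ?B = "LINT x|M. (g x)\<^sup>2" and ?C = "LINT x|M. f x * g x"
  have fg: "integrable M (\<lambda>x. f x * g x)" by (rule sqint_mult_integrable[OF f g])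
  have fi: "integrable M (\<lambda>x. (f x)\<^sup>2)" and gi: "integrable M (\<lambda>x. (g x)\<^sup>2)" using f g by (auto simp: sqint_def)
  have pos: "0 \<le> s\<^sup>2 * ?A + 2 * s * t * ?C + t\<^sup>2 * ?B" for s t
  proof -
    have "0 \<le> (LINT x|M. (s * f x + t * g x)\<^sup>2)" by simp
    also have "\<dots> = (LINT x|M. s\<^sup>2 * (f x)\<^sup>2 + 2 * s * t * (f x * g x) + t\<^sup>2 * (g x)\<^sup>2)"
      by (simp add: power2_sum power_mult_distrib algebra_simps)
    also have "\<dots> = s\<^sup>2 * ?A + 2 * s * t * ?C + t\<^sup>2 * ?B"
      using fg fi gi by simp
    finally show ?thesis .
  qed
  have B: "?B \<ge> 0" by simp
  have "?C\<^sup>2 \<le> ?A * ?B"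
  proof (cases "?B = 0")
    case True
    have "?C = 0"
    proof (rule ccontr)
      assume "?C \<noteq> 0"
      then show False using pos[of 1 "- (?A + 1) / (2 * ?C)"] True by (simp add: field_simps)
    qed
    then show ?thesis using True by simp
  next
    case False
    then have "0 \<le> ?B * (?A * ?B - ?C\<^sup>2)"
      using pos[of "?B" "- ?C"] by (simp add: power2_eq_square algebra_simps)
    then show ?thesis using B False by (simp add: zero_le_mult_iff)
  qed
  then have "\<bar>?C\<bar> \<le> sqrt (?A * ?B)" using real_le_rsqrt by (metis power2_abs)
  then show ?thesis by (simp add: nrm_def real_sqrt_mult)
qed

lemma nrm_triangle:
  assumes f: "sqint M f" and g: "sqint M g"
  shows "nrm M (\<lambda>x. f x + g x) \<le> nrm M f + nrm M g"
proof -
  have "(nrm M (\<lambda>x. f x + g x))\<^sup>2 = (LINT x|M. (f x)\<^sup>2 + (g x)\<^sup>2 + 2 * (f x * g x))"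
    by (simp add: nrm_square power2_sum mult.assoc)
  also have "\<dots> = (nrm M f)\<^sup>2 + (nrm M g)\<^sup>2 + 2 * (LINT x|M. f x * g x)"
    using f g sqint_mult_integrable[OF f g] by (simp add: sqint_def nrm_square)
  also have "\<dots> \<le> (nrm M f + nrm M g)\<^sup>2"
    using Cauchy_Schwarz_integral[OF f g] by (simp add: power2_sum)
  finally show ?thesis by (rule power2_le_imp_le) (simp add: nrm_nonneg)
qed

text \<open>Products of \<open>L\<^sub>2\<close>-convergent families converge in \<open>L\<^sub>1\<close>, also against a bounded weight.\<close>

lemma tendsto_integral_product:
  assumes f: "\<forall>\<^sub>F n in F. sqint M (fn n)" "sqint M f" and g: "\<forall>\<^sub>F n in F. sqint M (gn n)" "sqint M g"
    and lf: "((\<lambda>n. nrm M (\<lambda>x. fn n x - f x)) \<longlongrightarrow> 0) F" and lg: "((\<lambda>n. nrm M (\<lambda>x. gn n x - g x)) \<longlongrightarrow> 0) F"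
    and k: "k \<in> borel_measurable M" "\<And>x. x \<in> space M \<Longrightarrow> \<bar>k x\<bar> \<le> C"
  shows "((\<lambda>n. LINT x|M. k x * (fn n x * gn n x)) \<longlongrightarrow> (LINT x|M. k x * (f x * g x))) F"
proof -
  define kf where "kf x = k x * f x" for x
  have kf: "sqint M kf" unfolding kf_def by (rule sqint_bounded_mult[OF f(2) k])
  have bound: "\<forall>\<^sub>F n in F. norm ((LINT x|M. k x * (fn n x * gn n x)) - (LINT x|M. k x * (f x * g x)))
     \<le> \<bar>C\<bar> * nrm M (\<lambda>x. fn n x - f x) * (nrm M (\<lambda>x. gn n x - g x) + nrm M g) + nrm M kf * nrm M (\<lambda>x. gn n x - g x)"
    using f(1) g(1)
  proof eventually_elim
    case (elim n)
    define d where "d x = fn n x - f x" for x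
    define e where "e x = gn n x - g x" for x
    have d: "sqint M d" and e: "sqint M e" unfolding d_def e_def using elim f(2) g(2) by (auto intro: sqint_diff)
    have gn: "sqint M (\<lambda>x. e x + g x)" using e g(2) by (rule sqint_add)
    have kd: "sqint M (\<lambda>x. k x * d x)" by (rule sqint_bounded_mult[OF d k])
    have nkd: "nrm M (\<lambda>x. k x * d x) \<le> \<bar>C\<bar> * nrm M d"
    proof (rule power2_le_imp_le)
      have "(nrm M (\<lambda>x. k x * d x))\<^sup>2 \<le> (LINT x|M. C\<^sup>2 * (d x)\<^sup>2)"
        unfolding nrm_square
      proof (rule integral_mono)
        show "integrable M (\<lambda>x. (k x * d x)\<^sup>2)" "integrable M (\<lambda>x. C\<^sup>2 * (d x)\<^sup>2)" using kd d by (auto simp: sqint_def)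
        fix x assume "x \<in> space M"
        then have "(k x)\<^sup>2 \<le> C\<^sup>2" using k(2)[of x] by (metis abs_ge_zero power2_abs power_mono)
        then show "(k x * d x)\<^sup>2 \<le> C\<^sup>2 * (d x)\<^sup>2" by (simp add: power_mult_distrib mult_right_mono)
      qed
      then show "(nrm M (\<lambda>x. k x * d x))\<^sup>2 \<le> (\<bar>C\<bar> * nrm M d)\<^sup>2" by (simp add: power_mult_distrib nrm_square)
    qed (simp add: nrm_nonneg)
    have i1: "integrable M (\<lambda>x. (k x * d x) * (e x + g x))" and i2: "integrable M (\<lambda>x. kf x * e x)"
      and i3: "integrable M (\<lambda>x. kf x * g x)"
      using kd gn kf e g(2) by (auto intro: sqint_mult_integrable)
    have "(LINT x|M. k x * (fn n x * gn n x)) = (LINT x|M. (k x * d x) * (e x + g x) + kf x * e x + kf x * g x)"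
      by (intro Bochner_Integration.integral_cong) (auto simp: d_def e_def kf_def algebra_simps)
    also have "\<dots> = (LINT x|M. (k x * d x) * (e x + g x)) + (LINT x|M. kf x * e x) + (LINT x|M. kf x * g x)"
      using i1 i2 i3 by simp
    finally have "(LINT x|M. k x * (fn n x * gn n x)) - (LINT x|M. k x * (f x * g x))
       = (LINT x|M. (k x * d x) * (e x + g x)) + (LINT x|M. kf x * e x)"
      by (simp add: kf_def mult.assoc)
    moreover have "\<bar>LINT x|M. (k x * d x) * (e x + g x)\<bar> \<le> \<bar>C\<bar> * nrm M d * (nrm M e + nrm M g)"
      using Cauchy_Schwarz_integral[OF kd gn] nrm_triangle[OF e g(2)] nkd
      by (meson mult_mono nrm_nonneg order_trans mult_nonneg_nonneg abs_ge_zero)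
    moreover have "\<bar>LINT x|M. kf x * e x\<bar> \<le> nrm M kf * nrm M e" by (rule Cauchy_Schwarz_integral[OF kf e])
    ultimately show ?case unfolding d_def[symmetric] e_def[symmetric] by simp
  qed
  have "((\<lambda>n. \<bar>C\<bar> * nrm M (\<lambda>x. fn n x - f x) * (nrm M (\<lambda>x. gn n x - g x) + nrm M g)
      + nrm M kf * nrm M (\<lambda>x. gn n x - g x)) \<longlongrightarrow> \<bar>C\<bar> * 0 * (0 + nrm M g) + nrm M kf * 0) F"
    by (intro tendsto_intros lf lg)
  then have "((\<lambda>n. (LINT x|M. k x * (fn n x * gn n x)) - (LINT x|M. k x * (f x * g x))) \<longlongrightarrow> 0) F"
    by (intro Lim_null_comparison[OF bound]) simp
  then show ?thesis by (simp add: LIM_zero_iff)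
qed

lemma L2_on_iff_sqint:
  assumes "S \<in> sets lebesgue"
  shows "L2_on S f \<longleftrightarrow> sqint (lebesgue_on S) f"
  using assms unfolding L2_on_def sqint_def set_borel_measurable_def set_integrable_def
  by (simp add: borel_measurable_restrict_space_iff integrable_restrict_space mult.commute)

lemma set_integral_lebesgue_on:
  fixes f :: "'a::euclidean_space \<Rightarrow> real"
  assumes "S \<in> sets lebesgue"
  shows "(LINT x:S|lebesgue. f x) = integral\<^sup>L (lebesgue_on S) f"
    "set_integrable lebesgue S f \<longleftrightarrow> integrable (lebesgue_on S) f"
  using assms unfolding set_lebesgue_integral_def set_integrable_def
  by (simp_all add: integral_restrict_space integrable_restrict_space)

lemma L2_norm_on_eq_nrm: "S \<in> sets lebesgue \<Longrightarrow> L2_norm_on S f = nrm (lebesgue_on S) f"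
  by (simp add: L2_norm_on_def nrm_def set_integral_lebesgue_on)

lemma sqint_integrable:
  assumes "finite_measure M" "sqint M f"
  shows "integrable M f"
proof -
  have "sqint M (\<lambda>x. 1)" using finite_measure.integrable_const[OF assms(1)] by (simp add: sqint_def)
  from sqint_mult_integrable[OF this assms(2)] show ?thesis by simp
qed

lemma AE_lebesgue_on_iff:
  "S \<in> sets lebesgue \<Longrightarrow> (AE x in lebesgue_on S. P x) \<longleftrightarrow> (AE x in lebesgue. x \<in> S \<longrightarrow> P x)"
  by (simp add: AE_restrict_space_iff)


section \<open>Integrals of derivatives of compactly supported functions\<close>

lemma integral_lborel_derivative_zero:
  fixes H h :: "real \<Rightarrow> real"
  assumes der: "\<And>x. (H has_real_derivative h x) (at x)" and cont: "continuous_on UNIV h"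
    and zero: "\<And>x. x \<notin> {-R..R} \<Longrightarrow> H x = 0 \<and> h x = 0"
  shows "(LINT x|lborel. h x) = 0"
proof -
  define a where "a = \<bar>R\<bar> + 1"
  have "(LINT x|lborel. h x * indicator {-a..a} x) = H a - H (-a)"
    by (rule integral_FTC_Icc_real)
      (use der cont in \<open>auto simp: a_def continuous_on_eq_continuous_at\<close>)
  moreover have "h x * indicator {-a..a} x = h x" for x
  proof (cases "x \<in> {-a..a}")
    case False
    then have "x \<notin> {-R..R}" by (auto simp: a_def)
    then show ?thesis using zero by simp
  qed simp
  moreover have "a \<notin> {-R..R}" "-a \<notin> {-R..R}" by (auto simp: a_def)
  then have "H a = 0" "H (-a) = 0" using zero by blast+
  ultimately show ?thesis by simp
qed

lemma integrable_continuous_support: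
  fixes h :: "'a::euclidean_space \<Rightarrow> real"
  assumes "continuous_on UNIV h" "compact K" "\<And>p. p \<notin> K \<Longrightarrow> h p = 0"
  shows "integrable lborel h"
proof -
  have "integrable lborel (\<lambda>p. indicator K p *\<^sub>R h p)"
    using assms by (intro borel_integrable_compact) (auto intro: continuous_on_subset)
  moreover have "(\<lambda>p. indicator K p *\<^sub>R h p) = h" using assms(3) by (auto simp: indicator_def fun_eq_iff)
  ultimately show ?thesis by simp
qed

lemma integral_partial_derivative_zero:
  fixes H h :: "real \<times> real \<Rightarrow> real"
  assumes cont: "continuous_on UNIV h"
    and zero: "\<And>p. p \<notin> cbox (-R, -R) (R, R) \<Longrightarrow> H p = 0 \<and> h p = 0"
  shows "(\<And>x z. ((\<lambda>x. H (x, z)) has_real_derivative h (x, z)) (at x)) \<Longrightarrow> (LINT p|lborel. h p) = 0"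
    and "(\<And>x z. ((\<lambda>z. H (x, z)) has_real_derivative h (x, z)) (at z)) \<Longrightarrow> (LINT p|lborel. h p) = 0"
proof -
  have "integrable lborel h"
    by (rule integrable_continuous_support[OF cont compact_cbox]) (use zero in blast)
  then have int: "integrable (lborel \<Otimes>\<^sub>M lborel) (\<lambda>(x, z). h (x, z))" by (simp add: lborel_prod)
  have c: "continuous_on UNIV (\<lambda>x. h (x, z))" "continuous_on UNIV (\<lambda>x. h (z, x))" for z
    by (auto intro!: continuous_on_compose2[OF cont] continuous_intros)
  have out: "H (x, z) = 0 \<and> h (x, z) = 0" if "x \<notin> {-R..R} \<or> z \<notin> {-R..R}" for x z
    using zero[of "(x, z)"] that by (auto simp: cbox_Pair_eq)
  show "(LINT p|lborel. h p) = 0" if d: "\<And>x z. ((\<lambda>x. H (x, z)) has_real_derivative h (x, z)) (at x)"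
  proof -
    have "(LINT x|lborel. h (x, z)) = 0" for z
      by (rule integral_lborel_derivative_zero[OF d c(1)]) (use out in auto)
    then show ?thesis using lborel_pair.integral_snd[OF int] by (simp add: lborel_prod)
  qed
  show "(LINT p|lborel. h p) = 0" if d: "\<And>x z. ((\<lambda>z. H (x, z)) has_real_derivative h (x, z)) (at z)"
  proof -
    have "(LINT z|lborel. h (x, z)) = 0" for x
      by (rule integral_lborel_derivative_zero[OF d c(2)]) (use out in auto)
    then show ?thesis using lborel_pair.integral_fst[OF int] by (simp add: lborel_prod)
  qed
qed

lemma has_derivative_partials:
  fixes f :: "real \<times> real \<Rightarrow> real"
  assumes "(f has_derivative f') (at (x, z))"
  shows "((\<lambda>x. f (x, z)) has_real_derivative f' (1, 0)) (at x)"
    "((\<lambda>z. f (x, z)) has_real_derivative f' (0, 1)) (at z)"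
proof -
  have l: "linear f'" using assms has_derivative_linear by blast
  have e: "f' (h *\<^sub>R v) = f' v * h" for h v
    using linear_cmul[OF l, of h v] by (simp only: real_scaleR_def mult.commute)
  have e1: "(\<lambda>h. f' (h, 0)) = (*) (f' (1, 0))"
  proof
    fix h :: real
    have h: "(h, 0) = h *\<^sub>R (1, 0::real)" by simp
    show "f' (h, 0) = f' (1, 0) * h" by (subst h) (rule e)
  qed
  have e2: "(\<lambda>h. f' (0, h)) = (*) (f' (0, 1))"
  proof
    fix h :: real
    have h: "(0, h) = h *\<^sub>R (0::real, 1)" by simp
    show "f' (0, h) = f' (0, 1) * h" by (subst h) (rule e)
  qed
  have "((\<lambda>x. (x, z)) has_derivative (\<lambda>h. (h, 0))) (at x)"
    by (intro has_derivative_Pair has_derivative_ident has_derivative_const)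
  from has_derivative_compose[OF this assms]
  show "((\<lambda>x. f (x, z)) has_real_derivative f' (1, 0)) (at x)"
    unfolding has_field_derivative_def e1 .
  have "((\<lambda>z. (x, z)) has_derivative (\<lambda>h. (0, h))) (at z)"
    by (intro has_derivative_Pair has_derivative_ident has_derivative_const)
  from has_derivative_compose[OF this assms]
  show "((\<lambda>z. f (x, z)) has_real_derivative f' (0, 1)) (at z)"
    unfolding has_field_derivative_def e2 .
qed

lemma integral_directional_derivative_zero:
  fixes \<phi> :: "real \<times> real \<Rightarrow> real"
  assumes d: "\<And>p. (\<phi> has_derivative D p) (at p)" and c: "continuous_on UNIV (\<lambda>p. D p e)" and e: "e \<in> Basis"
    and K: "compact K" "\<And>p. p \<notin> K \<Longrightarrow> \<phi> p = 0 \<and> D p e = 0"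
  shows "(LINT p|lborel. D p e) = 0"
proof -
  obtain R where R: "K \<subseteq> cbox (-R, -R) (R, R)"
  proof -
    obtain B where B: "\<And>p. p \<in> K \<Longrightarrow> norm p \<le> B"
      using compact_imp_bounded[OF K(1)] by (auto simp: bounded_iff)
    have "p \<in> cbox (-B, -B) (B, B)" if "p \<in> K" for p
      using B[OF that] norm_fst_le[of "fst p" "snd p"] norm_snd_le[of "snd p" "fst p"]
      by (cases p) (auto simp: cbox_Pair_eq)
    then show ?thesis using that by blast
  qed
  have z: "p \<notin> cbox (-R, -R) (R, R) \<Longrightarrow> \<phi> p = 0 \<and> D p e = 0" for p using K(2) R by blast
  have "e = (1, 0) \<or> e = (0, 1)" using e by (auto simp: Basis_prod_def)
  then show ?thesis
  proof
    assume "e = (1, 0)"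
    then show ?thesis
      using integral_partial_derivative_zero(1)[OF c z has_derivative_partials(1)[OF d, folded \<open>e = (1, 0)\<close>]] by simp
  next
    assume "e = (0, 1)"
    then show ?thesis
      using integral_partial_derivative_zero(2)[OF c z has_derivative_partials(2)[OF d, folded \<open>e = (0, 1)\<close>]] by simp
  qed
qed

section \<open>Interior regularity\<close>

lemma linear_frechet_expand:
  fixes k :: "'a::euclidean_space \<Rightarrow> real"
  assumes "smooth k"
  shows "frechet_derivative k (at p) v = (\<Sum>b\<in>Basis. frechet_derivative k (at p) b * (v \<bullet> b))"
proof -
  have l: "linear (frechet_derivative k (at p))"
    using smooth_has_derivative[OF assms] has_derivative_linear by blast
  have "frechet_derivative k (at p) v = frechet_derivative k (at p) (\<Sum>b\<in>Basis. (v \<bullet> b) *\<^sub>R b)"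
    by (simp add: euclidean_representation)
  then show ?thesis using l by (simp add: linear_sum linear_cmul mult.commute)
qed

text \<open>Differentiation under the integral sign moves all derivatives to the kernel; the functions of this
  form are thus closed under differentiation.\<close>

lemma smooth_convolution:
  fixes k :: "'a::euclidean_space \<Rightarrow> real"
  assumes \<psi>: "continuous_on (cbox a b) \<psi>" and k: "smooth k"
  shows "smooth (\<lambda>y. integral (cbox a b) (\<lambda>x. \<psi> x * k (x - y)))"
proof -
  define T where "T h y = integral (cbox a b) (\<lambda>x. \<psi> x * h (x - y))" for h :: "'a \<Rightarrow> real" and y
  have der: "(T h has_derivative (\<lambda>v. T (\<lambda>p. - frechet_derivative h (at p) v) y)) (at y)"
    if h: "smooth h" for h y
  proof -
    define hb where "hb b p = frechet_derivative h (at p) b" for b p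
    have chb: "continuous_on UNIV (hb b)" for b
      unfolding hb_def by (rule smooth_continuous[OF smooth_frechet_derivative[OF h]])
    define D where "D y x = - (\<Sum>b\<in>Basis. (\<psi> x * hb b (x - y)) *\<^sub>R blinfun_inner_left b)" for x y
    have Dapp: "blinfun_apply (D y x) v = \<psi> x * - frechet_derivative h (at (x - y)) v" for x y v
      unfolding D_def hb_def linear_frechet_expand[OF h, of "x - y" v]
      by (simp add: blinfun.minus_left blinfun.sum_left blinfun.scaleR_left sum_distrib_left mult.assoc)
    have hd: "((\<lambda>y. \<psi> x * h (x - y)) has_derivative blinfun_apply (D y x)) (at y)" for x y
    proof -
      have "((\<lambda>y. x - y) has_derivative (\<lambda>v. - v)) (at y)"
        using has_derivative_diff[OF has_derivative_const has_derivative_ident, of x "at y"] by simp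
      from has_derivative_compose[OF this smooth_has_derivative[OF h]]
      have "((\<lambda>y. h (x - y)) has_derivative (\<lambda>v. frechet_derivative h (at (x - y)) (- v))) (at y)" .
      then have "((\<lambda>y. \<psi> x * h (x - y)) has_derivative (\<lambda>v. \<psi> x * frechet_derivative h (at (x - y)) (- v))) (at y)"
        by (rule has_derivative_mult_right)
      moreover have "frechet_derivative h (at (x - y)) (- v) = - frechet_derivative h (at (x - y)) v" for v
        by (rule linear_neg) (use smooth_has_derivative[OF h] has_derivative_linear in blast)
      ultimately show ?thesis unfolding Dapp[abs_def] by simp
    qed
    have cD: "continuous_on (UNIV \<times> cbox a b) (\<lambda>(y, x). D y x)"
      unfolding D_def split_beta
      by (intro continuous_intros continuous_on_compose2[OF \<psi>] continuous_on_compose2[OF chb]) auto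
    have int: "(\<lambda>x. \<psi> x * h (x - y)) integrable_on cbox a b" for y
      by (intro integrable_continuous continuous_intros \<psi> continuous_on_compose2[OF smooth_continuous[OF h, of UNIV]]) auto
    have "((\<lambda>y. integral (cbox a b) (\<lambda>x. \<psi> x * h (x - y))) has_derivative integral (cbox a b) (D y)) (at y within UNIV)"
      by (rule leibniz_rule[OF _ int cD]) (use hd in auto)
    moreover have "blinfun_apply (integral (cbox a b) (D y)) = (\<lambda>v. T (\<lambda>p. - frechet_derivative h (at p) v) y)"
    proof
      fix v
      have Di: "D y integrable_on cbox a b"
        unfolding D_def[abs_def]
        by (intro integrable_continuous continuous_intros continuous_on_compose2[OF \<psi>] continuous_on_compose2[OF chb]) auto
      have "blinfun_apply (integral (cbox a b) (D y)) v = integral (cbox a b) ((\<lambda>L. blinfun_apply L v) \<circ> D y)"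
        by (rule integral_linear[OF Di, symmetric]) (rule blinfun.bounded_linear_left)
      then show "blinfun_apply (integral (cbox a b) (D y)) v = T (\<lambda>p. - frechet_derivative h (at p) v) y"
        by (simp only: T_def Dapp o_def)
    qed
    ultimately show ?thesis unfolding T_def[abs_def] by simp
  qed
  have neg: "smooth (\<lambda>p. - frechet_derivative h (at p) v)" if "smooth h" for h v
    using smooth_mult[OF smooth_const[of "-1"] smooth_frechet_derivative[OF that, of v]] by simp
  have "Ck n (T h)" if "smooth h" for n h
    using that
  proof (induction n arbitrary: h)
    case (Suc n)
    show ?case by (rule Ck_SucI[OF der[OF Suc.prems] Suc.IH[OF neg[OF Suc.prems]]])
  qed simp
  then have "smooth (T k)" using k by (simp add: smooth_iff_Ck)
  then show ?thesis unfolding T_def[abs_def] .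
qed

text \<open>The kernel is \<open>\<rho> b (\<rho> s)\<close> with the quadratic form \<open>s\<close> adapted to the operator
  and the profile \<open>b = B'\<close>, where \<open>B\<close> vanishes on \<open>[1, \<infinity>)\<close>. The point of this form is
  that \<open>\<partial>\<^sub>\<rho> (\<rho> b (\<rho> s)) = b (\<rho> s) + \<rho> s b' (\<rho> s)\<close> is, up to the factor \<open>4 \<rho>\<close>, the elliptic operator
  applied to \<open>B (\<rho> s)\<close>.\<close>

text \<open>The form dual to \<open>\<epsilon>\<^sup>2 \<partial>\<^sub>x\<^sup>2 +
  \<partial>\<^sub>z\<^sup>2\<close>; functions of it are the radial functions of this operator.\<close>

definition qform :: "real \<Rightarrow> real \<times> real \<Rightarrow> real" where
  "qform \<epsilon> p = (fst p / \<epsilon>)\<^sup>2 + (snd p)\<^sup>2"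

definition prof0 :: "real \<Rightarrow> real" where "prof0 \<sigma> = - expinv 0 (1 - \<sigma>)"
definition prof1 :: "real \<Rightarrow> real" where "prof1 \<sigma> = expinv 2 (1 - \<sigma>)"
definition prof2 :: "real \<Rightarrow> real" where "prof2 \<sigma> = 2 * expinv 3 (1 - \<sigma>) - expinv 4 (1 - \<sigma>)"

lemma prof_deriv:
  "(prof0 has_real_derivative prof1 \<sigma>) (at \<sigma>)" "(prof1 has_real_derivative prof2 \<sigma>) (at \<sigma>)"
proof -
  have d: "((\<lambda>\<sigma>. 1 - \<sigma>) has_real_derivative - 1) (at \<sigma>)" by (auto intro!: derivative_eq_intros)
  show "(prof0 has_real_derivative prof1 \<sigma>) (at \<sigma>)"
    using DERIV_minus[OF DERIV_chain2[OF expinv_has_derivative[of 0] d]]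
    by (simp add: prof0_def[abs_def] prof1_def numeral_eq_Suc)
  show "(prof1 has_real_derivative prof2 \<sigma>) (at \<sigma>)"
    using DERIV_chain2[OF expinv_has_derivative[of 2] d]
    by (simp add: prof1_def[abs_def] prof2_def numeral_eq_Suc)
qed

lemma smooth_expinv_reflected: "smooth (\<lambda>x. expinv n (1 - x))"
  by (rule smooth_comp[OF smooth_expinv]) (intro smooth_diff smooth_const smooth_bounded_linear bounded_linear_ident)

lemma smooth_prof: "smooth prof0" "smooth prof1" "smooth prof2"
proof -
  have "smooth (\<lambda>\<sigma>. (-1) * expinv 0 (1 - \<sigma>))" by (intro smooth_mult smooth_const smooth_expinv_reflected)
  then show "smooth prof0" by (simp add: prof0_def[abs_def])
  show "smooth prof1" unfolding prof1_def[abs_def] by (rule smooth_expinv_reflected)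
  show "smooth prof2" unfolding prof2_def[abs_def] by (intro smooth_diff smooth_mult smooth_const smooth_expinv_reflected)
qed

lemma prof_zero: "\<sigma> \<ge> 1 \<Longrightarrow> prof0 \<sigma> = 0" "\<sigma> \<ge> 1 \<Longrightarrow> prof1 \<sigma> = 0" "\<sigma> \<ge> 1 \<Longrightarrow> prof2 \<sigma> = 0"
  by (auto simp: prof0_def prof1_def prof2_def expinv_def)

lemma prof1_nonneg: "prof1 \<sigma> \<ge> 0" and prof1_pos: "\<sigma> < 1 \<Longrightarrow> prof1 \<sigma> > 0"
  by (auto simp: prof1_def expinv_def)

lemma smooth_qform: "smooth (\<lambda>p. qform \<epsilon> (p - y))"
proof -
  have "smooth (\<lambda>p. (1 / \<epsilon>)\<^sup>2 * (fst p - fst y)\<^sup>2 + (snd p - snd y)\<^sup>2)"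
    by (intro smooth_intros)
  then show ?thesis by (simp add: qform_def power_mult_distrib[symmetric] divide_inverse mult.commute)
qed

lemma qform_outside:
  assumes "\<epsilon> > 0" "r > 0" "\<rho> \<ge> (1 / r)\<^sup>2" "\<rho> \<ge> (\<epsilon> / r)\<^sup>2" "\<bar>fst p\<bar> \<ge> r \<or> \<bar>snd p\<bar> \<ge> r"
  shows "\<rho> * qform \<epsilon> p \<ge> 1"
proof -
  have *: "1 \<le> \<rho> * x" if "\<rho> \<ge> c\<^sup>2" "x \<ge> (1 / c)\<^sup>2" "c > 0" for c x :: real
  proof -
    have "c\<^sup>2 * (1 / c)\<^sup>2 \<le> \<rho> * x" by (intro mult_mono that) (use that order_trans[OF zero_le_power2] in auto)
    then show ?thesis using that(3) by (simp add: power_mult_distrib[symmetric])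
  qed
  from assms(5) show ?thesis
  proof
    assume "\<bar>fst p\<bar> \<ge> r"
    then have "(r / \<epsilon>)\<^sup>2 \<le> (fst p / \<epsilon>)\<^sup>2"
      using assms(1,2) by (auto simp: power_divide intro!: divide_right_mono) (metis abs_le_square_iff abs_of_pos)
    then show ?thesis using *[of "\<epsilon> / r" "qform \<epsilon> p"] assms by (simp add: qform_def add_increasing2)
  next
    assume "\<bar>snd p\<bar> \<ge> r"
    then have "r\<^sup>2 \<le> (snd p)\<^sup>2" using assms(2) by (metis abs_le_square_iff abs_of_pos)
    then show ?thesis using *[of "1 / r" "qform \<epsilon> p"] assms by (simp add: qform_def add_increasing)
  qed
qed

definition second_deriv :: "('a::euclidean_space \<Rightarrow> real) \<Rightarrow> 'a \<Rightarrow> 'a \<Rightarrow> real" where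
  "second_deriv \<phi> e p = frechet_derivative (\<lambda>q. frechet_derivative \<phi> (at q) e) (at p) e"

lemma frechet_derivative_comp_qform:
  assumes "\<And>\<sigma>. (h has_real_derivative h' \<sigma>) (at \<sigma>)" "\<epsilon> \<noteq> 0"
  shows "((\<lambda>p. h (\<rho> * qform \<epsilon> (p - y))) has_derivative
    (\<lambda>v. h' (\<rho> * qform \<epsilon> (p - y)) * (\<rho> * (2 * (fst p - fst y) * fst v / \<epsilon>\<^sup>2 + 2 * (snd p - snd y) * snd v)))) (at p)"
proof -
  have "((\<lambda>p. \<rho> * qform \<epsilon> (p - y)) has_derivative
      (\<lambda>v. \<rho> * (2 * (fst p - fst y) * fst v / \<epsilon>\<^sup>2 + 2 * (snd p - snd y) * snd v))) (at p)"
    unfolding qform_def using assms(2)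
    by (auto intro!: derivative_eq_intros simp: power2_eq_square field_simps)
  from has_derivative_compose[OF this assms(1)[unfolded has_field_derivative_def]]
  show ?thesis .
qed

lemma elliptic_comp_qform:
  assumes "\<epsilon> > 0"
  shows "\<epsilon>\<^sup>2 * second_deriv (\<lambda>p. prof0 (\<rho> * qform \<epsilon> (p - y))) (1, 0) p
      + second_deriv (\<lambda>p. prof0 (\<rho> * qform \<epsilon> (p - y))) (0, 1) p
    = 4 * \<rho> * (prof1 (\<rho> * qform \<epsilon> (p - y)) + \<rho> * qform \<epsilon> (p - y) * prof2 (\<rho> * qform \<epsilon> (p - y)))"
proof -
  have e0: "\<epsilon> \<noteq> 0" using assms by simp
  let ?s = "\<lambda>p. \<rho> * qform \<epsilon> (p - y)"
  have D1: "frechet_derivative (\<lambda>p. prof0 (?s p)) (at q) v =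
    prof1 (?s q) * (\<rho> * (2 * (fst q - fst y) * fst v / \<epsilon>\<^sup>2 + 2 * (snd q - snd y) * snd v))" for q v
    by (rule frechet_derivative_at[OF frechet_derivative_comp_qform[OF prof_deriv(1) e0, of \<rho> y q], THEN fun_cong, symmetric])
  have "((\<lambda>q. (\<rho> * (2 * (fst q - fst y) / \<epsilon>\<^sup>2))) has_derivative (\<lambda>v. (\<rho> * (2 * fst v / \<epsilon>\<^sup>2)))) (at p)"
    using e0 by (auto intro!: derivative_eq_intros simp: fun_eq_iff field_simps power4_eq_xxxx power2_eq_square)
  from has_derivative_mult[OF frechet_derivative_comp_qform[OF prof_deriv(2) e0, of \<rho> y p] this]
  have "((\<lambda>q. prof1 (?s q) * (\<rho> * (2 * (fst q - fst y) / \<epsilon>\<^sup>2))) has_derivative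
     (\<lambda>v. prof1 (?s p) * (\<rho> * (2 * fst v / \<epsilon>\<^sup>2)) + prof2 (?s p) * (\<rho> * (2 * (fst p - fst y) * fst v / \<epsilon>\<^sup>2 + 2 * (snd p - snd y) * snd v)) * (\<rho> * (2 * (fst p - fst y) / \<epsilon>\<^sup>2)))) (at p)" .
  note d = frechet_derivative_at[OF this, THEN fun_cong, of "(1, 0)"]
  have "second_deriv (\<lambda>p. prof0 (?s p)) (1, 0) p = frechet_derivative (\<lambda>q. prof1 (?s q) * (\<rho> * (2 * (fst q - fst y) / \<epsilon>\<^sup>2))) (at p) (1, 0)"
    unfolding second_deriv_def D1
    by (simp only: fst_conv snd_conv mult_1_right mult_zero_right add_0_right add_0_left div_0)
  then have xx: "second_deriv (\<lambda>p. prof0 (?s p)) (1, 0) p = prof2 (?s p) * (\<rho> * (2 * (fst p - fst y) / \<epsilon>\<^sup>2))\<^sup>2 + prof1 (?s p) * (\<rho> * 2 / \<epsilon>\<^sup>2)"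
    unfolding d[symmetric] by (simp add: power2_eq_square)
  have "((\<lambda>q. (\<rho> * (2 * (snd q - snd y)))) has_derivative (\<lambda>v. (\<rho> * (2 * snd v)))) (at p)"
    using e0 by (auto intro!: derivative_eq_intros simp: fun_eq_iff field_simps power4_eq_xxxx power2_eq_square)
  from has_derivative_mult[OF frechet_derivative_comp_qform[OF prof_deriv(2) e0, of \<rho> y p] this]
  have "((\<lambda>q. prof1 (?s q) * (\<rho> * (2 * (snd q - snd y)))) has_derivative
     (\<lambda>v. prof1 (?s p) * (\<rho> * (2 * snd v)) + prof2 (?s p) * (\<rho> * (2 * (fst p - fst y) * fst v / \<epsilon>\<^sup>2 + 2 * (snd p - snd y) * snd v)) * (\<rho> * (2 * (snd p - snd y))))) (at p)" .
  note d = frechet_derivative_at[OF this, THEN fun_cong, of "(0, 1)"]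
  have "second_deriv (\<lambda>p. prof0 (?s p)) (0, 1) p = frechet_derivative (\<lambda>q. prof1 (?s q) * (\<rho> * (2 * (snd q - snd y)))) (at p) (0, 1)"
    unfolding second_deriv_def D1
    by (simp only: fst_conv snd_conv mult_1_right mult_zero_right add_0_right add_0_left div_0)
  then have zz: "second_deriv (\<lambda>p. prof0 (?s p)) (0, 1) p = prof2 (?s p) * (\<rho> * (2 * (snd p - snd y)))\<^sup>2 + prof1 (?s p) * (\<rho> * 2)"
    unfolding d[symmetric] by (simp add: power2_eq_square)
  have "\<epsilon>\<^sup>2 * (\<rho> * (2 * (fst p - fst y) / \<epsilon>\<^sup>2))\<^sup>2 + (\<rho> * (2 * (snd p - snd y)))\<^sup>2 = 4 * \<rho> * (\<rho> * qform \<epsilon> (p - y))"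
    using e0 by (simp add: qform_def power2_eq_square field_simps)
  then have h1: "P * (\<epsilon>\<^sup>2 * (\<rho> * (2 * (fst p - fst y) / \<epsilon>\<^sup>2))\<^sup>2 + (\<rho> * (2 * (snd p - snd y)))\<^sup>2)
      = P * (4 * \<rho> * (\<rho> * qform \<epsilon> (p - y)))" for P by simp
  have h2: "\<epsilon>\<^sup>2 * (P * (\<rho> * 2 / \<epsilon>\<^sup>2)) = P * (\<rho> * 2)" for P using e0 by simp
  have h3: "\<epsilon>\<^sup>2 * (P * A + B) + (P * C + D) = P * (\<epsilon>\<^sup>2 * A + C) + \<epsilon>\<^sup>2 * B + D" for P A B C D :: real
    by (simp add: algebra_simps)
  have h4: "Q * (4 * \<rho> * s) + P * (\<rho> * 2) + P * (\<rho> * 2) = 4 * \<rho> * (P + s * Q)" for P Q s :: real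
    by (simp add: algebra_simps)
  show ?thesis by (subst xx, subst zz, subst h3, subst h1, subst h2) (rule h4)
qed

lemma mem_cbox_square: "p \<in> cbox (y - (r, r)) (y + (r, r)) \<longleftrightarrow> \<bar>fst (p - y)\<bar> \<le> r \<and> \<bar>snd (p - y)\<bar> \<le> r"
  and mem_box_square: "p \<in> box (y - (r, r)) (y + (r, r)) \<longleftrightarrow> \<bar>fst (p - y)\<bar> < r \<and> \<bar>snd (p - y)\<bar> < r"
  for p y :: "real \<times> real"
proof -
  obtain p1 p2 y1 y2 where [simp]: "p = (p1, p2)" "y = (y1, y2)" by (cases p, cases y)
  have "p \<in> cbox (y - (r, r)) (y + (r, r)) \<longleftrightarrow> (y1 - r \<le> p1 \<and> p1 \<le> y1 + r) \<and> (y2 - r \<le> p2 \<and> p2 \<le> y2 + r)"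
    "p \<in> box (y - (r, r)) (y + (r, r)) \<longleftrightarrow> (y1 - r < p1 \<and> p1 < y1 + r) \<and> (y2 - r < p2 \<and> p2 < y2 + r)"
    by (auto simp: mem_box Basis_prod_def)
  then show "p \<in> cbox (y - (r, r)) (y + (r, r)) \<longleftrightarrow> \<bar>fst (p - y)\<bar> \<le> r \<and> \<bar>snd (p - y)\<bar> \<le> r"
    "p \<in> box (y - (r, r)) (y + (r, r)) \<longleftrightarrow> \<bar>fst (p - y)\<bar> < r \<and> \<bar>snd (p - y)\<bar> < r"
    by (auto simp: abs_le_iff abs_less_iff)
qed

lemma continuous_on_qform_comp:
  assumes "smooth h"
  shows "continuous_on UNIV (\<lambda>p. h (\<rho> * qform \<epsilon> (p - y)))"
  by (rule smooth_continuous[OF smooth_comp[OF assms smooth_mult[OF smooth_const smooth_qform]]])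

text \<open>The derivative of the average in \<open>\<rho>\<close> is, up to the factor \<open>4 \<rho>\<close>,
  the average of \<open>\<psi>\<close> against the elliptic operator applied to a test function, hence
  zero.\<close>

lemma kernel_average_constant:
  assumes \<epsilon>: "\<epsilon> > 0" and r0: "\<rho>0 > 0" and \<psi>: "continuous_on (cbox a b) \<psi>"
    and zero: "\<And>\<rho>. \<rho> \<ge> \<rho>0 \<Longrightarrow> integral (cbox a b) (\<lambda>x. \<psi> x *
      (\<epsilon>\<^sup>2 * second_deriv (\<lambda>p. prof0 (\<rho> * qform \<epsilon> (p - y))) (1, 0) x
        + second_deriv (\<lambda>p. prof0 (\<rho> * qform \<epsilon> (p - y))) (0, 1) x)) = 0"
    and \<rho>: "\<rho> \<ge> \<rho>0"
  shows "integral (cbox a b) (\<lambda>x. \<psi> x * (\<rho> * prof1 (\<rho> * qform \<epsilon> (x - y))))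
    = integral (cbox a b) (\<lambda>x. \<psi> x * (\<rho>0 * prof1 (\<rho>0 * qform \<epsilon> (x - y))))"
proof -
  define N where "N \<rho> = integral (cbox a b) (\<lambda>x. \<psi> x * (\<rho> * prof1 (\<rho> * qform \<epsilon> (x - y))))" for \<rho>
  define d where "d \<rho> x = \<psi> x * (prof1 (\<rho> * qform \<epsilon> (x - y)) + \<rho> * qform \<epsilon> (x - y) * prof2 (\<rho> * qform \<epsilon> (x - y)))" for \<rho> x
  have cq: "continuous_on UNIV (\<lambda>p. qform \<epsilon> (p - y))" by (rule smooth_continuous[OF smooth_qform])
  have cp: "continuous_on UNIV prof1" "continuous_on UNIV prof2" by (rule smooth_continuous[OF smooth_prof(2)], rule smooth_continuous[OF smooth_prof(3)])
  have "(N has_field_derivative 0) (at t within {\<rho>0..})" if t: "t \<in> {\<rho>0..}" for t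
  proof -
    have "(N has_field_derivative integral (cbox a b) (d t)) (at t within {\<rho>0..})"
      unfolding N_def
    proof (rule leibniz_rule_field_derivative[where fx = d])
      show "((\<lambda>\<rho>. \<psi> x * (\<rho> * prof1 (\<rho> * qform \<epsilon> (x - y)))) has_field_derivative d \<rho> x) (at \<rho> within {\<rho>0..})" for \<rho> x
      proof -
        have "((\<lambda>\<rho>. \<rho> * qform \<epsilon> (x - y)) has_real_derivative qform \<epsilon> (x - y)) (at \<rho> within {\<rho>0..})"
          by (auto intro!: derivative_eq_intros)
        from DERIV_chain2[OF prof_deriv(2) this]
        have "((\<lambda>\<rho>. prof1 (\<rho> * qform \<epsilon> (x - y))) has_real_derivative
          prof2 (\<rho> * qform \<epsilon> (x - y)) * qform \<epsilon> (x - y)) (at \<rho> within {\<rho>0..})" .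
        from DERIV_cmult[OF DERIV_mult[OF DERIV_ident this], of "\<psi> x"]
        show ?thesis by (simp add: d_def algebra_simps)
      qed
      show "(\<lambda>x. \<psi> x * (\<rho> * prof1 (\<rho> * qform \<epsilon> (x - y)))) integrable_on cbox a b" for \<rho>
        by (intro integrable_continuous continuous_intros \<psi> continuous_on_subset[OF continuous_on_qform_comp[OF smooth_prof(2)]]) auto
      show "continuous_on ({\<rho>0..} \<times> cbox a b) (\<lambda>(\<rho>, x). d \<rho> x)"
        unfolding d_def split_beta
        by (intro continuous_intros continuous_on_compose2[OF \<psi>] continuous_on_compose2[OF cq]
            continuous_on_compose2[OF cp(1)] continuous_on_compose2[OF cp(2)]) auto
    qed (use t in auto)
    moreover have "integral (cbox a b) (d t) = 0"
    proof -
      have tp: "t > 0" using t r0 by auto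
      have "integral (cbox a b) (\<lambda>x. (4 * t) * d t x) = 0"
        using zero[of t] t unfolding elliptic_comp_qform[OF \<epsilon>] d_def by (simp add: algebra_simps)
      then show ?thesis using tp by simp
    qed
    ultimately show ?thesis by simp
  qed
  from has_field_derivative_zero_constant[OF _ this]
  obtain c where "\<forall>x\<in>{\<rho>0..}. N x = c" by auto
  then show ?thesis using \<rho> unfolding N_def by auto
qed

lemma elliptic_test_zero_outside:
  assumes "\<epsilon> > 0" "\<rho> * qform \<epsilon> (p - y) \<ge> 1"
  shows "\<epsilon>\<^sup>2 * second_deriv (\<lambda>p. prof0 (\<rho> * qform \<epsilon> (p - y))) (1, 0) p
        + second_deriv (\<lambda>p. prof0 (\<rho> * qform \<epsilon> (p - y))) (0, 1) p = 0"
  unfolding elliptic_comp_qform[OF assms(1)] using assms(2) by (simp add: prof_zero)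

lemma smooth_second_deriv: "smooth \<phi> \<Longrightarrow> smooth (second_deriv \<phi> e)"
  unfolding second_deriv_def[abs_def] by (rule smooth_frechet_derivative[OF smooth_frechet_derivative])

lemma integral_second_deriv_zero:
  fixes \<phi> :: "real \<times> real \<Rightarrow> real"
  assumes \<phi>: "smooth \<phi>" "compact K" "{p. \<phi> p \<noteq> 0} \<subseteq> K" and e: "e \<in> Basis"
  shows "(LINT p|lborel. second_deriv \<phi> e p) = 0"
proof -
  let ?d = "\<lambda>q. frechet_derivative \<phi> (at q) e"
  have cl: "closure {p. \<phi> p \<noteq> 0} \<subseteq> K" using \<phi>(2,3) by (intro closure_minimal compact_imp_closed)
  have z: "?d q = 0" if "q \<notin> K" for q
    using fun_cong[OF frechet_derivative_eq_0_outside_support[OF contra_subsetD[OF cl that]]] by simp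
  have cl2: "closure {p. ?d p \<noteq> 0} \<subseteq> K" using z \<phi>(2) by (intro closure_minimal compact_imp_closed) auto
  have z2: "frechet_derivative ?d (at q) e = 0" if "q \<notin> K" for q
    using fun_cong[OF frechet_derivative_eq_0_outside_support[OF contra_subsetD[OF cl2 that]]] by simp
  show ?thesis unfolding second_deriv_def
    by (rule integral_directional_derivative_zero[OF smooth_has_derivative[OF smooth_frechet_derivative[OF \<phi>(1)]] _ e \<phi>(2)])
      (use z z2 smooth_continuous[OF smooth_frechet_derivative[OF smooth_frechet_derivative[OF \<phi>(1)]]] in auto)
qed

text \<open>Weyl's lemma. Averages against the kernel at \<open>y\<close> do not depend on the scale \<open>\<rho>\<close>; as
  \<open>\<rho> \<rightarrow> \<infinity>\<close> they tend to a multiple of \<open>\<psi> y\<close>, so \<open>\<psi>\<close> is locally a convolution with a smooth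
  kernel.\<close>

lemma very_weak_solution_smooth:
  fixes \<psi> :: "real \<times> real \<Rightarrow> real"
  assumes \<epsilon>: "\<epsilon> > 0" and S: "open S" and \<psi>: "continuous_on S \<psi>"
    and weak: "\<And>\<phi>. test_function S \<phi> \<Longrightarrow>
      (LINT p:S|lebesgue. \<psi> p * (\<epsilon>\<^sup>2 * second_deriv \<phi> (1, 0) p + second_deriv \<phi> (0, 1) p)) = 0"
    and y0: "y0 \<in> S"
  shows "\<exists>U f. open U \<and> y0 \<in> U \<and> U \<subseteq> S \<and> smooth f \<and> (\<forall>y\<in>U. \<psi> y = f y)"
proof -
  obtain r where r: "r > 0" and rS: "cbox (y0 - (2*r, 2*r)) (y0 + (2*r, 2*r)) \<subseteq> S"
  proof -
    obtain e where e: "e > 0" "ball y0 e \<subseteq> S" using S y0 open_contains_ball by blast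
    have "p \<in> ball y0 e" if "p \<in> cbox (y0 - (2*(e/8), 2*(e/8))) (y0 + (2*(e/8), 2*(e/8)))" for p
    proof -
      have "\<bar>fst (p - y0)\<bar> \<le> e / 4" "\<bar>snd (p - y0)\<bar> \<le> e / 4"
        using that unfolding mem_cbox_square by simp_all
      moreover have "norm (p - y0) \<le> \<bar>fst (p - y0)\<bar> + \<bar>snd (p - y0)\<bar>"
        using norm_Pair_le[of "fst (p - y0)" "snd (p - y0)"] unfolding prod.collapse real_norm_def .
      ultimately have "norm (p - y0) < e" using e(1) by linarith
      then show ?thesis by (simp add: dist_norm norm_minus_commute)
    qed
    then show ?thesis using e by (intro that[of "e / 8"]) auto
  qed
  define a b where "a = y0 - (2*r, 2*r)" and "b = y0 + (2*r, 2*r)"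
  have QS: "cbox a b \<subseteq> S" using rS by (simp add: a_def b_def)
  have \<psi>Q: "continuous_on (cbox a b) \<psi>" using \<psi> QS continuous_on_subset by blast
  \<comment> \<open>at this scale the kernel centred in \<open>U\<close> is supported in the larger square\<close>
  define \<rho>0 where "\<rho>0 = max ((1 / r)\<^sup>2) ((\<epsilon> / r)\<^sup>2)"
  have \<rho>0: "\<rho>0 > 0" using r by (simp add: \<rho>0_def less_max_iff_disj)
  define U where "U = box (y0 - (r, r)) (y0 + (r, r))"
  define k where "k p = \<rho>0 * prof1 (\<rho>0 * qform \<epsilon> p)" for p
  have k_smooth: "smooth k"
    using smooth_mult[OF smooth_const smooth_comp[OF smooth_prof(2) smooth_mult[OF smooth_const smooth_qform[of \<epsilon> 0]]]]
    unfolding k_def by simp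
  define c where "c = (LINT p|lborel. k p)"
  have inQ: "\<rho> * qform \<epsilon> (x - y) \<ge> 1" if y: "y \<in> U" and x: "x \<notin> cbox a b" and \<rho>: "\<rho> \<ge> \<rho>0" for x y \<rho>
  proof (rule qform_outside[OF \<epsilon> r])
    show "(1 / r)\<^sup>2 \<le> \<rho>" "(\<epsilon> / r)\<^sup>2 \<le> \<rho>" using \<rho> by (auto simp: \<rho>0_def)
    show "r \<le> \<bar>fst (x - y)\<bar> \<or> r \<le> \<bar>snd (x - y)\<bar>"
      using x y unfolding U_def a_def b_def mem_cbox_square mem_box_square fst_diff snd_diff by linarith
  qed
  \<comment> \<open>the scale is sent to infinity, where the kernel concentrates at \<open>y\<close>\<close>
  have key: "integral (cbox a b) (\<lambda>x. \<psi> x * k (x - y)) = \<psi> y * c" if y: "y \<in> U" for y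
  proof -
    define t where "t \<rho> p = prof0 (\<rho> * qform \<epsilon> (p - y))" for \<rho> p
    have yQ: "y \<in> cbox a b" using y r unfolding U_def a_def b_def mem_cbox_square mem_box_square by linarith
    have t_smooth: "smooth (t \<rho>)" for \<rho>
      unfolding t_def by (rule smooth_comp[OF smooth_prof(1) smooth_mult[OF smooth_const smooth_qform]])
    have t_supp: "{p. t \<rho> p \<noteq> 0} \<subseteq> cbox a b" if "\<rho> \<ge> \<rho>0" for \<rho>
      using inQ[OF y _ that] prof_zero(1) unfolding t_def by blast
    define L where "L \<rho> p = \<epsilon>\<^sup>2 * second_deriv (t \<rho>) (1, 0) p + second_deriv (t \<rho>) (0, 1) p" for \<rho> p
    have L_out: "L \<rho> p = 0" if "\<rho> \<ge> \<rho>0" "p \<notin> cbox a b" for \<rho> p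
      unfolding L_def t_def by (rule elliptic_test_zero_outside[OF \<epsilon> inQ[OF y that(2,1)]])
    have L_cont: "continuous_on X (L \<rho>)" for X \<rho>
      unfolding L_def[abs_def]
      by (rule smooth_continuous[OF smooth_add[OF smooth_mult[OF smooth_const smooth_second_deriv[OF t_smooth]] smooth_second_deriv[OF t_smooth]]])
    have LQ: "(LINT p:cbox a b|lebesgue. g p * L \<rho> p) = integral (cbox a b) (\<lambda>p. g p * L \<rho> p)"
      if "continuous_on (cbox a b) g" for g \<rho>
      by (intro set_lebesgue_integral_eq_integral(2) absolutely_integrable_continuous continuous_intros that L_cont)
    have z1: "integral (cbox a b) (\<lambda>p. \<psi> p * L \<rho> p) = 0" if "\<rho> \<ge> \<rho>0" for \<rho>
    proof -
      have cl: "closure {p. t \<rho> p \<noteq> 0} \<subseteq> cbox a b" using t_supp[OF that] by (intro closure_minimal) auto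
      then have "compact (closure {p. t \<rho> p \<noteq> 0})"
        using compact_Int_closed[OF compact_cbox[of a b] closed_closure[of "{p. t \<rho> p \<noteq> 0}"]] by (simp add: inf.absorb2)
      then have "test_function S (t \<rho>)" using t_smooth cl QS unfolding test_function_def by blast
      from weak[OF this] have "(LINT p:S|lebesgue. \<psi> p * L \<rho> p) = 0" unfolding L_def .
      moreover have "(LINT p:S|lebesgue. \<psi> p * L \<rho> p) = (LINT p:cbox a b|lebesgue. \<psi> p * L \<rho> p)"
        unfolding set_lebesgue_integral_def using L_out[OF that] QS
        by (intro Bochner_Integration.integral_cong) (auto simp: indicator_def)
      ultimately show ?thesis using LQ[OF \<psi>Q] by simp
    qed
    \<comment> \<open>the constant function is a solution too, so the mass of the kernel does not depend on the scale\<close>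
    have z2: "integral (cbox a b) (\<lambda>p. 1 * L \<rho> p) = 0" if "\<rho> \<ge> \<rho>0" for \<rho>
    proof -
      have i: "integrable lborel (second_deriv (t \<rho>) e)" for e
      proof (rule integrable_continuous_support[OF smooth_continuous[OF smooth_second_deriv[OF t_smooth]] compact_cbox])
        fix p assume p: "p \<notin> cbox a b"
        have cl: "closure {p. t \<rho> p \<noteq> 0} \<subseteq> cbox a b" using t_supp[OF that] by (intro closure_minimal) auto
        have z: "frechet_derivative (t \<rho>) (at q) e = 0" if "q \<notin> cbox a b" for q
          using fun_cong[OF frechet_derivative_eq_0_outside_support[OF contra_subsetD[OF cl that]]] by simp
        have cl2: "closure {q. frechet_derivative (t \<rho>) (at q) e \<noteq> 0} \<subseteq> cbox a b"
          using z by (intro closure_minimal) auto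
        show "second_deriv (t \<rho>) e p = 0"
          unfolding second_deriv_def
          using fun_cong[OF frechet_derivative_eq_0_outside_support[OF contra_subsetD[OF cl2 p]]] by simp
      qed
      have "(LINT p|lborel. L \<rho> p) = 0"
        unfolding L_def using i integral_second_deriv_zero[OF t_smooth compact_cbox t_supp[OF that]]
        by (simp add: Basis_prod_def)
      moreover have "(LINT p|lborel. L \<rho> p) = (LINT p:cbox a b|lebesgue. 1 * L \<rho> p)"
      proof -
        have "L \<rho> \<in> borel_measurable lborel" using borel_measurable_continuous_onI[OF L_cont] by simp
        then have "(LINT p|lborel. L \<rho> p) = (LINT p|lebesgue. L \<rho> p)" by (simp add: integral_completion)
        also have "\<dots> = (LINT p:cbox a b|lebesgue. 1 * L \<rho> p)"
          unfolding set_lebesgue_integral_def using L_out[OF that]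
          by (intro Bochner_Integration.integral_cong) (auto simp: indicator_def)
        finally show ?thesis .
      qed
      ultimately show ?thesis using LQ[of "\<lambda>_. 1"] by simp
    qed
    define M where "M g \<rho> = integral (cbox a b) (\<lambda>x. g x * (\<rho> * prof1 (\<rho> * qform \<epsilon> (x - y))))" for g :: "real \<times> real \<Rightarrow> real" and \<rho>
    have Mc: "M \<psi> \<rho> = M \<psi> \<rho>0" "M (\<lambda>_. 1) \<rho> = M (\<lambda>_. 1) \<rho>0" if "\<rho> \<ge> \<rho>0" for \<rho>
      unfolding M_def
      by (rule kernel_average_constant[OF \<epsilon> \<rho>0 \<psi>Q z1[unfolded L_def t_def] that], assumption,
          rule kernel_average_constant[OF \<epsilon> \<rho>0 continuous_on_const z2[unfolded L_def t_def] that], assumption)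
    have Mi: "(\<lambda>x. g x * (\<rho> * prof1 (\<rho> * qform \<epsilon> (x - y)))) integrable_on cbox a b"
      if "continuous_on (cbox a b) g" for g \<rho>
      by (intro integrable_continuous continuous_intros that continuous_on_subset[OF continuous_on_qform_comp[OF smooth_prof(2)]]) auto
    have M1: "M (\<lambda>_. 1) \<rho>0 = c"
    proof -
      have kc: "continuous_on X (\<lambda>x. k (x - y))" for X
        unfolding k_def by (intro continuous_intros continuous_on_subset[OF continuous_on_qform_comp[OF smooth_prof(2)]]) auto
      have km: "k \<in> borel_measurable borel" by (rule smooth_borel_measurable[OF k_smooth])
      have "M (\<lambda>_. 1) \<rho>0 = (LINT x:cbox a b|lebesgue. k (x - y))"
        unfolding M_def k_def[symmetric] mult_1
        by (rule set_lebesgue_integral_eq_integral(2)[symmetric]) (intro absolutely_integrable_continuous kc)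
      also have "\<dots> = (LINT x|lebesgue. k (x - y))"
        unfolding set_lebesgue_integral_def
      proof (intro Bochner_Integration.integral_cong refl)
        fix x
        have "k (x - y) = 0" if "x \<notin> cbox a b" using inQ[OF y that order_refl] by (simp add: k_def prof_zero)
        then show "indicat_real (cbox a b) x *\<^sub>R k (x - y) = k (x - y)" by (auto simp: indicator_def)
      qed
      also have "\<dots> = (LINT x|lborel. k (x - y))"
        by (rule integral_completion) (use borel_measurable_continuous_onI[OF kc] in simp)
      also have "\<dots> = (LINT x|distr lborel borel ((+) (- y)). k x)"
        by (subst integral_distr) (use km in \<open>auto simp: add.commute\<close>)
      also have "\<dots> = c" unfolding lborel_distr_plus c_def ..
      finally show ?thesis .
    qed
    have M1_nonneg: "0 \<le> c"
      unfolding M1[symmetric] M_def using \<rho>0 prof1_nonneg by (intro integral_nonneg Mi continuous_intros) auto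
    have approx: "\<bar>M \<psi> \<rho>0 - \<psi> y * c\<bar> \<le> \<eta> * c" if \<eta>: "\<eta> > 0" for \<eta>
    proof -
      obtain \<delta> where \<delta>: "\<delta> > 0" "\<And>x. x \<in> cbox a b \<Longrightarrow> dist x y < \<delta> \<Longrightarrow> dist (\<psi> x) (\<psi> y) < \<eta>"
        using \<psi>Q yQ \<eta> unfolding continuous_on_iff by blast
      define \<rho> where "\<rho> = max \<rho>0 (max ((1 / (\<delta> / 2))\<^sup>2) ((\<epsilon> / (\<delta> / 2))\<^sup>2))"
      have \<rho>: "\<rho> \<ge> \<rho>0" by (simp add: \<rho>_def)
      let ?k = "\<lambda>x. \<rho> * prof1 (\<rho> * qform \<epsilon> (x - y))"
      have kn: "?k x \<ge> 0" for x using \<rho> \<rho>0 prof1_nonneg by simp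
      have pw: "\<bar>(\<psi> x - \<psi> y) * ?k x\<bar> \<le> \<eta> * ?k x" if x: "x \<in> cbox a b" for x
      proof (cases "\<bar>fst (x - y)\<bar> \<ge> \<delta> / 2 \<or> \<bar>snd (x - y)\<bar> \<ge> \<delta> / 2")
        case True
        have "1 \<le> \<rho> * qform \<epsilon> (x - y)"
          by (rule qform_outside[OF \<epsilon> _ _ _ True]) (use \<delta>(1) in \<open>auto simp: \<rho>_def\<close>)
        then show ?thesis by (simp add: prof_zero)
      next
        case False
        then have "norm (x - y) < \<delta>"
          using norm_Pair_le[of "fst (x - y)" "snd (x - y)"] unfolding prod.collapse real_norm_def by linarith
        then have "\<bar>\<psi> x - \<psi> y\<bar> \<le> \<eta>" using \<delta>(2)[OF x] by (simp add: dist_norm)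
        then show ?thesis
          unfolding abs_mult[of "\<psi> x - \<psi> y"] abs_of_nonneg[OF kn] by (rule mult_right_mono) (rule kn)
      qed
      have d: "M \<psi> \<rho> - \<psi> y * M (\<lambda>_. 1) \<rho> = integral (cbox a b) (\<lambda>x. (\<psi> x - \<psi> y) * ?k x)"
      proof -
        have e1: "\<psi> y * M (\<lambda>_. 1) \<rho> = integral (cbox a b) (\<lambda>x. \<psi> y * ?k x)"
          unfolding M_def mult_1 by (rule integral_mult_right[symmetric])
        have e2: "(\<lambda>x. (\<psi> x - \<psi> y) * ?k x) = (\<lambda>x. \<psi> x * ?k x - \<psi> y * ?k x)"
          by (simp only: left_diff_distrib)
        show ?thesis
          unfolding e1 e2 unfolding M_def
          by (rule Henstock_Kurzweil_Integration.integral_diff[symmetric, OF Mi[OF \<psi>Q] Mi[OF continuous_on_const]])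
      qed
      have "\<bar>integral (cbox a b) (\<lambda>x. (\<psi> x - \<psi> y) * ?k x)\<bar> \<le> integral (cbox a b) (\<lambda>x. \<eta> * (1 * ?k x))"
        unfolding real_norm_def[symmetric]
        by (rule integral_norm_bound_integral)
          (use pw in \<open>auto intro!: Mi continuous_intros \<psi>Q integrable_on_cmult_left\<close>)
      also have "\<dots> = \<eta> * M (\<lambda>_. 1) \<rho>" unfolding M_def by (rule integral_mult_right)
      finally show ?thesis using d Mc[OF \<rho>] M1 by simp
    qed
    have "\<bar>M \<psi> \<rho>0 - \<psi> y * c\<bar> \<le> 0 + e" if "e > 0" for e
    proof (cases "c = 0")
      case False
      then show ?thesis using approx[of "e / c"] that M1_nonneg by simp
    qed (use approx[of 1] that in simp)
    then have "\<bar>M \<psi> \<rho>0 - \<psi> y * c\<bar> \<le> 0" by (rule field_le_epsilon)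
    then show ?thesis unfolding M_def k_def by simp
  qed
  have c_pos: "c > 0"
  proof -
    have ki: "integrable lborel k"
    proof (rule integrable_continuous_support[OF smooth_continuous[OF k_smooth] compact_cbox[of "a - y0" "b - y0"]])
      fix p assume "p \<notin> cbox (a - y0) (b - y0)"
      then have "p \<notin> cbox (0 - (2*r, 2*r)) (0 + (2*r, 2*r))" by (simp add: a_def b_def)
      then have "p + y0 \<notin> cbox a b" unfolding a_def b_def mem_cbox_square by simp
      moreover have "y0 \<in> U" using r unfolding U_def mem_box_square by simp
      ultimately show "k p = 0" using inQ[of y0 "p + y0" \<rho>0] by (simp add: k_def prof_zero)
    qed
    have kn: "k p \<ge> 0" for p using \<rho>0 prof1_nonneg by (simp add: k_def)
    have "c \<noteq> 0"
    proof
      assume "c = 0"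
      then have "AE p in lborel. k p = 0"
        using integral_nonneg_eq_0_iff_AE[OF ki] kn unfolding c_def by simp
      then have "AE p in lebesgue. p \<notin> {p. k p \<noteq> 0}" using AE_completion by fastforce
      then have "negligible {p. k p \<noteq> 0}" unfolding negligible_iff_null_sets
        by (subst completion.null_sets_iff_AE) auto
      moreover have "open {p. k p \<noteq> 0}"
        using smooth_continuous[OF k_smooth] by (intro open_Collect_neq continuous_intros)
      moreover have "k 0 \<noteq> 0" using \<rho>0 prof1_pos[of 0] by (simp add: k_def qform_def)
      ultimately show False using open_not_negligible by blast
    qed
    moreover have "c \<ge> 0" unfolding c_def using kn by simp
    ultimately show ?thesis by simp
  qed
  have "smooth (\<lambda>y. (1 / c) * integral (cbox a b) (\<lambda>x. \<psi> x * k (x - y)))"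
    by (rule smooth_mult[OF smooth_const smooth_convolution[OF \<psi>Q k_smooth]])
  moreover have "\<forall>y\<in>U. \<psi> y = (1 / c) * integral (cbox a b) (\<lambda>x. \<psi> x * k (x - y))"
    using key c_pos by simp
  moreover have "open U" "y0 \<in> U" "U \<subseteq> S"
  proof -
    show "open U" by (simp add: U_def open_box)
    show "y0 \<in> U" using r unfolding U_def mem_box_square by simp
    have "U \<subseteq> cbox a b" using r unfolding U_def a_def b_def subset_iff mem_box_square mem_cbox_square by auto
    then show "U \<subseteq> S" using QS by blast
  qed
  ultimately show ?thesis by blast
qed

section \<open>Divergence-free fields are orthogonal to gradients\<close>

lemma countable_simple_zeros:
  fixes f d :: "real \<Rightarrow> real"
  assumes "\<And>z. z \<in> A \<Longrightarrow> f z = 0 \<and> (f has_real_derivative d z) (at z) \<and> d z \<noteq> 0"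
  shows "countable A"
proof -
  have "\<exists>q. fst q \<in> \<rat> \<and> snd q \<in> \<rat> \<and> fst q < z \<and> z < snd q \<and> (\<forall>y\<in>A. fst q < y \<and> y < snd q \<longrightarrow> y = z)" if z: "z \<in> A" for z
  proof -
    have "((\<lambda>y. (f y - f z) / (y - z)) \<longlongrightarrow> d z) (at z)"
      using assms[OF z] unfolding has_field_derivative_iff by blast
    then have "\<forall>\<^sub>F y in at z. (f y - f z) / (y - z) \<noteq> 0"
      using assms[OF z] by (intro tendsto_imp_eventually_ne) auto
    then obtain e where e: "e > 0" "\<And>y. y \<noteq> z \<Longrightarrow> dist y z < e \<Longrightarrow> (f y - f z) / (y - z) \<noteq> 0"
      unfolding eventually_at by blast
    obtain q1 where q1: "q1 \<in> \<rat>" "z - e < q1" "q1 < z" using Rats_dense_in_real[of "z - e" z] e(1) by auto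
    obtain q2 where q2: "q2 \<in> \<rat>" "z < q2" "q2 < z + e" using Rats_dense_in_real[of z "z + e"] e(1) by auto
    have "y = z" if "y \<in> A" "q1 < y" "y < q2" for y
    proof (rule ccontr)
      assume "y \<noteq> z"
      moreover have "dist y z < e" using that q1 q2 by (auto simp: dist_real_def abs_less_iff)
      ultimately show False using e(2) assms[OF z] assms[OF that(1)] by force
    qed
    then show ?thesis using q1 q2 by (intro exI[of _ "(q1, q2)"]) auto
  qed
  then obtain q where q: "\<And>z. z \<in> A \<Longrightarrow> fst (q z) \<in> \<rat> \<and> snd (q z) \<in> \<rat> \<and> fst (q z) < z \<and> z < snd (q z)
      \<and> (\<forall>y\<in>A. fst (q z) < y \<and> y < snd (q z) \<longrightarrow> y = z)"
    by metis
  have "inj_on q A"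
  proof (rule inj_onI)
    fix y z assume "y \<in> A" "z \<in> A" "q y = q z"
    then show "y = z" using q[of y] q[of z] by auto
  qed
  moreover have "q ` A \<subseteq> \<rat> \<times> \<rat>" using q unfolding image_subset_iff mem_Times_iff by blast
  then have "countable (q ` A)" by (rule countable_subset) (simp add: countable_rat)
  ultimately show ?thesis by (simp add: countable_image_inj_eq)
qed

lemma borel_measurable_indicator_continuous:
  fixes f :: "'a::euclidean_space \<Rightarrow> real"
  assumes "open S" "continuous_on S f"
  shows "(\<lambda>q. indicator S q * f q) \<in> borel_measurable borel"
  using borel_measurable_continuous_on_indicator[of S f] assms by simp

text \<open>On each line, the zeros of \<open>p\<close> at which the partial derivative does not vanish are
  isolated, hence countable; Fubini gives a null set.\<close>

lemma AE_partial_zero_on_zero_set: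
  fixes p p' :: "real \<times> real \<Rightarrow> real"
  assumes S: "open S" and c: "continuous_on S p" "continuous_on S p'"
  shows "(\<And>x z. (x, z) \<in> S \<Longrightarrow> ((\<lambda>z. p (x, z)) has_real_derivative p' (x, z)) (at z)) \<Longrightarrow>
      AE q in lborel. q \<in> S \<and> p q = 0 \<longrightarrow> p' q = 0"
    and "(\<And>x z. (x, z) \<in> S \<Longrightarrow> ((\<lambda>x. p (x, z)) has_real_derivative p' (x, z)) (at x)) \<Longrightarrow>
      AE q in lborel. q \<in> S \<and> p q = 0 \<longrightarrow> p' q = 0"
proof -
  define Z where "Z = {q. q \<in> S \<and> p q = 0 \<and> p' q \<noteq> 0}"
  have [measurable]: "(\<lambda>q. indicator S q * p q) \<in> borel_measurable borel" "(\<lambda>q. indicator S q * p' q) \<in> borel_measurable borel"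
    using borel_measurable_indicator_continuous[OF S c(1)] borel_measurable_indicator_continuous[OF S c(2)] by auto
  have [measurable]: "S \<in> sets borel" using S by simp
  have "Z = {q \<in> space borel. q \<in> S \<and> indicator S q * p q = 0 \<and> indicator S q * p' q \<noteq> 0}"
    by (auto simp: Z_def indicator_def)
  also have "\<dots> \<in> sets borel" by measurable
  finally have Z: "Z \<in> sets borel" .
  then have Z': "Z \<in> sets (lborel \<Otimes>\<^sub>M lborel)" unfolding lborel_prod by simp
  have concl: "AE q in lborel. q \<in> S \<and> p q = 0 \<longrightarrow> p' q = 0" if "emeasure lborel Z = 0"
  proof -
    have "AE q in lborel. q \<notin> Z" using that Z by (intro AE_not_in) (simp add: null_sets_def)
    then show ?thesis by eventually_elim (auto simp: Z_def)
  qed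
  show "AE q in lborel. q \<in> S \<and> p q = 0 \<longrightarrow> p' q = 0"
    if d: "\<And>x z. (x, z) \<in> S \<Longrightarrow> ((\<lambda>z. p (x, z)) has_real_derivative p' (x, z)) (at z)"
  proof (rule concl)
    have "countable (Pair x -` Z)" for x
      by (rule countable_simple_zeros[of _ "\<lambda>z. p (x, z)" "\<lambda>z. p' (x, z)"]) (use d in \<open>auto simp: Z_def\<close>)
    then have "emeasure lborel (Pair x -` Z) = 0" for x by (rule emeasure_lborel_countable)
    then show "emeasure lborel Z = 0"
      using lborel.emeasure_pair_measure_alt[OF Z'] by (simp add: lborel_prod)
  qed
  show "AE q in lborel. q \<in> S \<and> p q = 0 \<longrightarrow> p' q = 0"
    if d: "\<And>x z. (x, z) \<in> S \<Longrightarrow> ((\<lambda>x. p (x, z)) has_real_derivative p' (x, z)) (at x)"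
  proof (rule concl)
    have "countable ((\<lambda>x. (x, z)) -` Z)" for z
      by (rule countable_simple_zeros[of _ "\<lambda>x. p (x, z)" "\<lambda>x. p' (x, z)"]) (use d in \<open>auto simp: Z_def\<close>)
    then have "emeasure lborel ((\<lambda>x. (x, z)) -` Z) = 0" for z by (rule emeasure_lborel_countable)
    then show "emeasure lborel Z = 0"
      using lborel_pair.emeasure_pair_measure_alt2[OF Z'] by (simp add: lborel_prod)
  qed
qed

text \<open>A smooth truncation of the values: zero for \<open>\<bar>y\<bar> \<le> 1 / n\<close> and the
  identity for large \<open>n y\<close>. Its derivative stays bounded and tends to \<open>1\<close>
  away from \<open>y = 0\<close>.\<close>

definition cut :: "nat \<Rightarrow> real \<Rightarrow> real" where
  "cut n y = y * step ((real n)\<^sup>2 * y\<^sup>2 - 1)"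

definition step' :: "real \<Rightarrow> real" where
  "step' x = frechet_derivative step (at x) 1"

definition cut' :: "nat \<Rightarrow> real \<Rightarrow> real" where
  "cut' n y = step ((real n)\<^sup>2 * y\<^sup>2 - 1) + 2 * ((real n)\<^sup>2 * y\<^sup>2) * step' ((real n)\<^sup>2 * y\<^sup>2 - 1)"

lemma smooth_real_derivative:
  fixes f :: "real \<Rightarrow> real"
  assumes "smooth f"
  shows "(f has_real_derivative frechet_derivative f (at x) 1) (at x)"
proof -
  have d: "(f has_derivative frechet_derivative f (at x)) (at x)" by (rule smooth_has_derivative[OF assms])
  then have l: "linear (frechet_derivative f (at x))" by (rule has_derivative_linear)
  have "frechet_derivative f (at x) = (*) (frechet_derivative f (at x) 1)"
  proof
    fix h :: real
    show "frechet_derivative f (at x) h = frechet_derivative f (at x) 1 * h"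
      using linear_cmul[OF l, of h 1] unfolding real_scaleR_def mult_1_right by (rule trans) (rule mult.commute)
  qed
  then show ?thesis using d unfolding has_field_derivative_def by metis
qed

lemma frechet_derivative_partials:
  fixes f :: "real \<times> real \<Rightarrow> real"
  assumes "smooth f"
  shows "frechet_derivative f (at q) h = frechet_derivative f (at q) (1, 0) * fst h + frechet_derivative f (at q) (0, 1) * snd h"
proof -
  have l: "linear (frechet_derivative f (at q))" using smooth_has_derivative[OF assms] by (rule has_derivative_linear)
  have "h = fst h *\<^sub>R (1, 0) + snd h *\<^sub>R (0, 1)" by (cases h) simp
  then have "frechet_derivative f (at q) h = frechet_derivative f (at q) (fst h *\<^sub>R (1, 0) + snd h *\<^sub>R (0, 1))" by (rule arg_cong)
  also have "\<dots> = fst h *\<^sub>R frechet_derivative f (at q) (1, 0) + snd h *\<^sub>R frechet_derivative f (at q) (0, 1)"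
    unfolding linear_add[OF l] linear_cmul[OF l] ..
  finally show ?thesis unfolding real_scaleR_def by (simp only: mult.commute)
qed

lemma step_has_derivative: "(step has_real_derivative step' x) (at x)"
  unfolding step'_def by (rule smooth_real_derivative[OF smooth_step])

lemma continuous_step': "continuous_on A step'"
  unfolding step'_def by (rule smooth_continuous[OF smooth_frechet_derivative[OF smooth_step]])

lemma step'_outside: "x < 0 \<or> x > 1 \<Longrightarrow> step' x = 0"
proof (elim disjE)
  have c: "((\<lambda>x::real. c::real) has_real_derivative 0) (at x)" for c by simp
  assume "x < 0"
  then have "(step has_real_derivative 0) (at x)"
    by (intro has_field_derivative_transform_within_open[OF c[of 0] open_lessThan[of 0]]) (auto simp: step_0)
  then show "step' x = 0" using step_has_derivative DERIV_unique by blast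
next
  have c: "((\<lambda>x::real. c::real) has_real_derivative 0) (at x)" for c by simp
  assume "x > 1"
  then have "(step has_real_derivative 0) (at x)"
    by (intro has_field_derivative_transform_within_open[OF c[of 1] open_greaterThan[of 1]]) (auto simp: step_1)
  then show "step' x = 0" using step_has_derivative DERIV_unique by blast
qed

lemma cut_has_derivative: "(cut n has_real_derivative cut' n y) (at y)"
proof -
  have "((\<lambda>y. (real n)\<^sup>2 * y\<^sup>2 - 1) has_real_derivative 2 * (real n)\<^sup>2 * y) (at y)"
    by (auto intro!: derivative_eq_intros)
  from DERIV_mult[OF DERIV_ident DERIV_chain2[OF step_has_derivative this]]
  have "((\<lambda>y. y * step ((real n)\<^sup>2 * y\<^sup>2 - 1)) has_real_derivative
    1 * step ((real n)\<^sup>2 * y\<^sup>2 - 1) + step' ((real n)\<^sup>2 * y\<^sup>2 - 1) * (2 * (real n)\<^sup>2 * y) * y) (at y)" .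
  then show ?thesis by (simp add: cut_def[abs_def] cut'_def power2_eq_square[of y] ac_simps)
qed

lemma continuous_cut': "continuous_on A (cut' n)"
proof -
  have p: "continuous_on A (\<lambda>y. (real n)\<^sup>2 * y\<^sup>2 - 1)" by (intro continuous_intros)
  show ?thesis
    unfolding cut'_def
    by (intro continuous_on_add continuous_on_mult continuous_on_const continuous_on_power continuous_on_id
        continuous_on_compose2[OF smooth_continuous[OF smooth_step, of UNIV] p subset_UNIV]
        continuous_on_compose2[OF continuous_step'[of UNIV] p subset_UNIV])
qed

lemma cut_zero: "(real n)\<^sup>2 * y\<^sup>2 < 1 \<Longrightarrow> cut n y = 0" "(real n)\<^sup>2 * y\<^sup>2 < 1 \<Longrightarrow> cut' n y = 0"
  by (simp_all add: cut_def cut'_def step_0 step'_outside)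

lemma cut'_bounded: "\<exists>C. \<forall>n y. \<bar>cut' n y\<bar> \<le> C"
proof -
  have "compact (step' ` {0..1})" by (intro compact_continuous_image continuous_step') simp
  from compact_imp_bounded[OF this] obtain B where "\<forall>x\<in>{0..1}. \<bar>step' x\<bar> \<le> B"
    by (auto simp: bounded_iff)
  then have B: "\<And>x. x \<in> {0..1} \<Longrightarrow> \<bar>step' x\<bar> \<le> B" by blast
  have B0: "0 \<le> B" using B[of 0] by simp
  have "\<bar>cut' n y\<bar> \<le> 1 + 4 * B" for n y
  proof -
    let ?s = "(real n)\<^sup>2 * y\<^sup>2"
    have "\<bar>2 * ?s * step' (?s - 1)\<bar> \<le> 4 * B"
    proof (cases "?s - 1 \<in> {0..1}")
      case True
      then have "\<bar>2 * ?s\<bar> \<le> 4" unfolding abs_le_iff atLeastAtMost_iff by linarith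
      then show ?thesis using B[OF True] B0 unfolding abs_mult[of "2 * ?s"] by (intro mult_mono) auto
    next
      case False
      then have "step' (?s - 1) = 0" by (intro step'_outside) auto
      then show ?thesis using B0 by simp
    qed
    moreover have "\<bar>step (?s - 1)\<bar> \<le> 1" using step_bounds[of "?s - 1"] by simp
    ultimately show ?thesis unfolding cut'_def by linarith
  qed
  then show ?thesis by blast
qed

lemma cut'_tendsto: "(\<lambda>n. cut' n y) \<longlonglongrightarrow> (if y = 0 then 0 else 1)"
proof (cases "y = 0")
  case True
  then show ?thesis by (simp add: cut_zero)
next
  case False
  obtain N :: nat where N: "2 / \<bar>y\<bar> < real N" using reals_Archimedean2 by blast
  have "cut' n y = 1" if "n \<ge> N" for n
  proof -
    have "2 < real N * \<bar>y\<bar>" using N False by (simp add: field_simps)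
    also have "\<dots> \<le> real n * \<bar>y\<bar>" using that by (intro mult_right_mono) auto
    finally have "2\<^sup>2 < (real n * \<bar>y\<bar>)\<^sup>2" by (intro power_strict_mono) auto
    then have "(real n)\<^sup>2 * y\<^sup>2 > 4" by (simp add: power_mult_distrib)
    then show ?thesis by (simp add: cut'_def step_1 step'_outside)
  qed
  then have "\<forall>\<^sub>F n in sequentially. 1 = cut' n y" by (intro eventually_sequentiallyI[of N]) simp
  then show ?thesis using False by (auto intro: Lim_transform_eventually[OF tendsto_const])
qed

definition C1_grad :: "(real \<times> real) set \<Rightarrow> (real \<times> real \<Rightarrow> real) \<Rightarrow> (real \<times> real \<Rightarrow> real) \<Rightarrow> (real \<times> real \<Rightarrow> real) \<Rightarrow> bool" where
  "C1_grad S f fx fz \<longleftrightarrow>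
     (\<forall>q\<in>S. (f has_derivative (\<lambda>h. fx q * fst h + fz q * snd h)) (at q)) \<and> continuous_on S fx \<and> continuous_on S fz"

lemma C1_gradD:
  assumes "C1_grad S f fx fz"
  shows "continuous_on S fx" "continuous_on S fz" "continuous_on S f"
    "(x, z) \<in> S \<Longrightarrow> ((\<lambda>x. f (x, z)) has_real_derivative fx (x, z)) (at x)"
    "(x, z) \<in> S \<Longrightarrow> ((\<lambda>z. f (x, z)) has_real_derivative fz (x, z)) (at z)"
proof -
  show "continuous_on S fx" "continuous_on S fz" using assms by (auto simp: C1_grad_def)
  have d: "q \<in> S \<Longrightarrow> (f has_derivative (\<lambda>h. fx q * fst h + fz q * snd h)) (at q)" for q
    using assms by (auto simp: C1_grad_def)
  show "continuous_on S f"
    by (intro continuous_at_imp_continuous_on ballI has_derivative_continuous[OF d])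
  show "((\<lambda>x. f (x, z)) has_real_derivative fx (x, z)) (at x)" if "(x, z) \<in> S"
    using has_derivative_partials(1)[OF d[OF that]] by simp
  show "((\<lambda>z. f (x, z)) has_real_derivative fz (x, z)) (at z)" if "(x, z) \<in> S"
    using has_derivative_partials(2)[OF d[OF that]] by simp
qed

text \<open>The support of \<open>cut n \<circ> p\<close> is a compact subset of \<open>S\<close>, so that \<open>cut n \<circ> p\<close> times a component of
  the field, extended by zero, is differentiable on the whole plane.\<close>

lemma cut_product_derivative:
  fixes p P' H h :: "real \<times> real \<Rightarrow> real" and \<iota> :: "real \<Rightarrow> real \<times> real"
  assumes S: "open S" and K: "closed K" "K \<subseteq> S" and out: "\<And>q. q \<in> S \<Longrightarrow> q \<notin> K \<Longrightarrow> (real n)\<^sup>2 * (p q)\<^sup>2 < 1"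
    and \<iota>: "continuous_on UNIV \<iota>"
    and dp: "\<iota> x \<in> S \<Longrightarrow> ((\<lambda>x. p (\<iota> x)) has_real_derivative p' (\<iota> x)) (at x)"
    and dF: "\<iota> x \<in> S \<Longrightarrow> ((\<lambda>x. F (\<iota> x)) has_real_derivative F' (\<iota> x)) (at x)"
  shows "((\<lambda>x. if \<iota> x \<in> S then cut n (p (\<iota> x)) * F (\<iota> x) else 0) has_real_derivative
     (if \<iota> x \<in> S then cut' n (p (\<iota> x)) * p' (\<iota> x) * F (\<iota> x) + cut n (p (\<iota> x)) * F' (\<iota> x) else 0)) (at x)"
proof (cases "\<iota> x \<in> S")
  case True
  have o: "open (\<iota> -` S)" using open_vimage[OF S] \<iota> by blast
  have "((\<lambda>x. cut n (p (\<iota> x)) * F (\<iota> x)) has_real_derivative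
     cut' n (p (\<iota> x)) * p' (\<iota> x) * F (\<iota> x) + cut n (p (\<iota> x)) * F' (\<iota> x)) (at x)"
    using DERIV_mult[OF DERIV_chain2[OF cut_has_derivative dp[OF True]] dF[OF True]] by (simp add: mult.commute)
  then have "((\<lambda>x. if \<iota> x \<in> S then cut n (p (\<iota> x)) * F (\<iota> x) else 0) has_real_derivative
     cut' n (p (\<iota> x)) * p' (\<iota> x) * F (\<iota> x) + cut n (p (\<iota> x)) * F' (\<iota> x)) (at x)"
    by (rule has_field_derivative_transform_within_open[OF _ o]) (use True in auto)
  then show ?thesis using True by simp
next
  case False
  have o: "open (\<iota> -` (- K))" using open_vimage[of "- K" \<iota>] K(1) \<iota> by auto
  have "((\<lambda>x::real. 0::real) has_real_derivative 0) (at x)" by simp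
  then have "((\<lambda>x. if \<iota> x \<in> S then cut n (p (\<iota> x)) * F (\<iota> x) else 0) has_real_derivative 0) (at x)"
    by (rule has_field_derivative_transform_within_open[OF _ o]) (use False K(2) out cut_zero(1) in auto)
  then show ?thesis using False by simp
qed

lemma continuous_on_extend_zero:
  fixes g :: "real \<times> real \<Rightarrow> real"
  assumes "open S" "closed K" "K \<subseteq> S" "continuous_on S g" "\<And>q. q \<in> S \<Longrightarrow> q \<notin> K \<Longrightarrow> g q = 0"
  shows "continuous_on UNIV (\<lambda>q. if q \<in> S then g q else 0)"
proof -
  have "continuous_on S (\<lambda>q. if q \<in> S then g q else 0)"
    using assms(4) by (rule continuous_on_eq) auto
  moreover have "continuous_on (- K) (\<lambda>q. if q \<in> S then g q else 0)"
    using continuous_on_const[of "- K" 0] by (rule continuous_on_eq) (use assms(5) in auto)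
  ultimately have "continuous_on (S \<union> - K) (\<lambda>q. if q \<in> S then g q else 0)"
    using assms by (intro continuous_on_open_Un) auto
  moreover have "S \<union> - K = UNIV" using assms(3) by blast
  ultimately show ?thesis by simp
qed

text \<open>No regularity of the boundary enters: \<open>cut n \<circ> p\<close> has compact support in
  \<open>S\<close> because \<open>p\<close> is continuous up to the boundary and vanishes there. For
  it the identity is partial integration on the plane, and dominated convergence passes to
  \<open>p\<close>; the set \<open>{p = 0}\<close>, where the truncated gradient does not converge to
  that of \<open>p\<close>, is harmless since the gradient vanishes almost everywhere on it.\<close>

lemma divergence_free_orthogonal:
  fixes p px pz F1 F1x F2 F2z :: "real \<times> real \<Rightarrow> real"
  assumes S: "open S" "bounded S" and p: "C1_grad S p px pz" "continuous_on (closure S) p"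
    and fr: "\<And>q. q \<in> frontier S \<Longrightarrow> p q = 0"
    and F1: "\<And>x z. (x, z) \<in> S \<Longrightarrow> ((\<lambda>x. F1 (x, z)) has_real_derivative F1x (x, z)) (at x)"
    and F2: "\<And>x z. (x, z) \<in> S \<Longrightarrow> ((\<lambda>z. F2 (x, z)) has_real_derivative F2z (x, z)) (at z)"
    and cF: "continuous_on S F1" "continuous_on S F2" "continuous_on S F1x" "continuous_on S F2z"
    and div: "\<And>q. q \<in> S \<Longrightarrow> F1x q + F2z q = 0"
    and int: "integrable lborel (\<lambda>q. indicator S q * (F1 q * px q + F2 q * pz q))"
  shows "(LINT q|lborel. indicator S q * (F1 q * px q + F2 q * pz q)) = 0"
proof -
  note cp = C1_gradD(1-3)[OF p(1)]
  obtain C where C: "\<And>n y. \<bar>cut' n y\<bar> \<le> C" using cut'_bounded by blast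
  obtain R where R: "S \<subseteq> cbox (-R, -R) (R, R)"
  proof -
    obtain B where B: "\<And>p. p \<in> S \<Longrightarrow> norm p \<le> B" using S(2) by (auto simp: bounded_iff)
    have "p \<in> cbox (-B, -B) (B, B)" if "p \<in> S" for p
      using B[OF that] norm_fst_le[of "fst p" "snd p"] norm_snd_le[of "snd p" "fst p"]
      by (cases p) (auto simp: cbox_Pair_eq)
    then show ?thesis using that by blast
  qed
  \<comment> \<open>by the chain rule, the pairing of the field with the gradient of \<open>cut n \<circ> p\<close>\<close>
  define f where "f n q = indicator S q * (cut' n (p q) * (F1 q * px q + F2 q * pz q))" for n q
  have zero: "(LINT q|lborel. f n q) = 0" for n
  proof -
    define K where "K = {q \<in> closure S. (real n)\<^sup>2 * (p q)\<^sup>2 \<ge> 1}"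
    have "continuous_on (closure S) (\<lambda>q. (real n)\<^sup>2 * (p q)\<^sup>2)" by (intro continuous_intros p(2))
    then have "closed (closure S \<inter> (\<lambda>q. (real n)\<^sup>2 * (p q)\<^sup>2) -` {1..})"
      by (intro continuous_closed_preimage) auto
    moreover have "closure S \<inter> (\<lambda>q. (real n)\<^sup>2 * (p q)\<^sup>2) -` {1..} = K" by (auto simp: K_def)
    ultimately have K: "closed K" by simp
    have KS: "K \<subseteq> S"
    proof
      fix q assume q: "q \<in> K"
      then have "q \<notin> frontier S" using fr[of q] by (auto simp: K_def)
      then show "q \<in> S" using q S(1) by (auto simp: K_def frontier_def interior_open)
    qed
    have out: "(real n)\<^sup>2 * (p q)\<^sup>2 < 1" if "q \<in> S" "q \<notin> K" for q
      using that closure_subset by (force simp: K_def)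
    \<comment> \<open>the partial derivatives of the field times \<open>cut n \<circ> p\<close>, extended by zero; their sum is the integrand because the field is divergence free\<close>
    define h1 where "h1 q = (if q \<in> S then cut' n (p q) * px q * F1 q + cut n (p q) * F1x q else 0)" for q
    define h2 where "h2 q = (if q \<in> S then cut' n (p q) * pz q * F2 q + cut n (p q) * F2z q else 0)" for q
    have cc: "continuous_on S (\<lambda>q. cut n (p q))" "continuous_on S (\<lambda>q. cut' n (p q))"
      by (rule continuous_on_compose2[OF DERIV_continuous_on[OF has_field_derivative_at_within[OF cut_has_derivative]] cp(3) subset_UNIV])
        (rule continuous_on_compose2[OF continuous_cut' cp(3) subset_UNIV])
    have ch1: "continuous_on UNIV h1"
      unfolding h1_def
      by (rule continuous_on_extend_zero[OF S(1) K KS]) (intro continuous_intros cc cp cF, use out cut_zero in simp)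
    have ch2: "continuous_on UNIV h2"
      unfolding h2_def
      by (rule continuous_on_extend_zero[OF S(1) K KS]) (intro continuous_intros cc cp cF, use out cut_zero in simp)
    note ch = ch1 ch2
    have i1: "(LINT q|lborel. h1 q) = 0"
    proof (rule integral_partial_derivative_zero(1)[OF ch(1), of R "\<lambda>q. if q \<in> S then cut n (p q) * F1 q else 0"])
      show "q \<notin> cbox (-R, -R) (R, R) \<Longrightarrow> (if q \<in> S then cut n (p q) * F1 q else 0) = 0 \<and> h1 q = 0" for q
        using R by (auto simp: h1_def)
      show "((\<lambda>x. if (x, z) \<in> S then cut n (p (x, z)) * F1 (x, z) else 0) has_real_derivative h1 (x, z)) (at x)" for x z
        unfolding h1_def
        by (rule cut_product_derivative[OF S(1) K KS out, where \<iota> = "\<lambda>x. (x, z)"])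
          (auto intro!: continuous_intros C1_gradD(4)[OF p(1)] F1)
    qed
    have i2: "(LINT q|lborel. h2 q) = 0"
    proof (rule integral_partial_derivative_zero(2)[OF ch(2), of R "\<lambda>q. if q \<in> S then cut n (p q) * F2 q else 0"])
      show "q \<notin> cbox (-R, -R) (R, R) \<Longrightarrow> (if q \<in> S then cut n (p q) * F2 q else 0) = 0 \<and> h2 q = 0" for q
        using R by (auto simp: h2_def)
      show "((\<lambda>z. if (x, z) \<in> S then cut n (p (x, z)) * F2 (x, z) else 0) has_real_derivative h2 (x, z)) (at z)" for x z
        unfolding h2_def
        by (rule cut_product_derivative[OF S(1) K KS out, where \<iota> = "\<lambda>z. (x, z)"])
          (auto intro!: continuous_intros C1_gradD(5)[OF p(1)] F2)
    qed
    have ih: "integrable lborel h1"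
      by (rule integrable_continuous_support[OF ch(1) compact_cbox[of "(-R, -R)" "(R, R)"]]) (use R in \<open>auto simp: h1_def\<close>)
    have ih': "integrable lborel h2"
      by (rule integrable_continuous_support[OF ch(2) compact_cbox[of "(-R, -R)" "(R, R)"]]) (use R in \<open>auto simp: h2_def\<close>)
    have "f n q = h1 q + h2 q" for q
    proof (cases "q \<in> S")
      case True
      have "h1 q + h2 q = cut' n (p q) * (F1 q * px q + F2 q * pz q) + cut n (p q) * (F1x q + F2z q)"
        using True by (simp add: h1_def h2_def algebra_simps)
      then show ?thesis using True div by (simp add: f_def)
    qed (simp add: f_def h1_def h2_def)
    then have "(LINT q|lborel. f n q) = (LINT q|lborel. h1 q) + (LINT q|lborel. h2 q)"
      using ih ih' by simp
    then show ?thesis using i1 i2 by simp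
  qed
  define g where "g q = indicator S q * (F1 q * px q + F2 q * pz q)" for q
  have gm[measurable]: "g \<in> borel_measurable borel" using int unfolding g_def by (simp add: borel_measurable_integrable[of lborel, simplified])
  have pm[measurable]: "(\<lambda>q. indicator S q * p q) \<in> borel_measurable borel"
    by (rule borel_measurable_indicator_continuous[OF S(1) cp(3)])
  have cm[measurable]: "cut' n \<in> borel_measurable borel" for n
    by (rule borel_measurable_continuous_onI[OF continuous_cut'])
  have f_alt: "f n = (\<lambda>q. cut' n (indicator S q * p q) * g q)" for n
    by (auto simp: f_def g_def indicator_def fun_eq_iff)
  have "(\<lambda>n. LINT q|lborel. f n q) \<longlonglongrightarrow> (LINT q|lborel. (if indicator S q * p q = 0 then 0 else 1) * g q)"
  proof (rule integral_dominated_convergence[where w = "\<lambda>q. C * norm (g q)"])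
    show "integrable lborel (\<lambda>q. C * norm (g q))" using int unfolding g_def by (intro integrable_mult_right integrable_norm)
    show "AE q in lborel. (\<lambda>n. f n q) \<longlonglongrightarrow> (if indicator S q * p q = 0 then 0 else 1) * g q"
      unfolding f_alt by (intro AE_I2 tendsto_mult cut'_tendsto tendsto_const)
    show "AE q in lborel. norm (f n q) \<le> C * norm (g q)" for n
      unfolding f_alt by (intro AE_I2) (simp add: abs_mult mult_right_mono C)
    show "f n \<in> borel_measurable lborel" for n unfolding f_alt by measurable
    show "(\<lambda>q. (if indicator S q * p q = 0 then 0 else 1) * g q) \<in> borel_measurable lborel" by measurable
  qed
  then have l0: "(LINT q|lborel. (if indicator S q * p q = 0 then 0 else 1) * g q) = 0"
    unfolding zero by (simp add: LIMSEQ_const_iff)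
  have "(LINT q|lborel. g q) = (LINT q|lborel. (if indicator S q * p q = 0 then 0 else 1) * g q)"
  proof (rule integral_cong_AE)
    have "AE q in lborel. q \<in> S \<and> p q = 0 \<longrightarrow> px q = 0"
      by (rule AE_partial_zero_on_zero_set(2)[OF S(1) cp(3,1) C1_gradD(4)[OF p(1)]])
    moreover have "AE q in lborel. q \<in> S \<and> p q = 0 \<longrightarrow> pz q = 0"
      by (rule AE_partial_zero_on_zero_set(1)[OF S(1) cp(3,2) C1_gradD(5)[OF p(1)]])
    ultimately show "AE q in lborel. g q = (if indicator S q * p q = 0 then 0 else 1) * g q"
      by eventually_elim (auto simp: g_def indicator_def)
  qed measurable
  then show ?thesis using l0 unfolding g_def by simp
qed

section \<open>Sobolev functions on the interval\<close>

lemma continuous_on_integrable_I: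
  fixes f :: "real \<Rightarrow> real"
  assumes "continuous_on {-1..1} f"
  shows "set_integrable lebesgue {-1..1} f"
  using absolutely_integrable_continuous[of "-1" 1 f] assms by simp

lemma set_integrable_I_closed: "set_integrable lebesgue I f \<longleftrightarrow> set_integrable lebesgue {-1..1} f"
  for f :: "real \<Rightarrow> real"
proof -
  have "AE x in lebesgue. x \<notin> {-1, 1::real}" by (intro AE_not_in) (auto simp: negligible_iff_null_sets[symmetric])
  then have e: "AE x in lebesgue. indicat_real I x *\<^sub>R f x = indicat_real {-1..1} x *\<^sub>R f x"
    by eventually_elim (auto simp: indicator_def)
  then have e': "AE x in lebesgue. indicat_real {-1..1} x *\<^sub>R f x = indicat_real I x *\<^sub>R f x"
    by eventually_elim (rule sym)
  show ?thesis
    unfolding set_integrable_def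
  proof
    assume a: "integrable lebesgue (\<lambda>x. indicat_real I x *\<^sub>R f x)"
    note m = borel_measurable_integrable[OF a]
    show "integrable lebesgue (\<lambda>x. indicat_real {-1..1} x *\<^sub>R f x)"
      using a integrable_cong_AE[OF m borel_measurable_lebesgue_cong_AE[OF m e] e] by simp
  next
    assume a: "integrable lebesgue (\<lambda>x. indicat_real {-1..1} x *\<^sub>R f x)"
    note m = borel_measurable_integrable[OF a]
    show "integrable lebesgue (\<lambda>x. indicat_real I x *\<^sub>R f x)"
      using a integrable_cong_AE[OF m borel_measurable_lebesgue_cong_AE[OF m e'] e'] by simp
  qed
qed

lemma set_integral_I: "set_integrable lebesgue I f \<Longrightarrow> (LINT x:I|lebesgue. f x) = integral {-1..1} f"
  for f :: "real \<Rightarrow> real"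
  using set_lebesgue_integral_eq_integral(2)[of I f] integral_open_interval_real[of "-1" 1 f] by simp

lemma finite_measure_I: "finite_measure (lebesgue_on I)"
  by (intro finite_measure_lebesgue_on) simp

lemma L2_on_I_integrable:
  assumes "L2_on I g"
  shows "set_integrable lebesgue I g" "set_integrable lebesgue {-1..1} g"
proof -
  have "sqint (lebesgue_on I) g" using assms by (simp add: L2_on_iff_sqint)
  from sqint_integrable[OF finite_measure_I this] show 1: "set_integrable lebesgue I g"
    by (subst set_integral_lebesgue_on) auto
  then show "set_integrable lebesgue {-1..1} g" by (simp add: set_integrable_I_closed)
qed

text \<open>Integration by parts against the primitive of a merely integrable function, by Fubini on the
  triangle \<open>y \<le> x\<close>.\<close>

lemma integral_parts_primitive:
  fixes g \<phi> \<phi>' :: "real \<Rightarrow> real"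
  assumes g: "set_integrable lebesgue {-1..1} g"
    and \<phi>: "\<And>x. x \<in> {-1..1} \<Longrightarrow> (\<phi> has_real_derivative \<phi>' x) (at x within {-1..1})"
    and c: "continuous_on {-1..1} \<phi>'" and end0: "\<phi> 1 = 0"
  shows "integral {-1..1} (\<lambda>x. integral {-1..x} g * \<phi>' x) = - integral {-1..1} (\<lambda>x. g x * \<phi> x)"
proof -
  let ?J = "{-1..1::real}"
  have gm: "(\<lambda>x. indicat_real ?J x *\<^sub>R g x) \<in> borel_measurable lebesgue" and gi: "integrable lebesgue (\<lambda>x. indicat_real ?J x *\<^sub>R g x)"
    using g unfolding set_integrable_def by auto
  \<comment> \<open>a Borel representative, as product measurability is needed\<close>
  obtain h where h[measurable]: "h \<in> borel_measurable lborel" and gh: "AE x in lborel. indicat_real ?J x *\<^sub>R g x = h x"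
    using completion_ex_borel_measurable_real[OF gm] by blast
  have gh': "AE x in lebesgue. indicat_real ?J x *\<^sub>R g x = h x" using gh by (rule AE_completion)
  have hm: "h \<in> borel_measurable lebesgue" using h by (rule measurable_completion)
  have "integrable lebesgue h" using gi integrable_cong_AE[OF gm hm gh'] by simp
  then have hi: "integrable lborel h" using integrable_completion[OF h] by simp
  define k where "k x = indicat_real ?J x *\<^sub>R \<phi>' x" for x
  have k[measurable]: "k \<in> borel_measurable borel"
    unfolding k_def by (rule borel_measurable_continuous_on_indicator[OF _ c]) simp
  have "compact (\<phi>' ` ?J)" by (rule compact_continuous_image[OF c]) simp
  from compact_imp_bounded[OF this] obtain C where "\<forall>x\<in>?J. \<bar>\<phi>' x\<bar> \<le> C" by (auto simp: bounded_iff)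
  then have "\<bar>\<phi>' x\<bar> \<le> \<bar>C\<bar>" if "x \<in> ?J" for x using that by (meson abs_ge_self order_trans)
  then have C: "\<bar>k x\<bar> \<le> \<bar>C\<bar> * indicat_real ?J x" for x by (auto simp: k_def indicator_def)
  define F where "F x y = (if -1 \<le> y \<and> y \<le> x then h y * k x else 0)" for x y
  have Fm[measurable]: "case_prod F \<in> borel_measurable (lborel \<Otimes>\<^sub>M lborel)"
    unfolding F_def by measurable
  have Fi: "integrable (lborel \<Otimes>\<^sub>M lborel) (case_prod F)"
  proof (rule Bochner_Integration.integrable_bound[OF _ Fm])
    show "integrable (lborel \<Otimes>\<^sub>M lborel) (\<lambda>(x, y). (\<bar>C\<bar> * indicat_real ?J x) * h y)"
    proof (rule lborel_pair.Fubini_integrable)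
      show "(\<lambda>(x, y). (\<bar>C\<bar> * indicat_real ?J x) * h y) \<in> borel_measurable (lborel \<Otimes>\<^sub>M lborel)" by measurable
      have "(\<lambda>x. LINT y|lborel. norm (case (x, y) of (x, y) \<Rightarrow> (\<bar>C\<bar> * indicat_real ?J x) * h y))
          = (\<lambda>x. (\<bar>C\<bar> * (LINT y|lborel. \<bar>h y\<bar>)) * indicat_real ?J x)"
        by (auto simp: fun_eq_iff abs_mult)
      moreover have "integrable lborel (\<lambda>x. (\<bar>C\<bar> * (LINT y|lborel. \<bar>h y\<bar>)) * indicat_real ?J x)"
        by (intro integrable_mult_right integrable_real_indicator) auto
      ultimately show "integrable lborel (\<lambda>x. LINT y|lborel. norm (case (x, y) of (x, y) \<Rightarrow> (\<bar>C\<bar> * indicat_real ?J x) * h y))"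
        by simp
      show "AE x in lborel. integrable lborel (\<lambda>y. case (x, y) of (x, y) \<Rightarrow> (\<bar>C\<bar> * indicat_real ?J x) * h y)"
        using hi by simp
    qed
    show "AE p in lborel \<Otimes>\<^sub>M lborel. norm (case_prod F p) \<le> norm (case p of (x, y) \<Rightarrow> (\<bar>C\<bar> * indicat_real ?J x) * h y)"
    proof (intro AE_I2)
      fix p :: "real \<times> real"
      obtain x y where p: "p = (x, y)" by (cases p)
      have "\<bar>h y * k x\<bar> \<le> (\<bar>C\<bar> * indicat_real ?J x) * \<bar>h y\<bar>"
        unfolding abs_mult using mult_left_mono[OF C, of "\<bar>h y\<bar>" x] by (simp add: mult.commute)
      then show "norm (case_prod F p) \<le> norm (case p of (x, y) \<Rightarrow> (\<bar>C\<bar> * indicat_real ?J x) * h y)"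
        by (auto simp: p F_def abs_mult)
    qed
  qed
  have prim: "(LINT y|lborel. indicat_real {-1..x} y * h y) = integral {-1..x} g" if x: "x \<in> ?J" for x
  proof -
    have gx: "set_integrable lebesgue {-1..x} g" by (rule set_integrable_subset[OF g]) (use x in auto)
    have m1: "(\<lambda>y. indicat_real {-1..x} y * h y) \<in> borel_measurable lborel" by measurable
    have "(LINT y|lborel. indicat_real {-1..x} y * h y) = (LINT y|lebesgue. indicat_real {-1..x} y * h y)"
      by (rule integral_completion[OF m1, symmetric])
    also have "\<dots> = (LINT y:{-1..x}|lebesgue. g y)"
      unfolding set_lebesgue_integral_def
    proof (rule integral_cong_AE)
      show "(\<lambda>y. indicat_real {-1..x} y * h y) \<in> borel_measurable lebesgue" using m1 by (rule measurable_completion)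
      show "(\<lambda>y. indicat_real {-1..x} y *\<^sub>R g y) \<in> borel_measurable lebesgue"
        using gx unfolding set_integrable_def by (rule borel_measurable_integrable)
      show "AE y in lebesgue. indicat_real {-1..x} y * h y = indicat_real {-1..x} y *\<^sub>R g y"
        using gh' by eventually_elim (use x in \<open>auto simp: indicator_def split: if_splits\<close>)
    qed
    also have "\<dots> = integral {-1..x} g" by (rule set_lebesgue_integral_eq_integral(2)[OF gx])
    finally show ?thesis .
  qed
  have inner1: "(LINT y|lborel. F x y) = indicat_real ?J x * (integral {-1..x} g * \<phi>' x)" for x
  proof (cases "x \<in> ?J")
    case True
    have "F x y = (indicat_real {-1..x} y * h y) * k x" for y by (auto simp: F_def indicator_def)
    then have "(LINT y|lborel. F x y) = integral {-1..x} g * k x" using prim[OF True] by simp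
    then show ?thesis using True by (simp add: k_def)
  next
    case False
    then have "F x y = 0" for y by (auto simp: F_def k_def)
    then show ?thesis using False by simp
  qed
  have inner2: "(LINT x|lborel. F x y) = - (indicat_real ?J y * (h y * \<phi> y))" for y
  proof (cases "y \<in> ?J")
    case True
    have "F x y = h y * (indicat_real {y..1} x *\<^sub>R \<phi>' x)" for x using True by (auto simp: F_def k_def indicator_def)
    then have "(LINT x|lborel. F x y) = h y * (LINT x|lborel. indicat_real {y..1} x *\<^sub>R \<phi>' x)" by simp
    also have "(LINT x|lborel. indicat_real {y..1} x *\<^sub>R \<phi>' x) = \<phi> 1 - \<phi> y"
    proof (rule integral_FTC_atLeastAtMost)
      show "y \<le> 1" using True by simp
      show "continuous_on {y..1} \<phi>'" by (rule continuous_on_subset[OF c]) (use True in auto)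
      fix x assume "y \<le> x" "x \<le> 1"
      then have "(\<phi> has_real_derivative \<phi>' x) (at x within {y..1})"
        by (intro DERIV_subset[OF \<phi>]) (use True in auto)
      then show "(\<phi> has_vector_derivative \<phi>' x) (at x within {y..1})"
        by (simp add: has_real_derivative_iff_has_vector_derivative)
    qed
    finally show ?thesis using True end0 by simp
  next
    case False
    then have "F x y = 0" for x by (auto simp: F_def k_def)
    then show ?thesis using False by simp
  qed
  have cP: "continuous_on ?J (\<lambda>x. integral {-1..x} g)"
    by (rule indefinite_integral_continuous_1) (rule set_lebesgue_integral_eq_integral(1)[OF g])
  have "(LINT x|lborel. indicat_real ?J x * (integral {-1..x} g * \<phi>' x)) = (LINT y|lborel. - (indicat_real ?J y * (h y * \<phi> y)))"
    using lborel_pair.Fubini_integral[OF Fi] unfolding inner1 inner2 by simp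
  moreover have "(LINT x|lborel. indicat_real ?J x * (integral {-1..x} g * \<phi>' x)) = integral ?J (\<lambda>x. integral {-1..x} g * \<phi>' x)"
  proof -
    have cc: "continuous_on ?J (\<lambda>x. integral {-1..x} g * \<phi>' x)" by (intro continuous_intros cP c)
    have "(\<lambda>x. indicat_real ?J x *\<^sub>R (integral {-1..x} g * \<phi>' x)) \<in> borel_measurable borel"
      by (rule borel_measurable_continuous_on_indicator[OF _ cc]) simp
    then have "(LINT x|lborel. indicat_real ?J x *\<^sub>R (integral {-1..x} g * \<phi>' x)) = (LINT x:?J|lebesgue. integral {-1..x} g * \<phi>' x)"
      unfolding set_lebesgue_integral_def by (intro integral_completion[symmetric]) simp
    then show ?thesis
      using set_lebesgue_integral_eq_integral(2)[OF continuous_on_integrable_I[OF cc]] by simp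
  qed
  moreover have "(LINT y|lborel. - (indicat_real ?J y * (h y * \<phi> y))) = - integral ?J (\<lambda>x. g x * \<phi> x)"
  proof -
    have c\<phi>: "continuous_on ?J \<phi>" using \<phi> by (rule DERIV_continuous_on)
    have pm: "(\<lambda>x. indicat_real ?J x *\<^sub>R \<phi> x) \<in> borel_measurable borel"
      by (rule borel_measurable_continuous_on_indicator[OF _ c\<phi>]) simp
    have m: "(\<lambda>y. h y * (indicat_real ?J y *\<^sub>R \<phi> y)) \<in> borel_measurable lborel" using pm by measurable
    have "compact (\<phi> ` ?J)" by (rule compact_continuous_image[OF c\<phi>]) simp
    from compact_imp_bounded[OF this] obtain B where "\<forall>x\<in>?J. \<bar>\<phi> x\<bar> \<le> B" by (auto simp: bounded_iff)
    then have "\<bar>\<phi> x\<bar> \<le> \<bar>B\<bar>" if "x \<in> ?J" for x using that by (meson abs_ge_self order_trans)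
    then have B: "\<bar>indicat_real ?J x *\<^sub>R \<phi> x\<bar> \<le> \<bar>B\<bar>" for x by (auto simp: indicator_def)
    have i: "integrable lborel (\<lambda>y. h y * (indicat_real ?J y *\<^sub>R \<phi> y))"
    proof (rule Bochner_Integration.integrable_bound[OF _ m])
      show "integrable lborel (\<lambda>y. h y * \<bar>B\<bar>)" using hi by simp
      show "AE y in lborel. norm (h y * (indicat_real ?J y *\<^sub>R \<phi> y)) \<le> norm (h y * \<bar>B\<bar>)"
        using mult_left_mono[OF B, of "\<bar>h _\<bar>"] by (intro AE_I2) (simp only: real_norm_def abs_mult abs_ge_zero abs_abs)
    qed
    have eqi: "AE y in lebesgue. h y * (indicat_real ?J y *\<^sub>R \<phi> y) = indicat_real ?J y *\<^sub>R (g y * \<phi> y)"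
      using gh' by eventually_elim (auto simp: indicator_def split: if_splits)
    have li: "integrable lebesgue (\<lambda>y. h y * (indicat_real ?J y *\<^sub>R \<phi> y))" using i integrable_completion[OF m] by simp
    note lm = borel_measurable_integrable[OF li]
    have "set_integrable lebesgue ?J (\<lambda>y. g y * \<phi> y)"
      unfolding set_integrable_def using li integrable_cong_AE[OF lm borel_measurable_lebesgue_cong_AE[OF lm eqi] eqi] by simp
    from set_lebesgue_integral_eq_integral(2)[OF this]
    have "integral ?J (\<lambda>x. g x * \<phi> x) = (LINT y|lebesgue. indicat_real ?J y *\<^sub>R (g y * \<phi> y))"
      unfolding set_lebesgue_integral_def by simp
    also have "\<dots> = (LINT y|lebesgue. h y * (indicat_real ?J y *\<^sub>R \<phi> y))"
      using integral_cong_AE[OF lm borel_measurable_lebesgue_cong_AE[OF lm eqi] eqi] by simp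
    also have "\<dots> = (LINT y|lborel. indicat_real ?J y * (h y * \<phi> y))"
      using integral_completion[OF m] by (simp add: mult.left_commute)
    finally show ?thesis by simp
  qed
  ultimately show ?thesis by simp
qed

lemma smooth_primitive:
  fixes b :: "real \<Rightarrow> real"
  assumes b: "smooth b" and zero: "\<And>x. x \<le> a \<Longrightarrow> b x = 0"
  shows "smooth (\<lambda>x. integral {a..x} b)" "((\<lambda>x. integral {a..x} b) has_real_derivative b x) (at x)"
proof -
  have der: "((\<lambda>x. integral {a..x} b) has_real_derivative b x) (at x)" for x
  proof (cases "x \<le> a")
    case True
    have shift: "integral {a..y} b = integral {x-1..y} b" if "y > x - 1" for y
    proof (cases "a \<le> y")
      case True
      have "integral {x-1..a} b + integral {a..y} b = integral {x-1..y} b"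
        by (intro Henstock_Kurzweil_Integration.integral_combine integrable_continuous_real smooth_continuous b)
          (use True \<open>x \<le> a\<close> in auto)
      moreover have "integral {x-1..a} b = 0"
        using integral_cong[of "{x-1..a}" b "\<lambda>_. 0"] zero by simp
      ultimately show ?thesis by simp
    next
      case False
      then show ?thesis using integral_cong[of "{x-1..y}" b "\<lambda>_. 0"] zero by simp
    qed
    have "((\<lambda>y. integral {x-1..y} b) has_real_derivative b x) (at x within {x-1..x+1})"
      by (rule integral_has_real_derivative[OF smooth_continuous[OF b]]) auto
    then have "((\<lambda>y. integral {x-1..y} b) has_real_derivative b x) (at x)"
      by (subst (asm) at_within_interior) (auto simp: interior_atLeastAtMost_real)
    then show ?thesis
      by (rule has_field_derivative_transform_within_open[OF _ open_greaterThan[of "x - 1"]]) (auto simp: shift)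
  next
    case False
    have "((\<lambda>y. integral {a..y} b) has_real_derivative b x) (at x within {a..x+1})"
      by (rule integral_has_real_derivative[OF smooth_continuous[OF b]]) (use False in auto)
    then show ?thesis
      by (subst (asm) at_within_interior) (use False in \<open>auto simp: interior_atLeastAtMost_real\<close>)
  qed
  show "((\<lambda>x. integral {a..x} b) has_real_derivative b x) (at x)" by (rule der)
  show "smooth (\<lambda>x. integral {a..x} b)" by (rule smooth_real_I[OF der b])
qed

lemma frechet_derivative_real:
  assumes "(f has_real_derivative d) (at x)"
  shows "frechet_derivative f (at x) 1 = (d::real)"
proof -
  have "(*) d = frechet_derivative f (at x)"
    using assms unfolding has_field_derivative_def by (rule frechet_derivative_at)
  from fun_cong[OF this, of 1] show ?thesis unfolding mult_1_right by (rule sym)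
qed

text \<open>Subtracting from a test function the multiple of a fixed bump with the same integral makes its
  primitive a test function. Hence \<open>f\<close> minus the constant \<open>c\<close> given by the
  bump annihilates all test functions.\<close>

lemma weak_deriv_zero_constant:
  assumes f: "has_weak_deriv I 1 f (\<lambda>x. 0)"
  shows "\<exists>c. AE x in lebesgue. x \<in> I \<longrightarrow> f x = c"
proof -
  have li: "locally_integrable I f" using f by (simp add: has_weak_deriv_def)
  let ?\<theta> = "box_bump 1 (- 1/2) (1/2) :: real \<Rightarrow> real"
  have \<theta>t: "test_function I ?\<theta>" by (rule test_function_box_bump) auto
  have \<theta>s: "smooth ?\<theta>" by (rule smooth_box_bump)
  have \<theta>0: "?\<theta> x = 0" if "x \<le> -1/2 \<or> x \<ge> 1/2" for x using that by (intro box_bump_outside) auto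
  define m where "m = integral {-1..1} ?\<theta>"
  have m: "m > 0"
  proof -
    have "m \<noteq> 0"
    proof
      assume "m = 0"
      have iff: "(integral {-1..1} ?\<theta> = 0) = (\<forall>x\<in>{-1..1}. ?\<theta> x = 0)"
        by (rule integral_eq_0_iff[OF smooth_continuous[OF \<theta>s]]) (simp, rule box_bump_bounds(1))
      have "\<forall>x\<in>{-1..1}. ?\<theta> x = 0" using \<open>m = 0\<close> unfolding m_def iff .
      then have "?\<theta> 0 = 0" by (rule bspec) simp
      moreover have "?\<theta> 0 = step (1/2) * step (1/2)" by (simp add: box_bump_def)
      ultimately show False using step_pos[of "1/2"] by simp
    qed
    moreover have "m \<ge> 0" unfolding m_def
      by (intro integral_nonneg integrable_continuous_real smooth_continuous \<theta>s box_bump_bounds)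
    ultimately show ?thesis by simp
  qed
  define c where "c = (LINT x:I|lebesgue. f x * ?\<theta> x) / m"
  have main: "(LINT x:I|lebesgue. (f x - c) * \<phi> x) = 0" if \<phi>: "test_function I \<phi>" for \<phi>
  proof -
    have s: "smooth \<phi>" and K: "compact (closure {x. \<phi> x \<noteq> 0})" "closure {x. \<phi> x \<noteq> 0} \<subseteq> I"
      using \<phi> by (auto simp: test_function_def)
    \<comment> \<open>chosen so that \<open>b\<close> has integral zero\<close>
    define q where "q = integral {-1..1} \<phi> / m"
    define b where "b x = \<phi> x - q * ?\<theta> x" for x
    have bs: "smooth b" unfolding b_def by (intro smooth_diff s smooth_mult smooth_const \<theta>s)
    obtain \<alpha> \<beta> where ab: "-1 < \<alpha>" "\<alpha> < \<beta>" "\<beta> < 1" and b0: "\<And>x. x \<le> \<alpha> \<or> x \<ge> \<beta> \<Longrightarrow> b x = 0"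
    proof -
      let ?K = "insert (1/2) (insert (-1/2) (closure {x. \<phi> x \<noteq> 0}))"
      have Kc: "compact ?K" "?K \<noteq> {}" using K(1) by (auto intro!: compact_insert)
      obtain s1 where s1: "s1 \<in> ?K" "\<And>x. x \<in> ?K \<Longrightarrow> s1 \<le> x" using compact_attains_inf[OF Kc] by blast
      obtain s2 where s2: "s2 \<in> ?K" "\<And>x. x \<in> ?K \<Longrightarrow> x \<le> s2" using compact_attains_sup[OF Kc] by blast
      have KI: "?K \<subseteq> I" using K(2) by auto
      have "s1 \<in> I" "s2 \<in> I" using KI s1(1) s2(1) by blast+
      moreover have "s1 \<le> -1/2" by (rule s1(2)) simp
      moreover have "1/2 \<le> s2" by (rule s2(2)) simp
      ultimately have i: "-1 < s1" "s2 < 1" "s1 \<le> -1/2" "1/2 \<le> s2" by auto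
      have z: "b x = 0" if x: "x < s1 \<or> x > s2" for x
      proof -
        have "x \<notin> closure {x. \<phi> x \<noteq> 0}" using s1(2)[of x] s2(2)[of x] x by auto
        then have "\<phi> x = 0" using closure_subset[of "{x. \<phi> x \<noteq> 0}"] by auto
        moreover have "?\<theta> x = 0" using x i by (intro \<theta>0) auto
        ultimately show ?thesis by (simp add: b_def)
      qed
      show ?thesis by (rule that[of "(s1 - 1) / 2" "(s2 + 1) / 2"]) (use i in \<open>auto intro!: z\<close>)
    qed
    define X where "X x = integral {-1..x} b" for x
    have bint: "b integrable_on {x..y}" for x y by (intro integrable_continuous_real smooth_continuous bs)
    have Xs: "smooth X" and Xd: "(X has_real_derivative b x) (at x)" for x
      unfolding X_def[abs_def] using smooth_primitive[OF bs, of "-1"] b0 ab by auto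
    have total: "integral {-1..1} b = 0"
    proof -
      have "integral {-1..1} b = integral {-1..1} \<phi> - integral {-1..1} (\<lambda>x. q * ?\<theta> x)"
        unfolding b_def
        by (intro Henstock_Kurzweil_Integration.integral_diff integrable_continuous_real continuous_intros smooth_continuous s \<theta>s)
      also have "\<dots> = 0" using m by (simp add: q_def m_def)
      finally show ?thesis .
    qed
    have X0: "X x = 0" if "x \<notin> {\<alpha>..\<beta>}" for x
    proof (cases "x < \<alpha>")
      case True
      then show ?thesis unfolding X_def using integral_cong[of "{-1..x}" b "\<lambda>_. 0"] b0 by simp
    next
      case False
      then have x: "x > \<beta>" using that by auto
      have z: "integral {\<beta>..y} b = 0" for y using integral_cong[of "{\<beta>..y}" b "\<lambda>_. 0"] b0 by simp
      have "X x = integral {-1..\<beta>} b + integral {\<beta>..x} b"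
        unfolding X_def by (intro Henstock_Kurzweil_Integration.integral_combine[symmetric] bint) (use ab x in auto)
      also have "\<dots> = integral {-1..\<beta>} b + integral {\<beta>..1} b" by (simp add: z)
      also have "\<dots> = integral {-1..1} b"
        by (intro Henstock_Kurzweil_Integration.integral_combine bint) (use ab in auto)
      finally show ?thesis using total by simp
    qed
    have cl: "closure {x. X x \<noteq> 0} \<subseteq> {\<alpha>..\<beta>}" by (rule closure_minimal) (use X0 in blast)+
    then have "compact (closure {x. X x \<noteq> 0})"
      using compact_Int_closed[OF compact_Icc[of \<alpha> \<beta>] closed_closure[of "{x. X x \<noteq> 0}"]] by (simp add: inf.absorb2)
    moreover have "closure {x. X x \<noteq> 0} \<subseteq> I" using cl ab by force
    ultimately have Xt: "test_function I X" using Xs by (simp add: test_function_def)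
    have "(LINT x:I|lebesgue. f x * frechet_derivative X (at x) 1) = - (LINT x:I|lebesgue. 0 * X x)"
      using f Xt unfolding has_weak_deriv_def by blast
    then have "(LINT x:I|lebesgue. f x * b x) = 0"
      by (simp only: frechet_derivative_real[OF Xd] mult_zero_left set_lebesgue_integral_def scaleR_zero_right integral_zero minus_zero)
    moreover have i1: "set_integrable lebesgue I (\<lambda>x. f x * \<phi> x)" and i2: "set_integrable lebesgue I (\<lambda>x. f x * ?\<theta> x)"
      by (rule test_function_integrable[OF li \<phi>], rule test_function_integrable[OF li \<theta>t])
    then have "(LINT x:I|lebesgue. f x * b x) = (LINT x:I|lebesgue. f x * \<phi> x) - q * (LINT x:I|lebesgue. f x * ?\<theta> x)"
      unfolding b_def by (subst set_integral_mult_right[symmetric], subst set_integral_diff(2)[symmetric])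
        (auto simp: algebra_simps)
    moreover have "q * (LINT x:I|lebesgue. f x * ?\<theta> x) = c * integral {-1..1} \<phi>"
      using m by (simp add: q_def c_def)
    moreover have "(LINT x:I|lebesgue. \<phi> x) = integral {-1..1} \<phi>" and i3: "set_integrable lebesgue I \<phi>"
      using set_integral_I[of \<phi>] continuous_on_integrable_I[OF smooth_continuous[OF s]] by (auto simp: set_integrable_I_closed)
    then have "(LINT x:I|lebesgue. (f x - c) * \<phi> x) = (LINT x:I|lebesgue. f x * \<phi> x) - c * integral {-1..1} \<phi>"
      using i1 i3 by (simp add: left_diff_distrib)
    ultimately show ?thesis by simp
  qed
  have "AE x in lebesgue. x \<in> I \<longrightarrow> f x - c = 0"
  proof (rule fundamental_lemma[OF _ _ main])
    have "locally_integrable I (\<lambda>x. 1)"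
      unfolding locally_integrable_def
      by (auto simp: set_integrable_def fmeasurable_def dest!: lmeasurable_compact intro!: integrable_real_indicator)
    from locally_integrable_lincomb[OF li this, of 1 "-c"] show "locally_integrable I (\<lambda>x. f x - c)" by simp
  qed auto
  then show ?thesis by (intro exI[of _ c]) simp
qed


lemma integral_cong_test_function:
  assumes li: "locally_integrable I f" and \<phi>: "test_function I \<phi>"
  shows "(LINT x:I|lebesgue. f x * \<phi> x) = integral {-1..1} (\<lambda>x. f x * \<phi> x)"
  by (rule set_integral_I[OF test_function_integrable[OF li \<phi>]])

lemma L2_on_I_bounded_continuous:
  assumes "continuous_on {-1..1} f"
  shows "L2_on I f"
proof -
  have "(\<lambda>x. indicat_real I x *\<^sub>R f x) \<in> borel_measurable borel"
    by (rule borel_measurable_continuous_on_indicator[OF _ continuous_on_subset[OF assms]]) auto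
  then have "set_borel_measurable lebesgue I f"
    unfolding set_borel_measurable_def by (intro measurable_completion) simp
  moreover have "set_integrable lebesgue I (\<lambda>x. (f x)\<^sup>2)"
    unfolding set_integrable_I_closed by (intro continuous_on_integrable_I continuous_intros assms)
  ultimately show ?thesis unfolding L2_on_def by simp
qed

lemma set_integrable_locally_integrable:
  fixes f :: "real \<Rightarrow> real"
  assumes "set_integrable lebesgue I f"
  shows "locally_integrable I f"
  unfolding locally_integrable_def
proof (intro allI impI)
  fix K :: "real set" assume K: "compact K \<and> K \<subseteq> I"
  then have "K \<in> sets lebesgue" using lmeasurable_compact by blast
  then show "set_integrable lebesgue K f" using set_integrable_subset[OF assms] K by blast
qed

lemma primitive_continuous:
  "set_integrable lebesgue {-1..1} g \<Longrightarrow> continuous_on {-1..1} (\<lambda>x. integral {-1..x} g)" for g :: "real \<Rightarrow> real"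
  by (rule indefinite_integral_continuous_1) (rule set_lebesgue_integral_eq_integral(1))

lemma has_weak_deriv_primitive:
  assumes g: "set_integrable lebesgue I g"
  shows "has_weak_deriv I 1 (\<lambda>x. integral {-1..x} g) g"
proof -
  let ?P = "\<lambda>x. integral {-1..x} g"
  have gJ: "set_integrable lebesgue {-1..1} g" using g by (simp add: set_integrable_I_closed)
  note cP = primitive_continuous[OF gJ]
  have liP: "locally_integrable I ?P"
    by (rule set_integrable_locally_integrable) (simp only: set_integrable_I_closed continuous_on_integrable_I[OF cP])
  have lig: "locally_integrable I g" by (rule set_integrable_locally_integrable[OF g])
  have "(LINT x:I|lebesgue. ?P x * frechet_derivative \<phi> (at x) 1) = - (LINT x:I|lebesgue. g x * \<phi> x)"
    if \<phi>: "test_function I \<phi>" for \<phi>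
  proof -
    have s: "smooth \<phi>" and sub: "closure {x. \<phi> x \<noteq> 0} \<subseteq> I" using \<phi> by (auto simp: test_function_def)
    have "1 \<notin> closure {x. \<phi> x \<noteq> 0}" using sub by auto
    then have \<phi>1: "\<phi> 1 = 0" using closure_subset[of "{x. \<phi> x \<noteq> 0}"] by blast
    have d: "(\<phi> has_real_derivative frechet_derivative \<phi> (at x) 1) (at x within A)" for x A
      by (rule has_field_derivative_at_within[OF smooth_real_derivative[OF s]])
    have "integral {-1..1} (\<lambda>x. ?P x * frechet_derivative \<phi> (at x) 1) = - integral {-1..1} (\<lambda>x. g x * \<phi> x)"
      by (rule integral_parts_primitive[OF gJ d smooth_continuous[OF smooth_frechet_derivative[OF s]] \<phi>1])
    then show ?thesis
      using integral_cong_test_function[OF liP test_function_frechet[OF \<phi>]] integral_cong_test_function[OF lig \<phi>] by simp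
  qed
  then show ?thesis using liP lig by (simp add: has_weak_deriv_def)
qed

lemma weak_deriv_imp_primitive:
  assumes f: "has_weak_deriv I 1 f g" and g: "L2_on I g"
  shows "\<exists>c. AE x in lebesgue. x \<in> I \<longrightarrow> f x = c + integral {-1..x} g"
proof -
  have "has_weak_deriv I 1 (\<lambda>x. f x - integral {-1..x} g) (\<lambda>x. g x - g x)"
    by (rule has_weak_deriv_diff[OF f has_weak_deriv_primitive[OF L2_on_I_integrable(1)[OF g]]])
  then obtain c where c: "AE x in lebesgue. x \<in> I \<longrightarrow> f x - integral {-1..x} g = c"
    using weak_deriv_zero_constant by auto
  have "AE x in lebesgue. x \<in> I \<longrightarrow> f x = c + integral {-1..x} g"
    using c by eventually_elim auto
  then show ?thesis by blast
qed

lemma continuous_AE_eq: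
  fixes f g :: "real \<Rightarrow> real"
  assumes c: "continuous_on {-1..1} f" "continuous_on {-1..1} g" and ae: "AE x in lebesgue. x \<in> I \<longrightarrow> f x = g x"
    and x: "x \<in> {-1..1}"
  shows "f x = g x"
proof -
  have cd: "continuous_on {-1..1} (\<lambda>x. f x - g x)" by (intro continuous_intros c)
  have "open {x \<in> I. f x - g x \<in> - {0}}"
    by (rule continuous_open_preimage[OF continuous_on_subset[OF cd], unfolded vimage_def Int_def, simplified]) auto
  moreover have "negligible {x \<in> I. f x - g x \<in> - {0}}"
  proof -
    have "AE x in lebesgue. x \<notin> {x \<in> I. f x - g x \<in> - {0}}" using ae by eventually_elim auto
    then show ?thesis unfolding negligible_iff_null_sets by (subst completion.null_sets_iff_AE) auto
  qed
  ultimately have "{x \<in> I. f x - g x \<in> - {0}} = {}" using open_not_negligible by blast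
  then have z: "f x - g x = 0" if "x \<in> I" for x using that by auto
  have cl: "closure I = {-1..1}" by simp
  show ?thesis
    using continuous_constant_on_closure[of I "\<lambda>x. f x - g x" 0 x] cd z x unfolding cl by auto
qed

text \<open>The regularity of a function in \<open>H\<^sup>4(I)\<close>: three classical derivatives on the closed
  interval, the third one being a primitive of the fourth weak derivative.\<close>

definition H4_rep :: "(real \<Rightarrow> real) \<Rightarrow> (real \<Rightarrow> real) \<Rightarrow> (real \<Rightarrow> real) \<Rightarrow> (real \<Rightarrow> real) \<Rightarrow> (real \<Rightarrow> real) \<Rightarrow> bool" where
  "H4_rep v v1 v2 v3 v4 \<longleftrightarrow>
     (\<forall>x\<in>{-1..1}. (v has_real_derivative v1 x) (at x within {-1..1}) \<and>
        (v1 has_real_derivative v2 x) (at x within {-1..1}) \<and>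
        (v2 has_real_derivative v3 x) (at x within {-1..1})) \<and>
     continuous_on {-1..1} v3 \<and> L2_on I v4 \<and> (\<exists>c. \<forall>x\<in>{-1..1}. v3 x = c + integral {-1..x} v4)"

lemma primitive_derivative:
  fixes g :: "real \<Rightarrow> real"
  assumes "continuous_on {-1..1} g" "x \<in> {-1..1}"
  shows "((\<lambda>x. c + integral {-1..x} g) has_real_derivative g x) (at x within {-1..1})"
  using DERIV_add[OF DERIV_const integral_has_real_derivative[OF assms]] by simp

text \<open>Each weak derivative is almost everywhere the primitive of the next one, so regularity climbs down
  from the fourth derivative to the function itself, which agrees with its primitive everywhere by
  continuity.\<close>

lemma H4_rep_exists:
  assumes "H4 v"
  shows "\<exists>v1 v2 v3. H4_rep v v1 v2 v3 ((dx1 ^^ 4) v) \<and>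
    (AE x in lebesgue. x \<in> I \<longrightarrow> dx1 v x = v1 x) \<and> (AE x in lebesgue. x \<in> I \<longrightarrow> (dx1 ^^ 2) v x = v2 x)"
proof -
  have oI: "open I" and B: "(1::real) \<in> Basis" by auto
  have s4: "sobolev (Suc (Suc (Suc (Suc 0)))) I v" and cv: "continuous_on {-1..1} v"
    using assms by (simp_all add: H4_def numeral_eq_Suc del: sobolev.simps)
  note w1 = sobolev_weak_deriv[OF oI s4 B]
  note w2 = sobolev_weak_deriv[OF oI w1(2) B]
  note w3 = sobolev_weak_deriv[OF oI w2(2) B]
  note w4 = sobolev_weak_deriv[OF oI w3(2) B]
  define d4 where "d4 = dx1 (dx1 (dx1 (dx1 v)))"
  have d4: "(dx1 ^^ 4) v = d4" and d2: "(dx1 ^^ 2) v = dx1 (dx1 v)" by (simp_all add: d4_def numeral_eq_Suc)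
  have L4: "L2_on I d4" using sobolev_L2[OF w4(2)] by (simp add: d4_def)
  obtain c3 where c3: "AE x in lebesgue. x \<in> I \<longrightarrow> dx1 (dx1 (dx1 v)) x = c3 + integral {-1..x} d4"
    using weak_deriv_imp_primitive[OF w4(1) sobolev_L2[OF w4(2)]] unfolding d4_def by blast
  define v3 where "v3 x = c3 + integral {-1..x} d4" for x
  have cv3: "continuous_on {-1..1} v3"
    unfolding v3_def by (intro continuous_intros primitive_continuous L2_on_I_integrable(2) L4)
  have refl: "AE x in lebesgue. x \<in> I \<longrightarrow> f x = f x" for f :: "real \<Rightarrow> real" by simp
  obtain c2 where c2: "AE x in lebesgue. x \<in> I \<longrightarrow> dx1 (dx1 v) x = c2 + integral {-1..x} v3"
    using weak_deriv_imp_primitive[OF has_weak_deriv_cong_AE[OF w3(1) refl c3[folded v3_def]] L2_on_I_bounded_continuous[OF cv3]] by blast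
  define v2 where "v2 x = c2 + integral {-1..x} v3" for x
  have dv2: "(v2 has_real_derivative v3 x) (at x within {-1..1})" if "x \<in> {-1..1}" for x
    unfolding v2_def[abs_def] by (rule primitive_derivative[OF cv3 that])
  have cv2: "continuous_on {-1..1} v2" by (rule DERIV_continuous_on[OF dv2])
  obtain c1 where c1: "AE x in lebesgue. x \<in> I \<longrightarrow> dx1 v x = c1 + integral {-1..x} v2"
    using weak_deriv_imp_primitive[OF has_weak_deriv_cong_AE[OF w2(1) refl c2[folded v2_def]] L2_on_I_bounded_continuous[OF cv2]] by blast
  define v1 where "v1 x = c1 + integral {-1..x} v2" for x
  have dv1: "(v1 has_real_derivative v2 x) (at x within {-1..1})" if "x \<in> {-1..1}" for x
    unfolding v1_def[abs_def] by (rule primitive_derivative[OF cv2 that])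
  have cv1: "continuous_on {-1..1} v1" by (rule DERIV_continuous_on[OF dv1])
  obtain c0 where c0: "AE x in lebesgue. x \<in> I \<longrightarrow> v x = c0 + integral {-1..x} v1"
    using weak_deriv_imp_primitive[OF has_weak_deriv_cong_AE[OF w1(1) refl c1[folded v1_def]] L2_on_I_bounded_continuous[OF cv1]] by blast
  have p0: "((\<lambda>x. c0 + integral {-1..x} v1) has_real_derivative v1 x) (at x within {-1..1})" if "x \<in> {-1..1}" for x
    by (rule primitive_derivative[OF cv1 that])
  have veq: "v x = c0 + integral {-1..x} v1" if "x \<in> {-1..1}" for x
    by (rule continuous_AE_eq[OF cv DERIV_continuous_on[OF p0] c0 that])
  have dv: "(v has_real_derivative v1 x) (at x within {-1..1})" if x: "x \<in> {-1..1}" for x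
    by (rule has_field_derivative_transform_within[OF p0[OF x], of 1]) (use x veq in auto)
  have "H4_rep v v1 v2 v3 d4"
    unfolding H4_rep_def using dv dv1 dv2 cv3 L4 v3_def by blast
  then show ?thesis unfolding d4 d2 using c1 c2 by (intro exI[of _ v1] exI[of _ v2] exI[of _ v3]) (simp add: v1_def v2_def)
qed

lemma H4_repD:
  assumes "H4_rep v v1 v2 v3 v4"
  shows "x \<in> {-1..1} \<Longrightarrow> (v has_real_derivative v1 x) (at x within {-1..1})"
    "x \<in> {-1..1} \<Longrightarrow> (v1 has_real_derivative v2 x) (at x within {-1..1})"
    "x \<in> {-1..1} \<Longrightarrow> (v2 has_real_derivative v3 x) (at x within {-1..1})"
    "continuous_on {-1..1} v" "continuous_on {-1..1} v1" "continuous_on {-1..1} v2" "continuous_on {-1..1} v3"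
    "L2_on I v4" "set_integrable lebesgue {-1..1} v4"
proof -
  show d: "x \<in> {-1..1} \<Longrightarrow> (v has_real_derivative v1 x) (at x within {-1..1})"
    "x \<in> {-1..1} \<Longrightarrow> (v1 has_real_derivative v2 x) (at x within {-1..1})"
    "x \<in> {-1..1} \<Longrightarrow> (v2 has_real_derivative v3 x) (at x within {-1..1})" for x
    using assms by (auto simp: H4_rep_def)
  show "continuous_on {-1..1} v" "continuous_on {-1..1} v1" "continuous_on {-1..1} v2"
    using d by (blast intro: DERIV_continuous_on)+
  show "continuous_on {-1..1} v3" using assms by (auto simp: H4_rep_def)
  show L: "L2_on I v4" using assms by (auto simp: H4_rep_def)
  show "set_integrable lebesgue {-1..1} v4" by (rule L2_on_I_integrable(2)[OF L])
qed

lemma integral_by_parts_I: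
  fixes f g f' g' :: "real \<Rightarrow> real"
  assumes f: "\<And>x. x \<in> {-1..1} \<Longrightarrow> (f has_real_derivative f' x) (at x within {-1..1})"
    and g: "\<And>x. x \<in> {-1..1} \<Longrightarrow> (g has_real_derivative g' x) (at x within {-1..1})"
    and c: "continuous_on {-1..1} f'" "continuous_on {-1..1} g'" and f0: "f (-1) = 0" "f 1 = 0"
  shows "integral {-1..1} (\<lambda>x. f' x * g x) = - integral {-1..1} (\<lambda>x. f x * g' x)"
proof -
  have cf: "continuous_on {-1..1} f" and cg: "continuous_on {-1..1} g"
    using DERIV_continuous_on[OF f] DERIV_continuous_on[OF g] by blast+
  have "((\<lambda>x. f' x * g x + f x * g' x) has_integral (f 1 * g 1 - f (-1) * g (-1))) {-1..1}"
  proof (rule fundamental_theorem_of_calculus)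
    fix x :: real assume "x \<in> {-1..1}"
    from DERIV_mult[OF f[OF this] g[OF this]]
    show "((\<lambda>x. f x * g x) has_vector_derivative f' x * g x + f x * g' x) (at x within {-1..1})"
      by (simp add: has_real_derivative_iff_has_vector_derivative[symmetric] mult.commute add.commute)
  qed simp
  then have "integral {-1..1} (\<lambda>x. f' x * g x + f x * g' x) = 0" using f0 by (simp add: integral_unique)
  moreover have "integral {-1..1} (\<lambda>x. f' x * g x + f x * g' x)
      = integral {-1..1} (\<lambda>x. f' x * g x) + integral {-1..1} (\<lambda>x. f x * g' x)"
    by (intro Henstock_Kurzweil_Integration.integral_add integrable_continuous_real continuous_intros c cf cg)
  ultimately show ?thesis by simp
qed

text \<open>The two partial integrations behind the derivatives of the stretching and of the bending energy.\<close>

lemma H4_rep_parts: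
  assumes w: "H4_rep w w1 w2 w3 w4" and S: "H4_rep S S1 S2 S3 S4"
    and w0: "w (-1) = 0" "w 1 = 0" and w10: "w1 (-1) = 0" "w1 1 = 0"
  shows "integral {-1..1} (\<lambda>x. w1 x * S1 x) = - integral {-1..1} (\<lambda>x. w x * S2 x)"
    "integral {-1..1} (\<lambda>x. w2 x * S2 x) = integral {-1..1} (\<lambda>x. w x * S4 x)"
proof -
  note W = H4_repD[OF w] and T = H4_repD[OF S]
  show "integral {-1..1} (\<lambda>x. w1 x * S1 x) = - integral {-1..1} (\<lambda>x. w x * S2 x)"
    by (rule integral_by_parts_I[OF W(1) T(2) W(5) T(6) w0])
  have e1: "integral {-1..1} (\<lambda>x. w2 x * S2 x) = - integral {-1..1} (\<lambda>x. w1 x * S3 x)"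
    by (rule integral_by_parts_I[OF W(2) T(3) W(6) T(7) w10])
  obtain c where c: "\<forall>x\<in>{-1..1}. S3 x = c + integral {-1..x} S4" using S by (auto simp: H4_rep_def)
  have "integral {-1..1} (\<lambda>x. w1 x * S3 x) = integral {-1..1} (\<lambda>x. c * w1 x + integral {-1..x} S4 * w1 x)"
    by (rule Henstock_Kurzweil_Integration.integral_cong) (use c in \<open>simp add: algebra_simps\<close>)
  also have "\<dots> = c * integral {-1..1} w1 + integral {-1..1} (\<lambda>x. integral {-1..x} S4 * w1 x)"
    by (subst Henstock_Kurzweil_Integration.integral_add)
      (auto intro!: integrable_continuous_real continuous_intros W(5) primitive_continuous[OF T(9)])
  also have "integral {-1..1} w1 = 0"
  proof -
    have "(w1 has_integral (w 1 - w (-1))) {-1..1}"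
      by (rule fundamental_theorem_of_calculus)
        (use W(1) in \<open>simp_all add: has_real_derivative_iff_has_vector_derivative[symmetric]\<close>)
    then show ?thesis using w0 by (simp add: integral_unique)
  qed
  also have "integral {-1..1} (\<lambda>x. integral {-1..x} S4 * w1 x) = - integral {-1..1} (\<lambda>x. S4 x * w x)"
    by (rule integral_parts_primitive[OF T(9) W(1) W(5) w0(2)])
  finally show "integral {-1..1} (\<lambda>x. w2 x * S2 x) = integral {-1..1} (\<lambda>x. w x * S4 x)"
    unfolding e1 by (simp add: mult.commute)
qed

section \<open>The domains below a profile\<close>

text \<open>An admissible deflection: its derivative is carried along as a function, and the gap \<open>1 +
  v\<close> is positive on the closed interval, hence bounded away from zero.\<close>

definition profile :: "(real \<Rightarrow> real) \<Rightarrow> (real \<Rightarrow> real) \<Rightarrow> bool" where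
  "profile v v1 \<longleftrightarrow> (\<forall>x\<in>{-1..1}. v x > -1 \<and> (v has_real_derivative v1 x) (at x within {-1..1})) \<and>
     continuous_on {-1..1} v1"

lemma profileD:
  assumes "profile v v1"
  shows "x \<in> {-1..1} \<Longrightarrow> v x > -1" "x \<in> {-1..1} \<Longrightarrow> (v has_real_derivative v1 x) (at x within {-1..1})"
    "x \<in> I \<Longrightarrow> (v has_real_derivative v1 x) (at x)" "continuous_on {-1..1} v1" "continuous_on {-1..1} v"
proof -
  show 1: "x \<in> {-1..1} \<Longrightarrow> v x > -1" "x \<in> {-1..1} \<Longrightarrow> (v has_real_derivative v1 x) (at x within {-1..1})"
    "continuous_on {-1..1} v1" for x
    using assms by (auto simp: profile_def)
  show "continuous_on {-1..1} v" by (rule DERIV_continuous_on[OF 1(2)])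
  show "(v has_real_derivative v1 x) (at x)" if "x \<in> I"
    using 1(2)[of x] that by (simp add: at_within_Icc_at)
qed

lemma bounded_on_I:
  fixes f :: "real \<Rightarrow> real"
  assumes "continuous_on {-1..1} f"
  obtains C where "C \<ge> 0" "\<And>x. x \<in> {-1..1} \<Longrightarrow> \<bar>f x\<bar> \<le> C"
proof -
  have "compact (f ` {-1..1})" by (rule compact_continuous_image[OF assms]) simp
  from compact_imp_bounded[OF this] obtain B where B: "\<forall>x\<in>{-1..1}. \<bar>f x\<bar> \<le> B" by (auto simp: bounded_iff)
  moreover have "0 \<le> B" using B by (metis abs_ge_zero atLeastAtMost_iff order_trans zero_le_one neg_le_0_iff_le)
  ultimately show ?thesis using that by blast
qed

lemma open_Omega:
  assumes "continuous_on {-1..1} v"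
  shows "open (Omega v)"
proof -
  let ?T = "I \<times> {-1<..} :: (real \<times> real) set"
  have "continuous_on ?T (\<lambda>p. v (fst p) - snd p)"
    by (intro continuous_intros continuous_on_compose2[OF assms]) auto
  then have "open (?T \<inter> (\<lambda>p. v (fst p) - snd p) -` {0<..})"
    by (rule continuous_open_preimage) (auto intro: open_Times)
  moreover have "?T \<inter> (\<lambda>p. v (fst p) - snd p) -` {0<..} = Omega v" by (auto simp: Omega_def)
  ultimately show ?thesis by simp
qed

definition closed_Omega :: "(real \<Rightarrow> real) \<Rightarrow> (real \<times> real) set" where
  "closed_Omega v = {(x, z). x \<in> {-1..1} \<and> -1 \<le> z \<and> z \<le> v x}"

lemma compact_closed_Omega:
  assumes "continuous_on {-1..1} v"
  shows "compact (closed_Omega v)"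
proof -
  obtain C where C: "\<And>x. x \<in> {-1..1} \<Longrightarrow> \<bar>v x\<bar> \<le> C" using bounded_on_I[OF assms] by blast
  let ?T = "{-1..1} \<times> {-1..C} :: (real \<times> real) set"
  have "closed ?T" by (intro closed_Times) auto
  moreover have "continuous_on ?T (\<lambda>p. v (fst p) - snd p)"
    by (intro continuous_intros continuous_on_compose2[OF assms]) auto
  ultimately have "closed (?T \<inter> (\<lambda>p. v (fst p) - snd p) -` {0..})"
    by (intro continuous_closed_preimage) auto
  moreover have "?T \<inter> (\<lambda>p. v (fst p) - snd p) -` {0..} = closed_Omega v"
    using C by (force simp: closed_Omega_def abs_le_iff)
  moreover have "compact ?T" by (intro compact_Times) auto
  ultimately show ?thesis using compact_Int_closed[of ?T "closed_Omega v"] by (metis inf.left_idem)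
qed

lemma Omega_subset_closed: "Omega v \<subseteq> closed_Omega v"
  by (auto simp: Omega_def closed_Omega_def)

lemma closure_Omega:
  assumes "continuous_on {-1..1} v"
  shows "closure (Omega v) \<subseteq> closed_Omega v"
  by (rule closure_minimal[OF Omega_subset_closed compact_imp_closed[OF compact_closed_Omega[OF assms]]])

lemma bounded_Omega: "continuous_on {-1..1} v \<Longrightarrow> bounded (Omega v)"
  using bounded_subset[OF compact_imp_bounded[OF compact_closed_Omega] Omega_subset_closed] .

lemma frontier_Omega: "continuous_on {-1..1} v \<Longrightarrow> frontier (Omega v) = closure (Omega v) - Omega v"
  using open_Omega by (simp add: frontier_def interior_open)

lemma Omega_sets: "continuous_on {-1..1} v \<Longrightarrow> Omega v \<in> sets lebesgue"
  by (rule lmeasurable_open[OF bounded_Omega open_Omega, THEN fmeasurableD])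

lemma finite_measure_Omega: "continuous_on {-1..1} v \<Longrightarrow> finite_measure (lebesgue_on (Omega v))"
  by (rule finite_measure_lebesgue_on[OF lmeasurable_open[OF bounded_Omega open_Omega]])

text \<open>A potential with all the regularity that is used: classical derivatives in the open domain,
  square integrable first derivatives and a continuous extension to the boundary.\<close>

definition classical_potential where
  "classical_potential \<epsilon> v \<psi> \<psi>x \<psi>z \<psi>xx \<psi>xz \<psi>zz \<longleftrightarrow>
     C1_grad (Omega v) \<psi> \<psi>x \<psi>z \<and> C1_grad (Omega v) \<psi>x \<psi>xx \<psi>xz \<and> C1_grad (Omega v) \<psi>z \<psi>xz \<psi>zz \<and>
     (\<forall>q\<in>Omega v. \<epsilon>\<^sup>2 * \<psi>xx q + \<psi>zz q = 0) \<and>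
     continuous_on (closure (Omega v)) \<psi> \<and>
     (\<forall>(x, z)\<in>frontier (Omega v). \<psi> (x, z) = (1 + z) / (1 + v x)) \<and>
     L2_on (Omega v) \<psi>x \<and> L2_on (Omega v) \<psi>z"

definition dirichlet :: "real \<Rightarrow> (real \<Rightarrow> real) \<Rightarrow> (real \<times> real \<Rightarrow> real) \<Rightarrow> (real \<times> real \<Rightarrow> real) \<Rightarrow> real" where
  "dirichlet \<epsilon> v fx fz = (LINT q|lebesgue_on (Omega v). \<epsilon>\<^sup>2 * (fx q)\<^sup>2 + (fz q)\<^sup>2)"

lemma integral_lborel_lebesgue_on:
  fixes f :: "'a::euclidean_space \<Rightarrow> real"
  assumes S: "S \<in> sets borel" and m: "(\<lambda>q. indicator S q * f q) \<in> borel_measurable borel"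
  shows "integrable (lebesgue_on S) f \<longleftrightarrow> integrable lborel (\<lambda>q. indicator S q * f q)"
    "integral\<^sup>L (lebesgue_on S) f = (LINT q|lborel. indicator S q * f q)"
proof -
  have "S \<in> sets lebesgue" using S by simp
  then show "integrable (lebesgue_on S) f \<longleftrightarrow> integrable lborel (\<lambda>q. indicator S q * f q)"
    "integral\<^sup>L (lebesgue_on S) f = (LINT q|lborel. indicator S q * f q)"
    using integrable_completion[of "\<lambda>q. indicator S q * f q" lborel] integral_completion[of "\<lambda>q. indicator S q * f q" lborel] m
    by (simp_all add: integrable_restrict_space integral_restrict_space)
qed

lemma continuous_measurable_Omega:
  assumes "continuous_on {-1..1} v" "continuous_on (Omega v) f"
  shows "(f :: _ \<Rightarrow> real) \<in> borel_measurable (lebesgue_on (Omega v))"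
  using continuous_imp_measurable_on_sets_lebesgue[OF assms(2) Omega_sets[OF assms(1)]] .

lemma continuous_on_Omega_fst:
  assumes "continuous_on {-1..1} f"
  shows "continuous_on (Omega v) (\<lambda>q. f (fst q))"
  by (rule continuous_on_compose2[OF assms continuous_on_fst[OF continuous_on_id]]) (auto simp: Omega_def)

section \<open>Potentials are classical solutions\<close>

text \<open>Both mixed derivatives are, at nearby points, the second difference over a small square, by the mean
  value theorem applied in either order.\<close>

lemma mixed_derivatives_commute:
  fixes f :: "real \<times> real \<Rightarrow> real"
  assumes f: "smooth f"
  shows "frechet_derivative (\<lambda>q. frechet_derivative f (at q) (1, 0)) (at p) (0, 1)
    = frechet_derivative (\<lambda>q. frechet_derivative f (at q) (0, 1)) (at p) (1, 0)"
proof -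
  obtain a b where p: "p = (a, b)" by (cases p)
  define fx where "fx q = frechet_derivative f (at q) (1, 0)" for q
  define fz where "fz q = frechet_derivative f (at q) (0, 1)" for q
  define fxz where "fxz q = frechet_derivative fx (at q) (0, 1)" for q
  define fzx where "fzx q = frechet_derivative fz (at q) (1, 0)" for q
  have sx: "smooth fx" and sz: "smooth fz" unfolding fx_def fz_def by (rule smooth_frechet_derivative[OF f])+
  have dx: "((\<lambda>x. f (x, z)) has_real_derivative fx (x, z)) (at x)" for x z
    using has_derivative_partials(1)[OF smooth_has_derivative[OF f]] by (simp add: fx_def)
  have dz: "((\<lambda>z. f (x, z)) has_real_derivative fz (x, z)) (at z)" for x z
    using has_derivative_partials(2)[OF smooth_has_derivative[OF f]] by (simp add: fz_def)
  have dxz: "((\<lambda>z. fx (x, z)) has_real_derivative fxz (x, z)) (at z)" for x z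
    using has_derivative_partials(2)[OF smooth_has_derivative[OF sx]] by (simp add: fxz_def)
  have dzx: "((\<lambda>x. fz (x, z)) has_real_derivative fzx (x, z)) (at x)" for x z
    using has_derivative_partials(1)[OF smooth_has_derivative[OF sz]] by (simp add: fzx_def)
  have c1: "continuous_on UNIV fxz" unfolding fxz_def by (rule smooth_continuous[OF smooth_frechet_derivative[OF sx]])
  have c2: "continuous_on UNIV fzx" unfolding fzx_def by (rule smooth_continuous[OF smooth_frechet_derivative[OF sz]])
  have mvt: "\<exists>P Q. dist P p \<le> 2 * h \<and> dist Q p \<le> 2 * h \<and> fxz P = fzx Q" if h: "h > 0" for h
  proof -
    have "((\<lambda>x. f (x, b + h) - f (x, b)) has_real_derivative fx (x, b + h) - fx (x, b)) (at x)" for x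
      by (intro DERIV_diff dx)
    then obtain \<xi> where \<xi>: "a < \<xi>" "\<xi> < a + h"
      and e1: "(f (a + h, b + h) - f (a + h, b)) - (f (a, b + h) - f (a, b)) = (a + h - a) * (fx (\<xi>, b + h) - fx (\<xi>, b))"
      using MVT2[of a "a + h" "\<lambda>x. f (x, b + h) - f (x, b)" "\<lambda>x. fx (x, b + h) - fx (x, b)"] h by auto
    obtain \<eta> where \<eta>: "b < \<eta>" "\<eta> < b + h" and e2: "fx (\<xi>, b + h) - fx (\<xi>, b) = (b + h - b) * fxz (\<xi>, \<eta>)"
      using MVT2[of b "b + h" "\<lambda>z. fx (\<xi>, z)" "\<lambda>z. fxz (\<xi>, z)"] dxz h by auto
    have "((\<lambda>z. f (a + h, z) - f (a, z)) has_real_derivative fz (a + h, z) - fz (a, z)) (at z)" for z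
      by (intro DERIV_diff dz)
    then obtain \<eta>' where \<eta>': "b < \<eta>'" "\<eta>' < b + h"
      and e3: "(f (a + h, b + h) - f (a, b + h)) - (f (a + h, b) - f (a, b)) = (b + h - b) * (fz (a + h, \<eta>') - fz (a, \<eta>'))"
      using MVT2[of b "b + h" "\<lambda>z. f (a + h, z) - f (a, z)" "\<lambda>z. fz (a + h, z) - fz (a, z)"] h by auto
    obtain \<xi>' where \<xi>': "a < \<xi>'" "\<xi>' < a + h" and e4: "fz (a + h, \<eta>') - fz (a, \<eta>') = (a + h - a) * fzx (\<xi>', \<eta>')"
      using MVT2[of a "a + h" "\<lambda>x. fz (x, \<eta>')" "\<lambda>x. fzx (x, \<eta>')"] dzx h by auto
    have "h * (h * fxz (\<xi>, \<eta>)) = h * (h * fzx (\<xi>', \<eta>'))"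
      using e1 e3 unfolding e2 e4 add_diff_cancel_left' by linarith
    then have "fxz (\<xi>, \<eta>) = fzx (\<xi>', \<eta>')" using h by simp
    moreover have "dist (s, t) p \<le> 2 * h" if "a < s" "s < a + h" "b < t" "t < b + h" for s t
    proof -
      have "norm (s - a, t - b) \<le> \<bar>s - a\<bar> + \<bar>t - b\<bar>" using norm_Pair_le[of "s - a" "t - b"] by simp
      then show ?thesis using that by (simp add: dist_norm p)
    qed
    ultimately show ?thesis using \<xi> \<eta> \<xi>' \<eta>' by blast
  qed
  have "fxz p = fzx p"
  proof (rule ccontr)
    assume ne: "fxz p \<noteq> fzx p"
    define e where "e = \<bar>fxz p - fzx p\<bar> / 2"
    have e: "e > 0" using ne by (simp add: e_def)
    obtain d1 where d1: "d1 > 0" "\<And>q. dist q p < d1 \<Longrightarrow> dist (fxz q) (fxz p) < e"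
      using c1 e unfolding continuous_on_iff by (metis UNIV_I)
    obtain d2 where d2: "d2 > 0" "\<And>q. dist q p < d2 \<Longrightarrow> dist (fzx q) (fzx p) < e"
      using c2 e unfolding continuous_on_iff by (metis UNIV_I)
    obtain P Q where PQ: "dist P p \<le> 2 * (min d1 d2 / 4)" "dist Q p \<le> 2 * (min d1 d2 / 4)" "fxz P = fzx Q"
      using mvt[of "min d1 d2 / 4"] d1(1) d2(1) by auto
    have c: "dist (fxz P) (fxz p) < e" "dist (fzx Q) (fzx p) < e"
      using PQ d1 d2 by (intro d1(2) d2(2); linarith)+
    have "\<bar>fxz p - fzx p\<bar> \<le> dist (fxz P) (fxz p) + dist (fzx Q) (fzx p)"
      using PQ(3) unfolding dist_real_def by linarith
    also have "\<dots> < e + e" by (rule add_strict_mono[OF c])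
    also have "e + e = \<bar>fxz p - fzx p\<bar>" by (simp add: e_def)
    finally show False by simp
  qed
  then show ?thesis unfolding fxz_def fzx_def fx_def fz_def .
qed

lemma C1_grad_has_weak_deriv:
  assumes S: "open S" and f: "C1_grad S f fx fz"
  shows "has_weak_deriv S (1, 0) f fx" "has_weak_deriv S (0, 1) f fz"
proof -
  note C = C1_gradD[OF f]
  have li: "locally_integrable S g" if "continuous_on S g" for g :: "real \<times> real \<Rightarrow> real"
    unfolding locally_integrable_def
  proof (intro allI impI)
    fix K assume K: "compact K \<and> K \<subseteq> S"
    have cK: "continuous_on K g" using that K continuous_on_subset by blast
    have "integrable lborel (\<lambda>q. indicator K q *\<^sub>R g q)" using K cK by (intro borel_integrable_compact) auto
    moreover have "(\<lambda>q. indicator K q *\<^sub>R g q) \<in> borel_measurable lborel"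
      using calculation by (rule borel_measurable_integrable)
    ultimately show "set_integrable lebesgue K g"
      unfolding set_integrable_def by (simp add: integrable_completion)
  qed
  have parts: "(LINT q:S|lebesgue. f q * frechet_derivative \<phi> (at q) e) = - (LINT q:S|lebesgue. g q * \<phi> q)"
    if \<phi>: "test_function S \<phi>" and cg: "continuous_on S g" and e: "e \<in> Basis"
      and fe: "\<And>q. q \<in> S \<Longrightarrow> fx q * fst e + fz q * snd e = g q" for \<phi> g e
  proof -
    let ?K = "closure {q. \<phi> q \<noteq> 0}"
    have s: "smooth \<phi>" and K: "compact ?K" "?K \<subseteq> S" using \<phi> by (auto simp: test_function_def)
    have \<phi>0: "q \<notin> ?K \<Longrightarrow> \<phi> q = 0" for q using closure_subset[of "{q. \<phi> q \<noteq> 0}"] by auto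
    have d\<phi>0: "q \<notin> ?K \<Longrightarrow> frechet_derivative \<phi> (at q) = (\<lambda>v. 0)" for q
      by (rule frechet_derivative_eq_0_outside_support)
    define D where "D q h = (if q \<in> S then f q * frechet_derivative \<phi> (at q) h + (fx q * fst h + fz q * snd h) * \<phi> q else 0)" for q h
    have der: "((\<lambda>q. if q \<in> S then f q * \<phi> q else 0) has_derivative D q) (at q)" for q
    proof (cases "q \<in> S")
      case True
      have fd: "(f has_derivative (\<lambda>h. fx q * fst h + fz q * snd h)) (at q)" using f True by (simp add: C1_grad_def)
      have "((\<lambda>q. f q * \<phi> q) has_derivative D q) (at q)"
        using has_derivative_mult[OF fd smooth_has_derivative[OF s, of q]] True unfolding D_def[abs_def] by simp
      then show ?thesis by (rule has_derivative_transform_within_open[OF _ S True]) auto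
    next
      case False
      then have "q \<in> - ?K" using K(2) by auto
      have "((\<lambda>q. 0) has_derivative D q) (at q)" using False unfolding D_def[abs_def] by simp
      then show ?thesis
      proof (rule has_derivative_transform_within_open[OF _ open_Compl[OF closed_closure] \<open>q \<in> - ?K\<close>])
        fix y assume "y \<in> - ?K"
        then have "\<phi> y = 0" by (intro \<phi>0) simp
        then show "0 = (if y \<in> S then f y * \<phi> y else 0)" by simp
      qed
    qed
    have cD: "continuous_on UNIV (\<lambda>q. D q e)"
      unfolding D_def
    proof (rule continuous_on_extend_zero[OF S closed_closure K(2)])
      show "continuous_on S (\<lambda>q. f q * frechet_derivative \<phi> (at q) e + (fx q * fst e + fz q * snd e) * \<phi> q)"
        by (intro continuous_on_add continuous_on_mult continuous_on_const C(1,2,3)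
            smooth_continuous[OF smooth_frechet_derivative[OF s]] smooth_continuous[OF s])
      fix q assume q: "q \<notin> ?K"
      show "f q * frechet_derivative \<phi> (at q) e + (fx q * fst e + fz q * snd e) * \<phi> q = 0"
        unfolding d\<phi>0[OF q] \<phi>0[OF q] by simp
    qed
    have z: "(LINT q|lborel. D q e) = 0"
    proof (rule integral_directional_derivative_zero[OF der cD e K(1)])
      fix q assume q: "q \<notin> ?K"
      show "(if q \<in> S then f q * \<phi> q else 0) = 0 \<and> D q e = 0"
        unfolding D_def d\<phi>0[OF q] \<phi>0[OF q] by simp
    qed
    have zl: "(LINT q|lebesgue. D q e) = 0"
      using z integral_completion[of "\<lambda>q. D q e" lborel] borel_measurable_continuous_onI[OF cD] by simp
    have i1: "set_integrable lebesgue S (\<lambda>q. f q * frechet_derivative \<phi> (at q) e)"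
      by (rule test_function_integrable[OF li[OF C(3)] test_function_frechet[OF \<phi>]])
    have i2: "set_integrable lebesgue S (\<lambda>q. g q * \<phi> q)" by (rule test_function_integrable[OF li[OF cg] \<phi>])
    have "(LINT q:S|lebesgue. f q * frechet_derivative \<phi> (at q) e) + (LINT q:S|lebesgue. g q * \<phi> q)
       = (LINT q:S|lebesgue. f q * frechet_derivative \<phi> (at q) e + g q * \<phi> q)"
      by (rule set_integral_add(2)[OF i1 i2, symmetric])
    also have "\<dots> = (LINT q|lebesgue. D q e)"
      unfolding set_lebesgue_integral_def
      by (rule Bochner_Integration.integral_cong) (auto simp: D_def indicator_def fe)
    finally show ?thesis using zl by simp
  qed
  show "has_weak_deriv S (1, 0) f fx"
    unfolding has_weak_deriv_def using li[OF C(3)] li[OF C(1)] parts[OF _ C(1), of _ "(1, 0)"] by (auto simp: Basis_prod_def)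
  show "has_weak_deriv S (0, 1) f fz"
    unfolding has_weak_deriv_def using li[OF C(3)] li[OF C(2)] parts[OF _ C(2), of _ "(0, 1)"] by (auto simp: Basis_prod_def)
qed

lemma continuous_AE_zero_on_open:
  fixes f :: "'a::euclidean_space \<Rightarrow> real"
  assumes S: "open S" and c: "continuous_on S f" and ae: "AE q in lebesgue. q \<in> S \<longrightarrow> f q = 0" and q: "q \<in> S"
  shows "f q = 0"
proof -
  have "open (S \<inter> f -` (- {0}))" by (rule continuous_open_preimage[OF c S]) auto
  moreover have "AE q in lebesgue. q \<notin> S \<inter> f -` (- {0})" using ae by eventually_elim auto
  then have "negligible (S \<inter> f -` (- {0}))"
    unfolding negligible_iff_null_sets by (subst completion.null_sets_iff_AE) auto
  ultimately have "S \<inter> f -` (- {0}) = {}" using open_not_negligible by blast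
  then show ?thesis using q by auto
qed

text \<open>Testing twice shows that \<open>\<psi>\<close> is a very weak solution, so Weyl's
  lemma makes it locally equal to smooth functions. Its classical derivatives then represent the weak
  ones, and the equation, which holds almost everywhere, holds everywhere by continuity.\<close>

lemma potential_classical:
  assumes \<epsilon>: "\<epsilon> > 0" and v: "profile v v1" and pot: "is_potential \<epsilon> v \<psi>"
  shows "\<exists>\<psi>x \<psi>z \<psi>xx \<psi>xz \<psi>zz. classical_potential \<epsilon> v \<psi> \<psi>x \<psi>z \<psi>xx \<psi>xz \<psi>zz \<and>
    (AE q in lebesgue. q \<in> Omega v \<longrightarrow> dx v \<psi> q = \<psi>x q) \<and> (AE q in lebesgue. q \<in> Omega v \<longrightarrow> dz v \<psi> q = \<psi>z q)"
proof -
  let ?S = "Omega v"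
  have oS: "open ?S" by (rule open_Omega[OF profileD(5)[OF v]])
  have Bx: "(1, 0) \<in> (Basis :: (real \<times> real) set)" and Bz: "(0, 1) \<in> (Basis :: (real \<times> real) set)"
    by (auto simp: Basis_prod_def)
  have s2: "sobolev (Suc (Suc 0)) ?S \<psi>" and ccl: "continuous_on (closure ?S) \<psi>"
    and pde: "AE p in lebesgue. p \<in> ?S \<longrightarrow> \<epsilon>\<^sup>2 * dx v (dx v \<psi>) p + dz v (dz v \<psi>) p = 0"
    and bc: "\<forall>(x, z)\<in>frontier ?S. \<psi> (x, z) = (1 + z) / (1 + v x)"
    using pot unfolding is_potential_def by (simp_all add: numeral_eq_Suc del: sobolev.simps)
  note x1 = sobolev_weak_deriv[OF oS s2 Bx, folded dx_def] and z1 = sobolev_weak_deriv[OF oS s2 Bz, folded dz_def]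
  note x2 = sobolev_weak_deriv[OF oS x1(2) Bx, folded dx_def] and z2 = sobolev_weak_deriv[OF oS z1(2) Bz, folded dz_def]
  have cS: "continuous_on ?S \<psi>" by (rule continuous_on_subset[OF ccl closure_subset])
  have weak: "(LINT p:?S|lebesgue. \<psi> p * (\<epsilon>\<^sup>2 * second_deriv \<phi> (1, 0) p + second_deriv \<phi> (0, 1) p)) = 0"
    if \<phi>: "test_function ?S \<phi>" for \<phi>
  proof -
    have tw: "(LINT p:?S|lebesgue. f p * second_deriv \<phi> e p) = (LINT p:?S|lebesgue. h p * \<phi> p)"
      if "has_weak_deriv ?S e f g" "has_weak_deriv ?S e g h" for e f g h
    proof -
      have "(LINT p:?S|lebesgue. f p * second_deriv \<phi> e p) = - (LINT p:?S|lebesgue. g p * frechet_derivative \<phi> (at p) e)"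
        using that(1) test_function_frechet[OF \<phi>, of e] unfolding has_weak_deriv_def second_deriv_def by blast
      also have "(LINT p:?S|lebesgue. g p * frechet_derivative \<phi> (at p) e) = - (LINT p:?S|lebesgue. h p * \<phi> p)"
        using that(2) \<phi> unfolding has_weak_deriv_def by blast
      finally show ?thesis by simp
    qed
    have li: "locally_integrable ?S \<psi>" "locally_integrable ?S (dx v (dx v \<psi>))" "locally_integrable ?S (dz v (dz v \<psi>))"
      using x1(1) x2(1) z2(1) by (auto simp: has_weak_deriv_def)
    have t2: "test_function ?S (second_deriv \<phi> e)" for e
      unfolding second_deriv_def[abs_def] by (rule test_function_frechet[OF test_function_frechet[OF \<phi>]])
    have i: "set_integrable lebesgue ?S (\<lambda>p. \<psi> p * second_deriv \<phi> e p)" for e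
      by (rule test_function_integrable[OF li(1) t2])
    have "(LINT p:?S|lebesgue. \<psi> p * (\<epsilon>\<^sup>2 * second_deriv \<phi> (1, 0) p + second_deriv \<phi> (0, 1) p))
      = (LINT p:?S|lebesgue. \<epsilon>\<^sup>2 * (\<psi> p * second_deriv \<phi> (1, 0) p) + \<psi> p * second_deriv \<phi> (0, 1) p)"
      by (simp add: algebra_simps)
    also have "\<dots> = \<epsilon>\<^sup>2 * (LINT p:?S|lebesgue. \<psi> p * second_deriv \<phi> (1, 0) p) + (LINT p:?S|lebesgue. \<psi> p * second_deriv \<phi> (0, 1) p)"
      using i by (subst set_integral_add) auto
    also have "\<dots> = \<epsilon>\<^sup>2 * (LINT p:?S|lebesgue. dx v (dx v \<psi>) p * \<phi> p) + (LINT p:?S|lebesgue. dz v (dz v \<psi>) p * \<phi> p)"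
      unfolding tw[OF x1(1) x2(1)] tw[OF z1(1) z2(1)] ..
    also have "\<dots> = (LINT p:?S|lebesgue. \<epsilon>\<^sup>2 * (dx v (dx v \<psi>) p * \<phi> p) + dz v (dz v \<psi>) p * \<phi> p)"
      using test_function_integrable[OF li(2) \<phi>] test_function_integrable[OF li(3) \<phi>] by (subst set_integral_add) auto
    also have "\<dots> = (LINT p:?S|lebesgue. (0::real))"
    proof (rule set_integral_lebesgue_cong_AE)
      have "set_integrable lebesgue ?S (\<lambda>p. \<epsilon>\<^sup>2 * (dx v (dx v \<psi>) p * \<phi> p) + dz v (dz v \<psi>) p * \<phi> p)"
        using test_function_integrable[OF li(2) \<phi>] test_function_integrable[OF li(3) \<phi>] by (intro set_integral_add) auto
      then show "set_borel_measurable lebesgue ?S (\<lambda>p. \<epsilon>\<^sup>2 * (dx v (dx v \<psi>) p * \<phi> p) + dz v (dz v \<psi>) p * \<phi> p)"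
        unfolding set_integrable_def set_borel_measurable_def by (rule borel_measurable_integrable)
      show "AE p in lebesgue. p \<in> ?S \<longrightarrow> \<epsilon>\<^sup>2 * (dx v (dx v \<psi>) p * \<phi> p) + dz v (dz v \<psi>) p * \<phi> p = 0"
        using pde
      proof eventually_elim
        case (elim p)
        have "\<epsilon>\<^sup>2 * (dx v (dx v \<psi>) p * \<phi> p) + dz v (dz v \<psi>) p * \<phi> p = (\<epsilon>\<^sup>2 * dx v (dx v \<psi>) p + dz v (dz v \<psi>) p) * \<phi> p"
          by (simp add: algebra_simps)
        then show ?case using elim by simp
      qed
    qed
    finally show ?thesis by (simp add: set_lebesgue_integral_def)
  qed
  have loc: "\<exists>U f. open U \<and> q \<in> U \<and> U \<subseteq> ?S \<and> smooth f \<and> (\<forall>y\<in>U. \<psi> y = f y)" if "q \<in> ?S" for q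
    by (rule very_weak_solution_smooth[OF \<epsilon> oS cS weak that])
  define P where "P e q = frechet_derivative \<psi> (at q) e" for e q
  define P2 where "P2 e e' q = frechet_derivative (P e) (at q) e'" for e e' q
  have fd_eq: "frechet_derivative g (at y) = frechet_derivative f (at y)"
    if U: "open U" "y \<in> U" "\<And>y. y \<in> U \<Longrightarrow> g y = f y" and f: "smooth f" for U y and g f :: "real \<times> real \<Rightarrow> real"
  proof -
    have "(g has_derivative frechet_derivative f (at y)) (at y)"
      by (rule has_derivative_transform_within_open[OF smooth_has_derivative[OF f] U(1,2)]) (use U(3) in auto)
    then show ?thesis by (rule frechet_derivative_at[symmetric])
  qed
  have local_facts: "\<exists>U f. open U \<and> q \<in> U \<and> U \<subseteq> ?S \<and> smooth f \<and> (\<forall>y\<in>U. \<psi> y = f y) \<and>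
      (\<forall>y\<in>U. \<forall>e. P e y = frechet_derivative f (at y) e) \<and>
      (\<forall>y\<in>U. \<forall>e e'. P2 e e' y = frechet_derivative (\<lambda>p. frechet_derivative f (at p) e) (at y) e')" if qS: "q \<in> ?S" for q
  proof -
    obtain U f where U: "open U" "q \<in> U" "U \<subseteq> ?S" "smooth f" "\<forall>y\<in>U. \<psi> y = f y" using loc[OF qS] by blast
    have U5: "\<And>y. y \<in> U \<Longrightarrow> \<psi> y = f y" using U(5) by blast
    have p1: "P e y = frechet_derivative f (at y) e" if "y \<in> U" for e y
      unfolding P_def by (rule fun_cong[OF fd_eq[OF U(1) that U5 U(4)]])
    have p2: "P2 e e' y = frechet_derivative (\<lambda>p. frechet_derivative f (at p) e) (at y) e'" if "y \<in> U" for e e' y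
      unfolding P2_def by (rule fun_cong[OF fd_eq[OF U(1) that p1 smooth_frechet_derivative[OF U(4)]]])
    show ?thesis
      by (rule exI[of _ U], rule exI[of _ f]) (intro conjI ballI allI U p1 p2; assumption)
  qed
  have C1: "C1_grad ?S g gx gz"
    if hyp: "\<And>q. q \<in> ?S \<Longrightarrow> \<exists>U f. open U \<and> q \<in> U \<and> U \<subseteq> ?S \<and> smooth f \<and> (\<forall>y\<in>U. g y = f y) \<and>
       (\<forall>y\<in>U. gx y = frechet_derivative f (at y) (1, 0)) \<and> (\<forall>y\<in>U. gz y = frechet_derivative f (at y) (0, 1))" for g gx gz
  proof -
    have "(g has_derivative (\<lambda>h. gx q * fst h + gz q * snd h)) (at q) \<and> isCont gx q \<and> isCont gz q" if q: "q \<in> ?S" for q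
    proof -
      obtain U f where U: "open U" "q \<in> U" "smooth f" "\<And>y. y \<in> U \<Longrightarrow> g y = f y"
        and gx: "\<And>y. y \<in> U \<Longrightarrow> gx y = frechet_derivative f (at y) (1, 0)"
        and gz: "\<And>y. y \<in> U \<Longrightarrow> gz y = frechet_derivative f (at y) (0, 1)" using hyp[OF q] by blast
      have "(g has_derivative frechet_derivative f (at q)) (at q)"
        by (rule has_derivative_transform_within_open[OF smooth_has_derivative[OF U(3)] U(1,2)]) (use U(4) in auto)
      moreover have "frechet_derivative f (at q) = (\<lambda>h. gx q * fst h + gz q * snd h)"
        unfolding gx[OF U(2)] gz[OF U(2)] by (intro ext frechet_derivative_partials[OF U(3)])
      moreover have "continuous_on U gx"
        by (rule continuous_on_eq[OF smooth_continuous[OF smooth_frechet_derivative[OF U(3)]]]) (rule gx[symmetric])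
      then have "isCont gx q" using U(1,2) continuous_on_eq_continuous_at by blast
      moreover have "continuous_on U gz"
        by (rule continuous_on_eq[OF smooth_continuous[OF smooth_frechet_derivative[OF U(3)]]]) (rule gz[symmetric])
      then have "isCont gz q" using U(1,2) continuous_on_eq_continuous_at by blast
      ultimately show ?thesis by simp
    qed
    then show ?thesis unfolding C1_grad_def by (simp add: continuous_at_imp_continuous_on)
  qed
  have c0: "C1_grad ?S \<psi> (P (1, 0)) (P (0, 1))"
  proof (rule C1)
    fix q assume "q \<in> ?S"
    from local_facts[OF this] show "\<exists>U f. open U \<and> q \<in> U \<and> U \<subseteq> ?S \<and> smooth f \<and> (\<forall>y\<in>U. \<psi> y = f y) \<and>
       (\<forall>y\<in>U. P (1, 0) y = frechet_derivative f (at y) (1, 0)) \<and> (\<forall>y\<in>U. P (0, 1) y = frechet_derivative f (at y) (0, 1))"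
      by blast
  qed
  have c1: "C1_grad ?S (P e) (P2 e (1, 0)) (P2 e (0, 1))" for e
  proof (rule C1)
    fix q assume "q \<in> ?S"
    from local_facts[OF this] obtain U f where U: "open U" "q \<in> U" "U \<subseteq> ?S" "smooth f"
      "\<forall>y\<in>U. \<forall>e. P e y = frechet_derivative f (at y) e"
      "\<forall>y\<in>U. \<forall>e e'. P2 e e' y = frechet_derivative (\<lambda>p. frechet_derivative f (at p) e) (at y) e'" by blast
    show "\<exists>U f. open U \<and> q \<in> U \<and> U \<subseteq> ?S \<and> smooth f \<and> (\<forall>y\<in>U. P e y = f y) \<and>
       (\<forall>y\<in>U. P2 e (1, 0) y = frechet_derivative f (at y) (1, 0)) \<and> (\<forall>y\<in>U. P2 e (0, 1) y = frechet_derivative f (at y) (0, 1))"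
      by (rule exI[of _ U], rule exI[of _ "\<lambda>p. frechet_derivative f (at p) e"])
        (intro conjI U(1) U(2) U(3) smooth_frechet_derivative[OF U(4)]; use U(5,6) in blast)
  qed
  have comm: "P2 (0, 1) (1, 0) q = P2 (1, 0) (0, 1) q" if qS: "q \<in> ?S" for q
  proof -
    from local_facts[OF qS] obtain U f where "q \<in> U" "smooth f"
      and e: "\<forall>y\<in>U. \<forall>e e'. P2 e e' y = frechet_derivative (\<lambda>p. frechet_derivative f (at p) e) (at y) e'" by blast
    then show ?thesis using mixed_derivatives_commute[OF \<open>smooth f\<close>, of q] by simp
  qed
  have c1z: "C1_grad ?S (P (0, 1)) (P2 (1, 0) (0, 1)) (P2 (0, 1) (0, 1))"
    unfolding C1_grad_def
  proof (intro conjI ballI)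
    show "(P (0, 1) has_derivative (\<lambda>h. P2 (1, 0) (0, 1) q * fst h + P2 (0, 1) (0, 1) q * snd h)) (at q)" if "q \<in> ?S" for q
      using c1[of "(0, 1)"] that unfolding C1_grad_def comm[OF that, symmetric] by blast
    show "continuous_on ?S (P2 (1, 0) (0, 1))"
      by (rule continuous_on_eq[OF C1_gradD(1)[OF c1] comm])
    show "continuous_on ?S (P2 (0, 1) (0, 1))" by (rule C1_gradD(2)[OF c1])
  qed
  have aex: "AE q in lebesgue. q \<in> ?S \<longrightarrow> dx v \<psi> q = P (1, 0) q"
    by (rule has_weak_deriv_unique[OF oS x1(1) C1_grad_has_weak_deriv(1)[OF oS c0]])
  have aez: "AE q in lebesgue. q \<in> ?S \<longrightarrow> dz v \<psi> q = P (0, 1) q"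
    by (rule has_weak_deriv_unique[OF oS z1(1) C1_grad_has_weak_deriv(2)[OF oS c0]])
  have rf: "AE q in lebesgue. q \<in> ?S \<longrightarrow> f q = f q" for f :: "real \<times> real \<Rightarrow> real" by simp
  have aexx: "AE q in lebesgue. q \<in> ?S \<longrightarrow> dx v (dx v \<psi>) q = P2 (1, 0) (1, 0) q"
    by (rule has_weak_deriv_unique[OF oS has_weak_deriv_cong_AE[OF x2(1) aex rf] C1_grad_has_weak_deriv(1)[OF oS c1]])
  have aezz: "AE q in lebesgue. q \<in> ?S \<longrightarrow> dz v (dz v \<psi>) q = P2 (0, 1) (0, 1) q"
    by (rule has_weak_deriv_unique[OF oS has_weak_deriv_cong_AE[OF z2(1) aez rf] C1_grad_has_weak_deriv(2)[OF oS c1]])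
  have pde': "\<epsilon>\<^sup>2 * P2 (1, 0) (1, 0) q + P2 (0, 1) (0, 1) q = 0" if "q \<in> ?S" for q
  proof (rule continuous_AE_zero_on_open[OF oS _ _ that])
    show "continuous_on ?S (\<lambda>q. \<epsilon>\<^sup>2 * P2 (1, 0) (1, 0) q + P2 (0, 1) (0, 1) q)"
      by (intro continuous_intros C1_gradD(1)[OF c1] C1_gradD(2)[OF c1])
    show "AE q in lebesgue. q \<in> ?S \<longrightarrow> \<epsilon>\<^sup>2 * P2 (1, 0) (1, 0) q + P2 (0, 1) (0, 1) q = 0"
      using pde aexx aezz by eventually_elim auto
  qed
  have L2: "L2_on ?S (P (1, 0))" "L2_on ?S (P (0, 1))"
    using L2_on_cong_AE[OF sobolev_L2[OF x1(2)] aex] L2_on_cong_AE[OF sobolev_L2[OF z1(2)] aez] by auto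
  have "classical_potential \<epsilon> v \<psi> (P (1, 0)) (P (0, 1)) (P2 (1, 0) (1, 0)) (P2 (1, 0) (0, 1)) (P2 (0, 1) (0, 1))"
    unfolding classical_potential_def using c0 c1[of "(1, 0)"] c1z pde' ccl bc L2 by blast
  then show ?thesis using aex aez by blast
qed

section \<open>Vertical rescaling of domains\<close>

definition ratio :: "(real \<Rightarrow> real) \<Rightarrow> (real \<Rightarrow> real) \<Rightarrow> real \<Rightarrow> real" where
  "ratio v w x = (1 + w x) / (1 + v x)"

definition ratio' :: "(real \<Rightarrow> real) \<Rightarrow> (real \<Rightarrow> real) \<Rightarrow> (real \<Rightarrow> real) \<Rightarrow> (real \<Rightarrow> real) \<Rightarrow> real \<Rightarrow> real" where
  "ratio' v v1 w w1 x = (w1 x * (1 + v x) - (1 + w x) * v1 x) / (1 + v x)\<^sup>2"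

text \<open>The vertical rescaling; it fixes the bottom \<open>z = -1\<close> and maps the graph of
  \<open>v\<close> to that of \<open>w\<close>.\<close>

definition tmap :: "(real \<Rightarrow> real) \<Rightarrow> (real \<Rightarrow> real) \<Rightarrow> real \<times> real \<Rightarrow> real \<times> real" where
  "tmap v w q = (fst q, -1 + (1 + snd q) * ratio v w (fst q))"

lemma one_plus_profile: "profile v v1 \<Longrightarrow> x \<in> {-1..1} \<Longrightarrow> 1 + v x > 0"
  using profileD(1)[of v v1 x] by linarith

lemma ratio_pos: "profile v v1 \<Longrightarrow> profile w w1 \<Longrightarrow> x \<in> {-1..1} \<Longrightarrow> ratio v w x > 0"
  unfolding ratio_def by (intro divide_pos_pos one_plus_profile)

lemma ratio_inverse: "profile v v1 \<Longrightarrow> profile w w1 \<Longrightarrow> x \<in> {-1..1} \<Longrightarrow> ratio w v x = 1 / ratio v w x"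
  unfolding ratio_def by simp

lemma ratio'_inverse:
  assumes "profile v v1" "profile w w1" "x \<in> {-1..1}"
  shows "ratio' w w1 v v1 x = - ratio' v v1 w w1 x / (ratio v w x)\<^sup>2"
proof -
  have "(b * m - n * a) / m\<^sup>2 = - ((a * n - m * b) / n\<^sup>2) / (m / n)\<^sup>2" if "n \<noteq> 0" "m \<noteq> 0" for a b m n :: real
  proof -
    have "- ((a * n - m * b) / n\<^sup>2) / (m / n)\<^sup>2 = - (a * n - m * b) / m\<^sup>2"
      using that by (simp add: power_divide)
    then show ?thesis by (simp add: mult.commute)
  qed
  from this[of "1 + v x" "1 + w x" "v1 x" "w1 x"]
  show ?thesis
    using one_plus_profile[OF assms(1,3)] one_plus_profile[OF assms(2,3)] unfolding ratio_def ratio'_def by simp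
qed

lemma ratio_continuous:
  assumes "profile v v1" "profile w w1"
  shows "continuous_on {-1..1} (ratio v w)" "continuous_on {-1..1} (ratio' v v1 w w1)"
proof -
  have "\<forall>x\<in>{-1..1}. 1 + v x \<noteq> 0" using one_plus_profile[OF assms(1)] by force
  then show "continuous_on {-1..1} (ratio v w)" "continuous_on {-1..1} (ratio' v v1 w w1)"
    unfolding ratio_def ratio'_def
    by (intro continuous_intros profileD(4,5)[OF assms(1)] profileD(4,5)[OF assms(2)]; simp)+
qed

lemma ratio_derivative:
  assumes "profile v v1" "profile w w1" "x \<in> {-1..1}"
  shows "(ratio v w has_real_derivative ratio' v v1 w w1 x) (at x within {-1..1})"
proof -
  have n: "1 + v x \<noteq> 0" using one_plus_profile[OF assms(1,3)] by simp
  have "((\<lambda>x. (1 + w x) / (1 + v x)) has_real_derivative ((0 + w1 x) * (1 + v x) - (1 + w x) * (0 + v1 x)) / ((1 + v x) * (1 + v x)))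
      (at x within {-1..1})"
    by (intro DERIV_divide DERIV_add DERIV_const profileD(2)[OF assms(1,3)] profileD(2)[OF assms(2,3)] n)
  then show ?thesis by (simp add: ratio_def[abs_def] ratio'_def power2_eq_square)
qed

lemma ratio_derivative_at:
  assumes "profile v v1" "profile w w1" "x \<in> I"
  shows "(ratio v w has_real_derivative ratio' v v1 w w1 x) (at x)"
  using ratio_derivative[OF assms(1,2), of x] assms(3) by (simp add: at_within_Icc_at)

lemma tmap_Omega_iff:
  assumes "profile v v1" "profile w w1" "fst q \<in> {-1..1}"
  shows "tmap v w q \<in> Omega w \<longleftrightarrow> q \<in> Omega v"
proof -
  obtain x z where q: "q = (x, z)" by (cases q)
  then have x: "x \<in> {-1..1}" using assms(3) by simp
  note p = one_plus_profile[OF assms(1) x] one_plus_profile[OF assms(2) x] ratio_pos[OF assms(1,2) x]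
  have "-1 < -1 + (1 + z) * ratio v w x \<longleftrightarrow> -1 < z" using p(3) by (simp add: zero_less_mult_iff) linarith
  moreover have "-1 + (1 + z) * ratio v w x < w x \<longleftrightarrow> z < v x"
  proof -
    have "-1 + (1 + z) * ratio v w x < w x \<longleftrightarrow> (1 + z) * ((1 + w x) / (1 + v x)) < 1 + w x" unfolding ratio_def by linarith
    also have "\<dots> \<longleftrightarrow> (1 + z) * (1 + w x) < (1 + v x) * (1 + w x)" using p(1) by (simp add: field_simps)
    also have "\<dots> \<longleftrightarrow> z < v x" using p(2) by (simp add: mult_less_cancel_right)
    finally show ?thesis .
  qed
  ultimately show ?thesis by (simp add: q tmap_def Omega_def)
qed

lemma tmap_tmap:
  assumes "profile v v1" "profile w w1" "fst q \<in> {-1..1}"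
  shows "tmap w v (tmap v w q) = q"
proof -
  have "ratio v w (fst q) > 0" by (rule ratio_pos[OF assms])
  then show ?thesis
    unfolding tmap_def using ratio_inverse[OF assms] by (simp add: prod_eq_iff)
qed

lemma fst_tmap [simp]: "fst (tmap v w q) = fst q"
  by (simp add: tmap_def)

lemma fst_Omega: "q \<in> Omega v \<Longrightarrow> fst q \<in> I" "q \<in> Omega v \<Longrightarrow> fst q \<in> {-1..1}"
  by (auto simp: Omega_def)

lemma fst_closure_Omega: "profile v v1 \<Longrightarrow> q \<in> closure (Omega v) \<Longrightarrow> fst q \<in> {-1..1}"
  using closure_Omega[OF profileD(5)] by (force simp: closed_Omega_def)

lemma tmap_continuous:
  assumes "profile v v1" "profile w w1"
  shows "continuous_on (closed_Omega v) (tmap v w)"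
  unfolding tmap_def
  by (intro continuous_intros continuous_on_compose2[OF ratio_continuous(1)[OF assms] continuous_on_fst[OF continuous_on_id]])
    (auto simp: closed_Omega_def)

lemma tmap_closure:
  assumes "profile v v1" "profile w w1"
  shows "tmap v w ` closure (Omega v) \<subseteq> closure (Omega w)"
proof (rule image_closure_subset)
  show "continuous_on (closure (Omega v)) (tmap v w)"
    by (rule continuous_on_subset[OF tmap_continuous[OF assms] closure_Omega[OF profileD(5)[OF assms(1)]]])
  show "tmap v w ` Omega v \<subseteq> closure (Omega w)"
    using tmap_Omega_iff[OF assms fst_Omega(2)] closure_subset by blast
qed simp

lemma tmap_frontier:
  assumes "profile v v1" "profile w w1" "q \<in> frontier (Omega v)"
  shows "tmap v w q \<in> frontier (Omega w)"
proof -
  have q: "q \<in> closure (Omega v)" "q \<notin> Omega v" using assms(3) frontier_Omega[OF profileD(5)[OF assms(1)]] by auto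
  have "tmap v w q \<in> closure (Omega w)" using tmap_closure[OF assms(1,2)] q(1) by blast
  moreover have "tmap v w q \<notin> Omega w"
    using tmap_Omega_iff[OF assms(1,2) fst_closure_Omega[OF assms(1) q(1)]] q(2) by simp
  ultimately show ?thesis using frontier_Omega[OF profileD(5)[OF assms(2)]] by simp
qed

text \<open>The boundary values \<open>(1 + z) / (1 + v x)\<close> are invariant under the rescaling.\<close>

lemma tmap_boundary_values:
  assumes v: "profile v v1" and w: "profile w w1"
    and g: "\<forall>(x, z)\<in>frontier (Omega w). g (x, z) = (1 + z) / (1 + w x)" and q: "q \<in> frontier (Omega v)"
  shows "g (tmap v w q) = (1 + snd q) / (1 + v (fst q))"
proof -
  have x: "fst q \<in> {-1..1}" using fst_closure_Omega[OF v] q by (simp add: frontier_def)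
  have "g (tmap v w q) = (1 + snd (tmap v w q)) / (1 + w (fst (tmap v w q)))"
    using g tmap_frontier[OF v w q] by (cases "tmap v w q") auto
  then show ?thesis using one_plus_profile[OF v x] one_plus_profile[OF w x] by (simp add: tmap_def ratio_def)
qed

lemma tmap_pullback:
  assumes v: "profile v v1" and w: "profile w w1" and f: "C1_grad (Omega w) f fx fz"
  shows "C1_grad (Omega v) (\<lambda>q. f (tmap v w q))
    (\<lambda>q. fx (tmap v w q) + fz (tmap v w q) * ((1 + snd q) * ratio' v v1 w w1 (fst q)))
    (\<lambda>q. fz (tmap v w q) * ratio v w (fst q))"
  unfolding C1_grad_def
proof (intro conjI ballI)
  fix q assume q: "q \<in> Omega v"
  have t: "tmap v w q \<in> Omega w" using tmap_Omega_iff[OF v w fst_Omega(2)[OF q]] q by simp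
  have r: "((\<lambda>q. ratio v w (fst q)) has_derivative (\<lambda>h. ratio' v v1 w w1 (fst q) * fst h)) (at q)"
    by (rule has_derivative_compose[OF has_derivative_fst[OF has_derivative_ident]
          ratio_derivative_at[OF v w fst_Omega(1)[OF q], unfolded has_field_derivative_def]])
  have s: "((\<lambda>q. 1 + snd q) has_derivative (\<lambda>h. snd h)) (at q)"
    by (auto intro!: derivative_eq_intros)
  have "((\<lambda>q. (1 + snd q) * ratio v w (fst q)) has_derivative
      (\<lambda>h. (1 + snd q) * (ratio' v v1 w w1 (fst q) * fst h) + snd h * ratio v w (fst q))) (at q)"
    by (rule has_derivative_mult[OF s r])
  from has_derivative_add[OF has_derivative_const[of "-1"] this]
  have "((\<lambda>q. -1 + (1 + snd q) * ratio v w (fst q)) has_derivative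
      (\<lambda>h. (1 + snd q) * (ratio' v v1 w w1 (fst q) * fst h) + snd h * ratio v w (fst q))) (at q)" by simp
  from has_derivative_Pair[OF has_derivative_fst[OF has_derivative_ident] this]
  have d: "(tmap v w has_derivative (\<lambda>h. (fst h, (1 + snd q) * (ratio' v v1 w w1 (fst q) * fst h) + snd h * ratio v w (fst q)))) (at q)"
    unfolding tmap_def[abs_def] .
  have fd: "(f has_derivative (\<lambda>h. fx (tmap v w q) * fst h + fz (tmap v w q) * snd h)) (at (tmap v w q))"
    using f t by (simp add: C1_grad_def)
  from has_derivative_compose[OF d fd]
  show "((\<lambda>q. f (tmap v w q)) has_derivative
      (\<lambda>h. (fx (tmap v w q) + fz (tmap v w q) * ((1 + snd q) * ratio' v v1 w w1 (fst q))) * fst h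
        + fz (tmap v w q) * ratio v w (fst q) * snd h)) (at q)"
    by (rule has_derivative_eq_rhs) (auto simp: fun_eq_iff algebra_simps)
next
  have ct: "continuous_on (Omega v) (tmap v w)" by (rule continuous_on_subset[OF tmap_continuous[OF v w] Omega_subset_closed])
  have im: "tmap v w ` Omega v \<subseteq> Omega w" using tmap_Omega_iff[OF v w fst_Omega(2)] by blast
  note c = continuous_on_compose2[OF C1_gradD(1)[OF f] ct im] continuous_on_compose2[OF C1_gradD(2)[OF f] ct im]
    continuous_on_Omega_fst[OF ratio_continuous(1)[OF v w]] continuous_on_Omega_fst[OF ratio_continuous(2)[OF v w]]
  show "continuous_on (Omega v) (\<lambda>q. fx (tmap v w q) + fz (tmap v w q) * ((1 + snd q) * ratio' v v1 w w1 (fst q)))"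
    "continuous_on (Omega v) (\<lambda>q. fz (tmap v w q) * ratio v w (fst q))"
    by (intro continuous_intros c)+
qed

text \<open>Tonelli reduces the change of variables to an affine one in \<open>z\<close> for each
  \<open>x\<close>.\<close>

lemma nn_integral_rescale:
  fixes H :: "real \<times> real \<Rightarrow> real"
  assumes v: "profile v v1" and w: "profile w w1" and H: "continuous_on (Omega w) H"
  shows "(\<integral>\<^sup>+q. ennreal (indicator (Omega w) q * H q) \<partial>lborel)
    = (\<integral>\<^sup>+q. ennreal (indicator (Omega v) q * (ratio v w (fst q) * H (tmap v w q))) \<partial>lborel)"
proof -
  have ov: "open (Omega v)" and ow: "open (Omega w)" using open_Omega profileD(5) v w by blast+
  have ct: "continuous_on (Omega v) (tmap v w)" by (rule continuous_on_subset[OF tmap_continuous[OF v w] Omega_subset_closed])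
  have im: "tmap v w ` Omega v \<subseteq> Omega w" using tmap_Omega_iff[OF v w fst_Omega(2)] by blast
  define A where "A q = ennreal (indicator (Omega w) q * H q)" for q
  define B where "B q = ennreal (indicator (Omega v) q * (ratio v w (fst q) * H (tmap v w q)))" for q
  have [measurable]: "(\<lambda>q. indicator (Omega w) q * H q) \<in> borel_measurable borel"
    by (rule borel_measurable_indicator_continuous[OF ow H])
  have [measurable]: "(\<lambda>q. indicator (Omega v) q * (ratio v w (fst q) * H (tmap v w q))) \<in> borel_measurable borel"
    by (rule borel_measurable_indicator_continuous[OF ov])
      (intro continuous_intros continuous_on_compose2[OF H ct im] continuous_on_Omega_fst[OF ratio_continuous(1)[OF v w]])
  have Am: "A \<in> borel_measurable borel" and Bm: "B \<in> borel_measurable borel"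
    unfolding A_def B_def by measurable
  have Am': "A \<in> borel_measurable (lborel \<Otimes>\<^sub>M lborel)" and Bm': "B \<in> borel_measurable (lborel \<Otimes>\<^sub>M lborel)"
    unfolding lborel_prod using Am Bm by simp_all
  have inner: "(\<integral>\<^sup>+y. A (x, y) \<partial>lborel) = (\<integral>\<^sup>+z. B (x, z) \<partial>lborel)" for x
  proof (cases "x \<in> I")
    case False
    then have "A (x, y) = 0" "B (x, y) = 0" for y by (auto simp: A_def B_def Omega_def)
    then show ?thesis by simp
  next
    case True
    then have x: "x \<in> {-1..1}" by auto
    let ?r = "ratio v w x"
    have r: "?r > 0" by (rule ratio_pos[OF v w x])
    have Ax: "(\<lambda>y. A (x, y)) \<in> borel_measurable borel" using Am by measurable
    have "(\<integral>\<^sup>+y. A (x, y) \<partial>lborel) = ennreal \<bar>?r\<bar> * (\<integral>\<^sup>+z. A (x, (?r - 1) + ?r * z) \<partial>lborel)"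
      by (rule nn_integral_real_affine[OF Ax]) (use r in simp)
    also have "\<dots> = (\<integral>\<^sup>+z. ennreal \<bar>?r\<bar> * A (x, (?r - 1) + ?r * z) \<partial>lborel)"
      by (rule nn_integral_cmult[symmetric]) (use Ax in measurable)
    also have "\<dots> = (\<integral>\<^sup>+z. B (x, z) \<partial>lborel)"
    proof (rule nn_integral_cong)
      fix z
      have t: "(x, (?r - 1) + ?r * z) = tmap v w (x, z)" by (simp add: tmap_def algebra_simps)
      have "indicator (Omega w) (tmap v w (x, z)) = (indicator (Omega v) (x, z) :: real)"
        using tmap_Omega_iff[OF v w, of "(x, z)"] x by (simp add: indicator_def)
      then show "ennreal \<bar>?r\<bar> * A (x, (?r - 1) + ?r * z) = B (x, z)"
        unfolding t A_def B_def using r by (simp add: ennreal_mult'[symmetric] mult.left_commute)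
    qed
    finally show ?thesis .
  qed
  have "(\<integral>\<^sup>+q. A q \<partial>lborel) = (\<integral>\<^sup>+x. \<integral>\<^sup>+y. A (x, y) \<partial>lborel \<partial>lborel)"
    using lborel.nn_integral_fst[OF Am'] by (simp add: lborel_prod)
  also have "\<dots> = (\<integral>\<^sup>+x. \<integral>\<^sup>+z. B (x, z) \<partial>lborel \<partial>lborel)" by (simp add: inner)
  also have "\<dots> = (\<integral>\<^sup>+q. B q \<partial>lborel)"
    using lborel.nn_integral_fst[OF Bm'] by (simp add: lborel_prod)
  finally show ?thesis unfolding A_def B_def .
qed

lemma integral_rescale:
  fixes H :: "real \<times> real \<Rightarrow> real"
  assumes v: "profile v v1" and w: "profile w w1" and H: "continuous_on (Omega w) H" "\<And>q. q \<in> Omega w \<Longrightarrow> H q \<ge> 0"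
  shows "integrable (lebesgue_on (Omega w)) H \<longleftrightarrow> integrable (lebesgue_on (Omega v)) (\<lambda>q. ratio v w (fst q) * H (tmap v w q))"
    "integral\<^sup>L (lebesgue_on (Omega w)) H = (LINT q|lebesgue_on (Omega v). ratio v w (fst q) * H (tmap v w q))"
proof -
  have ov: "open (Omega v)" and ow: "open (Omega w)" using open_Omega profileD(5) v w by blast+
  have ct: "continuous_on (Omega v) (tmap v w)" by (rule continuous_on_subset[OF tmap_continuous[OF v w] Omega_subset_closed])
  have im: "tmap v w ` Omega v \<subseteq> Omega w" using tmap_Omega_iff[OF v w fst_Omega(2)] by blast
  let ?A = "\<lambda>q. indicator (Omega w) q * H q"
  let ?B = "\<lambda>q. indicator (Omega v) q * (ratio v w (fst q) * H (tmap v w q))"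
  have Am: "?A \<in> borel_measurable borel" by (rule borel_measurable_indicator_continuous[OF ow H(1)])
  have Bm: "?B \<in> borel_measurable borel"
    by (rule borel_measurable_indicator_continuous[OF ov])
      (intro continuous_intros continuous_on_compose2[OF H(1) ct im] continuous_on_Omega_fst[OF ratio_continuous(1)[OF v w]])
  have A0: "?A q \<ge> 0" for q using H(2) by (simp add: indicator_def)
  have B0: "?B q \<ge> 0" for q
  proof (cases "q \<in> Omega v")
    case True
    then have "H (tmap v w q) \<ge> 0" using H(2) im by blast
    then show ?thesis using ratio_pos[OF v w fst_Omega(2)[OF True]] by simp
  qed simp
  have e: "(\<integral>\<^sup>+q. ennreal (?A q) \<partial>lborel) = (\<integral>\<^sup>+q. ennreal (?B q) \<partial>lborel)" by (rule nn_integral_rescale[OF v w H(1)])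
  have "integrable lborel ?A \<longleftrightarrow> integrable lborel ?B"
    using Am Bm A0 B0 e by (simp add: integrable_iff_bounded)
  moreover have "integral\<^sup>L lborel ?A = integral\<^sup>L lborel ?B"
    using Am Bm A0 B0 e by (simp add: integral_eq_nn_integral)
  ultimately show "integrable (lebesgue_on (Omega w)) H \<longleftrightarrow> integrable (lebesgue_on (Omega v)) (\<lambda>q. ratio v w (fst q) * H (tmap v w q))"
    "integral\<^sup>L (lebesgue_on (Omega w)) H = (LINT q|lebesgue_on (Omega v). ratio v w (fst q) * H (tmap v w q))"
    using integral_lborel_lebesgue_on[OF borel_open[OF ow] Am] integral_lborel_lebesgue_on[OF borel_open[OF ov] Bm] by simp_all
qed


section \<open>Comparison of the electrostatic energies of two profiles\<close>

lemma classical_potentialD: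
  assumes "classical_potential \<epsilon> v f fx fz fxx fxz fzz" and v: "profile v v1"
  shows "C1_grad (Omega v) f fx fz" "C1_grad (Omega v) fx fxx fxz" "C1_grad (Omega v) fz fxz fzz"
    "q \<in> Omega v \<Longrightarrow> \<epsilon>\<^sup>2 * fxx q + fzz q = 0" "continuous_on (closure (Omega v)) f"
    "\<forall>(x, z)\<in>frontier (Omega v). f (x, z) = (1 + z) / (1 + v x)"
    "sqint (lebesgue_on (Omega v)) fx" "sqint (lebesgue_on (Omega v)) fz"
  using assms(1) L2_on_iff_sqint[OF Omega_sets[OF profileD(5)[OF v]]] unfolding classical_potential_def by auto

text \<open>The weak form of the equation, for competitors with the same boundary values. It expresses that the
  potential minimises the Dirichlet energy.\<close>

lemma potential_orthogonal:
  assumes v: "profile v v1" and f: "classical_potential \<epsilon> v f fx fz fxx fxz fzz"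
    and h: "C1_grad (Omega v) h hx hz" "continuous_on (closure (Omega v)) h"
    and fr: "\<And>q. q \<in> frontier (Omega v) \<Longrightarrow> h q = f q"
    and L: "sqint (lebesgue_on (Omega v)) hx" "sqint (lebesgue_on (Omega v)) hz"
  shows "(LINT q|lebesgue_on (Omega v). \<epsilon>\<^sup>2 * (fx q * (hx q - fx q)) + fz q * (hz q - fz q)) = 0"
    "integrable (lebesgue_on (Omega v)) (\<lambda>q. \<epsilon>\<^sup>2 * (fx q * (hx q - fx q)) + fz q * (hz q - fz q))"
proof -
  note F = classical_potentialD[OF f v]
  have o: "open (Omega v)" by (rule open_Omega[OF profileD(5)[OF v]])
  let ?G = "\<lambda>q. \<epsilon>\<^sup>2 * (fx q * (hx q - fx q)) + fz q * (hz q - fz q)"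
  show i: "integrable (lebesgue_on (Omega v)) ?G"
    by (intro Bochner_Integration.integrable_add integrable_mult_right sqint_mult_integrable sqint_diff F(7,8) L)
  have c: "continuous_on (Omega v) ?G"
    by (intro continuous_intros C1_gradD(1,2)[OF F(1)] C1_gradD(1,2)[OF h(1)])
  have m: "(\<lambda>q. indicator (Omega v) q * ?G q) \<in> borel_measurable borel"
    by (rule borel_measurable_indicator_continuous[OF o c])
  note conv = integral_lborel_lebesgue_on[OF borel_open[OF o] m]
  have eq: "(\<lambda>q. indicator (Omega v) q * ((\<epsilon>\<^sup>2 * fx q) * (hx q - fx q) + fz q * (hz q - fz q))) = (\<lambda>q. indicator (Omega v) q * ?G q)"
    by (simp add: mult.assoc)
  have p: "C1_grad (Omega v) (\<lambda>q. h q - f q) (\<lambda>q. hx q - fx q) (\<lambda>q. hz q - fz q)"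
    unfolding C1_grad_def
  proof (intro conjI ballI)
    fix q assume "q \<in> Omega v"
    then have "(h has_derivative (\<lambda>k. hx q * fst k + hz q * snd k)) (at q)" "(f has_derivative (\<lambda>k. fx q * fst k + fz q * snd k)) (at q)"
      using h(1) F(1) by (auto simp: C1_grad_def)
    from has_derivative_diff[OF this]
    show "((\<lambda>q. h q - f q) has_derivative (\<lambda>k. (hx q - fx q) * fst k + (hz q - fz q) * snd k)) (at q)"
      by (rule has_derivative_eq_rhs) (auto simp: fun_eq_iff algebra_simps)
  qed (intro continuous_intros C1_gradD(1,2)[OF F(1)] C1_gradD(1,2)[OF h(1)])+
  have "(LINT q|lborel. indicator (Omega v) q * ((\<epsilon>\<^sup>2 * fx q) * (hx q - fx q) + fz q * (hz q - fz q))) = 0"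
  proof (rule divergence_free_orthogonal[OF o bounded_Omega[OF profileD(5)[OF v]] p, where F1x = "\<lambda>q. \<epsilon>\<^sup>2 * fxx q" and F2z = fzz])
    show "continuous_on (closure (Omega v)) (\<lambda>q. h q - f q)" by (intro continuous_intros h(2) F(5))
    show "h q - f q = 0" if "q \<in> frontier (Omega v)" for q using fr[OF that] by simp
    show "((\<lambda>x. \<epsilon>\<^sup>2 * fx (x, z)) has_real_derivative \<epsilon>\<^sup>2 * fxx (x, z)) (at x)" if "(x, z) \<in> Omega v" for x z
      by (rule DERIV_cmult[OF C1_gradD(4)[OF F(2) that]])
    show "((\<lambda>z. fz (x, z)) has_real_derivative fzz (x, z)) (at z)" if "(x, z) \<in> Omega v" for x z
      by (rule C1_gradD(5)[OF F(3) that])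
    show "continuous_on (Omega v) (\<lambda>q. \<epsilon>\<^sup>2 * fx q)" "continuous_on (Omega v) fz"
      "continuous_on (Omega v) (\<lambda>q. \<epsilon>\<^sup>2 * fxx q)" "continuous_on (Omega v) fzz"
      by (intro continuous_intros C1_gradD[OF F(1)] C1_gradD[OF F(2)] C1_gradD[OF F(3)])+
    show "\<epsilon>\<^sup>2 * fxx q + fzz q = 0" if "q \<in> Omega v" for q by (rule F(4)[OF that])
    show "integrable lborel (\<lambda>q. indicator (Omega v) q * ((\<epsilon>\<^sup>2 * fx q) * (hx q - fx q) + fz q * (hz q - fz q)))"
      unfolding eq using i conv(1) by blast
  qed
  then show "(LINT q|lebesgue_on (Omega v). ?G q) = 0" unfolding eq using conv(2) by simp
qed


text \<open>For the vertical rescaling with factor \<open>\<rho>\<close> the transformed Dirichlet integrand is a quadratic form in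
  the gradient; its deviation from the original one is the sum of a part linear in
  \<open>\<rho> - 1\<close> and its slope, and a quadratic remainder. The lower bound uses the dual form.\<close>

lemma rescaled_form_upper:
  fixes \<rho> \<mu> a b \<epsilon> :: real
  assumes "\<rho> > 0"
  shows "\<rho> * (\<epsilon>\<^sup>2 * (a - \<mu> / \<rho> * b)\<^sup>2 + (b / \<rho>)\<^sup>2) = (\<epsilon>\<^sup>2 * a\<^sup>2 + b\<^sup>2)
    + ((\<rho> - 1) * (\<epsilon>\<^sup>2 * a\<^sup>2 - b\<^sup>2) - 2 * \<epsilon>\<^sup>2 * \<mu> * (a * b)) + ((\<rho> - 1)\<^sup>2 + \<epsilon>\<^sup>2 * \<mu>\<^sup>2) / \<rho> * b\<^sup>2"
proof -
  define s where "s = 1 / \<rho>"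
  have s: "\<rho> * s = 1" using assms by (simp add: s_def)
  have d: "x / \<rho> = x * s" for x by (simp add: s_def)
  show ?thesis unfolding d using s by algebra
qed

lemma rescaled_form_lower:
  fixes \<rho> \<mu> a b X Z \<epsilon> :: real
  assumes "\<rho> > 0"
  shows "\<rho> * (\<epsilon>\<^sup>2 * X\<^sup>2 + Z\<^sup>2) \<ge> (\<epsilon>\<^sup>2 * a\<^sup>2 + b\<^sup>2) + 2 * (\<epsilon>\<^sup>2 * (a * (X + Z * \<mu> - a)) + b * (Z * \<rho> - b))
    + ((\<rho> - 1) * (\<epsilon>\<^sup>2 * a\<^sup>2 - b\<^sup>2) - 2 * \<epsilon>\<^sup>2 * \<mu> * (a * b)) - ((\<rho> - 1)\<^sup>2 + \<epsilon>\<^sup>2 * \<mu>\<^sup>2) / \<rho> * (\<epsilon>\<^sup>2 * a\<^sup>2)"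
proof -
  define s where "s = 1 / \<rho>"
  have s: "\<rho> * s = 1" "s \<ge> 0" using assms by (simp_all add: s_def)
  have d: "x / \<rho> = x * s" for x by (simp add: s_def)
  have "0 \<le> s * (\<epsilon>\<^sup>2 * (\<rho> * X - a)\<^sup>2 + (\<rho> * Z - (b * \<rho> + \<epsilon>\<^sup>2 * \<mu> * a))\<^sup>2)"
    using s(2) by (intro mult_nonneg_nonneg add_nonneg_nonneg) auto
  also have "\<dots> = \<rho> * (\<epsilon>\<^sup>2 * X\<^sup>2 + Z\<^sup>2) - ((\<epsilon>\<^sup>2 * a\<^sup>2 + b\<^sup>2) + 2 * (\<epsilon>\<^sup>2 * (a * (X + Z * \<mu> - a)) + b * (Z * \<rho> - b))
    + ((\<rho> - 1) * (\<epsilon>\<^sup>2 * a\<^sup>2 - b\<^sup>2) - 2 * \<epsilon>\<^sup>2 * \<mu> * (a * b)) - ((\<rho> - 1)\<^sup>2 + \<epsilon>\<^sup>2 * \<mu>\<^sup>2) * s * (\<epsilon>\<^sup>2 * a\<^sup>2))"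
    using s(1) by algebra
  finally show ?thesis unfolding d by simp
qed

lemma bounded_weight_Omega:
  assumes v: "profile v v1" and k: "continuous_on (closed_Omega v) k"
  shows "(k :: _ \<Rightarrow> real) \<in> borel_measurable (lebesgue_on (Omega v))" "\<exists>C. \<forall>q\<in>space (lebesgue_on (Omega v)). \<bar>k q\<bar> \<le> C"
proof -
  show "k \<in> borel_measurable (lebesgue_on (Omega v))"
    by (rule continuous_measurable_Omega[OF profileD(5)[OF v] continuous_on_subset[OF k Omega_subset_closed]])
  have "compact (k ` closed_Omega v)" by (rule compact_continuous_image[OF k compact_closed_Omega[OF profileD(5)[OF v]]])
  from compact_imp_bounded[OF this] obtain C where "\<forall>q\<in>closed_Omega v. \<bar>k q\<bar> \<le> C" by (auto simp: bounded_iff)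
  then show "\<exists>C. \<forall>q\<in>space (lebesgue_on (Omega v)). \<bar>k q\<bar> \<le> C" using Omega_subset_closed[of v] by auto
qed

lemma weighted_product_integrable:
  assumes v: "profile v v1" and k: "continuous_on (closed_Omega v) k"
    and a: "sqint (lebesgue_on (Omega v)) a" and b: "sqint (lebesgue_on (Omega v)) b"
  shows "integrable (lebesgue_on (Omega v)) (\<lambda>q. k q * (a q * b q))"
proof -
  obtain C where C: "\<And>q. q \<in> space (lebesgue_on (Omega v)) \<Longrightarrow> \<bar>k q\<bar> \<le> C" using bounded_weight_Omega(2)[OF v k] by blast
  have "sqint (lebesgue_on (Omega v)) (\<lambda>q. k q * a q)" by (rule sqint_bounded_mult[OF a bounded_weight_Omega(1)[OF v k] C])
  from sqint_mult_integrable[OF this b] show ?thesis by (simp add: mult.assoc)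
qed

lemma sqint_of_bound:
  assumes "integrable M F" "g \<in> borel_measurable M" "\<And>q. q \<in> space M \<Longrightarrow> (g q)\<^sup>2 \<le> C * F q"
  shows "sqint M g"
  unfolding sqint_def
proof
  show "integrable M (\<lambda>q. (g q)\<^sup>2)"
  proof (rule Bochner_Integration.integrable_bound)
    show "integrable M (\<lambda>q. C * F q)" using assms(1) by simp
    show "(\<lambda>q. (g q)\<^sup>2) \<in> borel_measurable M" using assms(2) by measurable
    show "AE q in M. norm ((g q)\<^sup>2) \<le> norm (C * F q)"
      using assms(3) by (intro AE_I2) (simp add: order_trans[OF _ abs_ge_self])
  qed
qed (rule assms(2))

text \<open>The \<open>x\<close>-derivative of the vertical component of \<open>tmap\<close>.\<close>

definition slope_weight where
  "slope_weight v v1 w w1 q = (1 + snd q) * ratio' v v1 w w1 (fst q)"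

text \<open>The first variation of the Dirichlet energy under the rescaling: the stress tensor of the potential
  against the derivative of the rescaling field.\<close>

definition first_order where
  "first_order \<epsilon> v v1 w w1 fx fz = (LINT q|lebesgue_on (Omega v).
     (ratio v w (fst q) - 1) * (\<epsilon>\<^sup>2 * (fx q)\<^sup>2 - (fz q)\<^sup>2) - 2 * \<epsilon>\<^sup>2 * slope_weight v v1 w w1 q * (fx q * fz q))"

definition rem_weight where
  "rem_weight \<epsilon> v v1 w w1 q =
     ((ratio v w (fst q) - 1)\<^sup>2 + \<epsilon>\<^sup>2 * (slope_weight v v1 w w1 q)\<^sup>2) / ratio v w (fst q)"

lemma weights_continuous:
  assumes v: "profile v v1" and w: "profile w w1"
  shows "continuous_on (closed_Omega v) (\<lambda>q. ratio v w (fst q))" "continuous_on (closed_Omega v) (slope_weight v v1 w w1)"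
    "continuous_on (closed_Omega v) (rem_weight \<epsilon> v v1 w w1)"
proof -
  have im: "fst ` closed_Omega v \<subseteq> {-1..1}" by (auto simp: closed_Omega_def)
  show r: "continuous_on (closed_Omega v) (\<lambda>q. ratio v w (fst q))"
    by (rule continuous_on_compose2[OF ratio_continuous(1)[OF v w] continuous_on_fst[OF continuous_on_id] im])
  have "continuous_on (closed_Omega v) (\<lambda>q. ratio' v v1 w w1 (fst q))"
    by (rule continuous_on_compose2[OF ratio_continuous(2)[OF v w] continuous_on_fst[OF continuous_on_id] im])
  then show s: "continuous_on (closed_Omega v) (slope_weight v v1 w w1)"
    unfolding slope_weight_def by (intro continuous_intros)
  have "\<forall>q\<in>closed_Omega v. ratio v w (fst q) \<noteq> 0" using ratio_pos[OF v w] im by force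
  then show "continuous_on (closed_Omega v) (rem_weight \<epsilon> v v1 w w1)"
    unfolding rem_weight_def by (intro continuous_intros r s)
qed

lemma first_order_integrable:
  assumes v: "profile v v1" and w: "profile w w1"
    and L: "sqint (lebesgue_on (Omega v)) fx" "sqint (lebesgue_on (Omega v)) fz"
  shows "integrable (lebesgue_on (Omega v)) (\<lambda>q. (ratio v w (fst q) - 1) * (\<epsilon>\<^sup>2 * (fx q)\<^sup>2 - (fz q)\<^sup>2)
      - 2 * \<epsilon>\<^sup>2 * slope_weight v v1 w w1 q * (fx q * fz q))"
proof -
  have "integrable (lebesgue_on (Omega v)) (\<lambda>q. ((ratio v w (fst q) - 1) * \<epsilon>\<^sup>2) * (fx q * fx q)
      - (ratio v w (fst q) - 1) * (fz q * fz q) - (2 * \<epsilon>\<^sup>2 * slope_weight v v1 w w1 q) * (fx q * fz q))"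
    by (intro Bochner_Integration.integrable_diff weighted_product_integrable[OF v] L continuous_intros weights_continuous[OF v w])
  then show ?thesis by (simp add: algebra_simps power2_eq_square)
qed

text \<open>Upper bound: the pull-back of \<open>f\<close> to the domain of \<open>w\<close> is a competitor for
  \<open>g\<close>. Lower bound: the pull-back of \<open>g\<close> is a competitor for
  \<open>f\<close>, and the orthogonality relation supplies the linear term that completes the square.
  Both remainders contain only \<open>f\<close>.\<close>

lemma dirichlet_comparison:
  assumes \<epsilon>: "\<epsilon> > 0" and v: "profile v v1" and w: "profile w w1"
    and f: "classical_potential \<epsilon> v f fx fz fxx fxz fzz" and g: "classical_potential \<epsilon> w g gx gz gxx gxz gzz"
  shows "dirichlet \<epsilon> w gx gz \<le> dirichlet \<epsilon> v fx fz + first_order \<epsilon> v v1 w w1 fx fz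
      + (LINT q|lebesgue_on (Omega v). rem_weight \<epsilon> v v1 w w1 q * (fz q)\<^sup>2)" (is ?upper)
    and "dirichlet \<epsilon> w gx gz \<ge> dirichlet \<epsilon> v fx fz + first_order \<epsilon> v v1 w w1 fx fz
      - (LINT q|lebesgue_on (Omega v). rem_weight \<epsilon> v v1 w w1 q * (\<epsilon>\<^sup>2 * (fx q)\<^sup>2))" (is ?lower)
proof -
  let ?M = "lebesgue_on (Omega v)" and ?N = "lebesgue_on (Omega w)"
  note F = classical_potentialD[OF f v] and G = classical_potentialD[OF g w]
  let ?r = "\<lambda>q. ratio v w (fst q)" and ?s = "slope_weight v v1 w w1" and ?R = "rem_weight \<epsilon> v v1 w w1"
  let ?lin = "\<lambda>q. (?r q - 1) * (\<epsilon>\<^sup>2 * (fx q)\<^sup>2 - (fz q)\<^sup>2) - 2 * \<epsilon>\<^sup>2 * ?s q * (fx q * fz q)"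
  have ilin: "integrable ?M ?lin" by (rule first_order_integrable[OF v w F(7,8)])
  have iD: "integrable ?M (\<lambda>q. \<epsilon>\<^sup>2 * (fx q)\<^sup>2 + (fz q)\<^sup>2)" and iDw: "integrable ?N (\<lambda>q. \<epsilon>\<^sup>2 * (gx q)\<^sup>2 + (gz q)\<^sup>2)"
    using F(7,8) G(7,8) by (auto simp: sqint_def)
  have iRz: "integrable ?M (\<lambda>q. ?R q * (fz q)\<^sup>2)"
    using weighted_product_integrable[OF v weights_continuous(3)[OF v w] F(8) F(8)] by (simp add: power2_eq_square)
  have iRx: "integrable ?M (\<lambda>q. ?R q * (\<epsilon>\<^sup>2 * (fx q)\<^sup>2))"
    using integrable_mult_right[OF weighted_product_integrable[OF v weights_continuous(3)[OF v w] F(7) F(7)], of "\<epsilon>\<^sup>2"]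
    by (simp add: power2_eq_square ac_simps)
  have tq: "tmap v w q \<in> Omega w" "fst q \<in> {-1..1}" "?r q > 0" if "q \<in> Omega v" for q
    using that tmap_Omega_iff[OF v w fst_Omega(2)[OF that]] fst_Omega(2)[OF that] ratio_pos[OF v w fst_Omega(2)[OF that]] by auto
  have closed_im: "continuous_on (closure (Omega a)) (tmap a b)" if "profile a a1" "profile b b1" for a b a1 b1
    by (rule continuous_on_subset[OF tmap_continuous[OF that] closure_Omega[OF profileD(5)[OF that(1)]]])
  show ?upper
  proof -
    define h where "h q = f (tmap w v q)" for q
    define hx where "hx q = fx (tmap w v q) + fz (tmap w v q) * ((1 + snd q) * ratio' w w1 v v1 (fst q))" for q
    define hz where "hz q = fz (tmap w v q) * ratio w v (fst q)" for q
    have h: "C1_grad (Omega w) h hx hz"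
      unfolding h_def hx_def hz_def by (rule tmap_pullback[OF w v F(1)])
    define H where "H q = \<epsilon>\<^sup>2 * (hx q)\<^sup>2 + (hz q)\<^sup>2" for q
    have cH: "continuous_on (Omega w) H" unfolding H_def by (intro continuous_intros C1_gradD(1,2)[OF h])
    have H0: "H q \<ge> 0" for q by (simp add: H_def)
    have pw: "?r q * H (tmap v w q) = (\<epsilon>\<^sup>2 * (fx q)\<^sup>2 + (fz q)\<^sup>2) + ?lin q + ?R q * (fz q)\<^sup>2" if q: "q \<in> Omega v" for q
    proof -
      have r: "?r q > 0" by (rule tq(3)[OF q])
      have tt: "tmap w v (tmap v w q) = q" by (rule tmap_tmap[OF v w tq(2)[OF q]])
      have "(1 + snd (tmap v w q)) * ratio' w w1 v v1 (fst q) = - (?s q / ?r q)"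
        using r unfolding ratio'_inverse[OF v w tq(2)[OF q]] slope_weight_def by (simp add: tmap_def power2_eq_square)
      then have "hx (tmap v w q) = fx q - ?s q / ?r q * fz q" unfolding hx_def tt fst_tmap by simp
      moreover have "hz (tmap v w q) = fz q / ?r q"
        unfolding hz_def tt fst_tmap using ratio_inverse[OF v w tq(2)[OF q]] by simp
      ultimately show ?thesis
        unfolding H_def using rescaled_form_upper[OF r, of \<epsilon> "fx q" "?s q" "fz q"] by (simp add: rem_weight_def)
    qed
    have "integrable ?M (\<lambda>q. (\<epsilon>\<^sup>2 * (fx q)\<^sup>2 + (fz q)\<^sup>2) + ?lin q + ?R q * (fz q)\<^sup>2)"
      by (intro Bochner_Integration.integrable_add iD ilin iRz)
    moreover have cong: "integrable ?M (\<lambda>q. ?r q * H (tmap v w q)) = integrable ?M (\<lambda>q. (\<epsilon>\<^sup>2 * (fx q)\<^sup>2 + (fz q)\<^sup>2) + ?lin q + ?R q * (fz q)\<^sup>2)"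
      by (rule Bochner_Integration.integrable_cong[OF refl]) (use pw in simp)
    ultimately have iH: "integrable ?N H" using integral_rescale(1)[OF v w cH H0] by simp
    have "integral\<^sup>L ?N H = (LINT q|?M. ?r q * H (tmap v w q))" by (rule integral_rescale(2)[OF v w cH H0])
    also have "\<dots> = (LINT q|?M. (\<epsilon>\<^sup>2 * (fx q)\<^sup>2 + (fz q)\<^sup>2) + ?lin q + ?R q * (fz q)\<^sup>2)"
      by (rule Bochner_Integration.integral_cong[OF refl]) (use pw in simp)
    also have "\<dots> = dirichlet \<epsilon> v fx fz + first_order \<epsilon> v v1 w w1 fx fz + (LINT q|?M. ?R q * (fz q)\<^sup>2)"
      unfolding dirichlet_def first_order_def
      by (simp only: Bochner_Integration.integral_add[OF Bochner_Integration.integrable_add[OF iD ilin] iRz]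
          Bochner_Integration.integral_add[OF iD ilin])
    finally have IH: "integral\<^sup>L ?N H = dirichlet \<epsilon> v fx fz + first_order \<epsilon> v v1 w w1 fx fz + (LINT q|?M. ?R q * (fz q)\<^sup>2)" .
    have e2: "\<epsilon>\<^sup>2 > 0" using \<epsilon> by simp
    have Lx: "sqint ?N hx"
      by (rule sqint_of_bound[OF iH continuous_measurable_Omega[OF profileD(5)[OF w] C1_gradD(1)[OF h]], of "1 / \<epsilon>\<^sup>2"])
        (use e2 in \<open>simp add: H_def field_simps\<close>)
    have Lz: "sqint ?N hz"
      by (rule sqint_of_bound[OF iH continuous_measurable_Omega[OF profileD(5)[OF w] C1_gradD(2)[OF h]], of 1])
        (simp add: H_def)
    have ch: "continuous_on (closure (Omega w)) h"
      unfolding h_def by (rule continuous_on_compose2[OF F(5) closed_im[OF w v] tmap_closure[OF w v]])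
    have fr: "h q = g q" if "q \<in> frontier (Omega w)" for q
      using tmap_boundary_values[OF w v F(6) that] G(6) that unfolding h_def by (cases q) auto
    note orth = potential_orthogonal[OF w g h ch fr Lx Lz]
    have io: "integrable ?N (\<lambda>q. 2 * (\<epsilon>\<^sup>2 * (gx q * (hx q - gx q)) + gz q * (hz q - gz q)))"
      by (rule integrable_mult_right[OF orth(2)])
    have "(LINT q|?N. 2 * (\<epsilon>\<^sup>2 * (gx q * (hx q - gx q)) + gz q * (hz q - gz q))) = 0"
      by (simp only: integral_mult_right_zero orth(1) mult_zero_right)
    then have "dirichlet \<epsilon> w gx gz = (LINT q|?N. (\<epsilon>\<^sup>2 * (gx q)\<^sup>2 + (gz q)\<^sup>2) + 2 * (\<epsilon>\<^sup>2 * (gx q * (hx q - gx q)) + gz q * (hz q - gz q)))"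
      unfolding dirichlet_def Bochner_Integration.integral_add[OF iDw io] by simp
    also have "\<dots> \<le> integral\<^sup>L ?N H"
    proof (rule integral_mono)
      show "integrable ?N (\<lambda>q. (\<epsilon>\<^sup>2 * (gx q)\<^sup>2 + (gz q)\<^sup>2) + 2 * (\<epsilon>\<^sup>2 * (gx q * (hx q - gx q)) + gz q * (hz q - gz q)))"
        by (rule Bochner_Integration.integrable_add[OF iDw io])
      fix q
      have "H q - ((\<epsilon>\<^sup>2 * (gx q)\<^sup>2 + (gz q)\<^sup>2) + 2 * (\<epsilon>\<^sup>2 * (gx q * (hx q - gx q)) + gz q * (hz q - gz q)))
        = \<epsilon>\<^sup>2 * (hx q - gx q)\<^sup>2 + (hz q - gz q)\<^sup>2"
        unfolding H_def by algebra
      moreover have "0 \<le> \<epsilon>\<^sup>2 * (hx q - gx q)\<^sup>2 + (hz q - gz q)\<^sup>2" by simp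
      ultimately show "(\<epsilon>\<^sup>2 * (gx q)\<^sup>2 + (gz q)\<^sup>2) + 2 * (\<epsilon>\<^sup>2 * (gx q * (hx q - gx q)) + gz q * (hz q - gz q)) \<le> H q"
        by linarith
    qed (rule iH)
    finally show ?thesis unfolding IH .
  qed
  show ?lower
  proof -
    define h where "h q = g (tmap v w q)" for q
    define hx where "hx q = gx (tmap v w q) + gz (tmap v w q) * ((1 + snd q) * ratio' v v1 w w1 (fst q))" for q
    define hz where "hz q = gz (tmap v w q) * ratio v w (fst q)" for q
    have h: "C1_grad (Omega v) h hx hz"
      unfolding h_def hx_def hz_def by (rule tmap_pullback[OF v w G(1)])
    define H where "H q = \<epsilon>\<^sup>2 * (gx q)\<^sup>2 + (gz q)\<^sup>2" for q
    have cH: "continuous_on (Omega w) H" unfolding H_def by (intro continuous_intros C1_gradD(1,2)[OF G(1)])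
    have H0: "H q \<ge> 0" for q by (simp add: H_def)
    have iN: "integrable ?N H" unfolding H_def by (rule iDw)
    then have iH: "integrable ?M (\<lambda>q. ?r q * H (tmap v w q))" using integral_rescale(1)[OF v w cH H0] by simp
    have IH: "dirichlet \<epsilon> w gx gz = (LINT q|?M. ?r q * H (tmap v w q))"
      using integral_rescale(2)[OF v w cH H0] unfolding dirichlet_def H_def by simp
    have ct: "continuous_on (Omega v) (tmap v w)" by (rule continuous_on_subset[OF tmap_continuous[OF v w] Omega_subset_closed])
    have im: "tmap v w ` Omega v \<subseteq> Omega w" using tq(1) by blast
    have e2: "\<epsilon>\<^sup>2 > 0" using \<epsilon> by simp
    have cinv: "continuous_on {-1..1} (\<lambda>x. 1 / ratio v w x)"
      using ratio_pos[OF v w] by (intro continuous_intros ratio_continuous(1)[OF v w]) force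
    obtain B where B: "B \<ge> 0" "\<And>x. x \<in> {-1..1} \<Longrightarrow> \<bar>1 / ratio v w x\<bar> \<le> B" using bounded_on_I[OF cinv] by blast
    have B': "y \<le> B * (?r q * y)" if "q \<in> Omega v" "y \<ge> 0" for q y
    proof -
      have "1 \<le> B * ?r q" using B(2)[OF tq(2)[OF that(1)]] tq(3)[OF that(1)] by (simp add: field_simps)
      then have "1 * y \<le> (B * ?r q) * y" by (intro mult_right_mono that(2))
      then show ?thesis by (simp add: mult.assoc)
    qed
    have LX: "sqint ?M (\<lambda>q. gx (tmap v w q))"
    proof (rule sqint_of_bound[OF iH, of _ "B / \<epsilon>\<^sup>2"])
      show "(\<lambda>q. gx (tmap v w q)) \<in> borel_measurable ?M"
        by (rule continuous_measurable_Omega[OF profileD(5)[OF v] continuous_on_compose2[OF C1_gradD(1)[OF G(1)] ct im]])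
      fix q assume "q \<in> space ?M"
      then have "H (tmap v w q) \<le> B * (?r q * H (tmap v w q))" using B' H0 by simp
      moreover have "\<epsilon>\<^sup>2 * (gx (tmap v w q))\<^sup>2 \<le> H (tmap v w q)" by (simp add: H_def)
      ultimately have "\<epsilon>\<^sup>2 * (gx (tmap v w q))\<^sup>2 \<le> B * (?r q * H (tmap v w q))" by linarith
      then show "(gx (tmap v w q))\<^sup>2 \<le> B / \<epsilon>\<^sup>2 * (?r q * H (tmap v w q))" using e2 by (simp add: field_simps)
    qed
    have LZ: "sqint ?M (\<lambda>q. gz (tmap v w q))"
    proof (rule sqint_of_bound[OF iH, of _ B])
      show "(\<lambda>q. gz (tmap v w q)) \<in> borel_measurable ?M"
        by (rule continuous_measurable_Omega[OF profileD(5)[OF v] continuous_on_compose2[OF C1_gradD(2)[OF G(1)] ct im]])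
      fix q assume "q \<in> space ?M"
      then have "H (tmap v w q) \<le> B * (?r q * H (tmap v w q))" using B' H0 by simp
      moreover have "(gz (tmap v w q))\<^sup>2 \<le> H (tmap v w q)" by (simp add: H_def)
      ultimately show "(gz (tmap v w q))\<^sup>2 \<le> B * (?r q * H (tmap v w q))" by linarith
    qed
    have wm: "sqint ?M (\<lambda>q. k q * gz (tmap v w q))" if kc: "continuous_on (closed_Omega v) k" for k
    proof -
      obtain C where C: "\<And>q. q \<in> space ?M \<Longrightarrow> \<bar>k q\<bar> \<le> C" using bounded_weight_Omega(2)[OF v kc] by blast
      show ?thesis by (rule sqint_bounded_mult[OF LZ bounded_weight_Omega(1)[OF v kc] C])
    qed
    have Lx: "sqint ?M hx"
      using sqint_add[OF LX wm[OF weights_continuous(2)[OF v w]]] unfolding hx_def slope_weight_def by (simp add: mult.commute)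
    have Lz: "sqint ?M hz"
      using wm[OF weights_continuous(1)[OF v w]] unfolding hz_def by (simp add: mult.commute)
    have ch: "continuous_on (closure (Omega v)) h"
      unfolding h_def by (rule continuous_on_compose2[OF G(5) closed_im[OF v w] tmap_closure[OF v w]])
    have fr: "h q = f q" if "q \<in> frontier (Omega v)" for q
      using tmap_boundary_values[OF v w G(6) that] F(6) that unfolding h_def by (cases q) auto
    note orth = potential_orthogonal[OF v f h ch fr Lx Lz]
    let ?o = "\<lambda>q. \<epsilon>\<^sup>2 * (fx q * (hx q - fx q)) + fz q * (hz q - fz q)"
    have io: "integrable ?M (\<lambda>q. 2 * ?o q)" by (rule integrable_mult_right[OF orth(2)])
    note i1 = Bochner_Integration.integrable_add[OF iD io]
    note i2 = Bochner_Integration.integrable_add[OF i1 ilin]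
    note i3 = Bochner_Integration.integrable_diff[OF i2 iRx]
    have "(LINT q|?M. 2 * ?o q) = 0"
      by (simp only: integral_mult_right_zero orth(1) mult_zero_right)
    then have "dirichlet \<epsilon> v fx fz + first_order \<epsilon> v v1 w w1 fx fz - (LINT q|?M. ?R q * (\<epsilon>\<^sup>2 * (fx q)\<^sup>2))
      = (LINT q|?M. (\<epsilon>\<^sup>2 * (fx q)\<^sup>2 + (fz q)\<^sup>2) + 2 * ?o q + ?lin q - ?R q * (\<epsilon>\<^sup>2 * (fx q)\<^sup>2))"
      unfolding dirichlet_def first_order_def Bochner_Integration.integral_diff[OF i2 iRx]
        Bochner_Integration.integral_add[OF i1 ilin] Bochner_Integration.integral_add[OF iD io] by simp
    also have "\<dots> \<le> (LINT q|?M. ?r q * H (tmap v w q))"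
    proof (rule integral_mono[OF i3 iH])
      fix q assume "q \<in> space ?M"
      then have r: "?r q > 0" using tq(3) by simp
      show "(\<epsilon>\<^sup>2 * (fx q)\<^sup>2 + (fz q)\<^sup>2) + 2 * ?o q + ?lin q - ?R q * (\<epsilon>\<^sup>2 * (fx q)\<^sup>2) \<le> ?r q * H (tmap v w q)"
        using rescaled_form_lower[OF r, of \<epsilon> "fx q" "fz q" "gx (tmap v w q)" "gz (tmap v w q)" "?s q"]
        unfolding H_def hx_def hz_def rem_weight_def slope_weight_def .
    qed
    finally show ?thesis unfolding IH .
  qed
qed

section \<open>Integration by parts up to the free boundary\<close>

lemma integral_Omega_fubini:
  fixes f :: "real \<times> real \<Rightarrow> real"
  assumes v: "profile v v1" and f: "continuous_on (closed_Omega v) f"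
  shows "(LINT q|lebesgue_on (Omega v). f q) = integral {-1..1} (\<lambda>x. integral {-1..v x} (\<lambda>z. f (x, z)))"
proof -
  let ?S = "Omega v"
  have o: "open ?S" by (rule open_Omega[OF profileD(5)[OF v]])
  let ?g = "\<lambda>q. indicator ?S q * f q"
  have m: "?g \<in> borel_measurable borel"
    by (rule borel_measurable_indicator_continuous[OF o continuous_on_subset[OF f Omega_subset_closed]])
  note conv = integral_lborel_lebesgue_on[OF borel_open[OF o] m]
  have "integrable (lebesgue_on ?S) f"
  proof -
    have one: "sqint (lebesgue_on ?S) (\<lambda>_. 1)"
      using finite_measure.integrable_const[OF finite_measure_Omega[OF profileD(5)[OF v]]] by (simp add: sqint_def)
    from weighted_product_integrable[OF v f one one] show ?thesis by simp
  qed
  then have gi: "integrable (lborel \<Otimes>\<^sub>M lborel) ?g" using conv(1) by (simp add: lborel_prod)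
  have inner: "(LINT z|lborel. ?g (x, z)) = indicator I x * integral {-1..v x} (\<lambda>z. f (x, z))" for x
  proof (cases "x \<in> I")
    case True
    then have x: "x \<in> {-1..1}" by auto
    have c: "continuous_on {-1..v x} (\<lambda>z. f (x, z))"
      by (rule continuous_on_compose2[OF f]) (use x in \<open>auto simp: closed_Omega_def intro!: continuous_intros\<close>)
    have "integrable lborel (\<lambda>z. indicator {-1..v x} z *\<^sub>R f (x, z))"
      by (rule borel_integrable_compact[OF compact_Icc c])
    then have "set_integrable lborel {-1..v x} (\<lambda>z. f (x, z))" unfolding set_integrable_def .
    then have si: "set_integrable lborel {-1<..<v x} (\<lambda>z. f (x, z))" by (rule set_integrable_subset) auto
    have "(LINT z|lborel. ?g (x, z)) = (LINT z:{-1<..<v x}|lborel. f (x, z))"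
      unfolding set_lebesgue_integral_def
      by (rule Bochner_Integration.integral_cong) (use True in \<open>auto simp: Omega_def indicator_def\<close>)
    also have "\<dots> = integral {-1<..<v x} (\<lambda>z. f (x, z))" by (rule set_borel_integral_eq_integral(2)[OF si])
    also have "\<dots> = integral {-1..v x} (\<lambda>z. f (x, z))" by (simp add: integral_open_interval_real)
    finally show ?thesis using True by simp
  next
    case False
    then have z: "(\<lambda>z. ?g (x, z)) = (\<lambda>_. 0)" by (auto simp: Omega_def fun_eq_iff)
    show ?thesis unfolding z using False by simp
  qed
  have oi: "integrable lborel (\<lambda>x. indicator I x * integral {-1..v x} (\<lambda>z. f (x, z)))"
    using lborel_pair.integrable_fst'[OF gi] unfolding inner .
  then have "set_integrable lborel I (\<lambda>x. integral {-1..v x} (\<lambda>z. f (x, z)))" by (simp add: set_integrable_def)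
  note outer = set_borel_integral_eq_integral(2)[OF this]
  have "(LINT q|lebesgue_on ?S. f q) = (LINT x|lborel. LINT z|lborel. ?g (x, z))"
    using lborel_pair.integral_fst'[OF gi] conv(2) by (simp add: lborel_prod)
  also have "\<dots> = (LINT x:I|lborel. integral {-1..v x} (\<lambda>z. f (x, z)))" unfolding inner set_lebesgue_integral_def by simp
  also have "\<dots> = integral {-1..1} (\<lambda>x. integral {-1..v x} (\<lambda>z. f (x, z)))"
    unfolding outer by (simp add: integral_open_interval_real)
  finally show ?thesis .
qed

abbreviation pdx :: "(real \<times> real \<Rightarrow> real) \<Rightarrow> real \<times> real \<Rightarrow> real" where
  "pdx f q \<equiv> frechet_derivative f (at q) (1, 0)"

abbreviation pdz :: "(real \<times> real \<Rightarrow> real) \<Rightarrow> real \<times> real \<Rightarrow> real" where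
  "pdz f q \<equiv> frechet_derivative f (at q) (0, 1)"

lemma smooth_partials:
  assumes "smooth f"
  shows "((\<lambda>x. f (x, z)) has_real_derivative pdx f (x, z)) (at x)" "((\<lambda>z. f (x, z)) has_real_derivative pdz f (x, z)) (at z)"
    "continuous_on A f" "continuous_on A (pdx f)" "continuous_on A (pdz f)"
  using has_derivative_partials[OF smooth_has_derivative[OF assms]] smooth_continuous[OF assms]
    smooth_continuous[OF smooth_frechet_derivative[OF assms]] by auto

lemma smooth_C1_grad: "smooth f \<Longrightarrow> C1_grad S f (pdx f) (pdz f)"
  unfolding C1_grad_def
proof (intro conjI ballI smooth_partials(4,5))
  fix q assume s: "smooth f"
  have "frechet_derivative f (at q) = (\<lambda>h. pdx f q * fst h + pdz f q * snd h)"
    by (rule ext) (rule frechet_derivative_partials[OF s])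
  then show "(f has_derivative (\<lambda>h. pdx f q * fst h + pdz f q * snd h)) (at q)" using smooth_has_derivative[OF s, of q] by simp
qed

text \<open>Leibniz' rule with a moving endpoint, by the chain rule for the function \<open>(x,
  y) \<mapsto> \<integral> \<Phi> (x, z) dz\<close> with \<open>z\<close> from \<open>-1\<close> to
  \<open>y\<close>.\<close>

lemma slice_integral_derivative:
  assumes v: "profile v v1" and \<Phi>: "smooth \<Phi>" and x: "x \<in> {-1..1}"
  shows "((\<lambda>x. integral {-1..v x} (\<lambda>z. \<Phi> (x, z))) has_real_derivative
    (integral {-1..v x} (\<lambda>z. pdx \<Phi> (x, z)) + v1 x * \<Phi> (x, v x))) (at x within {-1..1})"
proof -
  note P = smooth_partials[OF \<Phi>]
  obtain C where C: "\<And>x. x \<in> {-1..1} \<Longrightarrow> \<bar>v x\<bar> \<le> C" using bounded_on_I[OF profileD(5)[OF v]] by blast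
  let ?X = "{-1..1::real}" and ?Y = "{-1..C}"
  have vY: "v y \<in> ?Y" if "y \<in> ?X" for y using C[OF that] profileD(1)[OF v that] by auto
  define G where "G x y = integral {-1..y} (\<lambda>z. \<Phi> (x, z))" for x y
  have c2: "continuous_on A (\<lambda>z. \<Phi> (a, z))" for A a by (rule continuous_on_compose2[OF P(3)[of UNIV]]) (auto intro!: continuous_intros)
  have fx: "((\<lambda>x. G x y) has_derivative (*) (integral {-1..y} (\<lambda>z. pdx \<Phi> (x, z)))) (at x within ?X)" for y
    unfolding has_field_derivative_def[symmetric] G_def
  proof (rule leibniz_rule_field_derivative[of ?X "-1" y "\<lambda>x z. \<Phi> (x, z)" "\<lambda>x z. pdx \<Phi> (x, z)" x, unfolded cbox_interval])
    show "((\<lambda>x. \<Phi> (x, t)) has_real_derivative pdx \<Phi> (x, t)) (at x within ?X)" for x t by (rule has_field_derivative_at_within[OF P(1)])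
    show "(\<lambda>z. \<Phi> (x, z)) integrable_on {-1..y}" for x by (rule integrable_continuous_real[OF c2])
    show "continuous_on (?X \<times> {-1..y}) (\<lambda>(x, z). pdx \<Phi> (x, z))" using P(4)[of "?X \<times> {-1..y}"] by simp
  qed (use x in auto)
  have fy: "((\<lambda>y. G a y) has_derivative blinfun_apply (blinfun_scaleR_left (\<Phi> (a, y)))) (at y within ?Y)" if "y \<in> ?Y" for a y
    using integral_has_real_derivative[OF c2 that, of a] unfolding G_def has_field_derivative_def
    by (simp add: mult.commute[of _ "\<Phi> (a, y)"])
  have cont: "continuous (at (x, v x) within ?X \<times> ?Y) (\<lambda>(a, y). blinfun_scaleR_left (\<Phi> (a, y)) :: real \<Rightarrow>\<^sub>L real)"
  proof -
    have "continuous_on (?X \<times> ?Y) (\<lambda>p. blinfun_scaleR_left (\<Phi> p) :: real \<Rightarrow>\<^sub>L real)"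
      by (intro continuous_intros P(3))
    then have "continuous (at (x, v x) within ?X \<times> ?Y) (\<lambda>p. blinfun_scaleR_left (\<Phi> p) :: real \<Rightarrow>\<^sub>L real)"
      unfolding continuous_on_eq_continuous_within using x vY[OF x] by blast
    moreover have "(\<lambda>(a, y). blinfun_scaleR_left (\<Phi> (a, y)) :: real \<Rightarrow>\<^sub>L real) = (\<lambda>p. blinfun_scaleR_left (\<Phi> p))"
      by (auto simp: fun_eq_iff)
    ultimately show ?thesis by simp
  qed
  have D: "((\<lambda>(a, y). G a y) has_derivative (\<lambda>(tx, ty). integral {-1..v x} (\<lambda>z. pdx \<Phi> (x, z)) * tx
      + blinfun_apply (blinfun_scaleR_left (\<Phi> (x, v x))) ty)) (at (x, v x) within ?X \<times> ?Y)"
    by (rule has_derivative_partialsI[OF fx fy cont vY[OF x]]) auto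
  have dp: "((\<lambda>x. (x, v x)) has_derivative (\<lambda>h. (h, v1 x * h))) (at x within ?X)"
    using profileD(2)[OF v x] by (intro has_derivative_Pair has_derivative_ident) (simp add: has_field_derivative_def)
  have "((\<lambda>x. (\<lambda>(a, y). G a y) (x, v x)) has_derivative (\<lambda>h. (\<lambda>(tx, ty). integral {-1..v x} (\<lambda>z. pdx \<Phi> (x, z)) * tx
      + blinfun_apply (blinfun_scaleR_left (\<Phi> (x, v x))) ty) (h, v1 x * h))) (at x within ?X)"
    by (rule has_derivative_in_compose[OF dp has_derivative_subset[OF D]]) (use vY in auto)
  then have "((\<lambda>x. G x (v x)) has_derivative (\<lambda>h. integral {-1..v x} (\<lambda>z. pdx \<Phi> (x, z)) * h
      + blinfun_apply (blinfun_scaleR_left (\<Phi> (x, v x))) (v1 x * h))) (at x within ?X)"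
    by (simp only: prod.case)
  then show ?thesis
    unfolding has_field_derivative_def G_def
    by (rule has_derivative_eq_rhs) (auto simp: fun_eq_iff algebra_simps)
qed

lemma Omega_divergence_x:
  assumes v: "profile v v1" and \<Phi>: "smooth \<Phi>"
    and K: "\<And>x. x \<in> {-1..1} \<Longrightarrow> (K has_real_derivative K' x) (at x within {-1..1})" "continuous_on {-1..1} K'"
    and K0: "K (-1) = 0" "K 1 = 0"
  shows "(LINT q|lebesgue_on (Omega v). K' (fst q) * \<Phi> q + K (fst q) * pdx \<Phi> q)
    = - integral {-1..1} (\<lambda>x. K x * v1 x * \<Phi> (x, v x))"
proof -
  note P = smooth_partials[OF \<Phi>]
  have cK: "continuous_on {-1..1} K" by (rule DERIV_continuous_on[OF K(1)])
  have im: "fst ` closed_Omega v \<subseteq> {-1..1}" by (auto simp: closed_Omega_def)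
  have cf: "continuous_on (closed_Omega v) (\<lambda>q. K' (fst q) * \<Phi> q + K (fst q) * pdx \<Phi> q)"
    by (intro continuous_intros P(3,4) continuous_on_compose2[OF K(2) continuous_on_fst[OF continuous_on_id] im]
        continuous_on_compose2[OF cK continuous_on_fst[OF continuous_on_id] im])
  have ci: "(\<lambda>z. \<Phi> (a, z)) integrable_on {-1..y}" "(\<lambda>z. pdx \<Phi> (a, z)) integrable_on {-1..y}" for a y
    by (intro integrable_continuous_real continuous_on_compose2[OF P(3)[of UNIV]] continuous_on_compose2[OF P(4)[of UNIV]] continuous_intros; simp)+
  let ?S = "\<lambda>x. integral {-1..v x} (\<lambda>z. \<Phi> (x, z))"
  have d: "((\<lambda>x. K x * ?S x) has_real_derivative
     K' x * ?S x + (integral {-1..v x} (\<lambda>z. pdx \<Phi> (x, z)) + v1 x * \<Phi> (x, v x)) * K x) (at x within {-1..1})" if "x \<in> {-1..1}" for x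
    by (rule DERIV_mult[OF K(1)[OF that] slice_integral_derivative[OF v \<Phi> that]])
  have "((\<lambda>x. K' x * ?S x + (integral {-1..v x} (\<lambda>z. pdx \<Phi> (x, z)) + v1 x * \<Phi> (x, v x)) * K x) has_integral
      (K 1 * ?S 1 - K (-1) * ?S (-1))) {-1..1}"
    by (rule fundamental_theorem_of_calculus) (use d in \<open>auto simp: has_real_derivative_iff_has_vector_derivative\<close>)
  then have t: "((\<lambda>x. K' x * ?S x + (integral {-1..v x} (\<lambda>z. pdx \<Phi> (x, z)) + v1 x * \<Phi> (x, v x)) * K x) has_integral 0) {-1..1}"
    using K0 by simp
  have cb: "continuous_on {-1..1} (\<lambda>x. K x * v1 x * \<Phi> (x, v x))"
    by (intro continuous_intros cK profileD(4)[OF v] continuous_on_compose2[OF P(3)[of UNIV]] profileD(5)[OF v]) auto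
  have b: "((\<lambda>x. K x * v1 x * \<Phi> (x, v x)) has_integral integral {-1..1} (\<lambda>x. K x * v1 x * \<Phi> (x, v x))) {-1..1}"
    by (rule integrable_integral[OF integrable_continuous_real[OF cb]])
  have inner: "integral {-1..v x} (\<lambda>z. K' (fst (x, z)) * \<Phi> (x, z) + K (fst (x, z)) * pdx \<Phi> (x, z))
      = K' x * ?S x + K x * integral {-1..v x} (\<lambda>z. pdx \<Phi> (x, z))" for x
    unfolding fst_conv
    by (subst Henstock_Kurzweil_Integration.integral_add) (auto intro!: integrable_on_mult_right ci)
  have "integral {-1..1} (\<lambda>x. integral {-1..v x} (\<lambda>z. K' (fst (x, z)) * \<Phi> (x, z) + K (fst (x, z)) * pdx \<Phi> (x, z)))
    = 0 - integral {-1..1} (\<lambda>x. K x * v1 x * \<Phi> (x, v x))"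
    unfolding inner
    by (rule integral_unique) (use has_integral_diff[OF t b] in \<open>simp add: algebra_simps\<close>)
  then show ?thesis unfolding integral_Omega_fubini[OF v cf] by simp
qed

lemma Omega_divergence_z:
  assumes v: "profile v v1" and \<Phi>: "smooth \<Phi>" and k: "continuous_on {-1..1} k"
  shows "(LINT q|lebesgue_on (Omega v). k (fst q) * pdz \<Phi> q) = integral {-1..1} (\<lambda>x. k x * (\<Phi> (x, v x) - \<Phi> (x, -1)))"
proof -
  note P = smooth_partials[OF \<Phi>]
  have im: "fst ` closed_Omega v \<subseteq> {-1..1}" by (auto simp: closed_Omega_def)
  have cf: "continuous_on (closed_Omega v) (\<lambda>q. k (fst q) * pdz \<Phi> q)"
    by (intro continuous_intros P(5) continuous_on_compose2[OF k continuous_on_fst[OF continuous_on_id] im])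
  have "integral {-1..v x} (\<lambda>z. k (fst (x, z)) * pdz \<Phi> (x, z)) = k x * (\<Phi> (x, v x) - \<Phi> (x, -1))" if "x \<in> {-1..1}" for x
  proof -
    have "((\<lambda>z. pdz \<Phi> (x, z)) has_integral (\<Phi> (x, v x) - \<Phi> (x, -1))) {-1..v x}"
      by (rule fundamental_theorem_of_calculus)
        (use profileD(1)[OF v that] has_field_derivative_at_within[OF P(2)] in \<open>auto simp: has_real_derivative_iff_has_vector_derivative[symmetric]\<close>)
    then have "integral {-1..v x} (\<lambda>z. pdz \<Phi> (x, z)) = \<Phi> (x, v x) - \<Phi> (x, -1)" by (rule integral_unique)
    then show ?thesis by simp
  qed
  then show ?thesis
    unfolding integral_Omega_fubini[OF v cf] by (intro Henstock_Kurzweil_Integration.integral_cong) simp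
qed

text \<open>An \<open>H\<^sup>1\<close> function given by classical derivatives in the open domain, together with its trace on the
  graph; all integrations by parts up to the graph pass through the smooth approximants.\<close>

definition traced where
  "traced v a ax az ga \<longleftrightarrow> sqint (lebesgue_on (Omega v)) a \<and> sqint (lebesgue_on (Omega v)) ax \<and>
     sqint (lebesgue_on (Omega v)) az \<and> sqint (lebesgue_on I) ga \<and>
     (\<exists>\<phi>::nat \<Rightarrow> real \<times> real \<Rightarrow> real. (\<forall>n. smooth (\<phi> n)) \<and>
       (\<lambda>n. nrm (lebesgue_on (Omega v)) (\<lambda>q. \<phi> n q - a q)) \<longlonglongrightarrow> 0 \<and>
       (\<lambda>n. nrm (lebesgue_on (Omega v)) (\<lambda>q. pdx (\<phi> n) q - ax q)) \<longlonglongrightarrow> 0 \<and>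
       (\<lambda>n. nrm (lebesgue_on (Omega v)) (\<lambda>q. pdz (\<phi> n) q - az q)) \<longlonglongrightarrow> 0 \<and>
       (\<lambda>n. nrm (lebesgue_on I) (\<lambda>x. \<phi> n (x, v x) - ga x)) \<longlonglongrightarrow> 0)"

lemma sqint_continuous_Omega:
  assumes v: "profile v v1" and k: "continuous_on (closed_Omega v) k"
  shows "sqint (lebesgue_on (Omega v)) k"
proof -
  have one: "sqint (lebesgue_on (Omega v)) (\<lambda>_. 1)"
    using finite_measure.integrable_const[OF finite_measure_Omega[OF profileD(5)[OF v]]] by (simp add: sqint_def)
  obtain C where C: "\<And>q. q \<in> space (lebesgue_on (Omega v)) \<Longrightarrow> \<bar>k q\<bar> \<le> C" using bounded_weight_Omega(2)[OF v k] by blast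
  from sqint_bounded_mult[OF one bounded_weight_Omega(1)[OF v k] C] show ?thesis by simp
qed

lemma sqint_continuous_I: "continuous_on {-1..1} f \<Longrightarrow> sqint (lebesgue_on I) f"
  using L2_on_I_bounded_continuous L2_on_iff_sqint[of I f] by simp

lemma integral_lebesgue_on_I:
  fixes f :: "real \<Rightarrow> real"
  assumes "continuous_on {-1..1} f"
  shows "(LINT x|lebesgue_on I. f x) = integral {-1..1} f"
proof -
  have "set_integrable lebesgue I f" unfolding set_integrable_I_closed by (rule continuous_on_integrable_I[OF assms])
  then show ?thesis using set_integral_I[of f] set_integral_lebesgue_on(1)[of I f] by simp
qed

text \<open>The \<open>H\<^sup>1\<close> norm of the approximation error contains the weak derivatives chosen by
  \<open>weak_deriv\<close>; these agree almost everywhere with the differences of classical ones.\<close>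

lemma graph_trace_traced:
  assumes v: "profile v v1" and tr: "has_graph_trace v w g" and a: "C1_grad (Omega v) a ax az"
    and ae: "AE q in lebesgue. q \<in> Omega v \<longrightarrow> w q = a q"
  shows "traced v a ax az g"
proof -
  let ?S = "Omega v"
  have oS: "open ?S" by (rule open_Omega[OF profileD(5)[OF v]])
  have sS: "?S \<in> sets lebesgue" by (rule Omega_sets[OF profileD(5)[OF v]])
  note Liff = L2_on_iff_sqint[OF sS] and Nrm = L2_norm_on_eq_nrm[OF sS]
  have B: "(1, 0) \<in> (Basis :: (real \<times> real) set)" "(0, 1) \<in> (Basis :: (real \<times> real) set)" by (auto simp: Basis_prod_def)
  obtain \<phi> :: "nat \<Rightarrow> real \<times> real \<Rightarrow> real" where s1: "sobolev (Suc 0) ?S w" and Lg: "L2_on I g" and sm: "\<And>n. smooth (\<phi> n)"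
    and l1: "(\<lambda>n. sobolev_norm 1 ?S (\<lambda>p. \<phi> n p - w p)) \<longlonglongrightarrow> 0"
    and l2: "(\<lambda>n. L2_norm_on I (\<lambda>x. \<phi> n (x, v x) - g x)) \<longlonglongrightarrow> 0"
    using tr unfolding has_graph_trace_def One_nat_def by blast
  have ea: "AE q in lebesgue. q \<in> ?S \<longrightarrow> a q = w q" using ae by eventually_elim simp
  have rf: "AE q in lebesgue. q \<in> ?S \<longrightarrow> f q = f q" for f :: "real \<times> real \<Rightarrow> real" by simp
  note wx = has_weak_deriv_cong_AE[OF C1_grad_has_weak_deriv(1)[OF oS a] ea rf]
  note wz = has_weak_deriv_cong_AE[OF C1_grad_has_weak_deriv(2)[OF oS a] ea rf]
  have La: "L2_on ?S a" by (rule L2_on_cong_AE[OF sobolev_L2[OF s1] ae])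
  have Lax: "L2_on ?S ax"
    by (rule L2_on_cong_AE[OF sobolev_L2[OF sobolev_weak_deriv(2)[OF oS s1 B(1)]] weak_deriv_AE_eq[OF oS wx]])
  have Laz: "L2_on ?S az"
    by (rule L2_on_cong_AE[OF sobolev_L2[OF sobolev_weak_deriv(2)[OF oS s1 B(2)]] weak_deriv_AE_eq[OF oS wz]])
  have sq: "sqint (lebesgue_on ?S) (\<phi> n)" "sqint (lebesgue_on ?S) (pdx (\<phi> n))" "sqint (lebesgue_on ?S) (pdz (\<phi> n))" for n
    by (intro sqint_continuous_Omega[OF v] smooth_partials(3,4,5)[OF sm])+
  have n0: "L2_norm_on ?S (\<lambda>q. \<phi> n q - w q) = nrm (lebesgue_on ?S) (\<lambda>q. \<phi> n q - a q)" for n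
  proof -
    have "L2_on ?S (\<lambda>q. \<phi> n q - w q)"
      using sq(1)[of n] sobolev_L2[OF s1] unfolding Liff by (rule sqint_diff)
    moreover have "AE q in lebesgue. q \<in> ?S \<longrightarrow> \<phi> n q - w q = \<phi> n q - a q" using ae by eventually_elim simp
    ultimately show ?thesis using L2_norm_on_cong_AE Nrm by metis
  qed
  have nd: "L2_norm_on ?S (weak_deriv ?S e (\<lambda>q. \<phi> n q - w q)) = nrm (lebesgue_on ?S) (\<lambda>q. d q - ae q)"
    if "has_weak_deriv ?S e (\<phi> n) d" "has_weak_deriv ?S e w ae" "sqint (lebesgue_on ?S) d" "L2_on ?S ae" for n e d ae
  proof -
    have L: "L2_on ?S (\<lambda>q. d q - ae q)" using that(3,4) unfolding Liff by (rule sqint_diff)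
    have e: "AE q in lebesgue. q \<in> ?S \<longrightarrow> weak_deriv ?S e (\<lambda>q. \<phi> n q - w q) q = d q - ae q"
      by (rule weak_deriv_AE_eq[OF oS has_weak_deriv_diff[OF that(1,2)]])
    then have "AE q in lebesgue. q \<in> ?S \<longrightarrow> d q - ae q = weak_deriv ?S e (\<lambda>q. \<phi> n q - w q) q" by eventually_elim simp
    from L2_norm_on_cong_AE[OF L this] show ?thesis using Nrm by simp
  qed
  note wd = C1_grad_has_weak_deriv[OF oS smooth_C1_grad[OF sm]]
  have sn: "sobolev_norm 1 ?S (\<lambda>p. \<phi> n p - w p) = sqrt ((nrm (lebesgue_on ?S) (\<lambda>q. \<phi> n q - a q))\<^sup>2
     + ((nrm (lebesgue_on ?S) (\<lambda>q. pdx (\<phi> n) q - ax q))\<^sup>2 + (nrm (lebesgue_on ?S) (\<lambda>q. pdz (\<phi> n) q - az q))\<^sup>2))" for n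
    unfolding sobolev_norm_def
    using n0[of n] nd[OF wd(1) wx sq(2) Lax, of n] nd[OF wd(2) wz sq(3) Laz, of n]
    by (simp add: Basis_prod_def)
  have b: "nrm (lebesgue_on ?S) (\<lambda>q. \<phi> n q - a q) \<le> sobolev_norm 1 ?S (\<lambda>p. \<phi> n p - w p)"
    "nrm (lebesgue_on ?S) (\<lambda>q. pdx (\<phi> n) q - ax q) \<le> sobolev_norm 1 ?S (\<lambda>p. \<phi> n p - w p)"
    "nrm (lebesgue_on ?S) (\<lambda>q. pdz (\<phi> n) q - az q) \<le> sobolev_norm 1 ?S (\<lambda>p. \<phi> n p - w p)" for n
    unfolding sn by (rule real_le_rsqrt, simp)+
  have lim: "h \<longlonglongrightarrow> 0"
    if "\<And>n. 0 \<le> h n" "\<And>n. h n \<le> sobolev_norm 1 ?S (\<lambda>p. \<phi> n p - w p)" for h :: "nat \<Rightarrow> real"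
    by (rule tendsto_sandwich[OF _ _ tendsto_const l1]) (use that in auto)
  note lims = lim[OF nrm_nonneg b(1)] lim[OF nrm_nonneg b(2)] lim[OF nrm_nonneg b(3)]
  show ?thesis
    unfolding traced_def
    using La Lax Laz Lg l2 sm lims L2_norm_on_eq_nrm[of I] L2_on_iff_sqint[of I] unfolding Liff by auto
qed

lemma traced_one:
  assumes v: "profile v v1"
  shows "traced v (\<lambda>_. 1) (\<lambda>_. 0) (\<lambda>_. 0) (\<lambda>_. 1)"
proof -
  have d: "frechet_derivative (\<lambda>_. 1 :: real) (at q) e = 0" for q e :: "real \<times> real"
    by (simp add: frechet_derivative_const)
  have "sqint (lebesgue_on (Omega v)) (\<lambda>_. c)" for c by (intro sqint_continuous_Omega[OF v] continuous_on_const)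
  moreover have "sqint (lebesgue_on I) (\<lambda>_. 1)" by (intro sqint_continuous_I continuous_on_const)
  ultimately show ?thesis
    unfolding traced_def by (intro conjI exI[of _ "\<lambda>_ _. 1"]) (auto simp: d nrm_def intro: smooth_const)
qed

lemma fst_weight_continuous:
  "continuous_on {-1..1} k \<Longrightarrow> continuous_on (closed_Omega v) (\<lambda>q. k (fst q))"
  by (rule continuous_on_compose2[OF _ continuous_on_fst[OF continuous_on_id]]) (auto simp: closed_Omega_def)

lemma tendsto_weighted_Omega:
  assumes v: "profile v v1" and k: "continuous_on (closed_Omega v) k"
    and a: "\<And>n::nat. sqint (lebesgue_on (Omega v)) (an n)" "sqint (lebesgue_on (Omega v)) a"
      "(\<lambda>n. nrm (lebesgue_on (Omega v)) (\<lambda>q. an n q - a q)) \<longlonglongrightarrow> 0"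
    and b: "\<And>n. sqint (lebesgue_on (Omega v)) (bn n)" "sqint (lebesgue_on (Omega v)) b"
      "(\<lambda>n. nrm (lebesgue_on (Omega v)) (\<lambda>q. bn n q - b q)) \<longlonglongrightarrow> 0"
  shows "(\<lambda>n. LINT q|lebesgue_on (Omega v). k q * (an n q * bn n q)) \<longlonglongrightarrow> (LINT q|lebesgue_on (Omega v). k q * (a q * b q))"
proof -
  obtain C where C: "\<And>q. q \<in> space (lebesgue_on (Omega v)) \<Longrightarrow> \<bar>k q\<bar> \<le> C" using bounded_weight_Omega(2)[OF v k] by blast
  show ?thesis
    by (rule tendsto_integral_product[OF _ a(2) _ b(2) a(3) b(3) bounded_weight_Omega(1)[OF v k] C]) (simp_all add: a(1) b(1))
qed

lemma continuous_imp_measurable_I: "continuous_on {-1..1} k \<Longrightarrow> k \<in> borel_measurable (lebesgue_on I)" for k :: "real \<Rightarrow> real"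
  by (rule continuous_imp_measurable_on_sets_lebesgue) (auto intro: continuous_on_subset)

lemma tendsto_weighted_I:
  fixes k :: "real \<Rightarrow> real"
  assumes k: "continuous_on {-1..1} k"
    and a: "\<And>n::nat. sqint (lebesgue_on I) (an n)" "sqint (lebesgue_on I) a"
      "(\<lambda>n. nrm (lebesgue_on I) (\<lambda>q. an n q - a q)) \<longlonglongrightarrow> 0"
    and b: "\<And>n. sqint (lebesgue_on I) (bn n)" "sqint (lebesgue_on I) b"
      "(\<lambda>n. nrm (lebesgue_on I) (\<lambda>q. bn n q - b q)) \<longlonglongrightarrow> 0"
  shows "(\<lambda>n. LINT q|lebesgue_on I. k q * (an n q * bn n q)) \<longlonglongrightarrow> (LINT q|lebesgue_on I. k q * (a q * b q))"
proof -
  obtain C where C: "\<And>x. x \<in> {-1..1} \<Longrightarrow> \<bar>k x\<bar> \<le> C" using bounded_on_I[OF k] by blast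
  show ?thesis
    by (rule tendsto_integral_product[OF _ a(2) _ b(2) a(3) b(3) continuous_imp_measurable_I[OF k], where C = C]) (auto simp: a(1) b(1) intro!: C)
qed

lemma tracedE:
  assumes "traced v a ax az ga"
  obtains \<phi> :: "nat \<Rightarrow> real \<times> real \<Rightarrow> real" where "\<And>n. smooth (\<phi> n)"
    "(\<lambda>n. nrm (lebesgue_on (Omega v)) (\<lambda>q. \<phi> n q - a q)) \<longlonglongrightarrow> 0"
    "(\<lambda>n. nrm (lebesgue_on (Omega v)) (\<lambda>q. pdx (\<phi> n) q - ax q)) \<longlonglongrightarrow> 0"
    "(\<lambda>n. nrm (lebesgue_on (Omega v)) (\<lambda>q. pdz (\<phi> n) q - az q)) \<longlonglongrightarrow> 0"
    "(\<lambda>n. nrm (lebesgue_on I) (\<lambda>x. \<phi> n (x, v x) - ga x)) \<longlonglongrightarrow> 0"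
  using assms unfolding traced_def by blast

lemma tracedD:
  assumes "traced v a ax az ga"
  shows "sqint (lebesgue_on (Omega v)) a" "sqint (lebesgue_on (Omega v)) ax" "sqint (lebesgue_on (Omega v)) az"
    "sqint (lebesgue_on I) ga"
  using assms by (auto simp: traced_def)

text \<open>The factor \<open>1 + s z\<close> covers the two weights \<open>1\<close> and \<open>1 + z\<close> that occur.\<close>

lemma traced_parts_x:
  assumes v: "profile v v1" and a: "traced v a ax az ga" and b: "traced v b bx bz gb"
    and K: "\<And>x. x \<in> {-1..1} \<Longrightarrow> (K has_real_derivative K' x) (at x within {-1..1})" "continuous_on {-1..1} K'"
    and K0: "K (-1) = 0" "K 1 = 0"
  shows "(LINT q|lebesgue_on (Omega v). (K' (fst q) * (1 + s * snd q)) * (a q * b q))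
     + (LINT q|lebesgue_on (Omega v). (K (fst q) * (1 + s * snd q)) * (ax q * b q))
     + (LINT q|lebesgue_on (Omega v). (K (fst q) * (1 + s * snd q)) * (a q * bx q))
    = - (LINT x|lebesgue_on I. (K x * v1 x * (1 + s * v x)) * (ga x * gb x))"
proof -
  let ?M = "lebesgue_on (Omega v)"
  obtain \<phi> :: "nat \<Rightarrow> real \<times> real \<Rightarrow> real" where A: "\<And>n. smooth (\<phi> n)" "(\<lambda>n. nrm ?M (\<lambda>q. \<phi> n q - a q)) \<longlonglongrightarrow> 0"
    "(\<lambda>n. nrm ?M (\<lambda>q. pdx (\<phi> n) q - ax q)) \<longlonglongrightarrow> 0" "(\<lambda>n. nrm ?M (\<lambda>q. pdz (\<phi> n) q - az q)) \<longlonglongrightarrow> 0"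
    "(\<lambda>n. nrm (lebesgue_on I) (\<lambda>x. \<phi> n (x, v x) - ga x)) \<longlonglongrightarrow> 0"
    by (rule tracedE[OF a]) (rule that)
  obtain \<theta> :: "nat \<Rightarrow> real \<times> real \<Rightarrow> real" where B: "\<And>n. smooth (\<theta> n)" "(\<lambda>n. nrm ?M (\<lambda>q. \<theta> n q - b q)) \<longlonglongrightarrow> 0"
    "(\<lambda>n. nrm ?M (\<lambda>q. pdx (\<theta> n) q - bx q)) \<longlonglongrightarrow> 0" "(\<lambda>n. nrm ?M (\<lambda>q. pdz (\<theta> n) q - bz q)) \<longlonglongrightarrow> 0"
    "(\<lambda>n. nrm (lebesgue_on I) (\<lambda>x. \<theta> n (x, v x) - gb x)) \<longlonglongrightarrow> 0"
    by (rule tracedE[OF b]) (rule that)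
  note TA = tracedD[OF a] and TB = tracedD[OF b]
  have cK: "continuous_on {-1..1} K" by (rule DERIV_continuous_on[OF K(1)])
  have sA: "sqint ?M (\<phi> n)" "sqint ?M (pdx (\<phi> n))" and sB: "sqint ?M (\<theta> n)" "sqint ?M (pdx (\<theta> n))" for n
    by (intro sqint_continuous_Omega[OF v] smooth_partials(3,4)[OF A(1)])+
      (intro sqint_continuous_Omega[OF v] smooth_partials(3,4)[OF B(1)])+
  have cv: "continuous_on {-1..1} (\<lambda>x. \<phi> (x, v x))" if "smooth \<phi>" for \<phi>
    by (rule continuous_on_compose2[OF smooth_continuous[OF that, of UNIV]]) (auto intro!: continuous_intros profileD(5)[OF v])
  have tA: "sqint (lebesgue_on I) (\<lambda>x. \<phi> n (x, v x))" and tB: "sqint (lebesgue_on I) (\<lambda>x. \<theta> n (x, v x))" for n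
    by (rule sqint_continuous_I[OF cv[OF A(1)]], rule sqint_continuous_I[OF cv[OF B(1)]])
  have w: "continuous_on (closed_Omega v) (\<lambda>q. K' (fst q) * (1 + s * snd q))" "continuous_on (closed_Omega v) (\<lambda>q. K (fst q) * (1 + s * snd q))"
    by (intro continuous_intros fst_weight_continuous K(2) cK)+
  have wb: "continuous_on {-1..1} (\<lambda>x. K x * v1 x * (1 + s * v x))" by (intro continuous_intros cK profileD(4,5)[OF v])
  have id: "(LINT q|?M. (K' (fst q) * (1 + s * snd q)) * (\<phi> n q * \<theta> n q))
     + (LINT q|?M. (K (fst q) * (1 + s * snd q)) * (pdx (\<phi> n) q * \<theta> n q))
     + (LINT q|?M. (K (fst q) * (1 + s * snd q)) * (\<phi> n q * pdx (\<theta> n) q))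
    = - (LINT x|lebesgue_on I. (K x * v1 x * (1 + s * v x)) * (\<phi> n (x, v x) * \<theta> n (x, v x)))" for n
  proof -
    define \<Phi> where "\<Phi> q = (1 + s * snd q) * (\<phi> n q * \<theta> n q)" for q :: "real \<times> real"
    have s1: "smooth (\<lambda>q::real \<times> real. 1 + s * snd q)"
      by (rule smooth_add[OF smooth_const smooth_mult[OF smooth_const smooth_bounded_linear[OF bounded_linear_snd]]])
    have s\<Phi>: "smooth \<Phi>" unfolding \<Phi>_def by (rule smooth_mult[OF s1 smooth_mult[OF A(1) B(1)]])
    have px: "pdx \<Phi> q = (1 + s * snd q) * (pdx (\<phi> n) q * \<theta> n q + \<phi> n q * pdx (\<theta> n) q)" for q
    proof -
      obtain x z where q: "q = (x, z)" by (cases q)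
      have "((\<lambda>x. (1 + s * z) * (\<phi> n (x, z) * \<theta> n (x, z))) has_real_derivative
         (1 + s * z) * (pdx (\<phi> n) (x, z) * \<theta> n (x, z) + pdx (\<theta> n) (x, z) * \<phi> n (x, z))) (at x)"
        by (intro DERIV_cmult DERIV_mult smooth_partials(1)[OF A(1)] smooth_partials(1)[OF B(1)])
      moreover have "((\<lambda>x. (1 + s * z) * (\<phi> n (x, z) * \<theta> n (x, z))) has_real_derivative pdx \<Phi> (x, z)) (at x)"
        using smooth_partials(1)[OF s\<Phi>, of z x] by (simp add: \<Phi>_def)
      ultimately show ?thesis using DERIV_unique unfolding q by (fastforce simp: mult.commute)
    qed
    have i1: "integrable ?M (\<lambda>q. (K' (fst q) * (1 + s * snd q)) * (\<phi> n q * \<theta> n q))"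
      and i2: "integrable ?M (\<lambda>q. (K (fst q) * (1 + s * snd q)) * (pdx (\<phi> n) q * \<theta> n q))"
      and i3: "integrable ?M (\<lambda>q. (K (fst q) * (1 + s * snd q)) * (\<phi> n q * pdx (\<theta> n) q))"
      by (intro weighted_product_integrable[OF v] w sA sB)+
    have "(LINT q|?M. (K' (fst q) * (1 + s * snd q)) * (\<phi> n q * \<theta> n q))
     + (LINT q|?M. (K (fst q) * (1 + s * snd q)) * (pdx (\<phi> n) q * \<theta> n q))
     + (LINT q|?M. (K (fst q) * (1 + s * snd q)) * (\<phi> n q * pdx (\<theta> n) q))
     = (LINT q|?M. K' (fst q) * \<Phi> q + K (fst q) * pdx \<Phi> q)"
      unfolding Bochner_Integration.integral_add[OF i1 i2, symmetric]
        Bochner_Integration.integral_add[OF Bochner_Integration.integrable_add[OF i1 i2] i3, symmetric]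
      by (rule Bochner_Integration.integral_cong) (simp_all add: px \<Phi>_def algebra_simps)
    also have "\<dots> = - integral {-1..1} (\<lambda>x. K x * v1 x * \<Phi> (x, v x))" by (rule Omega_divergence_x[OF v s\<Phi> K K0])
    also have "integral {-1..1} (\<lambda>x. K x * v1 x * \<Phi> (x, v x)) = (LINT x|lebesgue_on I. (K x * v1 x * (1 + s * v x)) * (\<phi> n (x, v x) * \<theta> n (x, v x)))"
      unfolding integral_lebesgue_on_I[OF continuous_on_mult[OF wb continuous_on_mult[OF cv[OF A(1)[of n]] cv[OF B(1)[of n]]]]]
      by (simp add: \<Phi>_def mult.assoc)
    finally show ?thesis .
  qed
  have l1: "(\<lambda>n. (LINT q|?M. (K' (fst q) * (1 + s * snd q)) * (\<phi> n q * \<theta> n q))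
     + (LINT q|?M. (K (fst q) * (1 + s * snd q)) * (pdx (\<phi> n) q * \<theta> n q))
     + (LINT q|?M. (K (fst q) * (1 + s * snd q)) * (\<phi> n q * pdx (\<theta> n) q))) \<longlonglongrightarrow>
     (LINT q|?M. (K' (fst q) * (1 + s * snd q)) * (a q * b q))
     + (LINT q|?M. (K (fst q) * (1 + s * snd q)) * (ax q * b q))
     + (LINT q|?M. (K (fst q) * (1 + s * snd q)) * (a q * bx q))"
    by (intro tendsto_add tendsto_weighted_Omega[OF v] w sA sB TA TB A B)
  have l2: "(\<lambda>n. - (LINT x|lebesgue_on I. (K x * v1 x * (1 + s * v x)) * (\<phi> n (x, v x) * \<theta> n (x, v x)))) \<longlonglongrightarrow>
     - (LINT x|lebesgue_on I. (K x * v1 x * (1 + s * v x)) * (ga x * gb x))"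
    by (intro tendsto_minus tendsto_weighted_I[OF wb] tA tB TA TB A B)
  show ?thesis using LIMSEQ_unique[OF l1[unfolded id] l2] .
qed

text \<open>The weight \<open>1 + z\<close> vanishes on the bottom, so that only the trace on the graph appears.\<close>

lemma traced_parts_z:
  assumes v: "profile v v1" and a: "traced v a ax az ga" and b: "traced v b bx bz gb" and k: "continuous_on {-1..1} k"
  shows "(LINT q|lebesgue_on (Omega v). k (fst q) * (a q * b q))
     + (LINT q|lebesgue_on (Omega v). (k (fst q) * (1 + snd q)) * (az q * b q))
     + (LINT q|lebesgue_on (Omega v). (k (fst q) * (1 + snd q)) * (a q * bz q))
    = (LINT x|lebesgue_on I. (k x * (1 + v x)) * (ga x * gb x))"
proof -
  let ?M = "lebesgue_on (Omega v)"
  obtain \<phi> :: "nat \<Rightarrow> real \<times> real \<Rightarrow> real" where A: "\<And>n. smooth (\<phi> n)" "(\<lambda>n. nrm ?M (\<lambda>q. \<phi> n q - a q)) \<longlonglongrightarrow> 0"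
    "(\<lambda>n. nrm ?M (\<lambda>q. pdx (\<phi> n) q - ax q)) \<longlonglongrightarrow> 0" "(\<lambda>n. nrm ?M (\<lambda>q. pdz (\<phi> n) q - az q)) \<longlonglongrightarrow> 0"
    "(\<lambda>n. nrm (lebesgue_on I) (\<lambda>x. \<phi> n (x, v x) - ga x)) \<longlonglongrightarrow> 0"
    by (rule tracedE[OF a]) (rule that)
  obtain \<theta> :: "nat \<Rightarrow> real \<times> real \<Rightarrow> real" where B: "\<And>n. smooth (\<theta> n)" "(\<lambda>n. nrm ?M (\<lambda>q. \<theta> n q - b q)) \<longlonglongrightarrow> 0"
    "(\<lambda>n. nrm ?M (\<lambda>q. pdx (\<theta> n) q - bx q)) \<longlonglongrightarrow> 0" "(\<lambda>n. nrm ?M (\<lambda>q. pdz (\<theta> n) q - bz q)) \<longlonglongrightarrow> 0"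
    "(\<lambda>n. nrm (lebesgue_on I) (\<lambda>x. \<theta> n (x, v x) - gb x)) \<longlonglongrightarrow> 0"
    by (rule tracedE[OF b]) (rule that)
  note TA = tracedD[OF a] and TB = tracedD[OF b]
  have sA: "sqint ?M (\<phi> n)" "sqint ?M (pdz (\<phi> n))" and sB: "sqint ?M (\<theta> n)" "sqint ?M (pdz (\<theta> n))" for n
    by (intro sqint_continuous_Omega[OF v] smooth_partials(3,5)[OF A(1)])+
      (intro sqint_continuous_Omega[OF v] smooth_partials(3,5)[OF B(1)])+
  have cv: "continuous_on {-1..1} (\<lambda>x. \<phi> (x, v x))" if "smooth \<phi>" for \<phi>
    by (rule continuous_on_compose2[OF smooth_continuous[OF that, of UNIV]]) (auto intro!: continuous_intros profileD(5)[OF v])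
  have tA: "sqint (lebesgue_on I) (\<lambda>x. \<phi> n (x, v x))" and tB: "sqint (lebesgue_on I) (\<lambda>x. \<theta> n (x, v x))" for n
    by (rule sqint_continuous_I[OF cv[OF A(1)]], rule sqint_continuous_I[OF cv[OF B(1)]])
  have w: "continuous_on (closed_Omega v) (\<lambda>q. k (fst q))" "continuous_on (closed_Omega v) (\<lambda>q. k (fst q) * (1 + snd q))"
    by (intro continuous_intros fst_weight_continuous k)+
  have wb: "continuous_on {-1..1} (\<lambda>x. k x * (1 + v x))" by (intro continuous_intros k profileD(4,5)[OF v])
  have id: "(LINT q|?M. k (fst q) * (\<phi> n q * \<theta> n q))
     + (LINT q|?M. (k (fst q) * (1 + snd q)) * (pdz (\<phi> n) q * \<theta> n q))
     + (LINT q|?M. (k (fst q) * (1 + snd q)) * (\<phi> n q * pdz (\<theta> n) q))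
    = (LINT x|lebesgue_on I. (k x * (1 + v x)) * (\<phi> n (x, v x) * \<theta> n (x, v x)))" for n
  proof -
    define \<Phi> where "\<Phi> q = (1 + snd q) * (\<phi> n q * \<theta> n q)" for q :: "real \<times> real"
    have s1: "smooth (\<lambda>q::real \<times> real. 1 + snd q)"
      by (rule smooth_add[OF smooth_const smooth_bounded_linear[OF bounded_linear_snd]])
    have s\<Phi>: "smooth \<Phi>" unfolding \<Phi>_def by (rule smooth_mult[OF s1 smooth_mult[OF A(1) B(1)]])
    have pz: "pdz \<Phi> q = \<phi> n q * \<theta> n q + (1 + snd q) * (pdz (\<phi> n) q * \<theta> n q + \<phi> n q * pdz (\<theta> n) q)" for q
    proof -
      obtain x z where q: "q = (x, z)" by (cases q)
      have "((\<lambda>z. (1 + z) * (\<phi> n (x, z) * \<theta> n (x, z))) has_real_derivative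
         (0 + 1) * (\<phi> n (x, z) * \<theta> n (x, z)) + (pdz (\<phi> n) (x, z) * \<theta> n (x, z) + pdz (\<theta> n) (x, z) * \<phi> n (x, z)) * (1 + z)) (at z)"
        by (intro DERIV_add DERIV_const DERIV_ident DERIV_mult smooth_partials(2)[OF A(1)] smooth_partials(2)[OF B(1)])
      moreover have "((\<lambda>z. (1 + z) * (\<phi> n (x, z) * \<theta> n (x, z))) has_real_derivative pdz \<Phi> (x, z)) (at z)"
        using smooth_partials(2)[OF s\<Phi>, of x z] by (simp add: \<Phi>_def)
      ultimately have "pdz \<Phi> (x, z) = (0 + 1) * (\<phi> n (x, z) * \<theta> n (x, z)) + (pdz (\<phi> n) (x, z) * \<theta> n (x, z) + pdz (\<theta> n) (x, z) * \<phi> n (x, z)) * (1 + z)"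
        by (rule DERIV_unique[rotated])
      then show ?thesis unfolding q by (simp add: mult.commute)
    qed
    have i1: "integrable ?M (\<lambda>q. k (fst q) * (\<phi> n q * \<theta> n q))"
      and i2: "integrable ?M (\<lambda>q. (k (fst q) * (1 + snd q)) * (pdz (\<phi> n) q * \<theta> n q))"
      and i3: "integrable ?M (\<lambda>q. (k (fst q) * (1 + snd q)) * (\<phi> n q * pdz (\<theta> n) q))"
      by (intro weighted_product_integrable[OF v] w sA sB)+
    have "(LINT q|?M. k (fst q) * (\<phi> n q * \<theta> n q))
     + (LINT q|?M. (k (fst q) * (1 + snd q)) * (pdz (\<phi> n) q * \<theta> n q))
     + (LINT q|?M. (k (fst q) * (1 + snd q)) * (\<phi> n q * pdz (\<theta> n) q))
     = (LINT q|?M. k (fst q) * pdz \<Phi> q)"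
      unfolding Bochner_Integration.integral_add[OF i1 i2, symmetric]
        Bochner_Integration.integral_add[OF Bochner_Integration.integrable_add[OF i1 i2] i3, symmetric]
      by (rule Bochner_Integration.integral_cong) (simp_all add: pz algebra_simps)
    also have "\<dots> = integral {-1..1} (\<lambda>x. k x * (\<Phi> (x, v x) - \<Phi> (x, -1)))" by (rule Omega_divergence_z[OF v s\<Phi> k])
    also have "\<dots> = (LINT x|lebesgue_on I. (k x * (1 + v x)) * (\<phi> n (x, v x) * \<theta> n (x, v x)))"
      unfolding integral_lebesgue_on_I[OF continuous_on_mult[OF wb continuous_on_mult[OF cv[OF A(1)[of n]] cv[OF B(1)[of n]]]]]
      by (simp add: \<Phi>_def mult.assoc)
    finally show ?thesis .
  qed
  have l1: "(\<lambda>n. (LINT q|?M. k (fst q) * (\<phi> n q * \<theta> n q))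
     + (LINT q|?M. (k (fst q) * (1 + snd q)) * (pdz (\<phi> n) q * \<theta> n q))
     + (LINT q|?M. (k (fst q) * (1 + snd q)) * (\<phi> n q * pdz (\<theta> n) q))) \<longlonglongrightarrow>
     (LINT q|?M. k (fst q) * (a q * b q))
     + (LINT q|?M. (k (fst q) * (1 + snd q)) * (az q * b q))
     + (LINT q|?M. (k (fst q) * (1 + snd q)) * (a q * bz q))"
    by (intro tendsto_add tendsto_weighted_Omega[OF v] w sA sB TA TB A B)
  have l2: "(\<lambda>n. LINT x|lebesgue_on I. (k x * (1 + v x)) * (\<phi> n (x, v x) * \<theta> n (x, v x))) \<longlonglongrightarrow>
     (LINT x|lebesgue_on I. (k x * (1 + v x)) * (ga x * gb x))"
    by (intro tendsto_weighted_I[OF wb] tA tB TA TB A B)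
  show ?thesis using LIMSEQ_unique[OF l1[unfolded id] l2] .
qed

section \<open>The derivative of the electrostatic energy\<close>

lemma sqint_weight_I:
  assumes k: "continuous_on {-1..1} k" and g: "sqint (lebesgue_on I) g"
  shows "sqint (lebesgue_on I) (\<lambda>x. k x * g x)"
proof -
  obtain C where C: "\<And>x. x \<in> {-1..1} \<Longrightarrow> \<bar>k x\<bar> \<le> C" using bounded_on_I[OF k] by blast
  show ?thesis by (rule sqint_bounded_mult[OF g continuous_imp_measurable_I[OF k], where C = C]) (use C in auto)
qed

text \<open>Integrals of \<open>a\<^sup>2\<close> over vertical slices are bounded uniformly: integrate
  \<open>a\<^sup>2\<close> by parts against a primitive of \<open>k\<close> minus its mean. The
  primitive is at most \<open>\<integral> k\<close>, and what appears besides \<open>a\<close> is its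
  derivative in \<open>x\<close> and its trace. This replaces sup norm bounds on the gradient.\<close>

lemma weight_estimate:
  assumes v: "profile v v1" and a: "traced v a ax az ga"
  shows "\<exists>C\<ge>0. \<forall>k. continuous_on {-1..1} k \<longrightarrow> (\<forall>x\<in>{-1..1}. 0 \<le> k x) \<longrightarrow>
    (LINT q|lebesgue_on (Omega v). k (fst q) * (a q * a q)) \<le> C * integral {-1..1} k"
proof -
  let ?M = "lebesgue_on (Omega v)" and ?N = "lebesgue_on I"
  note T = tracedD[OF a]
  obtain B where B: "B \<ge> 0" "\<And>x. x \<in> {-1..1} \<Longrightarrow> \<bar>v1 x\<bar> \<le> B" using bounded_on_I[OF profileD(4)[OF v]] by blast
  define n0 where "n0 = (LINT q|?M. a q * a q)"
  define n1 where "n1 = (LINT q|?M. \<bar>ax q * a q\<bar>)"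
  define n2 where "n2 = (LINT x|?N. \<bar>ga x * ga x\<bar>)"
  have nn: "n0 \<ge> 0" "n1 \<ge> 0" "n2 \<ge> 0" unfolding n0_def n1_def n2_def by simp_all
  have main: "(LINT q|?M. k (fst q) * (a q * a q)) \<le> (n0 / 2 + 2 * n1 + B * n2) * integral {-1..1} k"
    if k: "continuous_on {-1..1} k" "\<forall>x\<in>{-1..1}. 0 \<le> k x" for k
  proof -
    define J where "J = integral {-1..1} k"
    have ki: "k integrable_on {x..y}" if "{x..y} \<subseteq> {-1..1}" for x y
      by (rule integrable_continuous_real[OF continuous_on_subset[OF k(1) that]])
    \<comment> \<open>the primitive of \<open>k\<close> minus its mean \<open>J / 2\<close>, so that \<open>K\<close> vanishes at both ends\<close>
    define K where "K x = integral {-1..x} k - (x + 1) / 2 * J" for x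
    have Kd: "(K has_real_derivative k x - J / 2) (at x within {-1..1})" if "x \<in> {-1..1}" for x
      unfolding K_def[abs_def]
      by (rule DERIV_diff[OF integral_has_real_derivative[OF k(1) that]]) (auto intro!: derivative_eq_intros)
    have J0: "J \<ge> 0" unfolding J_def by (rule integral_nonneg[OF ki]) (use k(2) in auto)
    have Kb: "\<bar>K x\<bar> \<le> J" if x: "x \<in> {-1..1}" for x
    proof -
      have i0: "0 \<le> integral {-1..x} k" by (rule integral_nonneg[OF ki]) (use k(2) x in auto)
      have i1: "0 \<le> integral {x..1} k" by (rule integral_nonneg[OF ki]) (use k(2) x in auto)
      have "integral {-1..x} k + integral {x..1} k = J"
        unfolding J_def by (rule Henstock_Kurzweil_Integration.integral_combine) (use x ki in auto)
      moreover have "0 \<le> (x + 1) / 2 * J" using x J0 by (intro mult_nonneg_nonneg) auto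
      moreover have "(x + 1) / 2 * J \<le> 1 * J" using x J0 by (intro mult_right_mono) auto
      ultimately show ?thesis using i0 i1 unfolding K_def abs_le_iff by linarith
    qed
    have cK: "continuous_on {-1..1} K" by (rule DERIV_continuous_on[OF Kd])
    have cK': "continuous_on {-1..1} (\<lambda>x. k x - J / 2)" by (intro continuous_intros k(1))
    have K0: "K (-1) = 0" "K 1 = 0" by (auto simp: K_def J_def)
    note id = traced_parts_x[OF v a a Kd cK' K0, where s = 0, unfolded mult_zero_left add_0_right mult_1_right]
    have iKa: "integrable ?M (\<lambda>q. (k (fst q) - J / 2) * (a q * a q))" and ika: "integrable ?M (\<lambda>q. k (fst q) * (a q * a q))"
      and iKx: "integrable ?M (\<lambda>q. K (fst q) * (ax q * a q))" and ia: "integrable ?M (\<lambda>q. a q * a q)"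
      and ixa: "integrable ?M (\<lambda>q. ax q * a q)"
      by (intro weighted_product_integrable[OF v] fst_weight_continuous cK cK' k(1) T sqint_mult_integrable)+
    have t1: "(LINT q|?M. (k (fst q) - J / 2) * (a q * a q)) = (LINT q|?M. k (fst q) * (a q * a q)) - J / 2 * n0"
      unfolding n0_def left_diff_distrib Bochner_Integration.integral_diff[OF ika integrable_mult_right[OF ia]] by simp
    have t2: "\<bar>LINT q|?M. K (fst q) * (ax q * a q)\<bar> \<le> J * n1"
    proof -
      have "\<bar>LINT q|?M. K (fst q) * (ax q * a q)\<bar> \<le> (LINT q|?M. \<bar>K (fst q) * (ax q * a q)\<bar>)" by (rule integral_abs_bound)
      also have "\<dots> \<le> (LINT q|?M. J * \<bar>ax q * a q\<bar>)"
      proof (rule integral_mono)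
        show "integrable ?M (\<lambda>q. \<bar>K (fst q) * (ax q * a q)\<bar>)" by (rule integrable_abs[OF iKx])
        show "integrable ?M (\<lambda>q. J * \<bar>ax q * a q\<bar>)" by (rule integrable_mult_right[OF integrable_abs[OF ixa]])
        fix q assume "q \<in> space ?M"
        then have "\<bar>K (fst q)\<bar> \<le> J" using Kb fst_Omega(2) by simp
        then show "\<bar>K (fst q) * (ax q * a q)\<bar> \<le> J * \<bar>ax q * a q\<bar>" unfolding abs_mult[of "K (fst q)"] by (rule mult_right_mono) simp
      qed
      finally show ?thesis by (simp add: n1_def)
    qed
    have t3: "(LINT q|?M. K (fst q) * (a q * ax q)) = (LINT q|?M. K (fst q) * (ax q * a q))"
      by (simp only: mult.commute[of "a _"])
    have t4: "\<bar>LINT x|?N. K x * v1 x * (ga x * ga x)\<bar> \<le> J * (B * n2)"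
    proof -
      have cw: "continuous_on {-1..1} (\<lambda>x. K x * v1 x)" by (intro continuous_intros cK profileD(4)[OF v])
      from sqint_mult_integrable[OF sqint_weight_I[OF cw T(4)] T(4)]
      have i: "integrable ?N (\<lambda>x. K x * v1 x * (ga x * ga x))" by (simp add: mult.assoc)
      have "\<bar>LINT x|?N. K x * v1 x * (ga x * ga x)\<bar> \<le> (LINT x|?N. \<bar>K x * v1 x * (ga x * ga x)\<bar>)" by (rule integral_abs_bound)
      also have "\<dots> \<le> (LINT x|?N. (J * B) * \<bar>ga x * ga x\<bar>)"
      proof (rule integral_mono)
        show "integrable ?N (\<lambda>x. \<bar>K x * v1 x * (ga x * ga x)\<bar>)" by (rule integrable_abs[OF i])
        show "integrable ?N (\<lambda>x. (J * B) * \<bar>ga x * ga x\<bar>)"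
          by (rule integrable_mult_right[OF integrable_abs[OF sqint_mult_integrable[OF T(4) T(4)]]])
        fix x assume "x \<in> space ?N"
        then have x: "x \<in> {-1..1}" by auto
        have "\<bar>K x * v1 x\<bar> \<le> J * B" unfolding abs_mult by (rule mult_mono[OF Kb[OF x] B(2)[OF x] J0]) simp
        then show "\<bar>K x * v1 x * (ga x * ga x)\<bar> \<le> (J * B) * \<bar>ga x * ga x\<bar>" unfolding abs_mult[of "K x * v1 x"] by (rule mult_right_mono) simp
      qed
      finally show ?thesis by (simp only: integral_mult_right_zero n2_def mult.assoc)
    qed
    have "(LINT q|?M. k (fst q) * (a q * a q)) \<le> J / 2 * n0 + J * n1 + J * n1 + J * (B * n2)"
      using id t2 t4 unfolding t1 t3 abs_le_iff by linarith
    then show ?thesis unfolding J_def[symmetric] by (simp add: algebra_simps)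
  qed
  show ?thesis
    by (rule exI[of _ "n0 / 2 + 2 * n1 + B * n2"]) (use main nn B(1) in auto)
qed

text \<open>Since \<open>\<psi> = 1\<close> on the graph, its gradient is normal there. In terms of the traces this comes from
  testing with \<open>(1 + z) \<xi> x\<close>, whose rotated gradient \<open>(\<xi>, - (1 + z) \<xi>')\<close> is divergence free.\<close>

lemma trace_tangential:
  assumes v: "profile v v1" and f: "classical_potential \<epsilon> v f fx fz fxx fxz fzz"
    and tx: "traced v fx fxx fxz gx" and tz: "traced v fz fxz fzz gz"
  shows "AE x in lebesgue. x \<in> I \<longrightarrow> gx x = - v1 x * gz x"
proof -
  let ?M = "lebesgue_on (Omega v)" and ?N = "lebesgue_on I"
  note F = classical_potentialD[OF f v]
  note TX = tracedD[OF tx] and TZ = tracedD[OF tz]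
  have oS: "open (Omega v)" by (rule open_Omega[OF profileD(5)[OF v]])
  have w0: "profile (\<lambda>_. 0) (\<lambda>_. 0)" by (auto simp: profile_def)
  let ?r = "ratio v (\<lambda>_. 0)" and ?r' = "ratio' v v1 (\<lambda>_. 0) (\<lambda>_. 0)"
  define h where "h x = (1 + v x) * (gx x + v1 x * gz x)" for x
  have cw: "continuous_on {-1..1} (\<lambda>x. 1 + v x)" "continuous_on {-1..1} (\<lambda>x. (1 + v x) * v1 x)"
    by (intro continuous_intros profileD(4,5)[OF v])+
  have hs: "sqint ?N h"
    using sqint_add[OF sqint_weight_I[OF cw(1) TX(4)] sqint_weight_I[OF cw(2) TZ(4)]] by (simp add: h_def[abs_def] algebra_simps)
  have "AE x in lebesgue. x \<in> I \<longrightarrow> h x = 0"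
  proof (rule fundamental_lemma)
    show "open I" by simp
    have "set_integrable lebesgue I h"
      using sqint_integrable[OF finite_measure_I hs] set_integral_lebesgue_on(2)[of I h] by simp
    then show "locally_integrable I h" by (rule set_integrable_locally_integrable)
    fix \<xi> :: "real \<Rightarrow> real" assume \<xi>: "test_function I \<xi>"
    have s: "smooth \<xi>" and sub: "closure {x. \<xi> x \<noteq> 0} \<subseteq> I" using \<xi> by (auto simp: test_function_def)
    have "1 \<notin> closure {x. \<xi> x \<noteq> 0}" "-1 \<notin> closure {x. \<xi> x \<noteq> 0}" using sub by auto
    then have \<xi>0: "\<xi> (-1) = 0" "\<xi> 1 = 0" using closure_subset[of "{x. \<xi> x \<noteq> 0}"] by blast+
    define \<xi>' where "\<xi>' x = frechet_derivative \<xi> (at x) 1" for x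
    have d: "(\<xi> has_real_derivative \<xi>' x) (at x)" for x
      unfolding \<xi>'_def by (rule smooth_real_derivative[OF s])
    have c: "continuous_on A \<xi>" "continuous_on A \<xi>'" for A
      unfolding \<xi>'_def by (rule smooth_continuous[OF s], rule smooth_continuous[OF smooth_frechet_derivative[OF s]])
    have e1: "(LINT q|?M. \<xi> (fst q) * fx q) + (LINT q|?M. (\<xi> (fst q) * (1 + snd q)) * fxz q) = (LINT x|?N. (\<xi> x * (1 + v x)) * gx x)"
      using traced_parts_z[OF v tx traced_one[OF v] c(1)] by simp
    have e2: "(LINT q|?M. (\<xi>' (fst q) * (1 + snd q)) * fz q) + (LINT q|?M. (\<xi> (fst q) * (1 + snd q)) * fxz q)
       = - (LINT x|?N. (\<xi> x * v1 x * (1 + v x)) * gz x)"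
      using traced_parts_x[OF v tz traced_one[OF v] has_field_derivative_at_within[OF d] c(2) \<xi>0, of 1] by simp
    have one: "sqint ?M (\<lambda>_. 1)" by (intro sqint_continuous_Omega[OF v] continuous_on_const)
    have iw: "integrable ?M (\<lambda>q. k q * g q)" if "continuous_on (closed_Omega v) k" "sqint ?M g" for k g
      using weighted_product_integrable[OF v that one] by simp
    have cF: "continuous_on (closed_Omega v) (\<lambda>q. \<xi> (fst q))" "continuous_on (closed_Omega v) (\<lambda>q. \<xi>' (fst q) * (1 + snd q))"
      by (intro continuous_intros fst_weight_continuous c)+
    have i1: "integrable ?M (\<lambda>q. \<xi> (fst q) * fx q)" and i2: "integrable ?M (\<lambda>q. (\<xi>' (fst q) * (1 + snd q)) * fz q)"
      by (rule iw[OF cF(1) F(7)], rule iw[OF cF(2) F(8)])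
    \<comment> \<open>the function \<open>(1 + z) / (1 + v)\<close>, an explicit extension of the boundary values\<close>
    define fh where "fh q = 1 + snd (tmap v (\<lambda>_. 0) q)" for q
    define fhx where "fhx q = (1 + snd q) * ?r' (fst q)" for q :: "real \<times> real"
    define fhz where "fhz q = ?r (fst q)" for q :: "real \<times> real"
    have "C1_grad (Omega (\<lambda>_. 0)) (\<lambda>q. 1 + snd q) (\<lambda>_. 0) (\<lambda>_. 1)"
      unfolding C1_grad_def by (auto intro!: derivative_eq_intros continuous_intros)
    from tmap_pullback[OF v w0 this] have hC: "C1_grad (Omega v) fh fhx fhz"
      by (simp add: fh_def[abs_def] fhx_def[abs_def] fhz_def[abs_def])
    have chx: "continuous_on (closed_Omega v) fhx" "continuous_on (closed_Omega v) fhz"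
      unfolding fhx_def fhz_def by (intro continuous_intros fst_weight_continuous ratio_continuous[OF v w0])+
    have i3: "integrable ?M (\<lambda>q. \<xi> (fst q) * fhx q)" and i4: "integrable ?M (\<lambda>q. (\<xi>' (fst q) * (1 + snd q)) * fhz q)"
      by (rule iw[OF cF(1) sqint_continuous_Omega[OF v chx(1)]], rule iw[OF cF(2) sqint_continuous_Omega[OF v chx(2)]])
    \<comment> \<open>on the explicit extension the pairing is computed by hand\<close>
    have z2: "(LINT q|?M. \<xi> (fst q) * fhx q - (\<xi>' (fst q) * (1 + snd q)) * fhz q) = 0"
    proof -
      have cc: "continuous_on (closed_Omega v) (\<lambda>q. \<xi> (fst q) * fhx q - (\<xi>' (fst q) * (1 + snd q)) * fhz q)"
        by (intro continuous_intros cF chx fst_weight_continuous c)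
      have minus_half: "- y / 2 = - (1/2) * y" for y :: real by simp
      have inner: "integral {-1..v x} (\<lambda>z. \<xi> (fst (x, z)) * fhx (x, z) - (\<xi>' (fst (x, z)) * (1 + snd (x, z))) * fhz (x, z))
          = - (1/2) * (\<xi>' x * (1 + v x) + v1 x * \<xi> x)" if x: "x \<in> {-1..1}" for x
      proof -
        let ?c = "\<xi> x * ?r' x - \<xi>' x * ?r x"
        have n: "1 + v x > 0" by (rule one_plus_profile[OF v x])
        have "((\<lambda>z. ?c * (1 + z)) has_integral (?c * (1 + v x)\<^sup>2 / 2 - ?c * (1 + (-1))\<^sup>2 / 2)) {-1..v x}"
          by (rule fundamental_theorem_of_calculus)
            (use n in \<open>auto intro!: derivative_eq_intros simp: has_real_derivative_iff_has_vector_derivative[symmetric] power2_eq_square\<close>)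
        then have "((\<lambda>z. ?c * (1 + z)) has_integral ?c * (1 + v x)\<^sup>2 / 2) {-1..v x}" by simp
        then have ia: "integral {-1..v x} (\<lambda>z. ?c * (1 + z)) = ?c * (1 + v x)\<^sup>2 / 2" by (rule integral_unique)
        have ib: "(\<lambda>z. \<xi> (fst (x, z)) * fhx (x, z) - (\<xi>' (fst (x, z)) * (1 + snd (x, z))) * fhz (x, z)) = (\<lambda>z. ?c * (1 + z))"
          by (auto simp: fhx_def fhz_def fun_eq_iff algebra_simps)
        have ic: "?c * (1 + v x)\<^sup>2 = - (\<xi>' x * (1 + v x) + v1 x * \<xi> x)"
        proof -
          have "(a * (- b / m\<^sup>2) - c * (1 / m)) * m\<^sup>2 = - (c * m + b * a)" if "m > 0" for a b c m :: real
            using that by (simp add: field_simps power2_eq_square)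
          from this[OF n, of "\<xi> x" "v1 x" "\<xi>' x"] show ?thesis by (simp add: ratio_def ratio'_def)
        qed
        show ?thesis unfolding ib ia ic by (rule minus_half)
      qed
      have "((\<lambda>x. \<xi>' x * (1 + v x) + v1 x * \<xi> x) has_integral (\<xi> 1 * (1 + v 1) - \<xi> (-1) * (1 + v (-1)))) {-1..1}"
      proof (rule fundamental_theorem_of_calculus)
        fix x :: real assume x: "x \<in> {-1..1}"
        have "((\<lambda>x. \<xi> x * (1 + v x)) has_real_derivative \<xi>' x * (1 + v x) + (0 + v1 x) * \<xi> x) (at x within {-1..1})"
          by (intro DERIV_mult DERIV_add DERIV_const has_field_derivative_at_within[OF d] profileD(2)[OF v x])
        then show "((\<lambda>x. \<xi> x * (1 + v x)) has_vector_derivative \<xi>' x * (1 + v x) + v1 x * \<xi> x) (at x within {-1..1})"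
          by (simp add: has_real_derivative_iff_has_vector_derivative)
      qed simp
      then have "integral {-1..1} (\<lambda>x. \<xi>' x * (1 + v x) + v1 x * \<xi> x) = 0" using \<xi>0 by (simp add: integral_unique)
      then have "integral {-1..1} (\<lambda>x. - (1/2) * (\<xi>' x * (1 + v x) + v1 x * \<xi> x)) = 0"
        by (simp only: integral_mult_right mult_zero_right)
      moreover have "integral {-1..1} (\<lambda>x. integral {-1..v x} (\<lambda>z. \<xi> (fst (x, z)) * fhx (x, z) - (\<xi>' (fst (x, z)) * (1 + snd (x, z))) * fhz (x, z)))
        = integral {-1..1} (\<lambda>x. - (1/2) * (\<xi>' x * (1 + v x) + v1 x * \<xi> x))"
        by (rule Henstock_Kurzweil_Integration.integral_cong) (rule inner)
      ultimately show ?thesis unfolding integral_Omega_fubini[OF v cc] by simp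
    qed
    have p: "C1_grad (Omega v) (\<lambda>q. f q - fh q) (\<lambda>q. fx q - fhx q) (\<lambda>q. fz q - fhz q)"
      unfolding C1_grad_def
    proof (intro conjI ballI)
      fix q assume "q \<in> Omega v"
      then have "(f has_derivative (\<lambda>k. fx q * fst k + fz q * snd k)) (at q)" "(fh has_derivative (\<lambda>k. fhx q * fst k + fhz q * snd k)) (at q)"
        using hC F(1) by (auto simp: C1_grad_def)
      from has_derivative_diff[OF this]
      show "((\<lambda>q. f q - fh q) has_derivative (\<lambda>k. (fx q - fhx q) * fst k + (fz q - fhz q) * snd k)) (at q)"
        by (rule has_derivative_eq_rhs) (auto simp: fun_eq_iff algebra_simps)
    qed (intro continuous_intros C1_gradD(1,2)[OF F(1)] C1_gradD(1,2)[OF hC])+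
    let ?G = "\<lambda>q. \<xi> (fst q) * (fx q - fhx q) + (- (\<xi>' (fst q) * (1 + snd q))) * (fz q - fhz q)"
    have G_alt: "?G = (\<lambda>q. (\<xi> (fst q) * fx q - (\<xi>' (fst q) * (1 + snd q)) * fz q) - (\<xi> (fst q) * fhx q - (\<xi>' (fst q) * (1 + snd q)) * fhz q))"
      by (auto simp: fun_eq_iff algebra_simps)
    note j1 = Bochner_Integration.integrable_diff[OF i1 i2] and j2 = Bochner_Integration.integrable_diff[OF i3 i4]
    have iG: "integrable ?M ?G" unfolding G_alt by (rule Bochner_Integration.integrable_diff[OF j1 j2])
    have cG: "continuous_on (Omega v) ?G"
      by (intro continuous_intros C1_gradD(1,2)[OF F(1)] C1_gradD(1,2)[OF hC] continuous_on_subset[OF cF(1) Omega_subset_closed]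
          continuous_on_subset[OF fst_weight_continuous[OF c(2)] Omega_subset_closed])
    note conv = integral_lborel_lebesgue_on[OF borel_open[OF oS] borel_measurable_indicator_continuous[OF oS cG]]
    have dfst: "((\<lambda>x. \<xi> (fst (x, z))) has_real_derivative \<xi>' (fst (x, z))) (at x)" for x z :: real
      using d[of x] by simp
    have "(LINT q|lborel. indicator (Omega v) q * ?G q) = 0"
    proof (rule divergence_free_orthogonal[OF oS bounded_Omega[OF profileD(5)[OF v]] p, where F1x = "\<lambda>q. \<xi>' (fst q)" and F2z = "\<lambda>q. - \<xi>' (fst q)"])
      show "continuous_on (closure (Omega v)) (\<lambda>q. f q - fh q)"
        unfolding fh_def
        by (intro continuous_intros F(5) continuous_on_subset[OF tmap_continuous[OF v w0] closure_Omega[OF profileD(5)[OF v]]])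
      show "f q - fh q = 0" if "q \<in> frontier (Omega v)" for q
        using F(6) that by (cases q) (auto simp: fh_def tmap_def ratio_def)
      show "((\<lambda>x. \<xi> (fst (x, z))) has_real_derivative \<xi>' (fst (x, z))) (at x)" for x z :: real by (rule dfst)
      show "((\<lambda>z. - (\<xi>' (fst (x, z)) * (1 + snd (x, z)))) has_real_derivative - \<xi>' (fst (x, z))) (at z)" for x z :: real
        by (auto intro!: derivative_eq_intros)
      show "continuous_on (Omega v) (\<lambda>q. \<xi> (fst q))" "continuous_on (Omega v) (\<lambda>q. - (\<xi>' (fst q) * (1 + snd q)))"
        "continuous_on (Omega v) (\<lambda>q. \<xi>' (fst q))" "continuous_on (Omega v) (\<lambda>q. - \<xi>' (fst q))"
        by (intro continuous_intros continuous_on_subset[OF fst_weight_continuous[OF c(1)] Omega_subset_closed]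
            continuous_on_subset[OF fst_weight_continuous[OF c(2)] Omega_subset_closed])+
      show "integrable lborel (\<lambda>q. indicator (Omega v) q * ?G q)" using iG conv(1) by blast
    qed simp
    then have "(LINT q|?M. ?G q) = 0" using conv(2) by simp
    then have z1: "(LINT q|?M. \<xi> (fst q) * fx q) - (LINT q|?M. (\<xi>' (fst q) * (1 + snd q)) * fz q) = 0"
      unfolding G_alt Bochner_Integration.integral_diff[OF j1 j2] z2 Bochner_Integration.integral_diff[OF i1 i2] by simp
    have ig: "integrable ?N (\<lambda>x. (\<xi> x * (1 + v x)) * gx x)" "integrable ?N (\<lambda>x. (\<xi> x * v1 x * (1 + v x)) * gz x)"
      by (rule sqint_integrable[OF finite_measure_I sqint_weight_I[OF _ TX(4)]], intro continuous_intros c profileD(4,5)[OF v],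
          rule sqint_integrable[OF finite_measure_I sqint_weight_I[OF _ TZ(4)]], intro continuous_intros c profileD(4,5)[OF v])
    have "(LINT x:I|lebesgue. h x * \<xi> x) = (LINT x|?N. (\<xi> x * (1 + v x)) * gx x + (\<xi> x * v1 x * (1 + v x)) * gz x)"
      unfolding set_integral_lebesgue_on(1)[of I, simplified] by (simp add: h_def algebra_simps)
    also have "\<dots> = 0"
      unfolding Bochner_Integration.integral_add[OF ig] using e1 e2 z1 by linarith
    finally show "(LINT x:I|lebesgue. h x * \<xi> x) = 0" .
  qed
  then show ?thesis
  proof eventually_elim
    case (elim x)
    show ?case
    proof
      assume x: "x \<in> I"
      then have "1 + v x > 0" using one_plus_profile[OF v, of x] by auto
      then show "gx x = - v1 x * gz x" using elim x by (simp add: h_def)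
    qed
  qed
qed

text \<open>Writing \<open>K = ratio - 1\<close>, the term is integrated by parts with the field \<open>(0, K (1
  + z))\<close>, which vanishes on the bottom and on the lateral sides. The bulk terms cancel by the
  equation, leaving an integral over the graph; there the gradient is normal
  (\<open>trace_tangential\<close>) and \<open>K (1 + v) = w - v\<close>.\<close>

lemma first_order_boundary:
  assumes v: "profile v v1" and w: "profile w w1" and ends: "v (-1) = w (-1)" "v 1 = w 1"
    and f: "classical_potential \<epsilon> v f fx fz fxx fxz fzz"
    and tx: "traced v fx fxx fxz gx" and tz: "traced v fz fxz fzz gz"
  shows "first_order \<epsilon> v v1 w w1 fx fz = - (LINT x|lebesgue_on I. (w x - v x) * (\<epsilon>\<^sup>2 * (gx x)\<^sup>2 + (gz x)\<^sup>2))"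
proof -
  let ?M = "lebesgue_on (Omega v)" and ?N = "lebesgue_on I"
  note F = classical_potentialD[OF f v]
  note TX = tracedD[OF tx] and TZ = tracedD[OF tz]
  define K where "K x = ratio v w x - 1" for x
  define K' where "K' = ratio' v v1 w w1"
  have Kd: "(K has_real_derivative K' x) (at x within {-1..1})" if "x \<in> {-1..1}" for x
    unfolding K_def[abs_def] K'_def using DERIV_diff[OF ratio_derivative[OF v w that] DERIV_const[of 1]] by simp
  have cK: "continuous_on {-1..1} K" by (rule DERIV_continuous_on[OF Kd])
  have cK': "continuous_on {-1..1} K'" unfolding K'_def by (rule ratio_continuous(2)[OF v w])
  have K0: "K (-1) = 0" "K 1 = 0"
    using ends one_plus_profile[OF v, of "-1"] one_plus_profile[OF v, of 1] by (auto simp: K_def ratio_def)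
  let ?z = "\<lambda>q :: real \<times> real. 1 + snd q"
  note a1 = traced_parts_z[OF v tx tx cK] and a2 = traced_parts_z[OF v tz tz cK]
  note a3 = traced_parts_x[OF v tx tz Kd cK' K0, where s = 1, unfolded mult_1]
  have wc: "continuous_on (closed_Omega v) (\<lambda>q. K (fst q))" "continuous_on (closed_Omega v) (\<lambda>q. K (fst q) * ?z q)"
    "continuous_on (closed_Omega v) (\<lambda>q. K' (fst q) * ?z q)"
    by (intro continuous_intros fst_weight_continuous cK cK')+
  note wi = weighted_product_integrable[OF v]
  \<comment> \<open>the equation multiplied by \<open>K (1 + z) \<psi>\<^sub>z\<close>\<close>
  have bulk: "\<epsilon>\<^sup>2 * (LINT q|?M. (K (fst q) * ?z q) * (fxz q * fx q)) + \<epsilon>\<^sup>2 * (LINT q|?M. (K (fst q) * ?z q) * (fx q * fxz q))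
     - (LINT q|?M. (K (fst q) * ?z q) * (fzz q * fz q)) - (LINT q|?M. (K (fst q) * ?z q) * (fz q * fzz q))
     - 2 * \<epsilon>\<^sup>2 * (LINT q|?M. (K (fst q) * ?z q) * (fxx q * fz q)) - 2 * \<epsilon>\<^sup>2 * (LINT q|?M. (K (fst q) * ?z q) * (fx q * fxz q)) = 0"
  proof -
    have s1: "(LINT q|?M. (K (fst q) * ?z q) * (fxz q * fx q)) = (LINT q|?M. (K (fst q) * ?z q) * (fx q * fxz q))"
      by (simp only: mult.commute[of "fxz _"])
    have s2: "(LINT q|?M. (K (fst q) * ?z q) * (fz q * fzz q)) = (LINT q|?M. (K (fst q) * ?z q) * (fzz q * fz q))"
      by (simp only: mult.commute[of "fz _"])
    have "\<epsilon>\<^sup>2 * (LINT q|?M. (K (fst q) * ?z q) * (fxx q * fz q)) + (LINT q|?M. (K (fst q) * ?z q) * (fzz q * fz q))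
      = (LINT q|?M. \<epsilon>\<^sup>2 * ((K (fst q) * ?z q) * (fxx q * fz q)) + (K (fst q) * ?z q) * (fzz q * fz q))"
      unfolding Bochner_Integration.integral_add[OF integrable_mult_right[OF wi[OF wc(2) TX(2) TZ(1)]] wi[OF wc(2) TZ(3) TZ(1)]]
        integral_mult_right_zero ..
    also have "\<dots> = (LINT q|?M. 0)"
    proof (rule Bochner_Integration.integral_cong[OF refl])
      fix q assume "q \<in> space ?M"
      then have "\<epsilon>\<^sup>2 * fxx q + fzz q = 0" using F(4) by simp
      moreover have "\<epsilon>\<^sup>2 * ((K (fst q) * ?z q) * (fxx q * fz q)) + (K (fst q) * ?z q) * (fzz q * fz q)
         = (K (fst q) * ?z q) * fz q * (\<epsilon>\<^sup>2 * fxx q + fzz q)" by (simp add: algebra_simps)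
      ultimately show "\<epsilon>\<^sup>2 * ((K (fst q) * ?z q) * (fxx q * fz q)) + (K (fst q) * ?z q) * (fzz q * fz q) = 0" by simp
    qed
    finally have "\<epsilon>\<^sup>2 * (LINT q|?M. (K (fst q) * ?z q) * (fxx q * fz q)) + (LINT q|?M. (K (fst q) * ?z q) * (fzz q * fz q)) = 0" by simp
    then show ?thesis unfolding s1 s2 by (simp add: algebra_simps)
  qed
  have i1: "integrable ?M (\<lambda>q. K (fst q) * (fx q * fx q))" and i2: "integrable ?M (\<lambda>q. K (fst q) * (fz q * fz q))"
    and i3: "integrable ?M (\<lambda>q. (K' (fst q) * ?z q) * (fx q * fz q))"
    by (rule wi[OF wc(1) TX(1) TX(1)], rule wi[OF wc(1) TZ(1) TZ(1)], rule wi[OF wc(3) TX(1) TZ(1)])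
  have "first_order \<epsilon> v v1 w w1 fx fz = (LINT q|?M. \<epsilon>\<^sup>2 * (K (fst q) * (fx q * fx q)) - K (fst q) * (fz q * fz q)
     - (2 * \<epsilon>\<^sup>2) * ((K' (fst q) * ?z q) * (fx q * fz q)))"
    unfolding first_order_def slope_weight_def K_def K'_def
    by (rule Bochner_Integration.integral_cong) (simp_all add: power2_eq_square algebra_simps)
  also have "\<dots> = \<epsilon>\<^sup>2 * (LINT q|?M. K (fst q) * (fx q * fx q)) - (LINT q|?M. K (fst q) * (fz q * fz q))
     - (2 * \<epsilon>\<^sup>2) * (LINT q|?M. (K' (fst q) * ?z q) * (fx q * fz q))"
    unfolding Bochner_Integration.integral_diff[OF Bochner_Integration.integrable_diff[OF integrable_mult_right[OF i1] i2] integrable_mult_right[OF i3]]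
      Bochner_Integration.integral_diff[OF integrable_mult_right[OF i1] i2] integral_mult_right_zero ..
  also have "\<dots> = \<epsilon>\<^sup>2 * (LINT x|?N. (K x * (1 + v x)) * (gx x * gx x)) - (LINT x|?N. (K x * (1 + v x)) * (gz x * gz x))
     + 2 * \<epsilon>\<^sup>2 * (LINT x|?N. (K x * v1 x * (1 + v x)) * (gx x * gz x))"
  proof -
    have lin: "e * A1 - A2 - (2 * e) * A3 = e * G1 - G2 + 2 * e * G3"
      if "A1 + B1 + B2 = G1" "A2 + C1 + C2 = G2" "A3 + D1 + D2 = - G3" "e * B1 + e * B2 - C1 - C2 - 2 * e * D1 - 2 * e * D2 = 0"
      for e A1 A2 A3 B1 B2 C1 C2 D1 D2 G1 G2 G3 :: real
    proof -
      have "A1 = G1 - B1 - B2" "A3 = - G3 - D1 - D2" using that(1,3) by linarith+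
      then have "e * A1 = e * G1 - e * B1 - e * B2" "e * A3 = - (e * G3) - e * D1 - e * D2"
        by (simp_all only: right_diff_distrib mult_minus_right)
      then show ?thesis using that(2,4) unfolding mult.assoc by linarith
    qed
    show ?thesis by (rule lin[OF a1 a2 a3 bulk])
  qed
  also have "\<dots> = (LINT x|?N. \<epsilon>\<^sup>2 * ((K x * (1 + v x)) * (gx x * gx x)) - (K x * (1 + v x)) * (gz x * gz x)
     + (2 * \<epsilon>\<^sup>2) * ((K x * v1 x * (1 + v x)) * (gx x * gz x)))"
  proof -
    have wN: "integrable ?N (\<lambda>x. k x * (a x * b x))" if k: "continuous_on {-1..1} k" and a: "sqint ?N a" and b: "sqint ?N b" for k a b
    proof -
      from sqint_mult_integrable[OF sqint_weight_I[OF k a] b] show ?thesis by (simp add: mult.assoc)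
    qed
    have ck: "continuous_on {-1..1} (\<lambda>x. K x * (1 + v x))" "continuous_on {-1..1} (\<lambda>x. K x * v1 x * (1 + v x))"
      by (intro continuous_intros cK profileD(4,5)[OF v])+
    note j1 = wN[OF ck(1) TX(4) TX(4)] and j2 = wN[OF ck(1) TZ(4) TZ(4)] and j3 = wN[OF ck(2) TX(4) TZ(4)]
    show ?thesis
      unfolding Bochner_Integration.integral_add[OF Bochner_Integration.integrable_diff[OF integrable_mult_right[OF j1] j2] integrable_mult_right[OF j3]]
        Bochner_Integration.integral_diff[OF integrable_mult_right[OF j1] j2] integral_mult_right_zero ..
  qed
  also have "\<dots> = (LINT x|?N. - ((w x - v x) * (\<epsilon>\<^sup>2 * (gx x)\<^sup>2 + (gz x)\<^sup>2)))"
  proof (rule integral_cong_AE)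
    have m[measurable]: "gx \<in> borel_measurable ?N" "gz \<in> borel_measurable ?N" "K \<in> borel_measurable ?N" "v \<in> borel_measurable ?N"
      "w \<in> borel_measurable ?N" "v1 \<in> borel_measurable ?N"
      using TX(4) TZ(4) by (auto simp: sqint_def intro!: continuous_imp_measurable_I cK profileD(4,5)[OF v] profileD(5)[OF w])
    show "(\<lambda>x. \<epsilon>\<^sup>2 * ((K x * (1 + v x)) * (gx x * gx x)) - (K x * (1 + v x)) * (gz x * gz x)
       + (2 * \<epsilon>\<^sup>2) * ((K x * v1 x * (1 + v x)) * (gx x * gz x))) \<in> borel_measurable ?N" by measurable
    show "(\<lambda>x. - ((w x - v x) * (\<epsilon>\<^sup>2 * (gx x)\<^sup>2 + (gz x)\<^sup>2))) \<in> borel_measurable ?N" by measurable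
    have "AE x in ?N. gx x = - v1 x * gz x \<and> x \<in> I"
      using trace_tangential[OF v f tx tz] by (subst AE_lebesgue_on_iff) auto
    then show "AE x in ?N. \<epsilon>\<^sup>2 * ((K x * (1 + v x)) * (gx x * gx x)) - (K x * (1 + v x)) * (gz x * gz x)
       + (2 * \<epsilon>\<^sup>2) * ((K x * v1 x * (1 + v x)) * (gx x * gz x)) = - ((w x - v x) * (\<epsilon>\<^sup>2 * (gx x)\<^sup>2 + (gz x)\<^sup>2))"
    proof eventually_elim
      case (elim x)
      have n: "1 + v x > 0" using one_plus_profile[OF v, of x] elim by auto
      have k: "K x * (1 + v x) = w x - v x" using n by (simp add: K_def ratio_def field_simps)
      have e: "v1 x * gz x = - gx x" using elim by simp
      have "\<epsilon>\<^sup>2 * ((K x * (1 + v x)) * (gx x * gx x)) - (K x * (1 + v x)) * (gz x * gz x)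
         + (2 * \<epsilon>\<^sup>2) * ((K x * v1 x * (1 + v x)) * (gx x * gz x))
        = (K x * (1 + v x)) * (\<epsilon>\<^sup>2 * (gx x * gx x) - gz x * gz x + 2 * \<epsilon>\<^sup>2 * gx x * (v1 x * gz x))"
        by (simp add: algebra_simps)
      also have "\<dots> = - ((w x - v x) * (\<epsilon>\<^sup>2 * (gx x)\<^sup>2 + (gz x)\<^sup>2))"
        unfolding k e by (simp add: algebra_simps power2_eq_square)
      finally show ?case .
    qed
  qed
  finally show ?thesis by simp
qed

section \<open>Variation of the Dirichlet energy with the domain\<close>

text \<open>The constant also serves as the smallness threshold: \<open>K \<bar>w - v\<bar> \<le> 1/2\<close>
  forces \<open>ratio \<ge> 1/2\<close>, which controls the denominator of \<open>rem_weight\<close>.\<close>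

lemma rescaling_bounds:
  assumes v: "profile v v1"
  shows "\<exists>K\<ge>0. \<forall>w w1 q. q \<in> Omega v \<longrightarrow> K * \<bar>w (fst q) - v (fst q)\<bar> \<le> 1/2 \<longrightarrow>
    \<bar>ratio v w (fst q) - 1\<bar> \<le> K * (\<bar>w (fst q) - v (fst q)\<bar> + \<bar>w1 (fst q) - v1 (fst q)\<bar>) \<and>
    \<bar>slope_weight v v1 w w1 q\<bar> \<le> K * (\<bar>w (fst q) - v (fst q)\<bar> + \<bar>w1 (fst q) - v1 (fst q)\<bar>) \<and>
    0 \<le> rem_weight \<epsilon> v v1 w w1 q \<and>
    rem_weight \<epsilon> v v1 w w1 q \<le> K * ((w (fst q) - v (fst q))\<^sup>2 + (w1 (fst q) - v1 (fst q))\<^sup>2)"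
proof -
  note P = profileD[OF v]
  have cB: "continuous_on {-1..1} (\<lambda>x. 1 / (1 + v x))"
    using one_plus_profile[OF v] by (intro continuous_intros P) force
  obtain B where B: "B \<ge> 0" "\<And>x. x \<in> {-1..1} \<Longrightarrow> \<bar>1 / (1 + v x)\<bar> \<le> B" by (rule bounded_on_I[OF cB]) metis
  obtain V where V: "V \<ge> 0" "\<And>x. x \<in> {-1..1} \<Longrightarrow> \<bar>v1 x\<bar> \<le> V" by (rule bounded_on_I[OF P(4)]) metis
  obtain Z0 where Z0: "Z0 \<ge> 0" "\<And>x. x \<in> {-1..1} \<Longrightarrow> \<bar>v x\<bar> \<le> Z0" by (rule bounded_on_I[OF P(5)]) metis
  define Z where "Z = 1 + Z0"
  define c where "c = B + V * B\<^sup>2"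
  define k where "k = c + Z * c"
  define K where "K = k + 4 * k\<^sup>2 * (1 + \<epsilon>\<^sup>2)"
  have c0: "c \<ge> 0" "B \<le> c" "V * B\<^sup>2 \<le> c" and Z1: "Z \<ge> 1" using B(1) V(1) Z0(1) by (auto simp: c_def Z_def)
  have k0: "k \<ge> 0" "c \<le> k" "Z * c \<le> k" using c0(1) Z1 by (auto simp: k_def)
  have K0: "K \<ge> 0" "k \<le> K" "4 * k\<^sup>2 * (1 + \<epsilon>\<^sup>2) \<le> K" using k0(1) by (auto simp: K_def)
  have main: "\<bar>ratio v w (fst q) - 1\<bar> \<le> K * (\<bar>w (fst q) - v (fst q)\<bar> + \<bar>w1 (fst q) - v1 (fst q)\<bar>) \<and>
    \<bar>slope_weight v v1 w w1 q\<bar> \<le> K * (\<bar>w (fst q) - v (fst q)\<bar> + \<bar>w1 (fst q) - v1 (fst q)\<bar>) \<and>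
    0 \<le> rem_weight \<epsilon> v v1 w w1 q \<and>
    rem_weight \<epsilon> v v1 w w1 q \<le> K * ((w (fst q) - v (fst q))\<^sup>2 + (w1 (fst q) - v1 (fst q))\<^sup>2)"
    if q: "q \<in> Omega v" and small: "K * \<bar>w (fst q) - v (fst q)\<bar> \<le> 1/2" for w w1 :: "real \<Rightarrow> real" and q
  proof -
    define x where "x = fst q"
    define d d1 i where "d = w x - v x" and "d1 = w1 x - v1 x" and "i = 1 / (1 + v x)"
    have x: "x \<in> {-1..1}" using fst_Omega(2)[OF q] by (simp add: x_def)
    note n = one_plus_profile[OF v x]
    have i: "\<bar>i\<bar> \<le> B" using B(2)[OF x] by (simp add: i_def)
    have z: "\<bar>1 + snd q\<bar> \<le> Z"
      using q Z0(2)[OF x] by (auto simp: Omega_def Z_def x_def)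
    define r s where "r = ratio v w x - 1" and "s = slope_weight v v1 w w1 q"
    have r: "r = d * i"
      using n by (simp add: r_def ratio_def d_def i_def divide_simps)
    have quotient: "(a * m - n * b) / m\<^sup>2 = (a - b) * (1 / m) - (n - m) * b * (1 / m)\<^sup>2" if "m > 0" for a b m n :: real
      using that by (simp add: field_simps power2_eq_square)
    have rr: "ratio' v v1 w w1 x = d1 * i - d * v1 x * i\<^sup>2"
      using quotient[OF n, of "w1 x" "1 + w x" "v1 x"] by (simp add: ratio'_def d_def d1_def i_def)
    have "\<bar>r\<bar> \<le> \<bar>d\<bar> * c"
      unfolding r abs_mult by (intro mult_left_mono order_trans[OF i c0(2)]) simp
    also have "\<dots> \<le> \<bar>d\<bar> * k" using k0(2) by (intro mult_left_mono) auto
    finally have r_d: "\<bar>r\<bar> \<le> \<bar>d\<bar> * k" .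
    also have "\<dots> \<le> k * (\<bar>d\<bar> + \<bar>d1\<bar>)" using k0(1) by (simp add: algebra_simps)
    finally have r_le: "\<bar>r\<bar> \<le> k * (\<bar>d\<bar> + \<bar>d1\<bar>)" .
    have "\<bar>d1 * i\<bar> \<le> \<bar>d1\<bar> * c" unfolding abs_mult by (intro mult_left_mono order_trans[OF i c0(2)]) simp
    moreover have "\<bar>d * v1 x * i\<^sup>2\<bar> \<le> \<bar>d\<bar> * c"
    proof -
      have "\<bar>i\<^sup>2\<bar> \<le> B\<^sup>2" using power_mono[OF i, of 2] by simp
      then have "\<bar>v1 x\<bar> * \<bar>i\<^sup>2\<bar> \<le> V * B\<^sup>2" using V by (intro mult_mono V(2)[OF x]) auto
      then have "\<bar>d\<bar> * (\<bar>v1 x\<bar> * \<bar>i\<^sup>2\<bar>) \<le> \<bar>d\<bar> * c" using c0(3) by (intro mult_left_mono) auto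
      then show ?thesis by (simp only: abs_mult mult.assoc)
    qed
    ultimately have "\<bar>ratio' v v1 w w1 x\<bar> \<le> c * (\<bar>d\<bar> + \<bar>d1\<bar>)"
      unfolding rr by (simp add: algebra_simps)
    then have "\<bar>s\<bar> \<le> Z * (c * (\<bar>d\<bar> + \<bar>d1\<bar>))"
      unfolding s_def slope_weight_def abs_mult x_def[symmetric] using z Z1 by (intro mult_mono) auto
    also have "\<dots> \<le> k * (\<bar>d\<bar> + \<bar>d1\<bar>)"
      unfolding mult.assoc[symmetric] using k0(3) by (intro mult_right_mono) auto
    finally have s_le: "\<bar>s\<bar> \<le> k * (\<bar>d\<bar> + \<bar>d1\<bar>)" .
    have kK: "k * (\<bar>d\<bar> + \<bar>d1\<bar>) \<le> K * (\<bar>d\<bar> + \<bar>d1\<bar>)" using K0(2) by (intro mult_right_mono) auto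
    have sq: "(k * (\<bar>d\<bar> + \<bar>d1\<bar>))\<^sup>2 \<le> 2 * k\<^sup>2 * (d\<^sup>2 + d1\<^sup>2)"
    proof -
      have "(\<bar>d\<bar> + \<bar>d1\<bar>)\<^sup>2 \<le> 2 * (d\<^sup>2 + d1\<^sup>2)"
        using zero_le_power2[of "\<bar>d\<bar> - \<bar>d1\<bar>"] by (simp add: power2_eq_square algebra_simps)
      from mult_left_mono[OF this zero_le_power2[of k]] show ?thesis by (simp only: power_mult_distrib mult_ac)
    qed
    have r2: "r\<^sup>2 \<le> 2 * k\<^sup>2 * (d\<^sup>2 + d1\<^sup>2)" and s2: "s\<^sup>2 \<le> 2 * k\<^sup>2 * (d\<^sup>2 + d1\<^sup>2)"
      using power_mono[OF r_le, of 2] power_mono[OF s_le, of 2] sq by auto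
    have num: "r\<^sup>2 + \<epsilon>\<^sup>2 * s\<^sup>2 \<le> (1 + \<epsilon>\<^sup>2) * (2 * k\<^sup>2 * (d\<^sup>2 + d1\<^sup>2))"
      using r2 mult_left_mono[OF s2, of "\<epsilon>\<^sup>2"] by (simp only: distrib_right mult_1_left) simp
    have "\<bar>d\<bar> * k \<le> K * \<bar>d\<bar>" using K0(2) by (simp only: mult.commute[of "\<bar>d\<bar>"]) (intro mult_right_mono, auto)
    then have half: "ratio v w x \<ge> 1/2" using r_d small unfolding r_def d_def x_def by linarith
    have rem: "rem_weight \<epsilon> v v1 w w1 q = (r\<^sup>2 + \<epsilon>\<^sup>2 * s\<^sup>2) / ratio v w x"
      by (simp add: rem_weight_def r_def s_def x_def)
    have double: "a / (1/2) \<le> 2 * b" if "a \<le> b" for a b :: real using that by simp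
    have rem0: "0 \<le> rem_weight \<epsilon> v v1 w w1 q" unfolding rem using half by simp
    have "rem_weight \<epsilon> v v1 w w1 q \<le> (r\<^sup>2 + \<epsilon>\<^sup>2 * s\<^sup>2) / (1/2)"
      unfolding rem using half by (intro divide_left_mono) auto
    also have "\<dots> \<le> 2 * ((1 + \<epsilon>\<^sup>2) * (2 * k\<^sup>2 * (d\<^sup>2 + d1\<^sup>2)))" by (rule double[OF num])
    also have "\<dots> = 4 * k\<^sup>2 * (1 + \<epsilon>\<^sup>2) * (d\<^sup>2 + d1\<^sup>2)" by (simp add: mult_ac)
    also have "\<dots> \<le> K * (d\<^sup>2 + d1\<^sup>2)" using K0(3) by (intro mult_right_mono) auto
    finally have "rem_weight \<epsilon> v v1 w w1 q \<le> K * (d\<^sup>2 + d1\<^sup>2)" .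
    then show ?thesis
      using order_trans[OF r_le kK] order_trans[OF s_le kK] rem0 unfolding r_def s_def d_def d1_def x_def by (intro conjI)
  qed
  show ?thesis
    by (rule exI[of _ K], rule conjI[OF K0(1)], intro allI impI, rule main)
qed

text \<open>Differentiability of the electrostatic energy at \<open>v\<close>, in a form that is quadratic in
  the \<open>H\<^sup>1\<close> norm of \<open>w - v\<close>.\<close>

lemma dirichlet_quadratic_expansion:
  assumes \<epsilon>: "\<epsilon> > 0" and v: "profile v v1" and f: "classical_potential \<epsilon> v f fx fz fxx fxz fzz"
    and tx: "traced v fx fxx fxz gx" and tz: "traced v fz fxz fzz gz"
  shows "\<exists>C\<ge>0. \<forall>w w1 h hx hz hxx hxz hzz. profile w w1 \<longrightarrow> w (-1) = v (-1) \<longrightarrow> w 1 = v 1 \<longrightarrow>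
    (\<forall>x\<in>{-1..1}. C * \<bar>w x - v x\<bar> \<le> 1/2) \<longrightarrow> classical_potential \<epsilon> w h hx hz hxx hxz hzz \<longrightarrow>
    \<bar>dirichlet \<epsilon> w hx hz - dirichlet \<epsilon> v fx fz
       + (LINT x|lebesgue_on I. (w x - v x) * (\<epsilon>\<^sup>2 * (gx x)\<^sup>2 + (gz x)\<^sup>2))\<bar>
     \<le> C * integral {-1..1} (\<lambda>x. (w x - v x)\<^sup>2 + (w1 x - v1 x)\<^sup>2)"
proof -
  let ?M = "lebesgue_on (Omega v)"
  obtain K where K: "K \<ge> 0" and bounds: "\<forall>w w1 q. q \<in> Omega v \<longrightarrow> K * \<bar>w (fst q) - v (fst q)\<bar> \<le> 1/2 \<longrightarrow>
    \<bar>ratio v w (fst q) - 1\<bar> \<le> K * (\<bar>w (fst q) - v (fst q)\<bar> + \<bar>w1 (fst q) - v1 (fst q)\<bar>) \<and>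
    \<bar>slope_weight v v1 w w1 q\<bar> \<le> K * (\<bar>w (fst q) - v (fst q)\<bar> + \<bar>w1 (fst q) - v1 (fst q)\<bar>) \<and>
    0 \<le> rem_weight \<epsilon> v v1 w w1 q \<and>
    rem_weight \<epsilon> v v1 w w1 q \<le> K * ((w (fst q) - v (fst q))\<^sup>2 + (w1 (fst q) - v1 (fst q))\<^sup>2)"
    using rescaling_bounds[OF v, of \<epsilon>] by (elim exE conjE) (rule that)
  note Kb = bounds[rule_format]
  obtain Cx where Cx0: "Cx \<ge> 0" and estx: "\<forall>k. continuous_on {-1..1} k \<longrightarrow> (\<forall>x\<in>{-1..1}. 0 \<le> k x) \<longrightarrow>
      (LINT q|?M. k (fst q) * (fx q * fx q)) \<le> Cx * integral {-1..1} k"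
    using weight_estimate[OF v tx] by (elim exE conjE) (rule that)
  note Cx = Cx0 estx[THEN spec, THEN mp, THEN mp]
  obtain Cz where Cz0: "Cz \<ge> 0" and estz: "\<forall>k. continuous_on {-1..1} k \<longrightarrow> (\<forall>x\<in>{-1..1}. 0 \<le> k x) \<longrightarrow>
      (LINT q|?M. k (fst q) * (fz q * fz q)) \<le> Cz * integral {-1..1} k"
    using weight_estimate[OF v tz] by (elim exE conjE) (rule that)
  note Cz = Cz0 estz[THEN spec, THEN mp, THEN mp]
  define C where "C = K + K * Cz + \<epsilon>\<^sup>2 * (K * Cx)"
  have C: "C \<ge> 0" "K \<le> C" "K * Cz \<le> C" "\<epsilon>\<^sup>2 * (K * Cx) \<le> C" using K Cx(1) Cz(1) by (auto simp: C_def)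
  have "\<bar>dirichlet \<epsilon> w hx hz - dirichlet \<epsilon> v fx fz
       + (LINT x|lebesgue_on I. (w x - v x) * (\<epsilon>\<^sup>2 * (gx x)\<^sup>2 + (gz x)\<^sup>2))\<bar>
     \<le> C * integral {-1..1} (\<lambda>x. (w x - v x)\<^sup>2 + (w1 x - v1 x)\<^sup>2)"
    if w: "profile w w1" and ends: "w (-1) = v (-1)" "w 1 = v 1" and small: "\<forall>x\<in>{-1..1}. C * \<bar>w x - v x\<bar> \<le> 1/2"
      and h: "classical_potential \<epsilon> w h hx hz hxx hxz hzz" for w w1 h hx hz hxx hxz hzz
  proof -
    define p where "p x = (w x - v x)\<^sup>2 + (w1 x - v1 x)\<^sup>2" for x
    have cp: "continuous_on {-1..1} (\<lambda>x. K * p x)" unfolding p_def by (intro continuous_intros profileD[OF v] profileD[OF w])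
    have p0: "\<forall>x\<in>{-1..1}. 0 \<le> K * p x" using K by (auto simp: p_def)
    have Ip: "integral {-1..1} (\<lambda>x. K * p x) = K * integral {-1..1} p" by (rule integral_mult_right)
    have Ip0: "0 \<le> integral {-1..1} p"
      by (rule Henstock_Kurzweil_Integration.integral_nonneg)
        (auto simp: p_def[abs_def] intro!: integrable_continuous_interval continuous_intros profileD[OF v] profileD[OF w])
    have Rb: "rem_weight \<epsilon> v v1 w w1 q \<le> K * p (fst q)" if q: "q \<in> Omega v" for q
    proof -
      have "K * \<bar>w (fst q) - v (fst q)\<bar> \<le> C * \<bar>w (fst q) - v (fst q)\<bar>" using C(2) by (intro mult_right_mono) auto
      also have "\<dots> \<le> 1/2" using small fst_Omega(2)[OF q] by blast
      finally have "K * \<bar>w (fst q) - v (fst q)\<bar> \<le> 1/2" .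
      from Kb[of q w w1, OF q this] show ?thesis unfolding p_def by (elim conjE)
    qed
    have est: "(LINT q|?M. rem_weight \<epsilon> v v1 w w1 q * (a q * a q)) \<le> Ca * (K * integral {-1..1} p)"
      if a: "sqint ?M a" and Ca: "\<And>k. continuous_on {-1..1} k \<Longrightarrow> \<forall>x\<in>{-1..1}. 0 \<le> k x \<Longrightarrow>
      (LINT q|?M. k (fst q) * (a q * a q)) \<le> Ca * integral {-1..1} k" for a Ca
    proof -
      have "(LINT q|?M. rem_weight \<epsilon> v v1 w w1 q * (a q * a q)) \<le> (LINT q|?M. (K * p (fst q)) * (a q * a q))"
      proof (rule integral_mono)
        show "integrable ?M (\<lambda>q. rem_weight \<epsilon> v v1 w w1 q * (a q * a q))"
          by (rule weighted_product_integrable[OF v weights_continuous(3)[OF v w] a a])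
        show "integrable ?M (\<lambda>q. (K * p (fst q)) * (a q * a q))"
          by (rule weighted_product_integrable[OF v fst_weight_continuous[OF cp] a a])
        show "rem_weight \<epsilon> v v1 w w1 q * (a q * a q) \<le> (K * p (fst q)) * (a q * a q)" if "q \<in> space ?M" for q
          using that Rb by (intro mult_right_mono) auto
      qed
      also have "\<dots> \<le> Ca * integral {-1..1} (\<lambda>x. K * p x)" by (rule Ca[OF cp p0])
      finally show ?thesis unfolding Ip .
    qed
    note D = dirichlet_comparison[OF \<epsilon> v w f h]
    note fo = first_order_boundary[OF v w ends(1)[symmetric] ends(2)[symmetric] f tx tz]
    have "(LINT q|?M. rem_weight \<epsilon> v v1 w w1 q * (fz q)\<^sup>2) \<le> Cz * (K * integral {-1..1} p)"
      using est[OF tracedD(1)[OF tz] Cz(2)] by (simp add: power2_eq_square)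
    also have "\<dots> = (K * Cz) * integral {-1..1} p" by simp
    also have "\<dots> \<le> C * integral {-1..1} p" by (rule mult_right_mono[OF C(3) Ip0])
    finally have up: "(LINT q|?M. rem_weight \<epsilon> v v1 w w1 q * (fz q)\<^sup>2) \<le> C * integral {-1..1} p" .
    have "(LINT q|?M. rem_weight \<epsilon> v v1 w w1 q * (\<epsilon>\<^sup>2 * (fx q)\<^sup>2)) = \<epsilon>\<^sup>2 * (LINT q|?M. rem_weight \<epsilon> v v1 w w1 q * (fx q * fx q))"
      unfolding integral_mult_right_zero[symmetric] by (simp add: power2_eq_square mult_ac)
    also have "\<dots> \<le> \<epsilon>\<^sup>2 * (Cx * (K * integral {-1..1} p))"
      by (rule mult_left_mono[OF est[OF tracedD(1)[OF tx] Cx(2)]]) auto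
    also have "\<dots> = (\<epsilon>\<^sup>2 * (K * Cx)) * integral {-1..1} p" by simp
    also have "\<dots> \<le> C * integral {-1..1} p" by (rule mult_right_mono[OF C(4) Ip0])
    finally have lo: "(LINT q|?M. rem_weight \<epsilon> v v1 w w1 q * (\<epsilon>\<^sup>2 * (fx q)\<^sup>2)) \<le> C * integral {-1..1} p" .
    show ?thesis using D up lo unfolding fo p_def[symmetric] by linarith
  qed
  then show ?thesis using C(1) by (intro exI[of _ C] conjI allI impI)
qed

text \<open>The cruder companion of the expansion: it holds for potentials without traces of the gradient, which
  are given at positive times only, and yields continuity of the energy at time zero.\<close>

lemma dirichlet_continuous_dependence:
  assumes \<epsilon>: "\<epsilon> > 0" and v: "profile v v1" and f: "classical_potential \<epsilon> v f fx fz fxx fxz fzz"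
  shows "\<exists>C\<ge>0. \<forall>w w1 h hx hz hxx hxz hzz \<delta>. profile w w1 \<longrightarrow> \<delta> \<le> 1 \<longrightarrow> C * \<delta> \<le> 1/2 \<longrightarrow>
    (\<forall>x\<in>{-1..1}. \<bar>w x - v x\<bar> \<le> \<delta> \<and> \<bar>w1 x - v1 x\<bar> \<le> \<delta>) \<longrightarrow> classical_potential \<epsilon> w h hx hz hxx hxz hzz \<longrightarrow>
    \<bar>dirichlet \<epsilon> w hx hz - dirichlet \<epsilon> v fx fz\<bar> \<le> C * \<delta>"
proof -
  let ?M = "lebesgue_on (Omega v)"
  note F = classical_potentialD[OF f v]
  obtain K where K: "K \<ge> 0" and bounds: "\<forall>w w1 q. q \<in> Omega v \<longrightarrow> K * \<bar>w (fst q) - v (fst q)\<bar> \<le> 1/2 \<longrightarrow>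
    \<bar>ratio v w (fst q) - 1\<bar> \<le> K * (\<bar>w (fst q) - v (fst q)\<bar> + \<bar>w1 (fst q) - v1 (fst q)\<bar>) \<and>
    \<bar>slope_weight v v1 w w1 q\<bar> \<le> K * (\<bar>w (fst q) - v (fst q)\<bar> + \<bar>w1 (fst q) - v1 (fst q)\<bar>) \<and>
    0 \<le> rem_weight \<epsilon> v v1 w w1 q \<and>
    rem_weight \<epsilon> v v1 w w1 q \<le> K * ((w (fst q) - v (fst q))\<^sup>2 + (w1 (fst q) - v1 (fst q))\<^sup>2)"
    using rescaling_bounds[OF v, of \<epsilon>] by (elim exE conjE) (rule that)
  note Kb = bounds[rule_format]
  have iA: "integrable ?M (\<lambda>q. (fx q)\<^sup>2 + (fz q)\<^sup>2)" using F(7,8) by (simp add: sqint_def)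
  define A where "A = (LINT q|?M. (fx q)\<^sup>2 + (fz q)\<^sup>2)"
  have A0: "A \<ge> 0" by (simp add: A_def)
  define c where "c = 2 * K * (1 + 3 * \<epsilon>\<^sup>2)"
  define C where "C = K + c * A + c * A"
  have c0: "c \<ge> 0" using K by (simp add: c_def)
  have C: "C \<ge> 0" "K \<le> C" using K c0 A0 by (auto simp: C_def)
  have "\<bar>dirichlet \<epsilon> w hx hz - dirichlet \<epsilon> v fx fz\<bar> \<le> C * \<delta>"
    if w: "profile w w1" and \<delta>: "\<delta> \<le> 1" "C * \<delta> \<le> 1/2" and small: "\<forall>x\<in>{-1..1}. \<bar>w x - v x\<bar> \<le> \<delta> \<and> \<bar>w1 x - v1 x\<bar> \<le> \<delta>"
      and h: "classical_potential \<epsilon> w h hx hz hxx hxz hzz" for w w1 h hx hz hxx hxz hzz \<delta>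
  proof -
    have "\<bar>w 0 - v 0\<bar> \<le> \<delta>" using small by simp
    then have \<delta>0: "\<delta> \<ge> 0" by linarith
    have b: "\<bar>ratio v w (fst q) - 1\<bar> \<le> 2 * K * \<delta>" "\<bar>slope_weight v v1 w w1 q\<bar> \<le> 2 * K * \<delta>"
        "0 \<le> rem_weight \<epsilon> v v1 w w1 q" "rem_weight \<epsilon> v v1 w w1 q \<le> 2 * K * \<delta>" if q: "q \<in> Omega v" for q
    proof -
      let ?d = "\<bar>w (fst q) - v (fst q)\<bar>" and ?e = "\<bar>w1 (fst q) - v1 (fst q)\<bar>"
      have de: "?d \<le> \<delta>" "?e \<le> \<delta>" using small fst_Omega(2)[OF q] by auto
      have "K * ?d \<le> C * \<delta>" using C(2) de(1) C(1) by (intro mult_mono) auto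
      then have "K * ?d \<le> 1/2" using \<delta>(2) by linarith
      note kb = Kb[of q w w1, OF q this]
      have 1: "K * (?d + ?e) \<le> K * (2 * \<delta>)" using K de by (intro mult_left_mono) auto
      have "?d\<^sup>2 \<le> \<delta>" "?e\<^sup>2 \<le> \<delta>"
        using mult_mono[OF de(1) order_trans[OF de(1) \<delta>(1)]] mult_mono[OF de(2) order_trans[OF de(2) \<delta>(1)]] \<delta>0
        unfolding power2_eq_square by auto
      then have 2: "K * ((w (fst q) - v (fst q))\<^sup>2 + (w1 (fst q) - v1 (fst q))\<^sup>2) \<le> K * (2 * \<delta>)"
        using K by (intro mult_left_mono) auto
      show "\<bar>ratio v w (fst q) - 1\<bar> \<le> 2 * K * \<delta>" "\<bar>slope_weight v v1 w w1 q\<bar> \<le> 2 * K * \<delta>"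
        "0 \<le> rem_weight \<epsilon> v v1 w w1 q" "rem_weight \<epsilon> v v1 w w1 q \<le> 2 * K * \<delta>"
        using kb 1 2 by (auto simp: mult_ac)
    qed
    have bound: "(LINT q|?M. G q) \<le> c * \<delta> * A"
      if iG: "integrable ?M G" and G: "\<And>q. q \<in> Omega v \<Longrightarrow> G q \<le> 2 * K * \<delta> * ((1 + 3 * \<epsilon>\<^sup>2) * ((fx q)\<^sup>2 + (fz q)\<^sup>2))" for G
    proof -
      have "(LINT q|?M. G q) \<le> (LINT q|?M. c * \<delta> * ((fx q)\<^sup>2 + (fz q)\<^sup>2))"
      proof (rule integral_mono[OF iG integrable_mult_right[OF iA]])
        fix q assume "q \<in> space ?M"
        then show "G q \<le> c * \<delta> * ((fx q)\<^sup>2 + (fz q)\<^sup>2)" using G[of q] unfolding c_def by (simp only: space_lebesgue_on mult_ac)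
      qed
      then show ?thesis unfolding A_def integral_mult_right_zero .
    qed
    have k0: "2 * K * \<delta> \<ge> 0" using K \<delta>0 by simp
    have fle: "a\<^sup>2 \<le> (1 + 3 * \<epsilon>\<^sup>2) * (a\<^sup>2 + b\<^sup>2)" "\<epsilon>\<^sup>2 * b\<^sup>2 \<le> (1 + 3 * \<epsilon>\<^sup>2) * (b\<^sup>2 + a\<^sup>2)" for a b :: real
      by (auto simp: algebra_simps add_increasing add_increasing2)
    let ?g = "\<lambda>q. (ratio v w (fst q) - 1) * (\<epsilon>\<^sup>2 * (fx q)\<^sup>2 - (fz q)\<^sup>2) - 2 * \<epsilon>\<^sup>2 * slope_weight v v1 w w1 q * (fx q * fz q)"
    have gb: "\<bar>?g q\<bar> \<le> 2 * K * \<delta> * ((1 + 3 * \<epsilon>\<^sup>2) * ((fx q)\<^sup>2 + (fz q)\<^sup>2))" if q: "q \<in> Omega v" for q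
    proof -
      have "\<bar>(ratio v w (fst q) - 1) * (\<epsilon>\<^sup>2 * (fx q)\<^sup>2 - (fz q)\<^sup>2)\<bar> \<le> 2 * K * \<delta> * (\<epsilon>\<^sup>2 * (fx q)\<^sup>2 + (fz q)\<^sup>2)"
        unfolding abs_mult using b(1)[OF q] k0 by (intro mult_mono) (auto intro: order_trans[OF abs_triangle_ineq4])
      moreover have "\<bar>slope_weight v v1 w w1 q * (fx q * fz q)\<bar> \<le> 2 * K * \<delta> * ((fx q)\<^sup>2 + (fz q)\<^sup>2)"
        unfolding abs_mult[of "slope_weight v v1 w w1 q"] using b(2)[OF q] k0 by (intro mult_mono abs_mult_le_sum_squares) auto
      then have "2 * \<epsilon>\<^sup>2 * \<bar>slope_weight v v1 w w1 q * (fx q * fz q)\<bar> \<le> 2 * \<epsilon>\<^sup>2 * (2 * K * \<delta> * ((fx q)\<^sup>2 + (fz q)\<^sup>2))"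
        by (intro mult_left_mono) auto
      then have "\<bar>2 * \<epsilon>\<^sup>2 * slope_weight v v1 w w1 q * (fx q * fz q)\<bar> \<le> 2 * \<epsilon>\<^sup>2 * (2 * K * \<delta> * ((fx q)\<^sup>2 + (fz q)\<^sup>2))"
        by (simp add: abs_mult mult_ac)
      ultimately have "\<bar>?g q\<bar> \<le> 2 * K * \<delta> * (\<epsilon>\<^sup>2 * (fx q)\<^sup>2 + (fz q)\<^sup>2) + 2 * \<epsilon>\<^sup>2 * (2 * K * \<delta> * ((fx q)\<^sup>2 + (fz q)\<^sup>2))"
        by linarith
      also have "\<dots> = 2 * K * \<delta> * ((\<epsilon>\<^sup>2 * (fx q)\<^sup>2 + (fz q)\<^sup>2) + 2 * \<epsilon>\<^sup>2 * ((fx q)\<^sup>2 + (fz q)\<^sup>2))"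
        by (simp only: distrib_left mult_ac)
      also have "\<dots> \<le> 2 * K * \<delta> * ((1 + 3 * \<epsilon>\<^sup>2) * ((fx q)\<^sup>2 + (fz q)\<^sup>2))"
        by (intro mult_left_mono k0) (auto simp: algebra_simps)
      finally show ?thesis .
    qed
    have ig: "integrable ?M ?g" by (rule first_order_integrable[OF v w F(7,8)])
    have ng: "integrable ?M (\<lambda>q. - ?g q)" by (rule Bochner_Integration.integrable_minus[OF ig])
    have "first_order \<epsilon> v v1 w w1 fx fz \<le> c * \<delta> * A"
      unfolding first_order_def using gb by (intro bound[OF ig]) (rule order_trans[OF abs_ge_self])
    moreover have "(LINT q|?M. - ?g q) \<le> c * \<delta> * A"
      using gb by (intro bound[OF ng]) (rule order_trans[OF abs_ge_minus_self])
    then have "- first_order \<epsilon> v v1 w w1 fx fz \<le> c * \<delta> * A"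
      unfolding first_order_def Bochner_Integration.integral_minus .
    moreover have "(LINT q|?M. rem_weight \<epsilon> v v1 w w1 q * (fz q)\<^sup>2) \<le> c * \<delta> * A"
    proof (rule bound)
      show "integrable ?M (\<lambda>q. rem_weight \<epsilon> v v1 w w1 q * (fz q)\<^sup>2)"
        unfolding power2_eq_square by (rule weighted_product_integrable[OF v weights_continuous(3)[OF v w] F(8,8)])
      show "rem_weight \<epsilon> v v1 w w1 q * (fz q)\<^sup>2 \<le> 2 * K * \<delta> * ((1 + 3 * \<epsilon>\<^sup>2) * ((fx q)\<^sup>2 + (fz q)\<^sup>2))" if "q \<in> Omega v" for q
        using b(4)[OF that] k0 fle(1)[of "fz q" "fx q"] by (intro mult_mono) (auto simp: add.commute)
    qed
    moreover have "(LINT q|?M. rem_weight \<epsilon> v v1 w w1 q * (\<epsilon>\<^sup>2 * (fx q)\<^sup>2)) \<le> c * \<delta> * A"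
    proof (rule bound)
      have "integrable ?M (\<lambda>q. \<epsilon>\<^sup>2 * (rem_weight \<epsilon> v v1 w w1 q * (fx q * fx q)))"
        by (rule integrable_mult_right[OF weighted_product_integrable[OF v weights_continuous(3)[OF v w] F(7,7)]])
      then show "integrable ?M (\<lambda>q. rem_weight \<epsilon> v v1 w w1 q * (\<epsilon>\<^sup>2 * (fx q)\<^sup>2))" by (simp add: power2_eq_square mult_ac)
      show "rem_weight \<epsilon> v v1 w w1 q * (\<epsilon>\<^sup>2 * (fx q)\<^sup>2) \<le> 2 * K * \<delta> * ((1 + 3 * \<epsilon>\<^sup>2) * ((fx q)\<^sup>2 + (fz q)\<^sup>2))" if "q \<in> Omega v" for q
        using b(4)[OF that] k0 fle(2)[of "fx q" "fz q"] by (intro mult_mono) auto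
    qed
    moreover have "c * \<delta> * A + c * \<delta> * A \<le> C * \<delta>"
      using mult_nonneg_nonneg[OF K \<delta>0] by (simp add: C_def algebra_simps)
    ultimately show ?thesis using dirichlet_comparison[OF \<epsilon> v w f h] by linarith
  qed
  then show ?thesis using C(1) by (intro exI[of _ C] conjI allI impI)
qed

text \<open>Comparison of a profile with itself; the energy does not depend on the choice of the potential.\<close>

lemma dirichlet_unique:
  assumes \<epsilon>: "\<epsilon> > 0" and v: "profile v v1" and f: "classical_potential \<epsilon> v f fx fz fxx fxz fzz"
    and h: "classical_potential \<epsilon> v h hx hz hxx hxz hzz"
  shows "dirichlet \<epsilon> v hx hz = dirichlet \<epsilon> v fx fz"
proof -
  obtain C where dep: "\<forall>w w1 h hx hz hxx hxz hzz \<delta>. profile w w1 \<longrightarrow> \<delta> \<le> 1 \<longrightarrow> C * \<delta> \<le> 1/2 \<longrightarrow>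
    (\<forall>x\<in>{-1..1}. \<bar>w x - v x\<bar> \<le> \<delta> \<and> \<bar>w1 x - v1 x\<bar> \<le> \<delta>) \<longrightarrow> classical_potential \<epsilon> w h hx hz hxx hxz hzz \<longrightarrow>
    \<bar>dirichlet \<epsilon> w hx hz - dirichlet \<epsilon> v fx fz\<bar> \<le> C * \<delta>"
    using dirichlet_continuous_dependence[OF \<epsilon> v f] by (elim exE conjE) (rule that)
  have "\<bar>dirichlet \<epsilon> v hx hz - dirichlet \<epsilon> v fx fz\<bar> \<le> C * 0"
    by (rule dep[rule_format, of v v1 0 h hx hz hxx hxz hzz]) (use v h in auto)
  then show ?thesis by simp
qed

lemma electrostatic_energy_dirichlet:
  assumes \<epsilon>: "\<epsilon> > 0" and v: "profile v v1" and \<psi>: "is_potential \<epsilon> v \<psi>"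
    and f: "classical_potential \<epsilon> v f fx fz fxx fxz fzz"
  shows "energy_electrostatic \<epsilon> v = dirichlet \<epsilon> v fx fz"
proof -
  have "is_potential \<epsilon> v (potential \<epsilon> v)" unfolding potential_def using someI[of "is_potential \<epsilon> v" \<psi>, OF \<psi>] .
  from potential_classical[OF \<epsilon> v this] obtain hx hz hxx hxz hzz where
    h: "classical_potential \<epsilon> v (potential \<epsilon> v) hx hz hxx hxz hzz"
    and ae: "AE q in lebesgue. q \<in> Omega v \<longrightarrow> dx v (potential \<epsilon> v) q = hx q"
      "AE q in lebesgue. q \<in> Omega v \<longrightarrow> dz v (potential \<epsilon> v) q = hz q"
    by blast
  note H = classical_potentialD[OF h v] and S = Omega_sets[OF profileD(5)[OF v]]
  have i: "set_integrable lebesgue (Omega v) (\<lambda>q. \<epsilon>\<^sup>2 * (hx q)\<^sup>2 + (hz q)\<^sup>2)"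
    unfolding set_integral_lebesgue_on(2)[OF S]
    by (intro Bochner_Integration.integrable_add integrable_mult_right) (use H(7,8) in \<open>auto simp: sqint_def\<close>)
  have "(LINT q:Omega v|lebesgue. \<epsilon>\<^sup>2 * (hx q)\<^sup>2 + (hz q)\<^sup>2) = energy_electrostatic \<epsilon> v"
    unfolding energy_electrostatic_def
  proof (rule set_integral_lebesgue_cong_AE)
    show "set_borel_measurable lebesgue (Omega v) (\<lambda>q. \<epsilon>\<^sup>2 * (hx q)\<^sup>2 + (hz q)\<^sup>2)"
      using i unfolding set_integrable_def set_borel_measurable_def by (rule borel_measurable_integrable)
    show "AE q in lebesgue. q \<in> Omega v \<longrightarrow> \<epsilon>\<^sup>2 * (hx q)\<^sup>2 + (hz q)\<^sup>2 = \<epsilon>\<^sup>2 * (dx v (potential \<epsilon> v) q)\<^sup>2 + (dz v (potential \<epsilon> v) q)\<^sup>2"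
      using ae by eventually_elim simp
  qed
  then have "energy_electrostatic \<epsilon> v = dirichlet \<epsilon> v hx hz"
    unfolding dirichlet_def set_integral_lebesgue_on(1)[OF S] by simp
  then show ?thesis using dirichlet_unique[OF \<epsilon> v f h] by simp
qed

section \<open>Curves in \<open>H\<^sup>4\<close> with clamped ends\<close>

lemma sobolev_iterate:
  "sobolev k I f \<Longrightarrow> j \<le> k \<Longrightarrow> sobolev (k - j) I ((dx1 ^^ j) f)"
proof (induction j)
  case (Suc j)
  then have s: "sobolev (Suc (k - Suc j)) I ((dx1 ^^ j) f)" by (simp add: Suc_diff_Suc)
  have "sobolev (k - Suc j) I (dx1 ((dx1 ^^ j) f))" by (rule sobolev_weak_deriv(2)[OF _ s]) auto
  then show ?case by simp
qed simp

lemma weak_deriv_iterate_diff: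
  assumes f: "sobolev k I f" and g: "sobolev k I g"
  shows "j \<le> k \<Longrightarrow> AE x in lebesgue. x \<in> I \<longrightarrow> (dx1 ^^ j) (\<lambda>x. f x - g x) x = (dx1 ^^ j) f x - (dx1 ^^ j) g x"
proof (induction j)
  case (Suc j)
  then have j: "j \<le> k" by simp
  have s: "sobolev (Suc (k - Suc j)) I ((dx1 ^^ j) f)" "sobolev (Suc (k - Suc j)) I ((dx1 ^^ j) g)"
    using sobolev_iterate[OF f j] sobolev_iterate[OF g j] Suc.prems by (simp_all add: Suc_diff_Suc)
  have "has_weak_deriv I 1 ((dx1 ^^ j) f) (dx1 ((dx1 ^^ j) f))" "has_weak_deriv I 1 ((dx1 ^^ j) g) (dx1 ((dx1 ^^ j) g))"
    by (rule sobolev_weak_deriv(1)[OF _ s(1)]; simp) (rule sobolev_weak_deriv(1)[OF _ s(2)]; simp)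
  note d = has_weak_deriv_diff[OF this]
  have ae: "AE x in lebesgue. x \<in> I \<longrightarrow> (dx1 ^^ j) f x - (dx1 ^^ j) g x = (dx1 ^^ j) (\<lambda>x. f x - g x) x"
    using Suc.IH[OF j] by eventually_elim simp
  have "has_weak_deriv I 1 ((dx1 ^^ j) (\<lambda>x. f x - g x)) (\<lambda>x. dx1 ((dx1 ^^ j) f) x - dx1 ((dx1 ^^ j) g) x)"
    by (rule has_weak_deriv_cong_AE[OF d ae]) simp
  from weak_deriv_AE_eq[OF _ this] show ?case by simp
qed simp

lemma sobolev_sqnorm_nonneg: "0 \<le> sobolev_sqnorm k S f"
proof (induction k arbitrary: f)
  case (Suc k)
  have "0 \<le> (\<Sum>e\<in>Basis. sobolev_sqnorm k S (weak_deriv S e f))" by (rule sum_nonneg) (rule Suc)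
  then show ?case by simp
qed simp

text \<open>In dimension one the recursion for the Sobolev norm has one summand per order.\<close>

lemma L2_norm_iterate_le_sobolev:
  "j \<le> k \<Longrightarrow> (L2_norm_on I ((dx1 ^^ j) f))\<^sup>2 \<le> sobolev_sqnorm k I f"
proof (induction k arbitrary: f j)
  case (Suc k)
  have e: "sobolev_sqnorm (Suc k) I f = (L2_norm_on I f)\<^sup>2 + sobolev_sqnorm k I (dx1 f)" by simp
  show ?case
  proof (cases j)
    case 0
    then show ?thesis unfolding e using sobolev_sqnorm_nonneg[of k I "dx1 f"] by simp
  next
    case (Suc i)
    then have "i \<le> k" using Suc.prems by simp
    from Suc.IH[OF this, of "dx1 f"] have "(L2_norm_on I ((dx1 ^^ j) f))\<^sup>2 \<le> sobolev_sqnorm k I (dx1 f)"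
      unfolding \<open>j = Suc i\<close> funpow_Suc_right o_apply .
    then show ?thesis unfolding e by (rule add_increasing[OF zero_le_power2])
  qed
qed simp

lemma has_real_derivative_within_I_unique:
  assumes "(f has_real_derivative a) (at x within {-1..1})" "(f has_real_derivative b) (at x within {-1..1})" "x \<in> {-1..1}"
  shows "a = (b::real)"
proof -
  have "at x within {-1..1::real} \<noteq> bot"
    using assms(3) islimpt_Icc[of "-1::real" 1 x] by (simp add: trivial_limit_within)
  then show ?thesis
    using assms(1,2) unfolding has_field_derivative_iff by (metis tendsto_unique)
qed

lemma H4_rep_add_cmult:
  assumes "H4_rep v v1 v2 v3 v4" "H4_rep w w1 w2 w3 w4"
  shows "H4_rep (\<lambda>x. v x + c * w x) (\<lambda>x. v1 x + c * w1 x) (\<lambda>x. v2 x + c * w2 x) (\<lambda>x. v3 x + c * w3 x) (\<lambda>x. v4 x + c * w4 x)"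
proof -
  note V = H4_repD[OF assms(1)] and W = H4_repD[OF assms(2)]
  obtain a b where ab: "\<forall>x\<in>{-1..1}. v3 x = a + integral {-1..x} v4" "\<forall>x\<in>{-1..1}. w3 x = b + integral {-1..x} w4"
    using assms unfolding H4_rep_def by blast
  have sub: "(g integrable_on {-1..x})" if "set_integrable lebesgue {-1..1} g" "x \<in> {-1..1}" for g :: "real \<Rightarrow> real" and x
    by (rule integrable_subinterval_real[OF set_lebesgue_integral_eq_integral(1)[OF that(1)]]) (use that(2) in auto)
  have "v3 x + c * w3 x = (a + c * b) + integral {-1..x} (\<lambda>x. v4 x + c * w4 x)" if x: "x \<in> {-1..1}" for x
  proof -
    have "integral {-1..x} (\<lambda>x. v4 x + c * w4 x) = integral {-1..x} v4 + c * integral {-1..x} w4"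
      unfolding integral_mult_right[symmetric]
      using Henstock_Kurzweil_Integration.integral_add[OF sub[OF V(9) x], of "\<lambda>x. c * w4 x"]
        integrable_on_cmult_left[OF sub[OF W(9) x], of c] by simp
    then show ?thesis using ab x by (simp add: algebra_simps)
  qed
  moreover have "L2_on I (\<lambda>x. v4 x + c * w4 x)"
    using V(8) W(8) unfolding L2_on_iff_sqint[of I, simplified] by (intro sqint_add sqint_cmult)
  moreover have "continuous_on {-1..1} (\<lambda>x. v3 x + c * w3 x)" by (intro continuous_intros V(7) W(7))
  ultimately show ?thesis
    unfolding H4_rep_def by (intro conjI ballI DERIV_add DERIV_cmult V(1-3) W(1-3) exI[of _ "a + c * b"]) 
qed

lemma sup_le_nrm_derivative:
  assumes f: "\<And>x. x \<in> {-1..1} \<Longrightarrow> (f has_real_derivative f' x) (at x within {-1..1})"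
    and c: "continuous_on {-1..1} f'" and f0: "f (-1) = 0" and x: "x \<in> {-1..1}"
  shows "\<bar>f x\<bar> \<le> sqrt 2 * nrm (lebesgue_on I) f'"
proof -
  let ?N = "lebesgue_on I"
  have x1: "{-1..x} \<subseteq> {-1..1}" using x by auto
  have ca: "continuous_on {-1..1} (\<lambda>y. \<bar>f' y\<bar>)" by (intro continuous_intros c)
  have "(f' has_integral (f x - f (-1))) {-1..x}"
    by (rule fundamental_theorem_of_calculus)
      (use x x1 in \<open>auto simp: has_real_derivative_iff_has_vector_derivative[symmetric] intro: has_field_derivative_subset[OF f]\<close>)
  then have "f x = integral {-1..x} f'" using f0 by (simp add: integral_unique)
  also have "\<bar>\<dots>\<bar> \<le> integral {-1..x} (\<lambda>y. \<bar>f' y\<bar>)"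
    using integral_norm_bound_integral[of f' "{-1..x}" "\<lambda>y. \<bar>f' y\<bar>"]
      integrable_continuous_interval[OF continuous_on_subset[OF c x1]] integrable_continuous_interval[OF continuous_on_subset[OF ca x1]] by simp
  also have "\<dots> \<le> integral {-1..1} (\<lambda>y. \<bar>f' y\<bar>)"
    by (rule integral_subset_le[OF x1])
      (use integrable_continuous_interval[OF continuous_on_subset[OF ca x1]] integrable_continuous_interval[OF ca] in auto)
  also have "\<dots> = (LINT y|?N. 1 * \<bar>f' y\<bar>)" using integral_lebesgue_on_I[OF ca] by simp
  also have "\<dots> \<le> nrm ?N (\<lambda>_. 1) * nrm ?N (\<lambda>y. \<bar>f' y\<bar>)"
    by (rule order_trans[OF abs_ge_self Cauchy_Schwarz_integral[OF sqint_continuous_I sqint_continuous_I[OF ca]]]) simp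
  also have "nrm ?N (\<lambda>_. 1) = sqrt 2" unfolding nrm_def by (subst integral_lebesgue_on_I) auto
  also have "nrm ?N (\<lambda>y. \<bar>f' y\<bar>) = nrm ?N f'" by (simp add: nrm_def)
  finally show ?thesis .
qed

text \<open>The spatial derivatives are carried along as functions: \<open>v1\<close>, \<open>v2\<close>,
  \<open>v3\<close> are the classical ones, while the fourth is only the chosen weak derivative.\<close>

locale clamped_curve =
  fixes J :: "real set" and u v1 v2 v3 :: "real \<Rightarrow> real \<Rightarrow> real"
  assumes time_C1: "C1_L2 J u" and space_H4: "C_H4 J u"
    and rep: "\<And>t. t \<in> J \<Longrightarrow> H4_rep (u t) (v1 t) (v2 t) (v3 t) ((dx1 ^^ 4) (u t))"
    and v1_ae: "\<And>t. t \<in> J \<Longrightarrow> AE x in lebesgue. x \<in> I \<longrightarrow> dx1 (u t) x = v1 t x"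
    and v2_ae: "\<And>t. t \<in> J \<Longrightarrow> AE x in lebesgue. x \<in> I \<longrightarrow> (dx1 ^^ 2) (u t) x = v2 t x"
    and ends: "\<And>t. t \<in> J \<Longrightarrow> u t (-1) = 0 \<and> u t 1 = 0 \<and> v1 t (-1) = 0 \<and> v1 t 1 = 0"
    and above: "\<And>t x. t \<in> J \<Longrightarrow> x \<in> I \<Longrightarrow> u t x > -1"
begin

abbreviation "N \<equiv> lebesgue_on I"
abbreviation "v4 t \<equiv> (dx1 ^^ 4) (u t)"
abbreviation "ut t \<equiv> time_deriv J u t"

lemmas repD = H4_repD[OF rep]

lemma profile_u: "t \<in> J \<Longrightarrow> profile (u t) (v1 t)"
proof -
  assume t: "t \<in> J"
  have "u t x > -1" if x: "x \<in> {-1..1}" for x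
  proof (cases "x \<in> I")
    case False
    then have "x = -1 \<or> x = 1" using x by auto
    then show ?thesis using ends[OF t] by auto
  qed (rule above[OF t])
  then show ?thesis unfolding profile_def using repD(1,5)[OF t] by blast
qed

lemma sobolev_u: "t \<in> J \<Longrightarrow> sobolev 4 I (u t)"
  using space_H4 unfolding C_H4_def H4_def by blast

lemma sqint_iterate: "t \<in> J \<Longrightarrow> j \<le> 4 \<Longrightarrow> sqint N ((dx1 ^^ j) (u t))"
  using sobolev_L2[OF sobolev_iterate[OF sobolev_u]] L2_on_iff_sqint[of I] by simp

lemma tendsto_iterate:
  assumes t: "t \<in> J" and j: "j \<le> 4"
  shows "((\<lambda>s. nrm N (\<lambda>x. (dx1 ^^ j) (u s) x - (dx1 ^^ j) (u t) x)) \<longlongrightarrow> 0) (at t within J)"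
proof (rule tendsto_sandwich[where f = "\<lambda>_. 0" and h = "\<lambda>s. sobolev_norm 4 I (\<lambda>x. u s x - u t x)"])
  show "((\<lambda>s. sobolev_norm 4 I (\<lambda>x. u s x - u t x)) \<longlongrightarrow> 0) (at t within J)"
    using space_H4 t unfolding C_H4_def by blast
  show "((\<lambda>s. 0::real) \<longlongrightarrow> 0) (at t within J)" by simp
  show "\<forall>\<^sub>F s in at t within J. 0 \<le> nrm N (\<lambda>x. (dx1 ^^ j) (u s) x - (dx1 ^^ j) (u t) x)"
    by (simp add: nrm_nonneg)
  show "\<forall>\<^sub>F s in at t within J. nrm N (\<lambda>x. (dx1 ^^ j) (u s) x - (dx1 ^^ j) (u t) x) \<le> sobolev_norm 4 I (\<lambda>x. u s x - u t x)"
    unfolding eventually_at_filter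
  proof (intro always_eventually allI impI)
    fix s assume s: "s \<in> J"
    have ae: "AE x in lebesgue. x \<in> I \<longrightarrow> (dx1 ^^ j) (u s) x - (dx1 ^^ j) (u t) x = (dx1 ^^ j) (\<lambda>x. u s x - u t x) x"
      using weak_deriv_iterate_diff[OF sobolev_u[OF s] sobolev_u[OF t] j] by eventually_elim simp
    have L: "L2_on I (\<lambda>x. (dx1 ^^ j) (u s) x - (dx1 ^^ j) (u t) x)"
      using sqint_diff[OF sqint_iterate[OF s j] sqint_iterate[OF t j]] L2_on_iff_sqint[of I] by simp
    have "nrm N (\<lambda>x. (dx1 ^^ j) (u s) x - (dx1 ^^ j) (u t) x) = L2_norm_on I ((dx1 ^^ j) (\<lambda>x. u s x - u t x))"
      using L2_norm_on_cong_AE[OF L ae] L2_norm_on_eq_nrm[of I] by simp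
    also have "\<dots> \<le> sobolev_norm 4 I (\<lambda>x. u s x - u t x)"
      unfolding sobolev_norm_def by (rule real_le_rsqrt[OF L2_norm_iterate_le_sobolev[OF j]])
    finally show "nrm N (\<lambda>x. (dx1 ^^ j) (u s) x - (dx1 ^^ j) (u t) x) \<le> sobolev_norm 4 I (\<lambda>x. u s x - u t x)" .
  qed
qed

lemma nrm_cong_AE:
  assumes "f \<in> borel_measurable N" "g \<in> borel_measurable N" "AE x in lebesgue. x \<in> I \<longrightarrow> f x = g x"
  shows "nrm N f = nrm N (g :: real \<Rightarrow> real)"
proof -
  have "(LINT x|N. (f x)\<^sup>2) = (LINT x|N. (g x)\<^sup>2)"
  proof (rule integral_cong_AE)
    show "(\<lambda>x. (f x)\<^sup>2) \<in> borel_measurable N" "(\<lambda>x. (g x)\<^sup>2) \<in> borel_measurable N"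
      using assms(1,2) by measurable
    show "AE x in N. (f x)\<^sup>2 = (g x)\<^sup>2"
      unfolding AE_lebesgue_on_iff[of I, simplified] using assms(3) by eventually_elim simp
  qed
  then show ?thesis by (simp add: nrm_def)
qed

lemma sqint_v: "t \<in> J \<Longrightarrow> sqint N (u t)" "t \<in> J \<Longrightarrow> sqint N (v1 t)" "t \<in> J \<Longrightarrow> sqint N (v2 t)" "t \<in> J \<Longrightarrow> sqint N (v4 t)"
  using sqint_continuous_I[OF repD(4)] sqint_continuous_I[OF repD(5)] sqint_continuous_I[OF repD(6)] sqint_iterate[of t 4] by auto

lemma tendsto_v:
  assumes t: "t \<in> J"
  shows "((\<lambda>s. nrm N (\<lambda>x. u s x - u t x)) \<longlongrightarrow> 0) (at t within J)"
    "((\<lambda>s. nrm N (\<lambda>x. v1 s x - v1 t x)) \<longlongrightarrow> 0) (at t within J)"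
    "((\<lambda>s. nrm N (\<lambda>x. v2 s x - v2 t x)) \<longlongrightarrow> 0) (at t within J)"
    "((\<lambda>s. nrm N (\<lambda>x. v4 s x - v4 t x)) \<longlongrightarrow> 0) (at t within J)"
proof -
  have transfer: "((\<lambda>s. nrm N (\<lambda>x. b s x - b t x)) \<longlongrightarrow> 0) (at t within J)"
    if j: "j \<le> 4" and b: "\<And>s. s \<in> J \<Longrightarrow> sqint N (b s)" and ae: "\<And>s. s \<in> J \<Longrightarrow> AE x in lebesgue. x \<in> I \<longrightarrow> (dx1 ^^ j) (u s) x = b s x" for b j
  proof (rule Lim_transform_eventually[OF tendsto_iterate[OF t j]])
    show "\<forall>\<^sub>F s in at t within J. nrm N (\<lambda>x. (dx1 ^^ j) (u s) x - (dx1 ^^ j) (u t) x) = nrm N (\<lambda>x. b s x - b t x)"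
      unfolding eventually_at_filter
    proof (rule always_eventually, intro allI impI, rule nrm_cong_AE)
      fix s assume s: "s \<in> J"
      show "(\<lambda>x. (dx1 ^^ j) (u s) x - (dx1 ^^ j) (u t) x) \<in> borel_measurable N"
        by (rule sqint_measurable[OF sqint_diff[OF sqint_iterate[OF s j] sqint_iterate[OF t j]]])
      show "(\<lambda>x. b s x - b t x) \<in> borel_measurable N" by (rule sqint_measurable[OF sqint_diff[OF b[OF s] b[OF t]]])
      show "AE x in lebesgue. x \<in> I \<longrightarrow> (dx1 ^^ j) (u s) x - (dx1 ^^ j) (u t) x = b s x - b t x"
        using ae[OF s] ae[OF t] by eventually_elim simp
    qed
  qed
  show "((\<lambda>s. nrm N (\<lambda>x. u s x - u t x)) \<longlongrightarrow> 0) (at t within J)" using tendsto_iterate[OF t, of 0] by simp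
  show "((\<lambda>s. nrm N (\<lambda>x. v1 s x - v1 t x)) \<longlongrightarrow> 0) (at t within J)"
    by (rule transfer[of 1]) (use sqint_v(2) v1_ae in auto)
  show "((\<lambda>s. nrm N (\<lambda>x. v2 s x - v2 t x)) \<longlongrightarrow> 0) (at t within J)"
    by (rule transfer[of 2, OF _ sqint_v(3) v2_ae]) auto
  show "((\<lambda>s. nrm N (\<lambda>x. v4 s x - v4 t x)) \<longlongrightarrow> 0) (at t within J)" by (rule tendsto_iterate[OF t]) simp
qed

text \<open>The difference of two states is small in \<open>C\<^sup>1\<close>, with a bound by its \<open>H\<^sup>2\<close> norm.\<close>

definition gap :: "real \<Rightarrow> real \<Rightarrow> real" where
  "gap s t = 4 * nrm N (\<lambda>x. v2 s x - v2 t x)"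

lemma gap_tendsto: "t \<in> J \<Longrightarrow> ((\<lambda>s. gap s t) \<longlongrightarrow> 0) (at t within J)"
  unfolding gap_def using tendsto_mult_right_zero[OF tendsto_v(3)] .

lemma rep_diff:
  assumes s: "s \<in> J" and t: "t \<in> J"
  shows "H4_rep (\<lambda>x. u s x - u t x) (\<lambda>x. v1 s x - v1 t x) (\<lambda>x. v2 s x - v2 t x) (\<lambda>x. v3 s x - v3 t x) (\<lambda>x. v4 s x - v4 t x)"
    "H4_rep (\<lambda>x. u s x + u t x) (\<lambda>x. v1 s x + v1 t x) (\<lambda>x. v2 s x + v2 t x) (\<lambda>x. v3 s x + v3 t x) (\<lambda>x. v4 s x + v4 t x)"
  using H4_rep_add_cmult[OF rep[OF s] rep[OF t], of "-1"] H4_rep_add_cmult[OF rep[OF s] rep[OF t], of 1] by simp_all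

lemma gap_bound:
  assumes s: "s \<in> J" and t: "t \<in> J"
  shows "\<forall>x\<in>{-1..1}. \<bar>u s x - u t x\<bar> \<le> gap s t \<and> \<bar>v1 s x - v1 t x\<bar> \<le> gap s t"
proof
  note D = H4_repD[OF rep_diff(1)[OF s t]]
  let ?n = "nrm N (\<lambda>x. v2 s x - v2 t x)"
  have d1: "\<bar>v1 s x - v1 t x\<bar> \<le> sqrt 2 * ?n" if "x \<in> {-1..1}" for x
    by (rule sup_le_nrm_derivative[OF D(2) D(6) _ that]) (use ends[OF s] ends[OF t] in auto)
  fix x :: real assume x: "x \<in> {-1..1}"
  have "\<bar>u s x - u t x\<bar> \<le> sqrt 2 * nrm N (\<lambda>x. v1 s x - v1 t x)"
    by (rule sup_le_nrm_derivative[OF D(1) D(5) _ x]) (use ends[OF s] ends[OF t] in auto)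
  also have "nrm N (\<lambda>x. v1 s x - v1 t x) \<le> 2 * ?n"
  proof -
    have "(nrm N (\<lambda>x. v1 s x - v1 t x))\<^sup>2 = integral {-1..1} (\<lambda>x. (v1 s x - v1 t x)\<^sup>2)"
      unfolding nrm_square by (intro integral_lebesgue_on_I continuous_intros D(5))
    also have "\<dots> \<le> integral {-1..1} (\<lambda>x::real. (sqrt 2 * ?n)\<^sup>2)"
    proof (rule Henstock_Kurzweil_Integration.integral_le)
      show "(\<lambda>x. (v1 s x - v1 t x)\<^sup>2) integrable_on {-1..1}" by (intro integrable_continuous_interval continuous_intros D(5))
      show "(v1 s x - v1 t x)\<^sup>2 \<le> (sqrt 2 * ?n)\<^sup>2" if "x \<in> {-1..1}" for x
        using power_mono[OF d1[OF that], of 2] by simp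
    qed (rule integrable_const_ivl)
    also have "\<dots> = (2 * ?n)\<^sup>2" by (simp add: power_mult_distrib)
    finally show ?thesis by (rule power2_le_imp_le) (simp add: nrm_nonneg)
  qed
  then have "sqrt 2 * nrm N (\<lambda>x. v1 s x - v1 t x) \<le> sqrt 2 * (2 * ?n)" by (rule mult_left_mono) simp
  also have "\<dots> \<le> 2 * (2 * ?n)" by (rule mult_right_mono) (auto simp: nrm_nonneg sqrt_le_D real_le_lsqrt)
  finally have a: "\<bar>u s x - u t x\<bar> \<le> gap s t" unfolding gap_def by simp
  have "sqrt 2 * ?n \<le> 4 * ?n" by (rule mult_right_mono) (auto simp: nrm_nonneg real_le_lsqrt)
  then show "\<bar>u s x - u t x\<bar> \<le> gap s t \<and> \<bar>v1 s x - v1 t x\<bar> \<le> gap s t"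
    using a d1[OF x] unfolding gap_def by linarith
qed

lemma time_derivative:
  assumes t: "t \<in> J"
  shows "sqint N (ut t)" "((\<lambda>s. nrm N (\<lambda>x. (u s x - u t x) / (s - t) - ut t x)) \<longlongrightarrow> 0) (at t within J)"
    "((\<lambda>s. nrm N (\<lambda>x. ut s x - ut t x)) \<longlongrightarrow> 0) (at t within J)"
proof -
  have "\<exists>g. has_L2_time_deriv J u t g" using time_C1 t unfolding C1_L2_def by blast
  then have "has_L2_time_deriv J u t (ut t)" unfolding time_deriv_def by (rule someI_ex)
  then show "sqint N (ut t)" "((\<lambda>s. nrm N (\<lambda>x. (u s x - u t x) / (s - t) - ut t x)) \<longlongrightarrow> 0) (at t within J)"
    unfolding has_L2_time_deriv_def L2_on_iff_sqint[of I, simplified] L2_norm_on_eq_nrm[of I, simplified] by auto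
  show "((\<lambda>s. nrm N (\<lambda>x. ut s x - ut t x)) \<longlongrightarrow> 0) (at t within J)"
    using time_C1 t unfolding C1_L2_def L2_norm_on_eq_nrm[of I, simplified] by blast
qed

end

section \<open>Dissipation of the energy\<close>

lemma integral_product_I:
  assumes "sqint (lebesgue_on I) f" "sqint (lebesgue_on I) g"
  shows "integral {-1..1} (\<lambda>x. f x * g x) = (LINT x|lebesgue_on I. f x * g x)"
  using set_integral_I[of "\<lambda>x. f x * g x"] sqint_mult_integrable[OF assms]
  by (simp add: set_integral_lebesgue_on[of I, simplified])

context clamped_curve
begin

lemma eventually_near: "(\<And>s. s \<in> J \<Longrightarrow> s \<noteq> t \<Longrightarrow> P s) \<Longrightarrow> \<forall>\<^sub>F s in at t within J. P s"
  unfolding eventually_at_filter by (intro always_eventually) blast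

definition quot :: "real \<Rightarrow> real \<Rightarrow> real \<Rightarrow> real" where
  "quot s t x = (u s x - u t x) / (s - t)"

lemma sqint_quot: "s \<in> J \<Longrightarrow> t \<in> J \<Longrightarrow> sqint N (quot s t)"
  using sqint_cmult[OF sqint_diff[OF sqint_v(1) sqint_v(1)], of s t "1 / (s - t)"] by (simp add: quot_def[abs_def])

text \<open>Difference quotients of \<open>u\<close> may be replaced by the time derivative in integrals against
  convergent families.\<close>

lemma quot_tendsto:
  assumes t: "t \<in> J" and g: "\<And>s. s \<in> J \<Longrightarrow> sqint N (gn s)" "sqint N g"
    and lim: "((\<lambda>s. nrm N (\<lambda>x. gn s x - g x)) \<longlongrightarrow> 0) (at t within J)"
  shows "((\<lambda>s. LINT x|N. quot s t x * gn s x) \<longlongrightarrow> (LINT x|N. ut t x * g x)) (at t within J)"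
proof -
  have "((\<lambda>s. LINT x|N. 1 * (quot s t x * gn s x)) \<longlongrightarrow> (LINT x|N. 1 * (ut t x * g x))) (at t within J)"
  proof (rule tendsto_integral_product)
    show "\<forall>\<^sub>F s in at t within J. sqint N (quot s t)" "\<forall>\<^sub>F s in at t within J. sqint N (gn s)"
      using sqint_quot[OF _ t] g(1) by (auto intro: eventually_near)
    show "((\<lambda>s. nrm N (\<lambda>x. quot s t x - ut t x)) \<longlongrightarrow> 0) (at t within J)"
      using time_derivative(2)[OF t] by (simp add: quot_def)
  qed (use time_derivative(1)[OF t] g(2) lim in auto)
  then show ?thesis by simp
qed

text \<open>The difference of the squares is the product of difference and sum; partial integration moves both
  derivatives from the difference to the sum, so that only the difference quotient of \<open>u\<close>
  in \<open>L\<^sub>2\<close> is needed.\<close>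

lemma bending_derivative:
  assumes t: "t \<in> J"
  shows "((\<lambda>s. ((nrm N (v2 s))\<^sup>2 - (nrm N (v2 t))\<^sup>2) / (s - t)) \<longlongrightarrow> 2 * (LINT x|N. ut t x * v4 t x)) (at t within J)"
proof -
  have sq: "(nrm N (v2 s))\<^sup>2 = integral {-1..1} (\<lambda>x. (v2 s x)\<^sup>2)" if "s \<in> J" for s
    unfolding nrm_square by (intro integral_lebesgue_on_I continuous_intros repD(6) that)
  have e: "((nrm N (v2 s))\<^sup>2 - (nrm N (v2 t))\<^sup>2) / (s - t) = (LINT x|N. quot s t x * (v4 s x + v4 t x))"
    if s: "s \<in> J" for s
  proof -
    note D = H4_rep_parts[OF rep_diff[OF s t]]
    have "(nrm N (v2 s))\<^sup>2 - (nrm N (v2 t))\<^sup>2 = integral {-1..1} (\<lambda>x. (v2 s x)\<^sup>2 - (v2 t x)\<^sup>2)"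
      unfolding sq[OF s] sq[OF t]
      by (rule Henstock_Kurzweil_Integration.integral_diff[symmetric]; intro integrable_continuous_interval continuous_intros repD(6) s t)
    also have "\<dots> = integral {-1..1} (\<lambda>x. (v2 s x - v2 t x) * (v2 s x + v2 t x))"
      by (simp add: power2_eq_square algebra_simps)
    also have "\<dots> = integral {-1..1} (\<lambda>x. (u s x - u t x) * (v4 s x + v4 t x))"
      by (rule D(2)) (use ends[OF s] ends[OF t] in auto)
    also have "\<dots> = (LINT x|N. (u s x - u t x) * (v4 s x + v4 t x))"
      by (rule integral_product_I[OF sqint_diff[OF sqint_v(1)[OF s] sqint_v(1)[OF t]] sqint_add[OF sqint_v(4)[OF s] sqint_v(4)[OF t]]])
    finally show ?thesis by (simp add: quot_def)
  qed
  have "((\<lambda>s. LINT x|N. quot s t x * (v4 s x + v4 t x)) \<longlongrightarrow> (LINT x|N. ut t x * (v4 t x + v4 t x))) (at t within J)"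
    by (rule quot_tendsto[OF t sqint_add[OF sqint_v(4) sqint_v(4)[OF t]] sqint_add[OF sqint_v(4)[OF t] sqint_v(4)[OF t]]])
      (simp_all add: tendsto_v(4)[OF t])
  note lim = this
  have eq: "(LINT x|N. ut t x * (v4 t x + v4 t x)) = 2 * (LINT x|N. ut t x * v4 t x)"
    unfolding integral_mult_right_zero[symmetric] by (simp add: algebra_simps)
  have ev: "\<forall>\<^sub>F s in at t within J. (LINT x|N. quot s t x * (v4 s x + v4 t x)) = ((nrm N (v2 s))\<^sup>2 - (nrm N (v2 t))\<^sup>2) / (s - t)"
    by (rule eventually_near) (rule e[symmetric])
  show ?thesis using Lim_transform_eventually[OF lim ev] unfolding eq .
qed

lemma stretching_derivative:
  assumes t: "t \<in> J"
  shows "((\<lambda>s. ((nrm N (v1 s))\<^sup>2 - (nrm N (v1 t))\<^sup>2) / (s - t)) \<longlongrightarrow> - 2 * (LINT x|N. ut t x * v2 t x)) (at t within J)"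
proof -
  have sq: "(nrm N (v1 s))\<^sup>2 = integral {-1..1} (\<lambda>x. (v1 s x)\<^sup>2)" if "s \<in> J" for s
    unfolding nrm_square by (intro integral_lebesgue_on_I continuous_intros repD(5) that)
  have e: "((nrm N (v1 s))\<^sup>2 - (nrm N (v1 t))\<^sup>2) / (s - t) = - (LINT x|N. quot s t x * (v2 s x + v2 t x))"
    if s: "s \<in> J" for s
  proof -
    note D = H4_rep_parts[OF rep_diff[OF s t]]
    have "(nrm N (v1 s))\<^sup>2 - (nrm N (v1 t))\<^sup>2 = integral {-1..1} (\<lambda>x. (v1 s x)\<^sup>2 - (v1 t x)\<^sup>2)"
      unfolding sq[OF s] sq[OF t]
      by (rule Henstock_Kurzweil_Integration.integral_diff[symmetric]; intro integrable_continuous_interval continuous_intros repD(5) s t)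
    also have "\<dots> = integral {-1..1} (\<lambda>x. (v1 s x - v1 t x) * (v1 s x + v1 t x))"
      by (simp add: power2_eq_square algebra_simps)
    also have "\<dots> = - integral {-1..1} (\<lambda>x. (u s x - u t x) * (v2 s x + v2 t x))"
      by (rule D(1)) (use ends[OF s] ends[OF t] in auto)
    also have "integral {-1..1} (\<lambda>x. (u s x - u t x) * (v2 s x + v2 t x)) = (LINT x|N. (u s x - u t x) * (v2 s x + v2 t x))"
      by (rule integral_product_I[OF sqint_diff[OF sqint_v(1)[OF s] sqint_v(1)[OF t]] sqint_add[OF sqint_v(3)[OF s] sqint_v(3)[OF t]]])
    finally show ?thesis by (simp add: quot_def)
  qed
  have "((\<lambda>s. LINT x|N. quot s t x * (v2 s x + v2 t x)) \<longlongrightarrow> (LINT x|N. ut t x * (v2 t x + v2 t x))) (at t within J)"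
    by (rule quot_tendsto[OF t sqint_add[OF sqint_v(3) sqint_v(3)[OF t]] sqint_add[OF sqint_v(3)[OF t] sqint_v(3)[OF t]]])
      (simp_all add: tendsto_v(3)[OF t])
  then have "((\<lambda>s. - (LINT x|N. quot s t x * (v2 s x + v2 t x))) \<longlongrightarrow> - (LINT x|N. ut t x * (v2 t x + v2 t x))) (at t within J)"
    by (rule tendsto_minus)
  note lim = this
  have eq: "- (LINT x|N. ut t x * (v2 t x + v2 t x)) = - 2 * (LINT x|N. ut t x * v2 t x)"
    unfolding integral_mult_right_zero[symmetric] by (simp add: algebra_simps)
  have ev: "\<forall>\<^sub>F s in at t within J. - (LINT x|N. quot s t x * (v2 s x + v2 t x)) = ((nrm N (v1 s))\<^sup>2 - (nrm N (v1 t))\<^sup>2) / (s - t)"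
    by (rule eventually_near) (rule e[symmetric])
  show ?thesis using Lim_transform_eventually[OF lim ev] unfolding eq .
qed

text \<open>The interpolation \<open>\<parallel>d'\<parallel>\<^sup>2 \<le> \<parallel>d\<parallel>
  \<parallel>d''\<parallel>\<close>. The factor \<open>\<parallel>d\<parallel>\<close> is \<open>O (s
  - t)\<close> and the other one tends to zero.\<close>

lemma gap_quadratic:
  assumes s: "s \<in> J" and t: "t \<in> J"
  shows "integral {-1..1} (\<lambda>x. (u s x - u t x)\<^sup>2 + (v1 s x - v1 t x)\<^sup>2)
    \<le> nrm N (\<lambda>x. u s x - u t x) * (nrm N (\<lambda>x. u s x - u t x) + nrm N (\<lambda>x. v2 s x - v2 t x))"
proof -
  note D = H4_repD[OF rep_diff(1)[OF s t]]
  let ?d = "\<lambda>x. u s x - u t x" and ?d1 = "\<lambda>x. v1 s x - v1 t x" and ?d2 = "\<lambda>x. v2 s x - v2 t x"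
  have "integral {-1..1} (\<lambda>x. (?d x)\<^sup>2 + (?d1 x)\<^sup>2) = integral {-1..1} (\<lambda>x. (?d x)\<^sup>2) + integral {-1..1} (\<lambda>x. (?d1 x)\<^sup>2)"
    by (rule Henstock_Kurzweil_Integration.integral_add; intro integrable_continuous_interval continuous_on_power D(4,5))
  also have "integral {-1..1} (\<lambda>x. (?d x)\<^sup>2) = nrm N ?d * nrm N ?d"
    using integral_lebesgue_on_I[OF continuous_on_power[OF D(4), of 2]] unfolding power2_eq_square[symmetric] nrm_square by simp
  also have "integral {-1..1} (\<lambda>x. (?d1 x)\<^sup>2) = - integral {-1..1} (\<lambda>x. ?d x * ?d2 x)"
    unfolding power2_eq_square
    by (rule integral_by_parts_I[OF D(1,2,5,6)]) (use ends[OF s] ends[OF t] in auto)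
  also have "\<dots> = - (LINT x|N. ?d x * ?d2 x)"
    unfolding integral_product_I[OF sqint_diff[OF sqint_v(1)[OF s] sqint_v(1)[OF t]] sqint_diff[OF sqint_v(3)[OF s] sqint_v(3)[OF t]]] ..
  also have "\<dots> \<le> nrm N ?d * nrm N ?d2"
    using Cauchy_Schwarz_integral[OF sqint_diff[OF sqint_v(1)[OF s] sqint_v(1)[OF t]] sqint_diff[OF sqint_v(3)[OF s] sqint_v(3)[OF t]]]
    by linarith
  finally show ?thesis by (simp add: algebra_simps)
qed

lemma electrostatic_continuous:
  assumes \<epsilon>: "\<epsilon> > 0" and \<psi>: "\<And>s. s \<in> J \<Longrightarrow> is_potential \<epsilon> (u s) (\<psi> s)" and t: "t \<in> J"
  shows "((\<lambda>s. energy_electrostatic \<epsilon> (u s)) \<longlongrightarrow> energy_electrostatic \<epsilon> (u t)) (at t within J)"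
proof -
  let ?E = "\<lambda>s. energy_electrostatic \<epsilon> (u s)"
  obtain fx fz fxx fxz fzz where f: "classical_potential \<epsilon> (u t) (\<psi> t) fx fz fxx fxz fzz"
    using potential_classical[OF \<epsilon> profile_u[OF t] \<psi>[OF t]] by (elim exE conjE) (rule that)
  obtain C where C: "C \<ge> 0" and dep: "\<forall>w w1 h hx hz hxx hxz hzz \<delta>. profile w w1 \<longrightarrow> \<delta> \<le> 1 \<longrightarrow> C * \<delta> \<le> 1/2 \<longrightarrow>
    (\<forall>x\<in>{-1..1}. \<bar>w x - u t x\<bar> \<le> \<delta> \<and> \<bar>w1 x - v1 t x\<bar> \<le> \<delta>) \<longrightarrow> classical_potential \<epsilon> w h hx hz hxx hxz hzz \<longrightarrow>
    \<bar>dirichlet \<epsilon> w hx hz - dirichlet \<epsilon> (u t) fx fz\<bar> \<le> C * \<delta>"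
    using dirichlet_continuous_dependence[OF \<epsilon> profile_u[OF t] f] by (elim exE conjE) (rule that)
  have est: "\<bar>?E s - ?E t\<bar> \<le> C * gap s t" if s: "s \<in> J" and small: "gap s t \<le> 1" "C * gap s t \<le> 1/2" for s
  proof -
    obtain hx hz hxx hxz hzz where h: "classical_potential \<epsilon> (u s) (\<psi> s) hx hz hxx hxz hzz"
      using potential_classical[OF \<epsilon> profile_u[OF s] \<psi>[OF s]] by (elim exE conjE) (rule that)
    have "\<bar>dirichlet \<epsilon> (u s) hx hz - dirichlet \<epsilon> (u t) fx fz\<bar> \<le> C * gap s t"
      using dep[THEN spec, THEN spec, THEN spec, THEN spec, THEN spec, THEN spec, THEN spec, THEN spec, THEN spec,
          THEN mp, THEN mp, THEN mp, THEN mp, THEN mp, OF profile_u[OF s] small gap_bound[OF s t] h] .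
    then show ?thesis
      unfolding electrostatic_energy_dirichlet[OF \<epsilon> profile_u[OF s] \<psi>[OF s] h] electrostatic_energy_dirichlet[OF \<epsilon> profile_u[OF t] \<psi>[OF t] f] .
  qed
  have lim: "((\<lambda>s. C * gap s t) \<longlongrightarrow> 0) (at t within J)" by (rule tendsto_mult_right_zero[OF gap_tendsto[OF t]])
  have ev1: "\<forall>\<^sub>F s in at t within J. gap s t < 1" by (rule order_tendstoD(2)[OF gap_tendsto[OF t]]) simp
  have ev2: "\<forall>\<^sub>F s in at t within J. C * gap s t < 1/2" by (rule order_tendstoD(2)[OF lim]) simp
  have evJ: "\<forall>\<^sub>F s in at t within J. s \<in> J" by (rule eventually_near)
  have "\<forall>\<^sub>F s in at t within J. norm (?E s - ?E t) \<le> C * gap s t"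
    using ev1 ev2 evJ
  proof eventually_elim
    case (elim s)
    then show ?case using est[OF elim(3)] by simp
  qed
  from Lim_null_comparison[OF this lim] show ?thesis by (rule LIM_zero_cancel)
qed

lemma electrostatic_derivative:
  assumes \<epsilon>: "\<epsilon> > 0" and \<psi>: "\<And>s. s \<in> J \<Longrightarrow> is_potential \<epsilon> (u s) (\<psi> s)" and t: "t \<in> J"
    and gx: "has_graph_trace (u t) (dx (u t) (\<psi> t)) gx" and gz: "has_graph_trace (u t) (dz (u t) (\<psi> t)) gz"
    and L: "sqint N (\<lambda>x. \<epsilon>\<^sup>2 * (gx x)\<^sup>2 + (gz x)\<^sup>2)"
  shows "((\<lambda>s. (energy_electrostatic \<epsilon> (u s) - energy_electrostatic \<epsilon> (u t)) / (s - t)) \<longlongrightarrow>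
    - (LINT x|N. ut t x * (\<epsilon>\<^sup>2 * (gx x)\<^sup>2 + (gz x)\<^sup>2))) (at t within J)"
proof -
  let ?E = "\<lambda>s. energy_electrostatic \<epsilon> (u s)" and ?g = "\<lambda>x. \<epsilon>\<^sup>2 * (gx x)\<^sup>2 + (gz x)\<^sup>2"
  obtain fx fz fxx fxz fzz where f: "classical_potential \<epsilon> (u t) (\<psi> t) fx fz fxx fxz fzz"
    and fae: "AE q in lebesgue. q \<in> Omega (u t) \<longrightarrow> dx (u t) (\<psi> t) q = fx q" "AE q in lebesgue. q \<in> Omega (u t) \<longrightarrow> dz (u t) (\<psi> t) q = fz q"
    using potential_classical[OF \<epsilon> profile_u[OF t] \<psi>[OF t]] by (elim exE conjE) (rule that)
  note F = classical_potentialD[OF f profile_u[OF t]]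
  note tx = graph_trace_traced[OF profile_u[OF t] gx F(2) fae(1)] and tz = graph_trace_traced[OF profile_u[OF t] gz F(3) fae(2)]
  obtain C where C: "C \<ge> 0" and expansion: "\<forall>w w1 h hx hz hxx hxz hzz. profile w w1 \<longrightarrow> w (-1) = u t (-1) \<longrightarrow> w 1 = u t 1 \<longrightarrow>
    (\<forall>x\<in>{-1..1}. C * \<bar>w x - u t x\<bar> \<le> 1/2) \<longrightarrow> classical_potential \<epsilon> w h hx hz hxx hxz hzz \<longrightarrow>
    \<bar>dirichlet \<epsilon> w hx hz - dirichlet \<epsilon> (u t) fx fz
       + (LINT x|lebesgue_on I. (w x - u t x) * (\<epsilon>\<^sup>2 * (gx x)\<^sup>2 + (gz x)\<^sup>2))\<bar>
     \<le> C * integral {-1..1} (\<lambda>x. (w x - u t x)\<^sup>2 + (w1 x - v1 t x)\<^sup>2)"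
    using dirichlet_quadratic_expansion[OF \<epsilon> profile_u[OF t] f tx tz] by (elim exE conjE) (rule that)
  let ?n = "\<lambda>s. nrm N (\<lambda>x. u s x - u t x)" and ?n2 = "\<lambda>s. nrm N (\<lambda>x. v2 s x - v2 t x)"
  let ?q = "\<lambda>s. LINT x|N. quot s t x * ?g x" and ?r = "\<lambda>s. nrm N (\<lambda>x. quot s t x - ut t x) + nrm N (ut t)"
  have est: "norm ((?E s - ?E t) / (s - t) + ?q s) \<le> C * ?r s * (?n s + ?n2 s)"
    if s: "s \<in> J" "s \<noteq> t" and small: "C * gap s t \<le> 1/2" for s
  proof -
    obtain hx hz hxx hxz hzz where h: "classical_potential \<epsilon> (u s) (\<psi> s) hx hz hxx hxz hzz"
      using potential_classical[OF \<epsilon> profile_u[OF s(1)] \<psi>[OF s(1)]] by (elim exE conjE) (rule that)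
    have ends': "u s (-1) = u t (-1)" "u s 1 = u t 1" using ends[OF s(1)] ends[OF t] by auto
    have sm: "\<forall>x\<in>{-1..1}. C * \<bar>u s x - u t x\<bar> \<le> 1/2"
    proof
      fix x :: real assume "x \<in> {-1..1}"
      then have "\<bar>u s x - u t x\<bar> \<le> gap s t" using gap_bound[OF s(1) t] by blast
      from mult_left_mono[OF this C] show "C * \<bar>u s x - u t x\<bar> \<le> 1/2" using small by linarith
    qed
    have "\<bar>?E s - ?E t + (LINT x|N. (u s x - u t x) * ?g x)\<bar>
       \<le> C * integral {-1..1} (\<lambda>x. (u s x - u t x)\<^sup>2 + (v1 s x - v1 t x)\<^sup>2)"
      unfolding electrostatic_energy_dirichlet[OF \<epsilon> profile_u[OF s(1)] \<psi>[OF s(1)] h] electrostatic_energy_dirichlet[OF \<epsilon> profile_u[OF t] \<psi>[OF t] f]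
      using expansion[THEN spec, THEN spec, THEN spec, THEN spec, THEN spec, THEN spec, THEN spec, THEN spec,
          THEN mp, THEN mp, THEN mp, THEN mp, THEN mp, OF profile_u[OF s(1)] ends' sm h] .
    also have "\<dots> \<le> C * (?n s * (?n s + ?n2 s))" by (rule mult_left_mono[OF gap_quadratic[OF s(1) t] C])
    finally have main: "\<bar>?E s - ?E t + (LINT x|N. (u s x - u t x) * ?g x)\<bar> \<le> C * (?n s * (?n s + ?n2 s))" .
    have st: "\<bar>s - t\<bar> > 0" using s(2) by simp
    have q: "(\<lambda>x. u s x - u t x) = (\<lambda>x. (s - t) * quot s t x)" using s(2) by (simp add: quot_def fun_eq_iff)
    have nq: "?n s = \<bar>s - t\<bar> * nrm N (quot s t)" unfolding q nrm_cmult ..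
    have gi: "(LINT x|N. (u s x - u t x) * ?g x) = (s - t) * ?q s"
      unfolding integral_mult_right_zero[symmetric] using s(2) by (simp add: quot_def)
    have "(?E s - ?E t) / (s - t) + ?q s = (?E s - ?E t + (LINT x|N. (u s x - u t x) * ?g x)) / (s - t)"
      unfolding gi using s(2) by (simp add: add_divide_distrib)
    then have "norm ((?E s - ?E t) / (s - t) + ?q s) = \<bar>?E s - ?E t + (LINT x|N. (u s x - u t x) * ?g x)\<bar> / \<bar>s - t\<bar>"
      by (simp only: real_norm_def abs_divide)
    also have "\<dots> \<le> (C * (?n s * (?n s + ?n2 s))) / \<bar>s - t\<bar>" by (rule divide_right_mono[OF main]) simp
    also have "\<dots> = C * nrm N (quot s t) * (?n s + ?n2 s)"
    proof -
      have "(C * ((a * b) * c)) / a = C * b * c" if "a > 0" for a b c :: real using that by simp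
      from this[OF st, of "nrm N (quot s t)" "?n s + ?n2 s"] show ?thesis unfolding nq[symmetric] .
    qed
    also have "\<dots> \<le> C * ?r s * (?n s + ?n2 s)"
    proof (intro mult_right_mono mult_left_mono C)
      show "nrm N (quot s t) \<le> ?r s"
        using nrm_triangle[OF sqint_diff[OF sqint_quot[OF s(1) t] time_derivative(1)[OF t]] time_derivative(1)[OF t]] by simp
      show "0 \<le> ?n s + ?n2 s" by (intro add_nonneg_nonneg nrm_nonneg)
    qed
    finally show ?thesis .
  qed
  have lim_r: "((\<lambda>s. C * ?r s * (?n s + ?n2 s)) \<longlongrightarrow> C * (0 + nrm N (ut t)) * (0 + 0)) (at t within J)"
    using time_derivative(2)[OF t] unfolding quot_def[symmetric]
    by (intro tendsto_intros tendsto_v(1,3)[OF t])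
  have "\<forall>\<^sub>F s in at t within J. C * gap s t < 1/2"
    by (rule order_tendstoD(2)[OF tendsto_mult_right_zero[OF gap_tendsto[OF t]]]) simp
  moreover have "\<forall>\<^sub>F s in at t within J. s \<in> J \<and> s \<noteq> t" by (rule eventually_near) blast
  ultimately have ev: "\<forall>\<^sub>F s in at t within J. norm ((?E s - ?E t) / (s - t) + ?q s) \<le> C * ?r s * (?n s + ?n2 s)"
  proof eventually_elim
    case (elim s)
    then show ?case using est[of s] by simp
  qed
  have "((\<lambda>s. (?E s - ?E t) / (s - t) + ?q s) \<longlongrightarrow> 0) (at t within J)"
    by (rule Lim_null_comparison[OF ev]) (use lim_r in simp)
  moreover have "(?q \<longlongrightarrow> (LINT x|N. ut t x * ?g x)) (at t within J)"
    by (rule quot_tendsto[OF t, of "\<lambda>_. ?g"]) (use L in \<open>auto simp: nrm_def\<close>)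
  ultimately have "((\<lambda>s. ((?E s - ?E t) / (s - t) + ?q s) - ?q s) \<longlongrightarrow> 0 - (LINT x|N. ut t x * ?g x)) (at t within J)"
    by (rule tendsto_diff)
  then show ?thesis by simp
qed

lemma nrm_tendsto:
  assumes "\<And>s. s \<in> J \<Longrightarrow> sqint N (b s)" "t \<in> J" "((\<lambda>s. nrm N (\<lambda>x. b s x - b t x)) \<longlongrightarrow> 0) (at t within J)"
  shows "((\<lambda>s. (nrm N (b s))\<^sup>2) \<longlongrightarrow> (nrm N (b t))\<^sup>2) (at t within J)"
proof -
  have ev: "\<forall>\<^sub>F s in at t within J. sqint N (b s)" by (rule eventually_near) (rule assms(1))
  have "((\<lambda>s. LINT x|N. 1 * (b s x * b s x)) \<longlongrightarrow> (LINT x|N. 1 * (b t x * b t x))) (at t within J)"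
    by (rule tendsto_integral_product[OF ev assms(1)[OF assms(2)] ev assms(1)[OF assms(2)] assms(3,3)]) auto
  then show ?thesis unfolding nrm_square by (simp add: power2_eq_square)
qed

lemma energy_nrm:
  assumes t: "t \<in> J"
  shows "energy \<epsilon> \<beta> \<tau> lam (u t) = \<beta> / 2 * (nrm N (v2 t))\<^sup>2 + \<tau> / 2 * (nrm N (v1 t))\<^sup>2 - lam * energy_electrostatic \<epsilon> (u t)"
proof -
  have "L2_norm_on I ((dx1 ^^ 2) (u t)) = nrm N (v2 t)"
    unfolding L2_norm_on_eq_nrm[of I, simplified]
    by (rule nrm_cong_AE[OF sqint_measurable[OF sqint_iterate[OF t]] sqint_measurable[OF sqint_v(3)[OF t]] v2_ae[OF t]]) simp
  moreover have "L2_norm_on I (dx1 (u t)) = nrm N (v1 t)"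
    unfolding L2_norm_on_eq_nrm[of I, simplified]
    by (rule nrm_cong_AE[OF _ sqint_measurable[OF sqint_v(2)[OF t]] v1_ae[OF t]])
      (use sqint_measurable[OF sqint_iterate[OF t, of 1]] in simp)
  ultimately show ?thesis by (simp add: energy_def energy_bending_def energy_stretching_def)
qed

lemma energy_continuous:
  assumes \<epsilon>: "\<epsilon> > 0" and \<psi>: "\<And>s. s \<in> J \<Longrightarrow> is_potential \<epsilon> (u s) (\<psi> s)"
  shows "continuous_on J (\<lambda>s. energy \<epsilon> \<beta> \<tau> lam (u s))"
  unfolding continuous_on_def
proof
  fix t assume t: "t \<in> J"
  have "((\<lambda>s. \<beta> / 2 * (nrm N (v2 s))\<^sup>2 + \<tau> / 2 * (nrm N (v1 s))\<^sup>2 - lam * energy_electrostatic \<epsilon> (u s)) \<longlongrightarrow>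
    energy \<epsilon> \<beta> \<tau> lam (u t)) (at t within J)"
    unfolding energy_nrm[OF t]
    by (intro tendsto_add tendsto_diff tendsto_mult tendsto_const electrostatic_continuous[OF \<epsilon> \<psi> t]
        nrm_tendsto[OF sqint_v(3) t tendsto_v(3)[OF t]] nrm_tendsto[OF sqint_v(2) t tendsto_v(2)[OF t]])
  then show "((\<lambda>s. energy \<epsilon> \<beta> \<tau> lam (u s)) \<longlongrightarrow> energy \<epsilon> \<beta> \<tau> lam (u t)) (at t within J)"
    by (rule Lim_transform_eventually) (rule eventually_near, simp add: energy_nrm)
qed

text \<open>The equation expresses the density on the graph through \<open>ut\<close>, \<open>v4\<close> and
  \<open>v2\<close>, which makes it square integrable and lets the elastic contributions cancel.\<close>

lemma energy_derivative:
  assumes \<epsilon>: "\<epsilon> > 0" and lam: "lam > 0" and \<psi>: "\<And>s. s \<in> J \<Longrightarrow> is_potential \<epsilon> (u s) (\<psi> s)" and t: "t \<in> J"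
    and gx: "has_graph_trace (u t) (dx (u t) (\<psi> t)) gx" and gz: "has_graph_trace (u t) (dz (u t) (\<psi> t)) gz"
    and pde: "AE x in lebesgue. x \<in> I \<longrightarrow> ut t x + \<beta> * v4 t x - \<tau> * (dx1 ^^ 2) (u t) x = - lam * (\<epsilon>\<^sup>2 * (gx x)\<^sup>2 + (gz x)\<^sup>2)"
  shows "((\<lambda>s. energy \<epsilon> \<beta> \<tau> lam (u s)) has_real_derivative - (nrm N (ut t))\<^sup>2) (at t within J)"
proof -
  let ?g = "\<lambda>x. \<epsilon>\<^sup>2 * (gx x)\<^sup>2 + (gz x)\<^sup>2" and ?E = "\<lambda>s. energy_electrostatic \<epsilon> (u s)"
  \<comment> \<open>the density on the graph as given by the equation\<close>
  define G where "G x = (- 1 / lam) * (ut t x + \<beta> * v4 t x + (- \<tau>) * v2 t x)" for x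
  have Gg: "AE x in lebesgue. x \<in> I \<longrightarrow> G x = ?g x"
    using pde v2_ae[OF t]
  proof eventually_elim
    case (elim x)
    show ?case
    proof
      assume x: "x \<in> I"
      have "ut t x + \<beta> * v4 t x + (- \<tau>) * v2 t x = - lam * ?g x" using elim x by simp
      then show "G x = ?g x" unfolding G_def using lam by simp
    qed
  qed
  have LG: "sqint N G"
    unfolding G_def[abs_def] by (intro sqint_cmult sqint_add time_derivative(1) sqint_v t)
  have Lg: "sqint N ?g"
    using L2_on_cong_AE[OF _ Gg] LG L2_on_iff_sqint[of I] by simp
  have "(LINT x|N. ut t x * ?g x) = (LINT x|N. ut t x * G x)"
  proof (rule integral_cong_AE)
    show "(\<lambda>x. ut t x * ?g x) \<in> borel_measurable N" "(\<lambda>x. ut t x * G x) \<in> borel_measurable N"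
      by (intro borel_measurable_times sqint_measurable Lg LG time_derivative(1) t)+
    show "AE x in N. ut t x * ?g x = ut t x * G x"
      unfolding AE_lebesgue_on_iff[of I, simplified] using Gg by eventually_elim simp
  qed
  also have "\<dots> = (LINT x|N. (- 1 / lam) * ((ut t x * ut t x + \<beta> * (ut t x * v4 t x)) + (- \<tau>) * (ut t x * v2 t x)))"
    by (rule Bochner_Integration.integral_cong) (simp_all add: G_def algebra_simps)
  also have "\<dots> = (- 1 / lam) * (((LINT x|N. ut t x * ut t x) + \<beta> * (LINT x|N. ut t x * v4 t x)) + (- \<tau>) * (LINT x|N. ut t x * v2 t x))"
  proof -
    note i = sqint_mult_integrable[OF time_derivative(1)[OF t] time_derivative(1)[OF t]]
      sqint_mult_integrable[OF time_derivative(1)[OF t] sqint_v(4)[OF t]] sqint_mult_integrable[OF time_derivative(1)[OF t] sqint_v(3)[OF t]]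
    show ?thesis
      unfolding integral_mult_right_zero
        Bochner_Integration.integral_add[OF Bochner_Integration.integrable_add[OF i(1) integrable_mult_right[OF i(2)]] integrable_mult_right[OF i(3)]]
        Bochner_Integration.integral_add[OF i(1) integrable_mult_right[OF i(2)]] ..
  qed
  finally have gI: "(LINT x|N. ut t x * ?g x) = (- 1 / lam) * (((LINT x|N. ut t x * ut t x) + \<beta> * (LINT x|N. ut t x * v4 t x)) + (- \<tau>) * (LINT x|N. ut t x * v2 t x))" .
  have slope: "\<beta> / 2 * (2 * (LINT x|N. ut t x * v4 t x)) + \<tau> / 2 * (- 2 * (LINT x|N. ut t x * v2 t x)) - lam * (- (LINT x|N. ut t x * ?g x))
    = - (nrm N (ut t))\<^sup>2"
    unfolding gI nrm_square using lam by (simp add: power2_eq_square algebra_simps)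
  have "((\<lambda>s. \<beta> / 2 * (((nrm N (v2 s))\<^sup>2 - (nrm N (v2 t))\<^sup>2) / (s - t)) + \<tau> / 2 * (((nrm N (v1 s))\<^sup>2 - (nrm N (v1 t))\<^sup>2) / (s - t))
      - lam * ((?E s - ?E t) / (s - t))) \<longlongrightarrow> - (nrm N (ut t))\<^sup>2) (at t within J)"
    unfolding slope[symmetric]
    by (intro tendsto_add tendsto_diff tendsto_mult tendsto_const bending_derivative[OF t] stretching_derivative[OF t]
        electrostatic_derivative[OF \<epsilon> \<psi> t gx gz Lg])
  then have "((\<lambda>s. (energy \<epsilon> \<beta> \<tau> lam (u s) - energy \<epsilon> \<beta> \<tau> lam (u t)) / (s - t)) \<longlongrightarrow> - (nrm N (ut t))\<^sup>2) (at t within J)"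
  proof (rule Lim_transform_eventually)
    show "\<forall>\<^sub>F s in at t within J. \<beta> / 2 * (((nrm N (v2 s))\<^sup>2 - (nrm N (v2 t))\<^sup>2) / (s - t)) + \<tau> / 2 * (((nrm N (v1 s))\<^sup>2 - (nrm N (v1 t))\<^sup>2) / (s - t))
      - lam * ((?E s - ?E t) / (s - t)) = (energy \<epsilon> \<beta> \<tau> lam (u s) - energy \<epsilon> \<beta> \<tau> lam (u t)) / (s - t)"
    proof (rule eventually_near)
      fix s assume s: "s \<in> J" "s \<noteq> t"
      have combine: "b * ((p - p') / k) + c * ((q - q') / k) - l * ((r - r') / k) = ((b * p + c * q - l * r) - (b * p' + c * q' - l * r')) / k"
        if "k \<noteq> 0" for b c l p p' q q' r r' k :: real
        using that by (simp add: field_simps)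
      show "\<beta> / 2 * (((nrm N (v2 s))\<^sup>2 - (nrm N (v2 t))\<^sup>2) / (s - t)) + \<tau> / 2 * (((nrm N (v1 s))\<^sup>2 - (nrm N (v1 t))\<^sup>2) / (s - t))
      - lam * ((?E s - ?E t) / (s - t)) = (energy \<epsilon> \<beta> \<tau> lam (u s) - energy \<epsilon> \<beta> \<tau> lam (u t)) / (s - t)"
        unfolding energy_nrm[OF s(1)] energy_nrm[OF t] by (rule combine) (use s(2) in simp)
    qed
  qed
  then show ?thesis unfolding has_field_derivative_iff .
qed

lemma dissipation_continuous: "continuous_on J (\<lambda>s. (L2_norm_on I (ut s))\<^sup>2)"
  unfolding continuous_on_def L2_norm_on_eq_nrm[of I, simplified]
  by (intro ballI nrm_tendsto time_derivative)

end

lemma weak_deriv_cong: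
  assumes "\<And>x. x \<in> S \<Longrightarrow> f x = g x"
  shows "weak_deriv S e f = weak_deriv S e g"
proof -
  have ae: "AE x in lebesgue. x \<in> S \<longrightarrow> f x = g x" "AE x in lebesgue. x \<in> S \<longrightarrow> g x = f x"
    by (rule AE_I2, simp add: assms)+
  have "has_weak_deriv S e f = has_weak_deriv S e g"
    by (rule ext, rule iffI; erule has_weak_deriv_cong_AE) (use ae in auto)
  then show ?thesis by (simp add: weak_deriv_def)
qed

text \<open>Profiles are compared on the closed interval only; weak derivatives do not see values outside
  \<open>I\<close>.\<close>

lemma energy_cong:
  assumes v: "continuous_on {-1..1} v" and e: "\<And>x. x \<in> {-1..1} \<Longrightarrow> v x = w x"
  shows "energy \<epsilon> \<beta> \<tau> lam v = energy \<epsilon> \<beta> \<tau> lam w"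
proof -
  have d: "dx1 v = dx1 w" by (rule weak_deriv_cong) (simp add: e)
  have O: "Omega v = Omega w" using e by (auto simp: Omega_def)
  have "fst q \<in> {-1..1}" if "q \<in> frontier (Omega w)" for q
    using that closure_Omega[OF v] unfolding O frontier_def by (auto simp: closed_Omega_def)
  then have fr: "(\<forall>(x, z)\<in>frontier (Omega w). \<psi> (x, z) = (1 + z) / (1 + v x)) \<longleftrightarrow>
      (\<forall>(x, z)\<in>frontier (Omega w). \<psi> (x, z) = (1 + z) / (1 + w x))" for \<psi> :: "real \<times> real \<Rightarrow> real"
    using e by fastforce
  have "is_potential \<epsilon> v = is_potential \<epsilon> w"
    by (rule ext) (simp only: is_potential_def dx_def dz_def O fr)
  then have "potential \<epsilon> v = potential \<epsilon> w" by (simp add: potential_def)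
  then show ?thesis
    unfolding energy_def energy_bending_def energy_stretching_def energy_electrostatic_def dx_def dz_def O
    by (simp add: numeral_2_eq_2 d)
qed

theorem proposition1p3:
  fixes \<epsilon> \<beta> \<tau> lam :: real
    and u0 :: "real \<Rightarrow> real"
    and Tm :: ereal
    and u :: "real \<Rightarrow> real \<Rightarrow> real"
    and \<psi> :: "real \<Rightarrow> real \<times> real \<Rightarrow> real"
  assumes "\<epsilon> > 0" and "\<beta> > 0" and "\<tau> \<ge> 0" and "lam > 0"
    and "H4 u0" and "clamped u0" and "\<forall>x\<in>I. u0 x > -1"
    and "maximal_solution \<epsilon> \<beta> \<tau> lam u0 Tm u \<psi>"
  shows "\<forall>t\<in>time_interval Tm.
    energy \<epsilon> \<beta> \<tau> lam (u t)
      + (LINT s:{0..t}|lebesgue. (L2_norm_on I (time_deriv (time_interval Tm) u s))\<^sup>2)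
    = energy \<epsilon> \<beta> \<tau> lam u0"
proof
  let ?J = "time_interval Tm"
  have sol: "solution \<epsilon> \<beta> \<tau> lam u0 Tm u \<psi>" using assms(8) unfolding maximal_solution_def by blast
  have C: "C1_L2 ?J u" "C_H4 ?J u" and pos: "\<forall>t\<in>?J. \<forall>x\<in>I. u t x > -1"
    and \<psi>: "\<forall>t\<in>?J. is_potential \<epsilon> (u t) (\<psi> t)" and init: "\<forall>x\<in>{-1..1}. u 0 x = u0 x" and T0: "0 < Tm"
    and evo: "\<forall>t\<in>?J. t > 0 \<longrightarrow> clamped (u t) \<and> (\<exists>gx gz.
           has_graph_trace (u t) (dx (u t) (\<psi> t)) gx \<and> has_graph_trace (u t) (dz (u t) (\<psi> t)) gz \<and>
           (AE x in lebesgue. x \<in> I \<longrightarrow> time_deriv ?J u t x + \<beta> * (dx1 ^^ 4) (u t) x - \<tau> * (dx1 ^^ 2) (u t) x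
                = - lam * (\<epsilon>\<^sup>2 * (gx x)\<^sup>2 + (gz x)\<^sup>2)))"
    using sol[unfolded solution_def] by - (elim conjE, assumption)+
  have J0: "0 \<in> ?J" using T0 by (simp add: time_interval_def zero_ereal_def)
  \<comment> \<open>at time zero the boundary conditions are inherited from the initial state\<close>
  have clamped: "clamped (u t)" if t: "t \<in> ?J" for t
  proof (cases "t > 0")
    case True
    then show ?thesis using evo t by blast
  next
    case False
    then have "t = 0" using t by (simp add: time_interval_def)
    have "(u 0 has_real_derivative 0) (at x within {-1..1})" if "(u0 has_real_derivative 0) (at x within {-1..1})" "x \<in> {-1..1}" for x
      by (rule has_field_derivative_transform_within[OF that(1) zero_less_one that(2)]) (use init in auto)
    then show ?thesis using assms(6) init unfolding \<open>t = 0\<close> clamped_def by auto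
  qed
  have "\<forall>t\<in>?J. \<exists>v1 v2 v3. H4_rep (u t) v1 v2 v3 ((dx1 ^^ 4) (u t)) \<and>
    (AE x in lebesgue. x \<in> I \<longrightarrow> dx1 (u t) x = v1 x) \<and> (AE x in lebesgue. x \<in> I \<longrightarrow> (dx1 ^^ 2) (u t) x = v2 x)"
    using C(2) unfolding C_H4_def by (blast intro: H4_rep_exists)
  from bchoice[OF this] obtain v1 where "\<forall>t\<in>?J. \<exists>v2 v3. H4_rep (u t) (v1 t) v2 v3 ((dx1 ^^ 4) (u t)) \<and>
    (AE x in lebesgue. x \<in> I \<longrightarrow> dx1 (u t) x = v1 t x) \<and> (AE x in lebesgue. x \<in> I \<longrightarrow> (dx1 ^^ 2) (u t) x = v2 x)" ..
  from bchoice[OF this] obtain v2 where "\<forall>t\<in>?J. \<exists>v3. H4_rep (u t) (v1 t) (v2 t) v3 ((dx1 ^^ 4) (u t)) \<and>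
    (AE x in lebesgue. x \<in> I \<longrightarrow> dx1 (u t) x = v1 t x) \<and> (AE x in lebesgue. x \<in> I \<longrightarrow> (dx1 ^^ 2) (u t) x = v2 t x)" ..
  from bchoice[OF this] obtain v3 where reps: "\<forall>t\<in>?J. H4_rep (u t) (v1 t) (v2 t) (v3 t) ((dx1 ^^ 4) (u t)) \<and>
    (AE x in lebesgue. x \<in> I \<longrightarrow> dx1 (u t) x = v1 t x) \<and> (AE x in lebesgue. x \<in> I \<longrightarrow> (dx1 ^^ 2) (u t) x = v2 t x)" ..
  interpret clamped_curve ?J u v1 v2 v3
  proof
    fix t assume t: "t \<in> ?J"
    show r: "H4_rep (u t) (v1 t) (v2 t) (v3 t) ((dx1 ^^ 4) (u t))" "AE x in lebesgue. x \<in> I \<longrightarrow> dx1 (u t) x = v1 t x"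
      "AE x in lebesgue. x \<in> I \<longrightarrow> (dx1 ^^ 2) (u t) x = v2 t x"
      using reps t by blast+
    have "u t x = 0 \<and> v1 t x = 0" if x: "x \<in> {-1, 1}" for x
    proof -
      have c: "u t x = 0" "(u t has_real_derivative 0) (at x within {-1..1})" using clamped[OF t] x unfolding clamped_def by auto
      have xI: "x \<in> {-1..1}" using x by auto
      show ?thesis using c(1) has_real_derivative_within_I_unique[OF H4_repD(1)[OF r(1) xI] c(2) xI] by blast
    qed
    then show "u t (-1) = 0 \<and> u t 1 = 0 \<and> v1 t (-1) = 0 \<and> v1 t 1 = 0" by simp
    show "u t x > -1" if "x \<in> I" for x using pos t that by blast
  qed (rule C)+
  fix t assume t: "t \<in> ?J"
  have t0: "0 \<le> t" using t by (simp add: time_interval_def)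
  have sub: "{0..t} \<subseteq> ?J"
  proof
    fix s assume "s \<in> {0..t}"
    then have s: "0 \<le> s" "ereal s \<le> ereal t" by auto
    have "ereal t < Tm" using t by (simp add: time_interval_def)
    from le_less_trans[OF s(2) this] show "s \<in> ?J" using s(1) by (simp add: time_interval_def)
  qed
  let ?En = "\<lambda>s. energy \<epsilon> \<beta> \<tau> lam (u s)" and ?D = "\<lambda>s. (L2_norm_on I (time_deriv ?J u s))\<^sup>2"
  have p: "is_potential \<epsilon> (u s) (\<psi> s)" if "s \<in> ?J" for s using \<psi> that by blast
  have der: "(?En has_vector_derivative - ?D s) (at s)" if s: "s \<in> {0<..<t}" for s
  proof -
    have sJ: "s \<in> ?J" using sub s by auto
    obtain gx gz where g: "has_graph_trace (u s) (dx (u s) (\<psi> s)) gx" "has_graph_trace (u s) (dz (u s) (\<psi> s)) gz"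
      "AE x in lebesgue. x \<in> I \<longrightarrow> time_deriv ?J u s x + \<beta> * (dx1 ^^ 4) (u s) x - \<tau> * (dx1 ^^ 2) (u s) x
                = - lam * (\<epsilon>\<^sup>2 * (gx x)\<^sup>2 + (gz x)\<^sup>2)"
      using evo[THEN bspec, OF sJ] s by auto
    have "(?En has_real_derivative - (nrm N (ut s))\<^sup>2) (at s within ?J)"
      by (rule energy_derivative[OF assms(1,4) p sJ g])
    then have "(?En has_real_derivative - (nrm N (ut s))\<^sup>2) (at s within {0..t})" by (rule has_field_derivative_subset[OF _ sub])
    then show ?thesis
      using s unfolding L2_norm_on_eq_nrm[of I, simplified] has_real_derivative_iff_has_vector_derivative[symmetric]
      by (simp add: at_within_Icc_at)
  qed
  have "((\<lambda>s. - ?D s) has_integral ?En t - ?En 0) {0..t}"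
    by (rule fundamental_theorem_of_calculus_interior[OF t0 continuous_on_subset[OF energy_continuous[OF assms(1) p] sub] der])
  then have "integral {0..t} (\<lambda>s. - ?D s) = ?En t - ?En 0" by (rule integral_unique)
  then have "- integral {0..t} ?D = ?En t - ?En 0" by simp
  moreover have "(LINT s:{0..t}|lebesgue. ?D s) = integral {0..t} ?D"
    by (rule set_lebesgue_integral_eq_integral(2)[OF absolutely_integrable_continuous_real[OF continuous_on_subset[OF dissipation_continuous sub]]])
  moreover have "?En 0 = energy \<epsilon> \<beta> \<tau> lam u0"
    by (rule energy_cong[OF repD(4)[OF J0]]) (use init in auto)
  ultimately show "?En t + (LINT s:{0..t}|lebesgue. ?D s) = energy \<epsilon> \<beta> \<tau> lam u0" by linarith
qed

end
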